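(* Let $W, V \in \mathbb{C}[x_1,\dots,x_n]$ be admissible polynomials and let $G \le G_W^{\max}\cap G_V^{\max}\cap \mathrm{SL}(n,\mathbb{C})$ be such that the pairs $(W,G)$ and $(V,G)$ are both well behaved. If $\phi: \mathcal{Q}_W \to \mathcal{Q}_V$ is an isomorphism of graded Frobenius algebras that is equivariant with respect to $G$, then $\phi$ extends to an isomorphism of graded Frobenius algebras $\psi: \mathcal{B}[W,G] \to \mathcal{B}[V,G]$; that is, there is such a $\psi$ with $\psi(\lfloor m;\mathbf{0}\rceil) = \lfloor \phi(m);\mathbf{0}\rceil$ for every $m \in (\mathcal{Q}_W)^G$.
   Context: **Admissible polynomials.** $W\in\mathbb{C}[x_1,\dots,x_n]$ is nondegenerate if it has an isolated critical point at the origin, and quasihomogeneous if there are positive rationals (weights) $q_1,\dots,q_n$ with $W(c^{q_1}x_1,\dots,c^{q_n}x_n)=cW(x_1,\dots,x_n)$ for all $c\in\mathbb{C}$. $W$ is admissible if it is nondegenerate and quasihomogeneous with unique weights, and has no monomials of the form $x_ix_j$ with $i\neq j$. **Symmetries.** $G_W^{\max}=\{(\zeta_1,\dots,\zeta_n)\in(\mathbb{C}^\times)^n : W(\zeta_1x_1,\dots,\zeta_nx_n)=W(x_1,\dots,x_n)\}$, a finite group whose elements have roots of unity as coordinates. It is written additively as a subgroup of $(\mathbb{Q}/\mathbb{Z})^n$ via $(e^{2\pi i\theta_1},\dots,e^{2\pi i\theta_n})\mapsto(\theta_1,\dots,\theta_n)$; the identity is $\mathbf{0}$. Elements are also regarded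 as diagonal matrices acting on $\mathbb{C}^n$. **Well behaved.** A pair $(W,G)$ is well behaved if $W=\sum_i W_i$, where the $W_i$ are admissible polynomials in pairwise disjoint sets of variables, and $G=\bigoplus_i G_i$, where $G_i$ is a group of diagonal symmetries of $W_i$ (acting trivially on the variables of $W_j$, $j\ne i$) and each $g\in G_i$ fixes either all or none of the variables of $W_i$. **Graded Frobenius algebras.** A graded Frobenius algebra is a graded $\mathbb{C}$-algebra with a symmetric, bilinear, nondegenerate pairing satisfying $\langle x\cdot y,z\rangle=\langle x,y\cdot z\rangle$. An isomorphism is a degree-preserving, unital algebra isomorphism that preserves the pairing. **Milnor ring.** $\mathcal{Q}_W=\mathbb{C}[x_1,\dots,x_n]/(\partial W/\partial x_1,\dots,\partial W/\partial x_n)$, with a monomial basis, graded by $\deg(x_1^{a_1}\cdots x_n^{a_n})=2\sum_i a_iq_i$. Its pairing is defined by $mm'=\frac{\langle m,m'\rangle}{\mu}\mathrm{Hess}(W)+(\text{terms of degree less than }\deg \mathrm{Hess}(W))$, where $\mu=\dim_{\mathbb{C}}\mathcal{Q}_W$ and $\mathrm{Hess}(W)$ is the determinant of the matrix of second partial derivatives. $\mathrm{Hess}(W)$ spans the one-dimensional top-degree part and can be represented by a scalar multiple of a monomial. **Group action and equivariance.** $g\in G_W^{\max}$ acts on $\mathcal{Q}_W$ by $g\cdot m=\det(g)\,(m\circ g)$. An isomorphism $\phi:\mathcal{Q}_W\to\mathcal{Q}_V$ is equivariant with respect to $G$ if $\phi(g\cdot m)=g\cdot\phi(m)$ for all $g\in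 G$, $m\in\mathcal{Q}_W$. The $G$-invariant elements are denoted $(\mathcal{Q}_W)^G$. **Orbifolded B-model.** For $g\in G_W^{\max}$, $\mathrm{fix}(g)=\{x\in\mathbb{C}^n: g(x)=x\}$ is a coordinate subspace, identified with the set of variables fixed by $g$; $W|_{\mathrm{fix}(g)}$ is the restriction of $W$ to these variables. For $G\le G_W^{\max}\cap \mathrm{SL}(n,\mathbb{C})$, the underlying vector space of $\mathcal{B}[W,G]$ is $\bigoplus_{g\in G}\left(\mathcal{Q}_{W|_{\mathrm{fix}(g)}}\right)^G$, where $G$ acts on $\mathcal{Q}_{W|_{\mathrm{fix}(g)}}$ by the formula above applied to the restriction of group elements to $\mathrm{fix}(g)$. An element $m$ of the $g$-summand is written $\lfloor m;g\rceil$; a basis consists of such elements with $m$ a monomial. If $\mathrm{fix}(g)=\{0\}$ then the corresponding Milnor ring is $\mathbb{C}$, with dimension $1$ and Hessian $1$. When $G=\{\mathbf{0}\}$, $\mathcal{B}[W,\{\mathbf 0\}]=\mathcal{Q}_W$. - Degree: $\deg\lfloor x_1^{a_1}\cdots x_n^{a_n};(g_1,\dots,g_n)\rceil=2\sum_i a_iq_i+\sum_{g_i\notin\mathbb{Z}}(1-2q_i)$. - Product: $\lfloor m;g\rceil\star\lfloor m';h\rceil=\lfloor\gamma mm';g+h\rceil$ if $\mathrm{fix}(g)\cup\mathrm{fix}(h)\cup\mathrm{fix}(g+h)=\mathbb{C}^n$ (every variable is fixed by at least one of $g,h,g+h$), and $0$ otherwise, where $\gamma=\dfrac{\mu_{g\cap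 h}\,\mathrm{Hess}(W|_{\mathrm{fix}(g+h)})}{\mu_{g+h}\,\mathrm{Hess}(W|_{\mathrm{fix}(g)\cap\mathrm{fix}(h)})}$ (a scalar multiple of a monomial), $\mu_{g\cap h}=\dim\mathcal{Q}_{W|_{\mathrm{fix}(g)\cap\mathrm{fix}(h)}}$ and $\mu_{g+h}=\dim\mathcal{Q}_{W|_{\mathrm{fix}(g+h)}}$. - Pairing: $\langle\lfloor m;g\rceil,\lfloor m';h\rceil\rangle=\langle m,m'\rangle_{\mathcal{Q}_{W|_{\mathrm{fix}(g)}}}$ if $g=-h$, and $0$ otherwise. *)

theory Defs
  imports
    "HOL-Analysis.Function_Topology"
    "HOL-Analysis.Isolated"
    "HOL-Analysis.Complex_Transcendental"
    "HOL-Library.Poly_Mapping"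
    "HOL-Library.Disjoint_Sets"
    "HOL-Combinatorics.Permutations"
    "HOL-Algebra.Module"
    "HOL-Algebra.QuotRing"
    "HOL-Algebra.Embedded_Algebras"
begin

section \<open>Polynomials in the variables indexed by a set of naturals\<close>

text \<open>
  A complex polynomial is a finitely supported map from exponent vectors to coefficients.
  The ring in the variables indexed by \<open>I\<close> is a subring of this type, so that
  restrictions of a polynomial to various coordinate subspaces share one type.
\<close>

type_synonym mpoly = "(nat \<Rightarrow>\<^sub>0 nat) \<Rightarrow>\<^sub>0 complex"

definition Const :: "complex \<Rightarrow> mpoly" where
  "Const c = Poly_Mapping.single 0 c"

definition Var :: "nat \<Rightarrow> mpoly" where
  "Var i = Poly_Mapping.single (Poly_Mapping.single i 1) 1"

definition polys :: "nat set \<Rightarrow> mpoly set" where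
  "polys I = {p. \<forall>a \<in> Poly_Mapping.keys p. Poly_Mapping.keys a \<subseteq> I}"

definition poly_ring :: "nat set \<Rightarrow> mpoly ring" where
  "poly_ring I = \<lparr>carrier = polys I, mult = (*), one = 1, zero = 0, add = (+)\<rparr>"

definition eval_poly :: "(nat \<Rightarrow> complex) \<Rightarrow> mpoly \<Rightarrow> complex" where
  "eval_poly x p =
     (\<Sum>a \<in> Poly_Mapping.keys p. Poly_Mapping.lookup p a *
        (\<Prod>i \<in> Poly_Mapping.keys a. x i ^ Poly_Mapping.lookup a i))"

definition subst_poly :: "(nat \<Rightarrow> mpoly) \<Rightarrow> mpoly \<Rightarrow> mpoly" where
  "subst_poly f p =
     (\<Sum>a \<in> Poly_Mapping.keys p. Const (Poly_Mapping.lookup p a) *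
        (\<Prod>i \<in> Poly_Mapping.keys a. f i ^ Poly_Mapping.lookup a i))"

text \<open>The truncated subtraction of exponents only matters where the coefficient is zero.\<close>

definition pdiff :: "nat \<Rightarrow> mpoly \<Rightarrow> mpoly" where
  "pdiff i p =
     (\<Sum>a \<in> Poly_Mapping.keys p.
        Poly_Mapping.single (a - Poly_Mapping.single i 1)
          (of_nat (Poly_Mapping.lookup a i) * Poly_Mapping.lookup p a))"

definition restrict_vars :: "nat set \<Rightarrow> mpoly \<Rightarrow> mpoly" where
  "restrict_vars A p = subst_poly (\<lambda>i. if i \<in> A then Var i else 0) p"

definition scale_vars :: "(nat \<Rightarrow> complex) \<Rightarrow> mpoly \<Rightarrow> mpoly" where
  "scale_vars g p = subst_poly (\<lambda>i. Const (g i) * Var i) p"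

text \<open>The Leibniz formula for the determinant of the matrix of second partials, indexed by \<open>I\<close>.\<close>

definition Hess :: "nat set \<Rightarrow> mpoly \<Rightarrow> mpoly" where
  "Hess I W = (\<Sum>\<pi> | \<pi> permutes I. of_int (sign \<pi>) * (\<Prod>i \<in> I. pdiff i (pdiff (\<pi> i) W)))"

section \<open>Admissible polynomials\<close>

text \<open>
  The space of points with coordinates indexed by a finite set \<open>I\<close> is the subspace
  of \<open>nat \<Rightarrow> complex\<close> (product topology) of points vanishing outside \<open>I\<close>.
\<close>

definition critical_points :: "nat set \<Rightarrow> mpoly \<Rightarrow> (nat \<Rightarrow> complex) set" where
  "critical_points I W =
     {x. (\<forall>j. j \<notin> I \<longrightarrow> x j = 0) \<and> (\<forall>i \<in> I. eval_poly x (pdiff i W) = 0)}"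

definition nondegenerate :: "nat set \<Rightarrow> mpoly \<Rightarrow> bool" where
  "nondegenerate I W \<longleftrightarrow> (\<lambda>_. 0) isolated_in critical_points I W"

text \<open>
  \<open>powr\<close> is the principal branch of the complex power, with \<open>0 powr q = 0\<close>.
  Weights are set to \<open>0\<close> outside \<open>I\<close> so that they can be unique as functions on \<open>nat\<close>.
\<close>

definition is_weights :: "nat set \<Rightarrow> mpoly \<Rightarrow> (nat \<Rightarrow> rat) \<Rightarrow> bool" where
  "is_weights I W q \<longleftrightarrow>
     (\<forall>i \<in> I. 0 < q i) \<and> (\<forall>i. i \<notin> I \<longrightarrow> q i = 0) \<and>
     (\<forall>c x. eval_poly (\<lambda>i. c powr of_rat (q i) * x i) W = c * eval_poly x W)"

definition weights :: "nat set \<Rightarrow> mpoly \<Rightarrow> nat \<Rightarrow> rat" where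
  "weights I W = (THE q. is_weights I W q)"

definition admissible :: "nat set \<Rightarrow> mpoly \<Rightarrow> bool" where
  "admissible I W \<longleftrightarrow>
     W \<in> polys I \<and> nondegenerate I W \<and> (\<exists>!q. is_weights I W q) \<and>
     (\<forall>i j. i \<noteq> j \<longrightarrow>
        Poly_Mapping.lookup W (Poly_Mapping.single i 1 + Poly_Mapping.single j 1) = 0)"

section \<open>Diagonal symmetries\<close>

text \<open>
  Diagonal matrices are given by their entries and written multiplicatively; the entry is
  \<open>1\<close> at every index outside \<open>I\<close>. Thus the additive identity \<open>0\<close> is \<open>\<lambda>_. 1\<close>, and
  a coordinate is in \<open>\<int>\<close> in additive notation iff the entry is \<open>1\<close>.
\<close>

definition diag_mult :: "(nat \<Rightarrow> complex) \<Rightarrow> (nat \<Rightarrow> complex) \<Rightarrow> nat \<Rightarrow> complex" where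
  "diag_mult g h = (\<lambda>i. g i * h i)"

definition diag_inv :: "(nat \<Rightarrow> complex) \<Rightarrow> nat \<Rightarrow> complex" where
  "diag_inv g = (\<lambda>i. inverse (g i))"

definition diag_one :: "nat \<Rightarrow> complex" where
  "diag_one = (\<lambda>_. 1)"

definition Gmax :: "nat set \<Rightarrow> mpoly \<Rightarrow> (nat \<Rightarrow> complex) monoid" where
  "Gmax I W =
     \<lparr>carrier = {g. (\<forall>i \<in> I. g i \<noteq> 0) \<and> (\<forall>i. i \<notin> I \<longrightarrow> g i = 1) \<and> scale_vars g W = W},
      mult = diag_mult, one = diag_one\<rparr>"

definition diag_det :: "nat set \<Rightarrow> (nat \<Rightarrow> complex) \<Rightarrow> complex" where
  "diag_det A g = (\<Prod>i \<in> A. g i)"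

definition fix_vars :: "nat set \<Rightarrow> (nat \<Rightarrow> complex) \<Rightarrow> nat set" where
  "fix_vars I g = {i \<in> I. g i = 1}"

definition well_behaved :: "nat set \<Rightarrow> mpoly \<Rightarrow> (nat \<Rightarrow> complex) set \<Rightarrow> bool" where
  "well_behaved I W G \<longleftrightarrow>
     (\<exists>P w \<Gamma>. partition_on I P \<and>
        (\<forall>S \<in> P. admissible S (w S) \<and> subgroup (\<Gamma> S) (Gmax S (w S)) \<and>
           (\<forall>g \<in> \<Gamma> S. fix_vars S g = S \<or> fix_vars S g = {})) \<and>
        W = (\<Sum>S \<in> P. w S) \<and>
        G = {\<lambda>i. \<Prod>S \<in> P. f S i | f. \<forall>S \<in> P. f S \<in> \<Gamma> S})"

section \<open>Graded Frobenius algebras\<close>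

definition complex_ring :: "complex ring" where
  "complex_ring = \<lparr>carrier = UNIV, mult = (*), one = 1, zero = 0, add = (+)\<rparr>"

record 'b frobenius = "(complex, 'b) module" +
  homog :: "rat \<Rightarrow> 'b set"
  pairing :: "'b \<Rightarrow> 'b \<Rightarrow> complex"

locale graded_frobenius_algebra = algebra complex_ring A
  for A :: "'b frobenius" (structure) +
  assumes homog_submodule: "submodule (homog A d) complex_ring A"
    and homog_direct_sum: "x \<in> carrier A \<Longrightarrow>
      \<exists>!f. (\<forall>d. f d \<in> homog A d) \<and> finite {d. f d \<noteq> \<zero>} \<and> x = (\<Oplus>d \<in> {d. f d \<noteq> \<zero>}. f d)"
    and homog_one: "\<one> \<in> homog A 0"
    and homog_mult: "x \<in> homog A d \<Longrightarrow> y \<in> homog A e \<Longrightarrow> x \<otimes> y \<in> homog A (d + e)"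
    and pairing_sym: "x \<in> carrier A \<Longrightarrow> y \<in> carrier A \<Longrightarrow> pairing A x y = pairing A y x"
    and pairing_add: "x \<in> carrier A \<Longrightarrow> y \<in> carrier A \<Longrightarrow> z \<in> carrier A \<Longrightarrow>
      pairing A (x \<oplus> y) z = pairing A x z + pairing A y z"
    and pairing_smult: "x \<in> carrier A \<Longrightarrow> y \<in> carrier A \<Longrightarrow>
      pairing A (c \<odot> x) y = c * pairing A x y"
    and pairing_nondegenerate: "x \<in> carrier A \<Longrightarrow>
      (\<And>y. y \<in> carrier A \<Longrightarrow> pairing A x y = 0) \<Longrightarrow> x = \<zero>"
    and pairing_mult: "x \<in> carrier A \<Longrightarrow> y \<in> carrier A \<Longrightarrow> z \<in> carrier A \<Longrightarrow>
      pairing A (x \<otimes> y) z = pairing A x (y \<otimes> z)"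

definition frobenius_iso :: "'b frobenius \<Rightarrow> 'c frobenius \<Rightarrow> ('b \<Rightarrow> 'c) \<Rightarrow> bool" where
  "frobenius_iso A B \<phi> \<longleftrightarrow>
     graded_frobenius_algebra A \<and> graded_frobenius_algebra B \<and>
     \<phi> \<in> ring_iso A B \<and>
     (\<forall>c. \<forall>x \<in> carrier A. \<phi> (c \<odot>\<^bsub>A\<^esub> x) = c \<odot>\<^bsub>B\<^esub> \<phi> x) \<and>
     (\<forall>d. \<forall>x \<in> homog A d. \<phi> x \<in> homog B d) \<and>
     (\<forall>x \<in> carrier A. \<forall>y \<in> carrier A. pairing B (\<phi> x) (\<phi> y) = pairing A x y)"

section \<open>The Milnor ring\<close>

definition mono_deg :: "(nat \<Rightarrow> rat) \<Rightarrow> (nat \<Rightarrow>\<^sub>0 nat) \<Rightarrow> rat" where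
  "mono_deg q a = 2 * (\<Sum>i \<in> Poly_Mapping.keys a. of_nat (Poly_Mapping.lookup a i) * q i)"

definition poly_deg :: "(nat \<Rightarrow> rat) \<Rightarrow> mpoly \<Rightarrow> rat" where
  "poly_deg q p = Max (mono_deg q ` Poly_Mapping.keys p)"

definition homog_polys :: "nat set \<Rightarrow> (nat \<Rightarrow> rat) \<Rightarrow> rat \<Rightarrow> mpoly set" where
  "homog_polys I q d = {p \<in> polys I. \<forall>a \<in> Poly_Mapping.keys p. mono_deg q a = d}"

definition jac :: "nat set \<Rightarrow> mpoly \<Rightarrow> mpoly set" where
  "jac I W = Idl\<^bsub>poly_ring I\<^esub> ((\<lambda>i. pdiff i W) ` I)"

definition cls :: "nat set \<Rightarrow> mpoly \<Rightarrow> mpoly \<Rightarrow> mpoly set" where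
  "cls I W p = jac I W +>\<^bsub>poly_ring I\<^esub> p"

definition milnor_ring :: "nat set \<Rightarrow> mpoly \<Rightarrow> mpoly set ring" where
  "milnor_ring I W = poly_ring I Quot jac I W"

definition milnor_number :: "nat set \<Rightarrow> mpoly \<Rightarrow> nat" where
  "milnor_number I W =
     ring.dim (milnor_ring I W) (range (\<lambda>c. cls I W (Const c))) (carrier (milnor_ring I W))"

definition milnor_pairing :: "nat set \<Rightarrow> mpoly \<Rightarrow> mpoly set \<Rightarrow> mpoly set \<Rightarrow> complex" where
  "milnor_pairing I W X Y =
     (THE c. \<exists>r \<in> polys I.
        (\<forall>a \<in> Poly_Mapping.keys r. mono_deg (weights I W) a < poly_deg (weights I W) (Hess I W)) \<and>
        X \<otimes>\<^bsub>milnor_ring I W\<^esub> Y =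
          cls I W (Const (c / of_nat (milnor_number I W)) * Hess I W + r))"

definition milnor :: "nat set \<Rightarrow> mpoly \<Rightarrow> mpoly set frobenius" where
  "milnor I W =
     \<lparr>carrier = carrier (milnor_ring I W),
      mult = mult (milnor_ring I W),
      one = one (milnor_ring I W),
      zero = zero (milnor_ring I W),
      add = add (milnor_ring I W),
      smult = (\<lambda>c X. cls I W (Const c) \<otimes>\<^bsub>milnor_ring I W\<^esub> X),
      homog = (\<lambda>d. cls I W ` homog_polys I (weights I W) d),
      pairing = milnor_pairing I W\<rparr>"

text \<open>
  As for \<^const>\<open>rcoset_mult\<close>, the operation on cosets is the union over representatives,
  which is a single coset because the ideal is preserved. Only the entries of \<open>g\<close> at
  indices in \<open>I\<close> matter, so \<open>g\<close> need not be restricted to \<open>I\<close> first.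
\<close>

definition act :: "nat set \<Rightarrow> mpoly \<Rightarrow> (nat \<Rightarrow> complex) \<Rightarrow> mpoly set \<Rightarrow> mpoly set" where
  "act I W g X = (\<Union>m \<in> X. cls I W (Const (diag_det I g) * scale_vars g m))"

definition invariants :: "nat set \<Rightarrow> mpoly \<Rightarrow> (nat \<Rightarrow> complex) set \<Rightarrow> mpoly set set" where
  "invariants I W G = {X \<in> carrier (milnor I W). \<forall>g \<in> G. act I W g X = X}"

definition equivariant ::
  "nat set \<Rightarrow> mpoly \<Rightarrow> mpoly \<Rightarrow> (nat \<Rightarrow> complex) set \<Rightarrow> (mpoly set \<Rightarrow> mpoly set) \<Rightarrow> bool" where
  "equivariant I W V G \<phi> \<longleftrightarrow>
     (\<forall>g \<in> G. \<forall>X \<in> carrier (milnor I W). \<phi> (act I W g X) = act I V g (\<phi> X))"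

section \<open>The orbifolded B-model\<close>

definition restr_fix :: "nat set \<Rightarrow> mpoly \<Rightarrow> (nat \<Rightarrow> complex) \<Rightarrow> mpoly" where
  "restr_fix I W g = restrict_vars (fix_vars I g) W"

definition sector :: "nat set \<Rightarrow> mpoly \<Rightarrow> (nat \<Rightarrow> complex) \<Rightarrow> mpoly set frobenius" where
  "sector I W g = milnor (fix_vars I g) (restr_fix I W g)"

text \<open>
  With \<open>A = fix(g) \<inter> fix(h)\<close> and \<open>K = fix(g + h)\<close>, the quotient
  \<open>\<mu>\<^sub>A Hess(W|\<^sub>K) / (\<mu>\<^sub>K Hess(W|\<^sub>A))\<close> is a scalar multiple of a monomial whose product
  with \<open>\<mu>\<^sub>K Hess(W|\<^sub>A)\<close> equals \<open>\<mu>\<^sub>A Hess(W|\<^sub>K)\<close> in the Milnor ring of \<open>W|\<^sub>K\<close>.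
  An exact quotient of polynomials need not exist, as a Hessian is a multiple of a monomial
  only modulo the Jacobian ideal.
\<close>

definition gamma_factor :: "mpoly \<Rightarrow> nat set \<Rightarrow> nat set \<Rightarrow> mpoly" where
  "gamma_factor W A K =
     (SOME \<gamma>. \<exists>b c. \<gamma> = Poly_Mapping.single b c \<and> Poly_Mapping.keys b \<subseteq> K \<and>
        cls K (restrict_vars K W)
          (\<gamma> * of_nat (milnor_number K (restrict_vars K W)) * Hess A (restrict_vars A W)) =
        cls K (restrict_vars K W)
          (of_nat (milnor_number A (restrict_vars A W)) * Hess K (restrict_vars K W)))"

text \<open>
  The product of \<open>\<lfloor>X;g\<rceil>\<close> and \<open>\<lfloor>Y;h\<rceil>\<close>, as an element of the sector of \<open>g + h\<close>.
  A product \<open>m m'\<close> may contain variables of \<open>fix(g)\<close> or \<open>fix(h)\<close> outside \<open>fix(g + h)\<close>; it is read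
  on \<open>fix(g + h)\<close> by restriction, that is, these variables are set to \<open>0\<close>.
\<close>

definition sector_mult ::
  "nat set \<Rightarrow> mpoly \<Rightarrow> (nat \<Rightarrow> complex) \<Rightarrow> (nat \<Rightarrow> complex) \<Rightarrow> mpoly set \<Rightarrow> mpoly set \<Rightarrow> mpoly set" where
  "sector_mult I W g h X Y =
     (let k = diag_mult g h; K = fix_vars I k in
      if fix_vars I g \<union> fix_vars I h \<union> K = I
      then (\<Union>m \<in> X. \<Union>m' \<in> Y. cls K (restr_fix I W k)
              (gamma_factor W (fix_vars I g \<inter> fix_vars I h) K * restrict_vars K (m * m')))
      else \<zero>\<^bsub>sector I W k\<^esub>)"

text \<open>
  Elements of the direct sum over the finite group \<open>G\<close> are families indexed by \<open>G\<close>.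
\<close>

definition sector_elem ::
  "nat set \<Rightarrow> mpoly \<Rightarrow> (nat \<Rightarrow> complex) set \<Rightarrow> mpoly set \<Rightarrow> (nat \<Rightarrow> complex) \<Rightarrow>
     (nat \<Rightarrow> complex) \<Rightarrow> mpoly set" where
  "sector_elem I W G X g = (\<lambda>h \<in> G. if h = g then X else \<zero>\<^bsub>sector I W h\<^esub>)"

definition bmodel ::
  "nat set \<Rightarrow> mpoly \<Rightarrow> (nat \<Rightarrow> complex) set \<Rightarrow> ((nat \<Rightarrow> complex) \<Rightarrow> mpoly set) frobenius" where
  "bmodel I W G =
     \<lparr>carrier = (\<Pi>\<^sub>E g \<in> G. invariants (fix_vars I g) (restr_fix I W g) G),
      mult = (\<lambda>x y. \<lambda>k \<in> G.
        \<Oplus>\<^bsub>sector I W k\<^esub>p \<in> {p \<in> G \<times> G. diag_mult (fst p) (snd p) = k}.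
          sector_mult I W (fst p) (snd p) (x (fst p)) (y (snd p))),
      one = sector_elem I W G \<one>\<^bsub>sector I W diag_one\<^esub> diag_one,
      zero = (\<lambda>g \<in> G. \<zero>\<^bsub>sector I W g\<^esub>),
      add = (\<lambda>x y. \<lambda>g \<in> G. x g \<oplus>\<^bsub>sector I W g\<^esub> y g),
      smult = (\<lambda>c x. \<lambda>g \<in> G. c \<odot>\<^bsub>sector I W g\<^esub> x g),
      homog = (\<lambda>d. {x \<in> \<Pi>\<^sub>E g \<in> G. invariants (fix_vars I g) (restr_fix I W g) G.
        \<forall>g \<in> G. x g \<in> cls (fix_vars I g) (restr_fix I W g) `
          homog_polys (fix_vars I g) (weights I W)
            (d - (\<Sum>i \<in> I - fix_vars I g. 1 - 2 * weights I W i))}),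
      pairing = (\<lambda>x y. \<Sum>g \<in> G. pairing (sector I W g) (x g) (y (diag_inv g)))\<rparr>"

end

theory Submission
  imports Defs
begin

text \<open>
  For \<open>g \<in> G\<close> the Milnor ring of the restriction of \<open>W\<close> to \<open>fix(g)\<close> is the quotient of that of \<open>W\<close>
  by the variables moved by \<open>g\<close>, and this ideal is generated by the eigenvectors of \<open>g\<close> with
  eigenvalue other than \<open>1\<close>. An equivariant isomorphism \<open>\<phi>\<close> therefore descends to every sector.
  It sends the Hessian in the moved variables to a scalar multiple \<open>d\<^sub>g\<close> of the corresponding Hessian
  of \<open>V\<close>, and the pairing and the product of the sectors are determined by the pairing on the
  untwisted sector together with these Hessians. Rescaling the sector of \<open>g\<close> by a square root of
  \<open>d\<^sub>g\<close>, chosen multiplicatively over the blocks of \<open>W\<close>, makes the sectorwise maps compatible with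
  both.
\<close>

text \<open>The only source of duality is the hypothesis that both Milnor rings are graded Frobenius
  algebras. It yields a functional, pairing with 1, that lives in the degree of the Hessian, does
  not kill the Hessian and is nondegenerate. Multiplication by the Hessian of the moved variables
  carries these properties to every sector, so that finiteness, Milnor numbers and pairings there
  all come from this one functional.

  The square root is forced by the pairing: it couples the sectors of an element and its inverse,
  which have the same moved variables, so the scale of a sector enters squared. Roots chosen
  separately for each element would fit the product only up to sign. The scalars are multiplicative
  over disjoint sets of moved variables, so one root per block is enough, provided every set of
  variables that occurs is a union of blocks; well-behavedness ensures this.

  That the orbifolded model is associative needs its own argument: the two bracketings differ by a
  scalar that is the constant term of a Hessian, and where they could disagree bounds on the weights
  make it vanish.\<close>

abbreviation coeff :: "('a \<Rightarrow>\<^sub>0 'b::zero) \<Rightarrow> 'a \<Rightarrow> 'b" where "coeff \<equiv> Poly_Mapping.lookup"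
abbreviation supp :: "('a \<Rightarrow>\<^sub>0 'b::zero) \<Rightarrow> 'a set" where "supp \<equiv> Poly_Mapping.keys"
abbreviation mon :: "'a \<Rightarrow> 'b::zero \<Rightarrow> ('a \<Rightarrow>\<^sub>0 'b)" where "mon \<equiv> Poly_Mapping.single"

section \<open>Polynomials as sums of monomials\<close>

lemma supp_iff: "a \<in> supp p \<longleftrightarrow> coeff p a \<noteq> 0"
  by (simp add: in_keys_iff)

lemma poly_eqI: "(\<And>a. coeff p a = coeff q a) \<Longrightarrow> p = q"
  by (rule poly_mapping_eqI)

lemma sum_mon_superset:
  assumes "finite A" "supp p \<subseteq> A"
  shows "(\<Sum>a\<in>A. mon a (coeff p a)) = p"
proof (rule poly_eqI)
  fix b
  have "coeff (\<Sum>a\<in>A. mon a (coeff p a)) b = (\<Sum>a\<in>A. if b = a then coeff p b else 0)"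
    unfolding lookup_sum by (rule sum.cong) (auto simp: lookup_single when_def)
  also have "\<dots> = coeff p b"
    using assms by (auto simp: sum.delta' supp_iff)
  finally show "coeff (\<Sum>a\<in>A. mon a (coeff p a)) b = coeff p b" .
qed

lemma sum_mon: "(\<Sum>a\<in>supp p. mon a (coeff p a)) = p"
  by (rule sum_mon_superset) auto

lemma supp_add: "supp (p + q) \<subseteq> supp p \<union> supp q"
  by (rule keys_add)

lemma supp_single: "supp (mon a c) \<subseteq> {a}"
  by (simp)

text \<open>The allowed exponents \<open>A\<close> stay fixed during the induction, so that the rule
  serves polynomials in chosen variables and also, in \<open>restrict_zero\<close>, polynomials all
  of whose monomials contain a moved variable.\<close>

lemma poly_supp_induct [consumes 1, case_names zero mon add]:
  fixes p :: "'a \<Rightarrow>\<^sub>0 'b::comm_monoid_add"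
  assumes "supp p \<subseteq> A" "P 0" "\<And>a c. a \<in> A \<Longrightarrow> P (mon a c)"
    "\<And>p q. supp p \<subseteq> A \<Longrightarrow> supp q \<subseteq> A \<Longrightarrow> P p \<Longrightarrow> P q \<Longrightarrow> P (p + q)"
  shows "P p"
proof -
  have "supp (\<Sum>a\<in>B. mon a (coeff p a)) \<subseteq> A \<and> P (\<Sum>a\<in>B. mon a (coeff p a))"
    if "finite B" "B \<subseteq> supp p" for B
    using that
  proof (induction B rule: finite_induct)
    case empty
    then show ?case using assms(2) by simp
  next
    case (insert b B)
    have b: "b \<in> A" using insert.prems assms(1) by auto
    then have s: "supp (mon b (coeff p b)) \<subseteq> A" using supp_single by fastforce
    have "supp (mon b (coeff p b) + (\<Sum>a\<in>B. mon a (coeff p a))) \<subseteq> A"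
      using supp_add insert s by (meson Un_least insert_subset order_trans)
    then show ?case
      using insert b s assms(3)[OF b] assms(4)[OF s] by simp
  qed
  from this[of "supp p"] show ?thesis by (simp add: sum_mon)
qed

lemma polys_iff: "p \<in> polys X \<longleftrightarrow> supp p \<subseteq> {a. supp a \<subseteq> X}"
  by (auto simp: polys_def)

lemma polysI: "(\<And>a. coeff p a \<noteq> 0 \<Longrightarrow> supp a \<subseteq> X) \<Longrightarrow> p \<in> polys X"
  by (simp add: polys_def in_keys_iff)

lemma polysD: "p \<in> polys X \<Longrightarrow> coeff p a \<noteq> 0 \<Longrightarrow> supp a \<subseteq> X"
  by (simp add: polys_def in_keys_iff)

lemma polys_induct [consumes 1, case_names zero mon add]:
  assumes "p \<in> polys X" "P 0" "\<And>a c. supp a \<subseteq> X \<Longrightarrow> P (mon a c)"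
    "\<And>p q. p \<in> polys X \<Longrightarrow> q \<in> polys X \<Longrightarrow> P p \<Longrightarrow> P q \<Longrightarrow> P (p + q)"
  shows "P p"
  using assms(1) unfolding polys_iff
  by (induction rule: poly_supp_induct) (auto intro: assms(2-4)[unfolded polys_iff])

lemma mpoly_induct [case_names mon add]:
  fixes p :: mpoly
  assumes "\<And>a c. P (mon a c)" "\<And>p q. P p \<Longrightarrow> P q \<Longrightarrow> P (p + q)"
  shows "P p"
proof -
  have "supp p \<subseteq> UNIV" by simp
  then show ?thesis
    by (induction rule: poly_supp_induct) (use assms(1)[of 0 0] assms in auto)
qed

lemma mon_mult: "mon a c * mon b d = mon (a + b) (c * d)" for c d :: complex
  by (simp add: mult_single)

lemma supp_exp_add [simp]: "supp (a + b) = supp a \<union> supp b" for a b :: "nat \<Rightarrow>\<^sub>0 nat"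
  by (auto simp: supp_iff lookup_add)

lemma polys_zero [simp, intro]: "0 \<in> polys X" by (simp add: polys_def)
lemma polys_mon [intro]: "supp a \<subseteq> X \<Longrightarrow> mon a c \<in> polys X"
  by (auto simp: polys_def)
lemma polys_one [simp, intro]: "1 \<in> polys X"
  unfolding single_one[symmetric] by (rule polys_mon) simp
lemma polys_Const [simp, intro]: "Const c \<in> polys X"
  unfolding Const_def by (rule polys_mon) simp
lemma polys_Var [intro]: "i \<in> X \<Longrightarrow> Var i \<in> polys X"
  unfolding Var_def by (rule polys_mon) simp
lemma polys_add [intro]: "p \<in> polys X \<Longrightarrow> q \<in> polys X \<Longrightarrow> p + q \<in> polys X"
  unfolding polys_iff using supp_add[of p q] by (meson Un_least order_trans)
lemma polys_uminus [intro]: "p \<in> polys X \<Longrightarrow> - p \<in> polys X"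
  by (rule polysI) (metis lookup_uminus neg_equal_0_iff_equal polysD)
lemma polys_diff [intro]: "p \<in> polys X \<Longrightarrow> q \<in> polys X \<Longrightarrow> p - q \<in> polys X"
  using polys_add[of p X "-q"] by auto
lemma polys_mult [intro]: "p \<in> polys X \<Longrightarrow> q \<in> polys X \<Longrightarrow> p * q \<in> polys X"
proof -
  assume p: "p \<in> polys X" and q: "q \<in> polys X"
  show ?thesis
    unfolding polys_def
  proof (intro CollectI ballI)
    fix a assume "a \<in> supp (p * q)"
    then obtain b c where "a = b + c" "b \<in> supp p" "c \<in> supp q" using keys_mult by blast
    then show "supp a \<subseteq> X" using p q by (auto simp: polys_def)
  qed
qed
lemma polys_sum [intro]: "(\<And>x. x \<in> A \<Longrightarrow> f x \<in> polys X) \<Longrightarrow> sum f A \<in> polys X"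
  by (induction A rule: infinite_finite_induct) auto
lemma polys_prod [intro]: "(\<And>x. x \<in> A \<Longrightarrow> f x \<in> polys X) \<Longrightarrow> prod f A \<in> polys X"
  by (induction A rule: infinite_finite_induct) auto
lemma polys_of_int [simp, intro]: "of_int n \<in> polys X"
  unfolding single_of_int[symmetric] by (rule polys_mon) simp
lemma polys_mono: "X \<subseteq> Y \<Longrightarrow> p \<in> polys X \<Longrightarrow> p \<in> polys Y"
  by (auto simp: polys_def)

lemma Const_add: "Const (c + d) = Const c + Const d" by (simp add: Const_def single_add)
lemma Const_mult: "Const (c * d) = Const c * Const d" by (simp add: Const_def mult_single)
lemma Const_zero [simp]: "Const 0 = 0" by (simp add: Const_def)
lemma Const_one [simp]: "Const 1 = 1" by (simp add: Const_def)
lemma Const_uminus: "Const (- c) = - Const c" by (simp add: Const_def single_uminus)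
lemma Const_diff: "Const (c - d) = Const c - Const d" by (simp add: Const_def single_diff)
lemma Const_of_nat: "of_nat n = Const (of_nat n)"
  unfolding Const_def by simp
lemma Const_prod: "Const (prod f A) = (\<Prod>x\<in>A. Const (f x))"
  by (induction A rule: infinite_finite_induct) (auto simp: Const_mult)
lemma Const_mon: "Const c * mon a d = mon a (c * d)"
  by (simp add: Const_def mult_single)
lemma mon_Const: "mon a c = Const c * mon a 1"
  by (simp add: Const_mon)
lemma coeff_Const_mult [simp]: "coeff (Const c * p) a = c * coeff p a"
proof (induction p rule: mpoly_induct)
  case (mon b d)
  then show ?case by (simp add: Const_mon lookup_single when_def)
next
  case (add p q)
  then show ?case by (simp add: distrib_left lookup_add)
qed

section \<open>Linear extension from monomials\<close>

text \<open>Substitution, scaling, restriction and the contraction of a tensor factor are all of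
  this shape, so they share the linearity lemmas below.\<close>

definition lin_ext :: "((nat \<Rightarrow>\<^sub>0 nat) \<Rightarrow> mpoly) \<Rightarrow> mpoly \<Rightarrow> mpoly" where
  "lin_ext u p = (\<Sum>a\<in>supp p. Const (coeff p a) * u a)"

lemma lin_ext_superset:
  "finite A \<Longrightarrow> supp p \<subseteq> A \<Longrightarrow> lin_ext u p = (\<Sum>a\<in>A. Const (coeff p a) * u a)"
  unfolding lin_ext_def by (rule sum.mono_neutral_left) (auto simp: supp_iff)

lemma lin_ext_add: "lin_ext u (p + q) = lin_ext u p + lin_ext u q"
proof -
  let ?A = "supp p \<union> supp q"
  have "lin_ext u (p + q) = (\<Sum>a\<in>?A. Const (coeff (p + q) a) * u a)"
    by (rule lin_ext_superset) (auto dest: supp_add[THEN subsetD])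
  also have "\<dots> = (\<Sum>a\<in>?A. Const (coeff p a) * u a) + (\<Sum>a\<in>?A. Const (coeff q a) * u a)"
    by (simp add: lookup_add Const_add distrib_right sum.distrib)
  also have "\<dots> = lin_ext u p + lin_ext u q"
    by (simp add: lin_ext_superset[of ?A])
  finally show ?thesis .
qed

lemma lin_ext_mon: "lin_ext u (mon a c) = Const c * u a"
  by (simp add: lin_ext_def)

lemma lin_ext_zero [simp]: "lin_ext u 0 = 0" by (simp add: lin_ext_def)

lemma lin_ext_uminus: "lin_ext u (- p) = - lin_ext u p"
  using lin_ext_add[of u p "-p"] by (simp add: add_eq_0_iff)

lemma lin_ext_diff: "lin_ext u (p - q) = lin_ext u p - lin_ext u q"
  using lin_ext_add[of u p "-q"] lin_ext_uminus[of u q] by simp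

lemma lin_ext_sum: "lin_ext u (sum f A) = (\<Sum>x\<in>A. lin_ext u (f x))"
  by (induction A rule: infinite_finite_induct) (auto simp: lin_ext_add)

lemma lin_ext_mult:
  assumes "\<And>a b. u (a + b) = u a * u b"
  shows "lin_ext u (p * q) = lin_ext u p * lin_ext u q"
proof (induction p rule: mpoly_induct)
  case (mon a c)
  show ?case
  proof (induction q rule: mpoly_induct)
    case (mon b d)
    then show ?case by (simp add: mon_mult lin_ext_mon assms Const_mult mult_ac)
  next
    case (add q r)
    then show ?case by (simp add: distrib_left lin_ext_add)
  qed
next
  case (add p q)
  then show ?case by (simp add: distrib_right lin_ext_add)
qed

lemma lin_ext_Const_mult: "lin_ext u (Const c * p) = Const c * lin_ext u p"
  by (induction p rule: mpoly_induct)
    (simp_all add: Const_mon lin_ext_mon Const_mult lin_ext_add distrib_left mult_ac)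

lemma subst_poly_lin_ext:
  "subst_poly f = lin_ext (\<lambda>a. \<Prod>i\<in>supp a. f i ^ coeff a i)"
  by (rule ext) (simp add: subst_poly_def lin_ext_def)

lemma exp_prod_superset:
  "finite A \<Longrightarrow> supp a \<subseteq> A \<Longrightarrow> (\<Prod>i\<in>supp a. f i ^ coeff a i) = (\<Prod>i\<in>A. f i ^ coeff a i)"
  for f :: "nat \<Rightarrow> 'a::comm_semiring_1"
  by (rule prod.mono_neutral_left) (auto simp: supp_iff)

text \<open>The value ring is left open: over the complex numbers this is evaluation of a monomial,
  over polynomials its image under a substitution.\<close>

definition mval :: "(nat \<Rightarrow> 'a::comm_semiring_1) \<Rightarrow> (nat \<Rightarrow>\<^sub>0 nat) \<Rightarrow> 'a" where
  "mval f a = (\<Prod>i\<in>supp a. f i ^ coeff a i)"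

lemma mval_superset: "finite A \<Longrightarrow> supp a \<subseteq> A \<Longrightarrow> mval f a = (\<Prod>i\<in>A. f i ^ coeff a i)"
  unfolding mval_def by (rule exp_prod_superset)

lemma mval_add: "mval f (a + b) = mval f a * mval f b"
proof -
  let ?A = "supp a \<union> supp b"
  have "mval f c = (\<Prod>i\<in>?A. f i ^ coeff c i)" if "supp c \<subseteq> ?A" for c
    using that by (intro mval_superset) auto
  then show ?thesis by (simp add: lookup_add power_add prod.distrib)
qed

lemma mval_zero [simp]: "mval f 0 = 1" by (simp add: mval_def)

lemma mval_single [simp]: "mval f (mon i k) = f i ^ k" by (simp add: mval_def)

lemma mval_mult: "mval (\<lambda>i. f i * g i) a = mval f a * mval g a"
  by (simp add: mval_def power_mult_distrib prod.distrib)

lemma mval_one [simp]: "mval (\<lambda>i. 1) a = 1"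
  by (simp add: mval_def)

lemma mval_cong: "(\<And>i. i \<in> supp a \<Longrightarrow> f i = g i) \<Longrightarrow> mval f a = mval g a"
  by (simp add: mval_def)

lemma mval_nonzero: "(\<And>i. i \<in> supp a \<Longrightarrow> f i \<noteq> 0) \<Longrightarrow> mval f a \<noteq> 0" for f :: "nat \<Rightarrow> complex"
  by (simp add: mval_def)

lemma mval_Var: "mval Var a = mon a 1"
proof -
  have *: "Var i ^ n = mon (mon i n) 1" for i n
    by (induction n) (auto simp: Var_def mon_mult simp flip: single_add)
  have "(\<Prod>i\<in>A. mon (mon i (coeff a i)) (1::complex)) = mon (\<Sum>i\<in>A. mon i (coeff a i)) 1"
    if "finite A" for A
    using that by (induction A rule: finite_induct) (auto simp: mon_mult)
  then show ?thesis by (simp add: mval_def * sum_mon)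
qed

lemma mval_Const: "mval (\<lambda>i. Const (g i)) a = Const (mval g a)"
proof -
  have "Const c ^ n = Const (c ^ n)" for c n by (induction n) (auto simp: Const_mult)
  then show ?thesis by (simp add: mval_def Const_prod)
qed

lemma subst_poly_mval: "subst_poly f = lin_ext (mval f)"
  by (simp add: subst_poly_lin_ext mval_def[abs_def])

lemma eval_poly_mval: "eval_poly x p = (\<Sum>a\<in>supp p. coeff p a * mval x a)"
  by (simp add: eval_poly_def mval_def)

section \<open>Restriction, scaling, homogeneous components\<close>

lemma coeff_scale_vars: "coeff (scale_vars g p) a = mval g a * coeff p a"
proof (induction p rule: mpoly_induct)
  case (mon b c)
  have "mval (\<lambda>i. Const (g i) * Var i) b = Const (mval g b) * mon b 1"
    by (simp add: mval_mult mval_Const mval_Var)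
  then show ?case
    by (simp add: scale_vars_def subst_poly_mval lin_ext_mon Const_mon lookup_single when_def)
next
  case (add p q)
  then show ?case by (simp add: scale_vars_def subst_poly_mval lin_ext_add lookup_add distrib_left)
qed

lemma scale_vars_add: "scale_vars g (p + q) = scale_vars g p + scale_vars g q"
  by (simp add: scale_vars_def subst_poly_mval lin_ext_add)
lemma scale_vars_diff: "scale_vars g (p - q) = scale_vars g p - scale_vars g q"
  by (simp add: scale_vars_def subst_poly_mval lin_ext_diff)
lemma scale_vars_mult: "scale_vars g (p * q) = scale_vars g p * scale_vars g q"
  by (simp add: scale_vars_def subst_poly_mval lin_ext_mult mval_add)
lemma scale_vars_sum: "scale_vars g (sum f A) = (\<Sum>x\<in>A. scale_vars g (f x))"
  by (simp add: scale_vars_def subst_poly_mval lin_ext_sum)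
lemma scale_vars_Const_mult: "scale_vars g (Const c * p) = Const c * scale_vars g p"
  by (simp add: scale_vars_def subst_poly_mval lin_ext_Const_mult)
lemma scale_vars_mon: "scale_vars g (mon a c) = mon a (mval g a * c)"
  by (rule poly_eqI) (simp add: coeff_scale_vars lookup_single when_def)
lemma scale_vars_one [simp]: "scale_vars g 1 = 1"
  using scale_vars_mon[of g 0 1] by simp
lemma scale_vars_Const [simp]: "scale_vars g (Const c) = Const c"
  unfolding Const_def by (simp add: scale_vars_mon)
lemma scale_vars_prod: "scale_vars g (prod f A) = (\<Prod>x\<in>A. scale_vars g (f x))"
  by (induction A rule: infinite_finite_induct) (auto simp: scale_vars_mult)
lemma scale_vars_polys [intro]: "p \<in> polys X \<Longrightarrow> scale_vars g p \<in> polys X"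
  by (rule polysI) (metis coeff_scale_vars mult_zero_right polysD)
lemma mval_indicator:
  "mval (\<lambda>i. if i \<in> X then Var i else 0) a = (if supp a \<subseteq> X then mon a 1 else 0)"
proof (cases "supp a \<subseteq> X")
  case True
  then have "mval (\<lambda>i. if i \<in> X then Var i else 0) a = mval Var a"
    by (intro mval_cong) auto
  then show ?thesis using True by (simp add: mval_Var)
next
  case False
  then show ?thesis by (auto simp: mval_def supp_iff intro!: prod_zero)
qed

lemma coeff_restrict_vars: "coeff (restrict_vars X p) a = (if supp a \<subseteq> X then coeff p a else 0)"
proof (induction p rule: mpoly_induct)
  case (mon b c)
  then show ?case
    by (auto simp: restrict_vars_def subst_poly_mval lin_ext_mon mval_indicator Const_mon
        lookup_single when_def)
next
  case (add p q)
  then show ?case by (simp add: restrict_vars_def subst_poly_mval lin_ext_add lookup_add)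
qed

lemma restrict_vars_add: "restrict_vars X (p + q) = restrict_vars X p + restrict_vars X q"
  by (simp add: restrict_vars_def subst_poly_mval lin_ext_add)
lemma restrict_vars_diff: "restrict_vars X (p - q) = restrict_vars X p - restrict_vars X q"
  by (simp add: restrict_vars_def subst_poly_mval lin_ext_diff)
lemma restrict_vars_mult: "restrict_vars X (p * q) = restrict_vars X p * restrict_vars X q"
  by (simp add: restrict_vars_def subst_poly_mval lin_ext_mult mval_add)
lemma restrict_vars_sum: "restrict_vars X (sum f A) = (\<Sum>x\<in>A. restrict_vars X (f x))"
  by (simp add: restrict_vars_def subst_poly_mval lin_ext_sum)
lemma restrict_vars_zero [simp]: "restrict_vars X 0 = 0"
  by (simp add: restrict_vars_def subst_poly_mval)
lemma restrict_vars_mon: "restrict_vars X (mon a c) = (if supp a \<subseteq> X then mon a c else 0)"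
  by (rule poly_eqI) (auto simp: coeff_restrict_vars lookup_single when_def)
lemma restrict_vars_id: "p \<in> polys X \<Longrightarrow> restrict_vars X p = p"
  by (rule poly_eqI) (metis coeff_restrict_vars polysD)
lemma restrict_vars_Const [simp]: "restrict_vars X (Const c) = Const c"
  by (rule restrict_vars_id) simp
lemma restrict_vars_one [simp]: "restrict_vars X 1 = 1"
  by (rule restrict_vars_id) simp
lemma restrict_vars_polys: "restrict_vars X p \<in> polys X"
  by (rule polysI) (auto simp: coeff_restrict_vars split: if_splits)
lemma restrict_vars_polys' [intro]: "X \<subseteq> Y \<Longrightarrow> restrict_vars X p \<in> polys Y"
  using restrict_vars_polys polys_mono by blast
lemma restrict_vars_polys_Int: "p \<in> polys Y \<Longrightarrow> restrict_vars X p \<in> polys (X \<inter> Y)"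
  by (rule polysI) (metis coeff_restrict_vars polysD le_inf_iff)
lemma restrict_restrict: "restrict_vars X (restrict_vars Y p) = restrict_vars (X \<inter> Y) p"
  by (rule poly_eqI) (auto simp: coeff_restrict_vars)
lemma restrict_vars_inter: "p \<in> polys Y \<Longrightarrow> restrict_vars X p = restrict_vars (X \<inter> Y) p"
  by (rule poly_eqI) (metis coeff_restrict_vars polysD le_inf_iff)
lemma restrict_scale: "restrict_vars X (scale_vars g p) = scale_vars g (restrict_vars X p)"
  by (rule poly_eqI) (auto simp: coeff_restrict_vars coeff_scale_vars)
lemma restrict_scale_fix: "(\<And>i. i \<in> X \<Longrightarrow> g i = 1) \<Longrightarrow> restrict_vars X (scale_vars g p) = restrict_vars X p"
proof (rule poly_eqI)
  fix a assume g: "\<And>i. i \<in> X \<Longrightarrow> g i = 1"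
  have "mval g a = 1" if "supp a \<subseteq> X"
    using g that by (subst mval_cong[of a g "\<lambda>_. 1"]) auto
  then show "coeff (restrict_vars X (scale_vars g p)) a = coeff (restrict_vars X p) a"
    by (auto simp: coeff_restrict_vars coeff_scale_vars)
qed

section \<open>Weighted degrees and homogeneous components\<close>

lemma mono_deg_superset:
  "finite A \<Longrightarrow> supp a \<subseteq> A \<Longrightarrow> mono_deg q a = 2 * (\<Sum>i\<in>A. of_nat (coeff a i) * q i)"
  unfolding mono_deg_def by (intro arg_cong[of _ _ "\<lambda>x. 2 * x"] sum.mono_neutral_left) (auto simp: supp_iff)

lemma mono_deg_add: "mono_deg q (a + b) = mono_deg q a + mono_deg q b"
proof -
  let ?A = "supp a \<union> supp b"
  have "mono_deg q c = 2 * (\<Sum>i\<in>?A. of_nat (coeff c i) * q i)" if "supp c \<subseteq> ?A" for c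
    using that by (intro mono_deg_superset) auto
  then show ?thesis by (simp add: lookup_add distrib_right sum.distrib)
qed

lemma mono_deg_zero [simp]: "mono_deg q 0 = 0" by (simp add: mono_deg_def)
lemma mono_deg_single [simp]: "mono_deg q (mon i k) = 2 * of_nat k * q i" by (simp add: mono_deg_def)

lemma mono_deg_cong: "supp a \<subseteq> X \<Longrightarrow> (\<And>i. i \<in> X \<Longrightarrow> q i = q' i) \<Longrightarrow> mono_deg q a = mono_deg q' a"
  unfolding mono_deg_def by (intro arg_cong[of _ _ "\<lambda>x. 2 * x"] sum.cong) auto

lemma mono_deg_nonneg: "supp a \<subseteq> X \<Longrightarrow> (\<And>i. i \<in> X \<Longrightarrow> q i > 0) \<Longrightarrow> mono_deg q a \<ge> 0"
  unfolding mono_deg_def by (intro mult_nonneg_nonneg sum_nonneg) (auto intro: less_imp_le)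

lemma mono_deg_pos:
  assumes "supp a \<subseteq> X" "\<And>i. i \<in> X \<Longrightarrow> q i > 0" "a \<noteq> 0"
  shows "mono_deg q a > 0"
proof -
  have "supp a \<noteq> {}" using assms(3) by simp
  then have "(\<Sum>i\<in>supp a. of_nat (coeff a i) * q i) > 0"
    using assms(1,2) by (intro sum_pos) (auto simp: supp_iff in_mono)
  then show ?thesis by (simp add: mono_deg_def)
qed

lift_definition hcomp :: "(nat \<Rightarrow> rat) \<Rightarrow> rat \<Rightarrow> mpoly \<Rightarrow> mpoly"
  is "\<lambda>q d f a. if mono_deg q a = d then f a else 0"
  by (rule finite_subset[rotated]) auto

lemma coeff_hcomp: "coeff (hcomp q d p) a = (if mono_deg q a = d then coeff p a else 0)"
  by transfer simp

lemma hcomp_add: "hcomp q d (p + r) = hcomp q d p + hcomp q d r"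
  by (rule poly_eqI) (simp add: coeff_hcomp lookup_add)
lemma hcomp_diff: "hcomp q d (p - r) = hcomp q d p - hcomp q d r"
  by (rule poly_eqI) (simp add: coeff_hcomp lookup_minus)
lemma hcomp_zero [simp]: "hcomp q d 0 = 0" by (rule poly_eqI) (simp add: coeff_hcomp)
lemma hcomp_sum: "hcomp q d (sum f A) = (\<Sum>x\<in>A. hcomp q d (f x))"
  by (induction A rule: infinite_finite_induct) (auto simp: hcomp_add)
lemma hcomp_Const_mult: "hcomp q d (Const c * p) = Const c * hcomp q d p"
  by (rule poly_eqI) (simp add: coeff_hcomp)
lemma hcomp_mon: "hcomp q d (mon a c) = (if mono_deg q a = d then mon a c else 0)"
  by (rule poly_eqI) (auto simp: coeff_hcomp lookup_single when_def)

definition homog_of :: "(nat \<Rightarrow> rat) \<Rightarrow> rat \<Rightarrow> mpoly \<Rightarrow> bool" where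
  "homog_of q d p \<longleftrightarrow> (\<forall>a\<in>supp p. mono_deg q a = d)"

lemma homog_polys_iff: "p \<in> homog_polys X q d \<longleftrightarrow> p \<in> polys X \<and> homog_of q d p"
  by (simp add: homog_polys_def homog_of_def)

lemma homog_of_hcomp: "homog_of q d (hcomp q d p)"
  by (auto simp: homog_of_def supp_iff coeff_hcomp split: if_splits)
lemma hcomp_polys [intro]: "p \<in> polys X \<Longrightarrow> hcomp q d p \<in> polys X"
  by (rule polysI) (metis coeff_hcomp polysD)
lemma hcomp_homog: "homog_of q d p \<Longrightarrow> hcomp q e p = (if e = d then p else 0)"
  by (rule poly_eqI) (auto simp: coeff_hcomp homog_of_def supp_iff)
lemma homog_of_iff: "homog_of q d p \<longleftrightarrow> hcomp q d p = p"
  using homog_of_hcomp hcomp_homog by metis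
lemma homog_of_zero [simp]: "homog_of q d 0" by (simp add: homog_of_def)
lemma homog_of_add: "homog_of q d p \<Longrightarrow> homog_of q d r \<Longrightarrow> homog_of q d (p + r)"
  by (simp add: homog_of_iff hcomp_add)
lemma homog_of_diff: "homog_of q d p \<Longrightarrow> homog_of q d r \<Longrightarrow> homog_of q d (p - r)"
  by (simp add: homog_of_iff hcomp_diff)
lemma homog_of_sum: "(\<And>x. x \<in> A \<Longrightarrow> homog_of q d (f x)) \<Longrightarrow> homog_of q d (sum f A)"
  by (simp add: homog_of_iff hcomp_sum)
lemma homog_of_mon: "mono_deg q a = d \<Longrightarrow> homog_of q d (mon a c)"
  by (auto simp: homog_of_def)
lemma homog_of_mult:
  assumes "homog_of q d p" "homog_of q e r" shows "homog_of q (d + e) (p * r)"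
  unfolding homog_of_def
proof
  fix a assume "a \<in> supp (p * r)"
  then obtain b c where "a = b + c" "b \<in> supp p" "c \<in> supp r" using keys_mult by blast
  then show "mono_deg q a = d + e" using assms by (simp add: homog_of_def mono_deg_add)
qed
lemma homog_of_Const [simp]: "homog_of q 0 (Const c)"
  unfolding Const_def by (rule homog_of_mon) simp
lemma homog_of_one [simp]: "homog_of q 0 1"
  using homog_of_Const[of q 1] by simp
lemma homog_of_of_int [simp]: "homog_of q 0 (of_int n)"
  unfolding single_of_int[symmetric] by (rule homog_of_mon) simp
lemma homog_of_prod:
  "(\<And>x. x \<in> A \<Longrightarrow> homog_of q (d x) (f x)) \<Longrightarrow> homog_of q (sum d A) (prod f A)"
  by (induction A rule: infinite_finite_induct) (auto intro: homog_of_mult)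
lemma homog_of_Const_mult: "homog_of q d p \<Longrightarrow> homog_of q d (Const c * p)"
  using homog_of_mult[OF homog_of_Const] by fastforce
lemma homog_of_cong:
  "p \<in> polys X \<Longrightarrow> (\<And>i. i \<in> X \<Longrightarrow> q i = q' i) \<Longrightarrow> homog_of q d p = homog_of q' d p"
proof -
  assume *: "p \<in> polys X" "\<And>i. i \<in> X \<Longrightarrow> q i = q' i"
  have "mono_deg q a = mono_deg q' a" if "a \<in> supp p" for a
    using * that by (intro mono_deg_cong[of _ X]) (auto simp: polys_def)
  then show ?thesis by (simp add: homog_of_def)
qed
lemma homog_of_restrict: "homog_of q d p \<Longrightarrow> homog_of q d (restrict_vars X p)"
  by (auto simp: homog_of_def supp_iff coeff_restrict_vars split: if_splits)

lemma hcomp_mult_homog: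
  assumes "homog_of q e r"
  shows "hcomp q d (p * r) = hcomp q (d - e) p * r"
proof (induction p rule: mpoly_induct)
  case (mon a c)
  have "homog_of q (mono_deg q a + e) (mon a c * r)"
    by (intro homog_of_mult homog_of_mon assms refl)
  then show ?case by (auto simp: hcomp_homog hcomp_mon)
next
  case (add p1 p2)
  then show ?case by (simp add: distrib_right hcomp_add)
qed

lemma sum_hcomp:
  assumes "finite A" "mono_deg q ` supp p \<subseteq> A"
  shows "(\<Sum>d\<in>A. hcomp q d p) = p"
proof (rule poly_eqI)
  fix a
  have "coeff (\<Sum>d\<in>A. hcomp q d p) a = (\<Sum>d\<in>A. if mono_deg q a = d then coeff p a else 0)"
    by (simp add: lookup_sum coeff_hcomp)
  also have "\<dots> = coeff p a" using assms by (auto simp: sum.delta' supp_iff image_subset_iff)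
  finally show "coeff (\<Sum>d\<in>A. hcomp q d p) a = coeff p a" .
qed

section \<open>Partial derivatives\<close>

lemma pdiff_superset:
  assumes "finite A" "supp p \<subseteq> A"
  shows "pdiff i p = (\<Sum>a\<in>A. mon (a - mon i 1) (of_nat (coeff a i) * coeff p a))"
  unfolding pdiff_def by (rule sum.mono_neutral_left) (use assms in \<open>auto simp: supp_iff\<close>)

lemma pdiff_add: "pdiff i (p + q) = pdiff i p + pdiff i q"
proof -
  let ?A = "supp p \<union> supp q"
  have "pdiff i (p + q) = (\<Sum>a\<in>?A. mon (a - mon i 1) (of_nat (coeff a i) * coeff (p + q) a))"
    by (rule pdiff_superset) (auto dest: supp_add[THEN subsetD])
  then show ?thesis
    by (simp add: lookup_add distrib_left sum.distrib single_add pdiff_superset[of ?A])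
qed

lemma pdiff_mon: "pdiff i (mon a c) = mon (a - mon i 1) (of_nat (coeff a i) * c)"
  by (simp add: pdiff_def)

text \<open>Read at the target exponent, the derivative involves no truncated subtraction; later
  arguments use this form.\<close>

lemma coeff_pdiff: "coeff (pdiff i p) a = of_nat (coeff a i + 1) * coeff p (a + mon i 1)"
proof (induction p rule: mpoly_induct)
  case (mon b c)
  show ?case
  proof (cases "coeff b i = 0")
    case True
    then have "b \<noteq> a + mon i 1" by (auto simp: lookup_add)
    then show ?thesis using True by (simp add: pdiff_mon lookup_single when_def)
  next
    case False
    have "b - mon i 1 + mon i 1 = b"
      using False by (intro poly_mapping_eqI) (auto simp: lookup_add lookup_minus lookup_single when_def)
    then have "b - mon i 1 = a \<longleftrightarrow> b = a + mon i 1" by (metis add_diff_cancel_right')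
    then show ?thesis by (auto simp: pdiff_mon lookup_single when_def lookup_add)
  qed
next
  case (add p q)
  then show ?case by (simp add: pdiff_add lookup_add distrib_left)
qed

lemma supp_pdiff: "a \<in> supp (pdiff i p) \<longleftrightarrow> a + mon i 1 \<in> supp p"
  by (simp add: supp_iff coeff_pdiff del: of_nat_add of_nat_Suc)

lemma pdiff_polys [intro]: "p \<in> polys X \<Longrightarrow> pdiff i p \<in> polys X"
  by (auto simp: polys_def supp_pdiff dest!: bspec)

lemma pdiff_homog:
  assumes "homog_of q d p" shows "homog_of q (d - 2 * q i) (pdiff i p)"
  using assms by (auto simp: homog_of_def supp_pdiff mono_deg_add dest!: bspec)

lemma pdiff_zero [simp]: "pdiff i 0 = 0" by (simp add: pdiff_def)

lemma pdiff_outside: "p \<in> polys X \<Longrightarrow> i \<notin> X \<Longrightarrow> pdiff i p = 0"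
proof (rule poly_eqI)
  fix a :: "nat \<Rightarrow>\<^sub>0 nat" assume *: "p \<in> polys X" "i \<notin> X"
  have "i \<in> supp (a + mon i 1)" by (simp add: supp_iff[of i] lookup_add)
  then have "a + mon i 1 \<notin> supp p" using * unfolding polys_def by blast
  then show "coeff (pdiff i p) a = coeff 0 a" by (simp add: supp_iff coeff_pdiff)
qed

text \<open>Chain rule: an eigenvector of \<open>g\<close> has derivatives that are again
  eigenvectors, with the eigenvalue divided by an entry of \<open>g\<close>.\<close>

lemma scale_pdiff:
  assumes "g i \<noteq> 0" "scale_vars g p = Const c * p"
  shows "scale_vars g (pdiff i p) = Const (c / g i) * pdiff i p"
proof (rule poly_eqI)
  fix a
  have "coeff (scale_vars g p) (a + mon i 1) = c * coeff p (a + mon i 1)"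
    by (simp add: assms(2))
  then have "mval g a * g i * coeff p (a + mon i 1) = c * coeff p (a + mon i 1)"
    by (simp add: coeff_scale_vars mval_add)
  then show "coeff (scale_vars g (pdiff i p)) a = coeff (Const (c / g i) * pdiff i p) a"
    unfolding coeff_scale_vars coeff_Const_mult coeff_pdiff using assms(1)
    by (simp add: divide_simps mult_ac del: of_nat_add of_nat_Suc One_nat_def)
qed

section \<open>Milnor rings by representatives\<close>

lemma poly_ring_simps [simp]:
  "carrier (poly_ring X) = polys X" "mult (poly_ring X) = (*)" "one (poly_ring X) = 1"
  "zero (poly_ring X) = 0" "add (poly_ring X) = (+)"
  by (simp_all add: poly_ring_def)

lemma cring_poly_ring: "cring (poly_ring X)"
proof (rule cringI)
  show "abelian_group (poly_ring X)"
  proof (rule abelian_groupI)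
    fix p assume "p \<in> carrier (poly_ring X)"
    then show "\<exists>q\<in>carrier (poly_ring X). q \<oplus>\<^bsub>poly_ring X\<^esub> p = \<zero>\<^bsub>poly_ring X\<^esub>"
      by (intro bexI[of _ "-p"]) auto
  qed (auto simp: add_ac)
  show "comm_monoid (poly_ring X)"
    by (rule comm_monoidI) (auto simp: mult_ac)
qed (auto simp: distrib_right)

lemma a_minus_poly_ring: "p \<in> polys X \<Longrightarrow> \<ominus>\<^bsub>poly_ring X\<^esub> p = - p"
proof -
  interpret cring "poly_ring X" by (rule cring_poly_ring)
  assume "p \<in> polys X"
  then show ?thesis by (intro minus_equality) auto
qed

lemma jac_ideal:
  assumes "F \<in> polys X" shows "ideal (jac X F) (poly_ring X)"
proof -
  interpret cring "poly_ring X" by (rule cring_poly_ring)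
  show ?thesis unfolding jac_def using assms by (intro genideal_ideal) auto
qed

context
  fixes X :: "nat set" and F :: mpoly
  assumes F: "F \<in> polys X"
begin

interpretation R: cring "poly_ring X" by (rule cring_poly_ring)
interpretation J: ideal "jac X F" "poly_ring X" by (rule jac_ideal[OF F])

lemma jac_polys: "p \<in> jac X F \<Longrightarrow> p \<in> polys X" using J.a_Hcarr by simp
lemma jac_zero: "0 \<in> jac X F" using J.zero_closed by simp
lemma jac_add: "p \<in> jac X F \<Longrightarrow> q \<in> jac X F \<Longrightarrow> p + q \<in> jac X F"
  using J.a_closed by simp
lemma jac_uminus: "p \<in> jac X F \<Longrightarrow> - p \<in> jac X F"
  using J.a_inv_closed[of p] by (simp add: a_minus_poly_ring jac_polys)
lemma jac_diff: "p \<in> jac X F \<Longrightarrow> q \<in> jac X F \<Longrightarrow> p - q \<in> jac X F"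
  using jac_add[OF _ jac_uminus, of p q] by simp
lemma jac_mult: "p \<in> jac X F \<Longrightarrow> q \<in> polys X \<Longrightarrow> q * p \<in> jac X F"
  using J.I_l_closed by simp
lemma jac_mult': "p \<in> jac X F \<Longrightarrow> q \<in> polys X \<Longrightarrow> p * q \<in> jac X F"
  using jac_mult by (simp add: mult.commute)
lemma jac_sum: "(\<And>x. x \<in> A \<Longrightarrow> f x \<in> jac X F) \<Longrightarrow> sum f A \<in> jac X F"
  by (induction A rule: infinite_finite_induct) (auto intro: jac_zero jac_add)
lemma jac_pdiff: "i \<in> X \<Longrightarrow> pdiff i F \<in> jac X F"
  unfolding jac_def using R.genideal_self[of "(\<lambda>i. pdiff i F) ` X"] F by auto

text \<open>The combinations of the partial derivatives form an ideal that contains the generators,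
  and the generated ideal is the smallest one. Membership is afterwards always unfolded into such
  coefficients.\<close>

lemma jac_explicit:
  assumes "finite X" "p \<in> jac X F"
  obtains r where "\<And>i. i \<in> X \<Longrightarrow> r i \<in> polys X" "p = (\<Sum>i\<in>X. r i * pdiff i F)"
proof -
  let ?I = "{\<Sum>i\<in>X. r i * pdiff i F | r. \<forall>i\<in>X. r i \<in> polys X}"
  have "ideal ?I (poly_ring X)"
  proof (rule idealI)
    show "ring (poly_ring X)" by (rule R.ring_axioms)
    show "subgroup ?I (add_monoid (poly_ring X))"
    proof (rule R.add.subgroupI)
      show "?I \<subseteq> carrier (poly_ring X)" using F by auto
      have "(\<Sum>i\<in>X. 0 * pdiff i F) \<in> ?I" by (intro CollectI exI[of _ "\<lambda>i. 0"]) auto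
      then show "?I \<noteq> {}" by blast
    next
      fix a assume "a \<in> ?I"
      then obtain r where r: "\<forall>i\<in>X. r i \<in> polys X" "a = (\<Sum>i\<in>X. r i * pdiff i F)" by blast
      then have a: "a \<in> polys X" using F by auto
      have "- a = (\<Sum>i\<in>X. (- r i) * pdiff i F)" using r(2) by (simp add: sum_negf)
      then have "- a \<in> ?I" using r(1) by (intro CollectI exI[of _ "\<lambda>i. - r i"]) auto
      then show "\<ominus>\<^bsub>poly_ring X\<^esub> a \<in> ?I"
        using a_minus_poly_ring[OF a] by simp
    next
      fix a b assume "a \<in> ?I" "b \<in> ?I"
      then obtain r s where r: "\<forall>i\<in>X. r i \<in> polys X" "a = (\<Sum>i\<in>X. r i * pdiff i F)"
        and s: "\<forall>i\<in>X. s i \<in> polys X" "b = (\<Sum>i\<in>X. s i * pdiff i F)" by blast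
      have "a + b = (\<Sum>i\<in>X. (r i + s i) * pdiff i F)"
        using r(2) s(2) by (simp add: sum.distrib distrib_right)
      then have "a + b \<in> ?I" using r(1) s(1) by (intro CollectI exI[of _ "\<lambda>i. r i + s i"]) auto
      then show "a \<oplus>\<^bsub>poly_ring X\<^esub> b \<in> ?I" by simp
    qed
    fix a x assume "a \<in> ?I" and x: "x \<in> carrier (poly_ring X)"
    then obtain r where r: "\<forall>i\<in>X. r i \<in> polys X" "a = (\<Sum>i\<in>X. r i * pdiff i F)" by blast
    have "x * a = (\<Sum>i\<in>X. (x * r i) * pdiff i F)"
      using r(2) by (simp add: sum_distrib_left mult_ac)
    then have "x * a \<in> ?I" using r(1) x by (intro CollectI exI[of _ "\<lambda>i. x * r i"]) auto
    then show "x \<otimes>\<^bsub>poly_ring X\<^esub> a \<in> ?I" "a \<otimes>\<^bsub>poly_ring X\<^esub> x \<in> ?I"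
      by (simp_all add: mult.commute)
  qed
  moreover have "(\<lambda>i. pdiff i F) ` X \<subseteq> ?I"
  proof (intro image_subsetI CollectI)
    fix i assume i: "i \<in> X"
    have "pdiff i F = (\<Sum>j\<in>X. (if j = i then 1 else 0) * pdiff j F)"
      using i assms(1) by (simp add: if_distrib if_distribR sum.delta cong: if_cong)
    then show "\<exists>r. pdiff i F = (\<Sum>i\<in>X. r i * pdiff i F) \<and> (\<forall>i\<in>X. r i \<in> polys X)"
      by (intro exI[of _ "\<lambda>j. if j = i then 1 else 0"]) auto
  qed
  ultimately have "jac X F \<subseteq> ?I" unfolding jac_def by (rule R.genideal_minimal)
  then show ?thesis using assms(2) that by blast
qed

section \<open>Classes, operations and the group action on representatives\<close>

lemma mem_cls: "p \<in> polys X \<Longrightarrow> r \<in> cls X F p \<longleftrightarrow> r - p \<in> jac X F"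
proof -
  have "r \<in> cls X F p \<longleftrightarrow> (\<exists>j\<in>jac X F. r = j + p)"
    by (simp add: cls_def a_r_coset_def r_coset_def)
  also have "\<dots> \<longleftrightarrow> r - p \<in> jac X F" by (metis add_diff_cancel_right' diff_add_cancel)
  finally show ?thesis .
qed

lemma cls_self: "p \<in> polys X \<Longrightarrow> p \<in> cls X F p"
  by (simp add: mem_cls jac_zero)

lemma cls_subset: "p \<in> polys X \<Longrightarrow> r \<in> cls X F p \<Longrightarrow> r \<in> polys X"
proof -
  assume "p \<in> polys X" "r \<in> cls X F p"
  then have "(r - p) + p \<in> polys X" by (intro polys_add) (auto simp: mem_cls jac_polys)
  then show ?thesis by simp
qed

lemma cls_eq_iff:
  assumes "p \<in> polys X" "q \<in> polys X" shows "cls X F p = cls X F q \<longleftrightarrow> p - q \<in> jac X F"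
proof
  assume "cls X F p = cls X F q"
  then show "p - q \<in> jac X F" using cls_self[OF assms(1)] assms by (simp add: mem_cls)
next
  assume *: "p - q \<in> jac X F"
  have "r - p \<in> jac X F \<longleftrightarrow> r - q \<in> jac X F" for r
    using jac_add[OF _ *, of "r - p"] jac_diff[OF _ *, of "r - q"] by auto
  then show "cls X F p = cls X F q" using assms by (auto simp: mem_cls)
qed

lemma carrier_milnor_ring: "carrier (milnor_ring X F) = cls X F ` polys X"
  by (auto simp: milnor_ring_def FactRing_def A_RCOSETS_def' cls_def)

lemma carrier_milnor: "carrier (milnor X F) = cls X F ` polys X"
  using carrier_milnor_ring by (simp add: milnor_def)

lemma milnor_ring_mult:
  "p \<in> polys X \<Longrightarrow> q \<in> polys X \<Longrightarrow> cls X F p \<otimes>\<^bsub>milnor_ring X F\<^esub> cls X F q = cls X F (p * q)"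
  using J.rcoset_mult_add[of p q] by (simp add: milnor_ring_def FactRing_def cls_def)

lemma milnor_ring_add:
  "p \<in> polys X \<Longrightarrow> q \<in> polys X \<Longrightarrow> cls X F p \<oplus>\<^bsub>milnor_ring X F\<^esub> cls X F q = cls X F (p + q)"
  using J.a_rcos_sum[of p q] by (simp add: milnor_ring_def FactRing_def cls_def)

lemma milnor_ring_zero: "\<zero>\<^bsub>milnor_ring X F\<^esub> = cls X F 0"
proof -
  have "r \<in> cls X F 0 \<longleftrightarrow> r \<in> jac X F" for r by (simp add: mem_cls)
  then show ?thesis by (auto simp: milnor_ring_def FactRing_def)
qed

lemma milnor_ring_one: "\<one>\<^bsub>milnor_ring X F\<^esub> = cls X F 1"
  by (simp add: milnor_ring_def FactRing_def cls_def)

lemma milnor_mult: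
  "p \<in> polys X \<Longrightarrow> q \<in> polys X \<Longrightarrow> cls X F p \<otimes>\<^bsub>milnor X F\<^esub> cls X F q = cls X F (p * q)"
  using milnor_ring_mult by (simp add: milnor_def)

lemma milnor_add:
  "p \<in> polys X \<Longrightarrow> q \<in> polys X \<Longrightarrow> cls X F p \<oplus>\<^bsub>milnor X F\<^esub> cls X F q = cls X F (p + q)"
  using milnor_ring_add by (simp add: milnor_def)

lemma milnor_zero: "\<zero>\<^bsub>milnor X F\<^esub> = cls X F 0"
  using milnor_ring_zero by (simp add: milnor_def)

lemma milnor_one: "\<one>\<^bsub>milnor X F\<^esub> = cls X F 1"
  using milnor_ring_one by (simp add: milnor_def)

lemma milnor_smult:
  "p \<in> polys X \<Longrightarrow> c \<odot>\<^bsub>milnor X F\<^esub> cls X F p = cls X F (Const c * p)"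
  using milnor_ring_mult[of "Const c" p] by (simp add: milnor_def)

lemma ring_milnor_ring: "ring (milnor_ring X F)"
  unfolding milnor_ring_def by (rule J.quotient_is_ring)

lemma abelian_group_milnor: "abelian_group (milnor X F)"
proof (rule abelian_groupI)
  fix x assume "x \<in> carrier (milnor X F)"
  then obtain p where "p \<in> polys X" "x = cls X F p" by (auto simp: carrier_milnor)
  then show "\<exists>y\<in>carrier (milnor X F). y \<oplus>\<^bsub>milnor X F\<^esub> x = \<zero>\<^bsub>milnor X F\<^esub>"
    by (intro bexI[of _ "cls X F (-p)"])
      (use milnor_add[of "-p" p] in \<open>auto simp: carrier_milnor milnor_zero\<close>)
qed (auto simp: carrier_milnor milnor_add milnor_zero add_ac polys_add)

lemma finsum_milnor:
  assumes "finite A" "\<And>x. x \<in> A \<Longrightarrow> f x \<in> polys X"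
  shows "finsum (milnor X F) (\<lambda>x. cls X F (f x)) A = cls X F (sum f A)"
  using assms
proof (induction A rule: finite_induct)
  case empty
  interpret abelian_group "milnor X F" by (rule abelian_group_milnor)
  show ?case by (simp add: milnor_zero)
next
  case (insert x A)
  interpret abelian_group "milnor X F" by (rule abelian_group_milnor)
  have "finsum (milnor X F) (\<lambda>x. cls X F (f x)) (insert x A) =
    cls X F (f x) \<oplus>\<^bsub>milnor X F\<^esub> finsum (milnor X F) (\<lambda>x. cls X F (f x)) A"
    using insert by (intro finsum_insert) (auto simp: carrier_milnor)
  then show ?case using insert by (simp add: milnor_add polys_sum)
qed

lemma act_cls:
  assumes "p \<in> polys X" "\<And>j. j \<in> jac X F \<Longrightarrow> scale_vars g j \<in> jac X F"
  shows "act X F g (cls X F p) = cls X F (Const (diag_det X g) * scale_vars g p)"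
proof -
  have "cls X F (Const (diag_det X g) * scale_vars g m) = cls X F (Const (diag_det X g) * scale_vars g p)"
    if "m \<in> cls X F p" for m
  proof (subst cls_eq_iff)
    have "scale_vars g (m - p) \<in> jac X F" using that assms by (simp add: mem_cls)
    then show "Const (diag_det X g) * scale_vars g m - Const (diag_det X g) * scale_vars g p \<in> jac X F"
      using jac_mult[of _ "Const (diag_det X g)"] by (simp add: scale_vars_diff flip: right_diff_distrib)
  qed (use assms cls_subset[OF assms(1) that] in auto)
  then show ?thesis unfolding act_def using cls_self[OF assms(1)] by blast
qed

text \<open>By the chain rule the generators of the ideal are eigenvectors of a symmetry.\<close>

lemma jac_scale:
  assumes "finite X" "scale_vars g F = F" "\<And>i. i \<in> X \<Longrightarrow> g i \<noteq> 0" "j \<in> jac X F"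
  shows "scale_vars g j \<in> jac X F"
proof -
  from assms obtain r where r: "\<And>i. i \<in> X \<Longrightarrow> r i \<in> polys X" "j = (\<Sum>i\<in>X. r i * pdiff i F)"
    using jac_explicit by metis
  have "scale_vars g (pdiff i F) = Const (1 / g i) * pdiff i F" if "i \<in> X" for i
    using scale_pdiff[of g i F 1] assms that by simp
  then have "scale_vars g j = (\<Sum>i\<in>X. (scale_vars g (r i) * Const (1 / g i)) * pdiff i F)"
    by (simp add: r(2) scale_vars_sum scale_vars_mult mult_ac)
  also have "\<dots> \<in> jac X F"
    by (intro jac_sum jac_mult jac_pdiff) (use r(1) in auto)
  finally show ?thesis .
qed

text \<open>The generators are homogeneous, so the ideal is graded.\<close>

lemma jac_hcomp:
  assumes "finite X" "homog_of q e F" "j \<in> jac X F"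
  shows "hcomp q d j \<in> jac X F"
proof -
  from assms obtain r where r: "\<And>i. i \<in> X \<Longrightarrow> r i \<in> polys X" "j = (\<Sum>i\<in>X. r i * pdiff i F)"
    using jac_explicit by metis
  have "hcomp q d j = (\<Sum>i\<in>X. hcomp q (d - (e - 2 * q i)) (r i) * pdiff i F)"
    by (simp add: r(2) hcomp_sum hcomp_mult_homog[OF pdiff_homog[OF assms(2)]])
  also have "\<dots> \<in> jac X F"
    by (intro jac_sum jac_mult jac_pdiff) (use r(1) in auto)
  finally show ?thesis .
qed

text \<open>The dimension is taken over the classes of constants inside the quotient ring;
  \<open>proper\<close> makes them a copy of the field of complex numbers. This lemma turns the
  abstract dimension into a count of exponents.\<close>

lemma milnor_number_basis:
  assumes "finite B" "\<And>a. a \<in> B \<Longrightarrow> supp a \<subseteq> X"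
    and indep: "\<And>p. supp p \<subseteq> B \<Longrightarrow> p \<in> jac X F \<Longrightarrow> p = 0"
    and span: "\<And>p. p \<in> polys X \<Longrightarrow> \<exists>r. supp r \<subseteq> B \<and> p - r \<in> jac X F"
    and proper: "1 \<notin> jac X F"
  shows "milnor_number X F = card B"
proof -
  let ?R = "milnor_ring X F"
  interpret M: ring ?R by (rule ring_milnor_ring)
  define K where "K = range (\<lambda>c. cls X F (Const c))"
  have K_mult: "cls X F (Const c) \<otimes>\<^bsub>?R\<^esub> cls X F p = cls X F (Const c * p)" if "p \<in> polys X" for c p
    using that by (intro milnor_ring_mult) auto
  have "cring ?R"
    unfolding milnor_ring_def by (rule J.quotient_is_cring[OF R.is_cring])
  then interpret M: cring ?R .
  have inv: "\<ominus>\<^bsub>?R\<^esub> cls X F p = cls X F (- p)" if "p \<in> polys X" for p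
    using that milnor_ring_add[of "-p" p]
    by (intro M.minus_equality) (auto simp: carrier_milnor_ring milnor_ring_zero)
  have one_neq: "\<one>\<^bsub>?R\<^esub> \<noteq> \<zero>\<^bsub>?R\<^esub>"
    using proper by (simp add: milnor_ring_one milnor_ring_zero cls_eq_iff)
  have "subfield K ?R"
  proof (rule M.subfieldI)
    have "subring K ?R"
    proof (rule M.subringI)
      show "K \<subseteq> carrier ?R" by (auto simp: K_def carrier_milnor_ring)
      show "\<one>\<^bsub>?R\<^esub> \<in> K" unfolding K_def milnor_ring_one
        by (rule range_eqI[of _ _ 1]) simp
      fix h1 assume "h1 \<in> K"
      then obtain c1 where 1: "h1 = cls X F (Const c1)" by (auto simp: K_def)
      show "\<ominus>\<^bsub>?R\<^esub> h1 \<in> K" unfolding 1 K_def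
        by (rule range_eqI[of _ _ "-c1"]) (simp add: inv Const_uminus)
      fix h2 assume "h2 \<in> K"
      then obtain c2 where 2: "h2 = cls X F (Const c2)" by (auto simp: K_def)
      show "h1 \<otimes>\<^bsub>?R\<^esub> h2 \<in> K" unfolding 1 2 K_def
        by (rule range_eqI[of _ _ "c1 * c2"]) (simp add: K_mult Const_mult)
      show "h1 \<oplus>\<^bsub>?R\<^esub> h2 \<in> K" unfolding 1 2 K_def
        by (rule range_eqI[of _ _ "c1 + c2"]) (simp add: milnor_ring_add Const_add)
    qed
    then show "subcring K ?R"
      by (rule M.subcringI) (auto simp: K_def K_mult mult.commute)
    show "Units (?R\<lparr>carrier := K\<rparr>) = K - {\<zero>\<^bsub>?R\<^esub>}"
    proof (intro equalityI subsetI)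
      fix k assume "k \<in> Units (?R\<lparr>carrier := K\<rparr>)"
      then show "k \<in> K - {\<zero>\<^bsub>?R\<^esub>}"
        using one_neq by (auto simp: Units_def K_def milnor_ring_zero milnor_ring_one K_mult)
    next
      fix k assume "k \<in> K - {\<zero>\<^bsub>?R\<^esub>}"
      then obtain c where k: "k = cls X F (Const c)" "k \<noteq> cls X F 0"
        by (auto simp: K_def milnor_ring_zero)
      then have c: "k = cls X F (Const c)" "c \<noteq> 0" by auto
      have "cls X F (Const (1 / c)) \<otimes>\<^bsub>?R\<^esub> k = \<one>\<^bsub>?R\<^esub>" "k \<otimes>\<^bsub>?R\<^esub> cls X F (Const (1 / c)) = \<one>\<^bsub>?R\<^esub>"
        using c by (simp_all add: K_mult milnor_ring_one flip: Const_mult)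
      then show "k \<in> Units (?R\<lparr>carrier := K\<rparr>)"
        using c(1) unfolding Units_def K_def by (intro CollectI conjI bexI[of _ "cls X F (Const (1 / c))"]) simp_all
    qed
  qed
  \<comment> \<open>Each further exponent enlarges the span by one line: if its monomial were
    congruent to an element of the previous span, the difference would be a nonzero member of the
    ideal supported in \<open>B\<close>.\<close>
  have dim: "M.dimension (card C) K (cls X F ` {p. supp p \<subseteq> C})" if "C \<subseteq> B" for C
    using finite_subset[OF that assms(1)] that
  proof (induction C rule: finite_induct)
    case empty
    have "cls X F ` {p. supp p \<subseteq> {}} = {\<zero>\<^bsub>?R\<^esub>}"
      by (auto simp: milnor_ring_zero)
    then show ?case using M.zero_dim by simp
  next
    case (insert b C)
    let ?E = "cls X F ` {p. supp p \<subseteq> C}"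
    have b: "b \<in> B" "supp b \<subseteq> X" using insert assms(2) by auto
    have CX: "p \<in> polys X" if "supp p \<subseteq> insert b C" for p
      using that insert assms(2) by (auto simp: polys_iff)
    have CX': "p \<in> polys X" if "supp p \<subseteq> C" for p using CX that by auto
    have bX: "mon b 1 \<in> polys X" "mon b c \<in> polys X" for c using b by auto
    have 1: "cls X F (mon b 1) \<notin> ?E"
    proof
      assume "cls X F (mon b 1) \<in> ?E"
      then obtain p where p: "supp p \<subseteq> C" "mon b 1 - p \<in> jac X F"
        using bX CX' by (auto simp: cls_eq_iff)
      have "supp (mon b 1 - p) \<subseteq> B"
        using p(1) insert.prems by (auto simp: supp_iff lookup_minus lookup_single when_def split: if_splits)
      then have "mon b 1 - p = 0" using p(2) indep by blast
      then have "coeff (mon b 1 - p) b = 0" by simp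
      moreover have "coeff p b = 0" using p(1) insert.hyps by (auto simp: supp_iff)
      ultimately show False by (simp add: lookup_minus)
    qed
    have 2: "M.line_extension K (cls X F (mon b 1)) ?E = cls X F ` {p. supp p \<subseteq> insert b C}"
    proof (intro equalityI subsetI)
      fix x assume "x \<in> M.line_extension K (cls X F (mon b 1)) ?E"
      then obtain k v where kv: "k \<in> K" "v \<in> ?E" "x = k \<otimes>\<^bsub>?R\<^esub> cls X F (mon b 1) \<oplus>\<^bsub>?R\<^esub> v"
        by (auto simp: M.line_extension_mem_iff)
      obtain c where c: "k = cls X F (Const c)" using kv by (auto simp: K_def)
      obtain p where p: "supp p \<subseteq> C" "v = cls X F p" using kv by auto
      have "x = cls X F (mon b c + p)"
        using kv(3) c p bX CX'[OF p(1)] by (simp add: K_mult Const_mon milnor_ring_add)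
      moreover have "supp (mon b c + p) \<subseteq> insert b C"
        using p(1) supp_add[of "mon b c" p] supp_single[of b c] by auto
      ultimately show "x \<in> cls X F ` {p. supp p \<subseteq> insert b C}" by auto
    next
      fix x assume "x \<in> cls X F ` {p. supp p \<subseteq> insert b C}"
      then obtain p where p: "supp p \<subseteq> insert b C" "x = cls X F p" by auto
      define p' where "p' = p - mon b (coeff p b)"
      have p': "supp p' \<subseteq> C"
        using p(1) by (auto simp: p'_def supp_iff lookup_minus lookup_single when_def subset_iff split: if_splits)
      have "x = cls X F (Const (coeff p b)) \<otimes>\<^bsub>?R\<^esub> cls X F (mon b 1) \<oplus>\<^bsub>?R\<^esub> cls X F p'"
        using bX CX'[OF p'] by (simp add: p(2) K_mult Const_mon milnor_ring_add p'_def)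
      then show "x \<in> M.line_extension K (cls X F (mon b 1)) ?E"
        using p' by (auto simp: M.line_extension_mem_iff K_def)
    qed
    have "M.dimension (Suc (card C)) K (M.line_extension K (cls X F (mon b 1)) ?E)"
      by (rule M.Suc_dim) (use insert bX 1 in \<open>auto simp: carrier_milnor_ring\<close>)
    then show ?case using insert.hyps 2 by simp
  qed
  have "carrier ?R = cls X F ` {p. supp p \<subseteq> B}"
  proof -
    have BX: "p \<in> polys X" if "supp p \<subseteq> B" for p
      using that assms(2) by (auto simp: polys_iff)
    have "cls X F p \<in> cls X F ` {p. supp p \<subseteq> B}" if p: "p \<in> polys X" for p
    proof -
      obtain r where r: "supp r \<subseteq> B" "p - r \<in> jac X F" using span[OF p] by auto
      then have "cls X F p = cls X F r" using p BX by (simp add: cls_eq_iff)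
      then show ?thesis using r by auto
    qed
    then show ?thesis using BX by (auto simp: carrier_milnor_ring)
  qed
  then have "M.dimension (card B) K (carrier ?R)" using dim[of B] by simp
  then have "M.dim K (carrier ?R) = card B"
    using M.dimI[OF \<open>subfield K ?R\<close>] by (simp add: over_def)
  then show ?thesis by (simp add: milnor_number_def K_def)
qed

end

section \<open>Splitting the variables of a quasihomogeneous polynomial\<close>

text \<open>Equivalently, \<open>F\<close> is a Thom-Sebastiani sum of a polynomial in
  \<open>U\<close> and one in the other variables. The fixed sets of a well-behaved group have this
  property, and it is closed under Boolean operations.\<close>

definition splits :: "mpoly \<Rightarrow> nat set \<Rightarrow> bool" where
  "splits F U \<longleftrightarrow> (\<forall>a\<in>supp F. supp a \<subseteq> U \<or> supp a \<inter> U = {})"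

lemma splits_Int: "splits F U \<Longrightarrow> splits F V \<Longrightarrow> splits F (U \<inter> V)"
  unfolding splits_def by blast
lemma splits_Un: "splits F U \<Longrightarrow> splits F V \<Longrightarrow> splits F (U \<union> V)"
  unfolding splits_def by blast
lemma splits_Diff: "splits F U \<Longrightarrow> splits F V \<Longrightarrow> splits F (U - V)"
  unfolding splits_def by blast
lemma splits_self: "F \<in> polys X \<Longrightarrow> splits F X"
  by (auto simp: splits_def polys_def)
lemma splits_empty: "splits F {}"
  by (auto simp: splits_def)
lemma splits_restrict: "splits F U \<Longrightarrow> splits (restrict_vars X F) U"
  by (metis coeff_restrict_vars in_keys_iff splits_def)

lemma pdiff_restrict:
  assumes "splits F U" "i \<in> U"
  shows "pdiff i (restrict_vars U F) = pdiff i F"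
proof (rule poly_eqI)
  fix a :: "nat \<Rightarrow>\<^sub>0 nat"
  have "i \<in> supp (a + mon i 1)" by (simp add: supp_iff[of i] lookup_add)
  then have "\<not> supp (a + mon i 1) \<inter> U = {}" using assms(2) by blast
  then have "supp (a + mon i 1) \<subseteq> U" if "a + mon i 1 \<in> supp F"
    using assms(1) that unfolding splits_def by blast
  then have "coeff F (a + mon i 1) \<noteq> 0 \<Longrightarrow> supp (a + mon i 1) \<subseteq> U"
    by (metis in_keys_iff)
  then show "coeff (pdiff i (restrict_vars U F)) a = coeff (pdiff i F) a"
    unfolding coeff_pdiff coeff_restrict_vars by auto
qed

lemma pdiff_split_polys:
  assumes "splits F U" "i \<in> U"
  shows "pdiff i F \<in> polys U"
proof -
  have "pdiff i (restrict_vars U F) \<in> polys U" by (intro pdiff_polys restrict_vars_polys)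
  then show ?thesis using assms by (simp add: pdiff_restrict)
qed

lemma Hess_restrict: "splits F U \<Longrightarrow> Hess U (restrict_vars U F) = Hess U F"
  unfolding Hess_def
proof (intro sum.cong refl arg_cong[of _ _ "\<lambda>x. of_int (sign _) * x"] prod.cong)
  fix \<pi> i assume *: "splits F U" "\<pi> \<in> {\<pi>. \<pi> permutes U}" "i \<in> U"
  then have "\<pi> i \<in> U" by (auto simp: permutes_in_image)
  then show "pdiff i (pdiff (\<pi> i) (restrict_vars U F)) = pdiff i (pdiff (\<pi> i) F)"
    using * by (simp add: pdiff_restrict)
qed

lemma Hess_polys: "splits F U \<Longrightarrow> Hess U F \<in> polys U"
  unfolding Hess_def
proof (intro polys_sum polys_mult polys_prod polys_of_int)
  fix \<pi> i assume *: "splits F U" "\<pi> \<in> {\<pi>. \<pi> permutes U}" "i \<in> U"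
  then have "\<pi> i \<in> U" by (auto simp: permutes_in_image)
  then show "pdiff i (pdiff (\<pi> i) F) \<in> polys U"
    using * by (intro pdiff_polys pdiff_split_polys)
qed

lemma Hess_empty [simp]: "Hess {} F = 1"
  by (simp add: Hess_def sign_id)

text \<open>The mixed second partials vanish, so the matrix is block diagonal. In the Leibniz
  formula only permutations that preserve \<open>U\<close> survive, and these are the products of a
  permutation of \<open>U\<close> with one of \<open>V\<close>.\<close>

lemma Hess_split:
  assumes "finite U" "finite V" "U \<inter> V = {}" "splits F U" "splits F V"
  shows "Hess (U \<union> V) F = Hess U F * Hess V F"
proof -
  let ?h = "\<lambda>\<pi> i. pdiff i (pdiff (\<pi> i) F)"
  let ?g = "\<lambda>\<pi>. of_int (sign \<pi>) * (\<Prod>i\<in>U \<union> V. ?h \<pi> i) :: mpoly"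
  let ?S = "{\<pi>. \<pi> permutes U \<union> V \<and> \<pi> ` U \<subseteq> U}"
  have fin: "finite {\<pi>. \<pi> permutes U \<union> V}" using assms by (simp add: finite_permutations)
  have "Hess (U \<union> V) F = sum ?g ?S"
    unfolding Hess_def
  proof (rule sum.mono_neutral_right)
    show "\<forall>\<pi>\<in>{\<pi>. \<pi> permutes U \<union> V} - ?S. ?g \<pi> = 0"
    proof
      fix \<pi> assume "\<pi> \<in> {\<pi>. \<pi> permutes U \<union> V} - ?S"
      then obtain i where i: "\<pi> permutes U \<union> V" "i \<in> U" "\<pi> i \<notin> U" by auto
      then have "\<pi> i \<in> V" using permutes_in_image[OF i(1), of i] by auto
      then have "?h \<pi> i = 0"
        using i assms by (intro pdiff_outside[OF pdiff_split_polys[of F V]]) auto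
      then have "(\<Prod>i\<in>U \<union> V. ?h \<pi> i) = 0"
        using assms(1,2) i(2) by (intro prod_zero) auto
      then show "?g \<pi> = 0" by simp
    qed
  qed (use fin in auto)
  also have "\<dots> = (\<Sum>(\<pi>, \<rho>)\<in>{\<pi>. \<pi> permutes U} \<times> {\<rho>. \<rho> permutes V}.
      (of_int (sign \<pi>) * (\<Prod>i\<in>U. ?h \<pi> i)) * (of_int (sign \<rho>) * (\<Prod>i\<in>V. ?h \<rho> i)))"
  proof (rule sum.reindex_bij_witness[where i = "\<lambda>(\<pi>, \<rho>). \<pi> \<circ> \<rho>"
        and j = "\<lambda>\<pi>. (\<lambda>x. if x \<in> U then \<pi> x else x, \<lambda>x. if x \<in> V then \<pi> x else x)"])
    fix \<pi> assume "\<pi> \<in> ?S"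
    then have p: "\<pi> permutes U \<union> V" "\<pi> ` U \<subseteq> U" by auto
    have inj: "inj \<pi>" using p(1) by (rule permutes_inj)
    have imU: "\<pi> ` U = U"
      using p(2) assms(1) inj by (intro endo_inj_surj) (auto intro: inj_on_subset)
    have inV: "\<pi> x \<in> V" if "x \<in> V" for x
    proof -
      have "\<pi> x \<in> U \<union> V" using permutes_in_image[OF p(1), of x] that by auto
      moreover have "\<pi> x \<notin> U"
      proof
        assume "\<pi> x \<in> U"
        then obtain y where "y \<in> U" "\<pi> y = \<pi> x" using imU by (metis imageE)
        then show False using inj that assms(3) by (auto dest: injD)
      qed
      ultimately show ?thesis by auto
    qed
    have imV: "\<pi> ` V = V"
      using inV assms(2) inj by (intro endo_inj_surj) (auto intro: inj_on_subset)
    let ?\<alpha> = "\<lambda>x. if x \<in> U then \<pi> x else x" and ?\<beta> = "\<lambda>x. if x \<in> V then \<pi> x else x"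
    have a: "?\<alpha> permutes U"
    proof (rule bij_imp_permutes)
      show "bij_betw ?\<alpha> U U"
        using imU inj unfolding bij_betw_def by (auto intro!: inj_onI dest: injD simp: image_iff)
    qed auto
    have b: "?\<beta> permutes V"
    proof (rule bij_imp_permutes)
      show "bij_betw ?\<beta> V V"
        using imV inj unfolding bij_betw_def by (auto intro!: inj_onI dest: injD simp: image_iff)
    qed auto
    show "(case (?\<alpha>, ?\<beta>) of (\<pi>, \<rho>) \<Rightarrow> \<pi> \<circ> \<rho>) = \<pi>"
    proof
      fix x
      show "(case (?\<alpha>, ?\<beta>) of (\<pi>, \<rho>) \<Rightarrow> \<pi> \<circ> \<rho>) x = \<pi> x"
        using inV[of x] assms(3) permutes_not_in[OF p(1), of x] by auto
    qed
    then have comp: "\<pi> = ?\<alpha> \<circ> ?\<beta>" by simp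
    show "(?\<alpha>, ?\<beta>) \<in> {\<pi>. \<pi> permutes U} \<times> {\<rho>. \<rho> permutes V}" using a b by auto
    have "permutation ?\<alpha>" "permutation ?\<beta>"
      using a b assms(1,2) by (auto intro: permutation_permutes[THEN iffD2])
    then have "sign \<pi> = sign ?\<alpha> * sign ?\<beta>"
      using comp sign_compose by metis
    moreover have "(\<Prod>i\<in>U \<union> V. ?h \<pi> i) = (\<Prod>i\<in>U. ?h ?\<alpha> i) * (\<Prod>i\<in>V. ?h ?\<beta> i)"
      using assms(1-3) by (subst prod.union_disjoint) auto
    ultimately show "(case (?\<alpha>, ?\<beta>) of (\<pi>, \<rho>) \<Rightarrow>
      (of_int (sign \<pi>) * (\<Prod>i\<in>U. ?h \<pi> i)) * (of_int (sign \<rho>) * (\<Prod>i\<in>V. ?h \<rho> i))) = ?g \<pi>"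
      by (simp add: mult_ac)
  next
    fix b assume "b \<in> {\<pi>. \<pi> permutes U} \<times> {\<rho>. \<rho> permutes V}"
    then obtain \<pi> \<rho> where b: "b = (\<pi>, \<rho>)" "\<pi> permutes U" "\<rho> permutes V" by auto
    have \<rho>V: "\<rho> x \<in> V" if "x \<in> V" for x using b(3) that by (simp add: permutes_in_image)
    have 1: "\<pi> x = x" if "x \<in> V" for x using b(2) that assms(3) by (auto intro: permutes_not_in)
    have 2: "\<rho> x = x" if "x \<in> U" for x using b(3) that assms(3) by (auto intro: permutes_not_in)
    have "\<pi> \<circ> \<rho> permutes U \<union> V"
      using b(2,3) by (intro permutes_compose) (auto intro: permutes_subset)
    moreover have "(\<pi> \<circ> \<rho>) ` U \<subseteq> U" using b(2) 2 by (auto simp: permutes_in_image)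
    ultimately show "(case b of (\<pi>, \<rho>) \<Rightarrow> \<pi> \<circ> \<rho>) \<in> ?S" using b(1) by auto
    have "(if x \<in> U then (\<pi> \<circ> \<rho>) x else x) = \<pi> x" for x
      using 2 permutes_not_in[OF b(2), of x] by auto
    moreover have "(if x \<in> V then (\<pi> \<circ> \<rho>) x else x) = \<rho> x" for x
      using 1 \<rho>V permutes_not_in[OF b(3), of x] by auto
    ultimately show "(\<lambda>x. if x \<in> U then (case b of (\<pi>, \<rho>) \<Rightarrow> \<pi> \<circ> \<rho>) x else x,
        \<lambda>x. if x \<in> V then (case b of (\<pi>, \<rho>) \<Rightarrow> \<pi> \<circ> \<rho>) x else x) = b"
      using b(1) by auto
  qed
  also have "\<dots> = Hess U F * Hess V F"
    unfolding Hess_def sum_product sum.cartesian_product ..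
  finally show ?thesis .
qed

text \<open>The degree of the Hessian in the variables \<open>X\<close> of a polynomial of degree 2,
  degrees being twice the weighted ones: a second partial in \<open>i\<close> and \<open>j\<close>
  has degree \<open>2 - 2 * q i - 2 * q j\<close>, and a permutation uses every index once as row
  and once as column.\<close>

definition hdeg :: "(nat \<Rightarrow> rat) \<Rightarrow> nat set \<Rightarrow> rat" where
  "hdeg q X = (\<Sum>i\<in>X. 2 - 4 * q i)"

lemma hdeg_Un: "finite U \<Longrightarrow> finite V \<Longrightarrow> U \<inter> V = {} \<Longrightarrow> hdeg q (U \<union> V) = hdeg q U + hdeg q V"
  by (simp add: hdeg_def sum.union_disjoint)

lemma Hess_homog:
  assumes "homog_of q 2 F"
  shows "homog_of q (hdeg q X) (Hess X F)"
  unfolding Hess_def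
proof (rule homog_of_sum)
  fix \<pi> assume "\<pi> \<in> {\<pi>. \<pi> permutes X}"
  then have \<pi>: "\<pi> permutes X" by simp
  have "homog_of q (2 - 2 * q (\<pi> i) - 2 * q i) (pdiff i (pdiff (\<pi> i) F))" for i
    by (intro pdiff_homog assms)
  then have "homog_of q (\<Sum>i\<in>X. 2 - 2 * q (\<pi> i) - 2 * q i) (\<Prod>i\<in>X. pdiff i (pdiff (\<pi> i) F))"
    by (intro homog_of_prod) auto
  moreover have "(\<Sum>i\<in>X. 2 - 2 * q (\<pi> i) - 2 * q i) = hdeg q X"
  proof -
    have "(\<Sum>i\<in>X. 2 * q (\<pi> i)) = (\<Sum>i\<in>X. 2 * q i)"
      using sum.permute[OF \<pi>, of "\<lambda>i. 2 * q i"] by (simp add: o_def)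
    then show ?thesis by (simp add: hdeg_def sum_subtractf flip: sum_distrib_left)
  qed
  ultimately show "homog_of q (hdeg q X) (of_int (sign \<pi>) * (\<Prod>i\<in>X. pdiff i (pdiff (\<pi> i) F)))"
    using homog_of_mult[OF homog_of_of_int] by fastforce
qed

text \<open>Each factor of a Leibniz term contributes the inverses of two entries of
  \<open>g\<close>; over a permutation every entry occurs exactly twice.\<close>

lemma Hess_scale:
  assumes "scale_vars g F = F" "\<And>i. i \<in> X \<Longrightarrow> g i \<noteq> 0"
  shows "scale_vars g (Hess X F) = Const (1 / diag_det X g ^ 2) * Hess X F"
proof -
  have 1: "scale_vars g (pdiff i (pdiff j F)) = Const (1 / g j / g i) * pdiff i (pdiff j F)"
    if "i \<in> X" "j \<in> X" for i j
  proof (rule scale_pdiff)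
    show "scale_vars g (pdiff j F) = Const (1 / g j) * pdiff j F"
      using assms that by (intro scale_pdiff) auto
  qed (use assms that in auto)
  have "scale_vars g (of_int (sign \<pi>) * (\<Prod>i\<in>X. pdiff i (pdiff (\<pi> i) F))) =
      Const (1 / diag_det X g ^ 2) * (of_int (sign \<pi>) * (\<Prod>i\<in>X. pdiff i (pdiff (\<pi> i) F)))"
    if \<pi>: "\<pi> permutes X" for \<pi>
  proof -
    have of_int: "scale_vars g (of_int k) = of_int k" for k
      using scale_vars_Const[of g "of_int k"] by (simp add: Const_def)
    have "(\<Prod>i\<in>X. scale_vars g (pdiff i (pdiff (\<pi> i) F))) =
        (\<Prod>i\<in>X. Const (1 / g (\<pi> i) / g i) * pdiff i (pdiff (\<pi> i) F))"
      using \<pi> by (intro prod.cong 1 refl) (auto simp: permutes_in_image)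
    also have "\<dots> = Const (\<Prod>i\<in>X. 1 / g (\<pi> i) / g i) * (\<Prod>i\<in>X. pdiff i (pdiff (\<pi> i) F))"
      by (simp add: prod.distrib Const_prod)
    also have "(\<Prod>i\<in>X. 1 / g (\<pi> i) / g i) = 1 / diag_det X g ^ 2"
      using prod.permute[OF \<pi>, of g]
      by (simp add: diag_det_def prod_dividef power2_eq_square o_def prod.distrib)
    finally show ?thesis
      by (simp add: scale_vars_mult scale_vars_prod of_int mult_ac)
  qed
  then show ?thesis
    unfolding Hess_def scale_vars_sum sum_distrib_left by (intro sum.cong) auto
qed

lift_definition exp_restrict :: "nat set \<Rightarrow> (nat \<Rightarrow>\<^sub>0 nat) \<Rightarrow> (nat \<Rightarrow>\<^sub>0 nat)"
  is "\<lambda>U a i. if i \<in> U then a i else 0"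
  by (rule finite_subset[rotated]) auto

lemma coeff_exp_restrict: "coeff (exp_restrict U a) i = (if i \<in> U then coeff a i else 0)"
  by transfer simp

lemma supp_exp_restrict: "supp (exp_restrict U a) = supp a \<inter> U"
  by (auto simp: in_keys_iff coeff_exp_restrict split: if_splits)

lemma exp_restrict_Un:
  "supp a \<subseteq> U \<union> V \<Longrightarrow> U \<inter> V = {} \<Longrightarrow> exp_restrict U a + exp_restrict V a = a"
  by (rule poly_mapping_eqI) (auto simp: lookup_add coeff_exp_restrict in_keys_iff subset_iff)

lemma exp_restrict_add: "exp_restrict U (a + b) = exp_restrict U a + exp_restrict U b"
  by (rule poly_mapping_eqI) (auto simp: lookup_add coeff_exp_restrict)

lemma exp_restrict_id: "supp a \<subseteq> U \<Longrightarrow> exp_restrict U a = a"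
  by (rule poly_mapping_eqI) (auto simp: coeff_exp_restrict in_keys_iff subset_iff)

lemma exp_restrict_disjoint: "supp a \<inter> U = {} \<Longrightarrow> exp_restrict U a = 0"
  by (rule poly_mapping_eqI) (auto simp: coeff_exp_restrict in_keys_iff disjoint_iff)

text \<open>In this locale the isolated critical point is represented only by \<open>F_crit\<close>,
  the absence of linear terms, which passes to restrictions at once. Finite dimension of the
  quotient is obtained later, from a nondegenerate functional.\<close>

locale quasihomogeneous =
  fixes X :: "nat set" and F :: mpoly and q :: "nat \<Rightarrow> rat"
  assumes finite_X: "finite X"
    and F_polys: "F \<in> polys X"
    and q_pos: "i \<in> X \<Longrightarrow> q i > 0"
    and F_homog: "homog_of q 2 F"
    and F_crit: "i \<in> X \<Longrightarrow> coeff (pdiff i F) 0 = 0"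
begin

lemma restrict_quasihomogeneous:
  assumes "U \<subseteq> X" "splits F U" shows "quasihomogeneous U (restrict_vars U F) q"
proof
  show "finite U" using assms finite_X finite_subset by blast
  show "restrict_vars U F \<in> polys U" by (rule restrict_vars_polys)
  show "homog_of q 2 (restrict_vars U F)" by (rule homog_of_restrict[OF F_homog])
qed (use assms q_pos F_crit in \<open>auto simp: pdiff_restrict\<close>)

lemma jac_restrict_subset:
  assumes U: "U \<subseteq> X" "splits F U" and p: "p \<in> jac U (restrict_vars U F)"
  shows "p \<in> jac X F"
proof -
  interpret U: quasihomogeneous U "restrict_vars U F" q
    by (rule restrict_quasihomogeneous[OF U])
  from p obtain r where r: "\<And>i. i \<in> U \<Longrightarrow> r i \<in> polys U" "p = (\<Sum>i\<in>U. r i * pdiff i (restrict_vars U F))"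
    using jac_explicit[OF U.F_polys U.finite_X] by metis
  have "p = (\<Sum>i\<in>U. r i * pdiff i F)"
    using r(2) U by (simp add: pdiff_restrict)
  also have "\<dots> \<in> jac X F"
    using r(1) U polys_mono[OF U(1)] by (intro jac_sum jac_mult jac_pdiff F_polys) auto
  finally show ?thesis .
qed

lemma restrict_jac:
  assumes U: "U \<subseteq> X" "splits F U" and p: "p \<in> jac X F"
  shows "restrict_vars U p \<in> jac U (restrict_vars U F)"
proof -
  interpret U: quasihomogeneous U "restrict_vars U F" q
    by (rule restrict_quasihomogeneous[OF U])
  have V: "splits F (X - U)" by (intro splits_Diff splits_self F_polys U)
  from p obtain r where r: "\<And>i. i \<in> X \<Longrightarrow> r i \<in> polys X" "p = (\<Sum>i\<in>X. r i * pdiff i F)"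
    using jac_explicit[OF F_polys finite_X] by metis
  have "restrict_vars U p = (\<Sum>i\<in>X. restrict_vars U (r i) * restrict_vars U (pdiff i F))"
    by (simp add: r(2) restrict_vars_sum restrict_vars_mult)
  also have "\<dots> \<in> jac U (restrict_vars U F)"
  proof (intro jac_sum U.F_polys jac_mult restrict_vars_polys)
    fix i assume i: "i \<in> X"
    show "restrict_vars U (pdiff i F) \<in> jac U (restrict_vars U F)"
    proof (cases "i \<in> U")
      case True
      then have "restrict_vars U (pdiff i F) = pdiff i (restrict_vars U F)"
        using U by (simp add: pdiff_restrict restrict_vars_id pdiff_split_polys)
      then show ?thesis using True jac_pdiff[OF U.F_polys] by simp
    next
      \<comment> \<open>A derivative in a discarded variable involves discarded variables only, so
        its restriction is its constant term, which is zero because the origin is critical.\<close>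
      case False
      then have "pdiff i F \<in> polys (X - U)" using i by (intro pdiff_split_polys V) auto
      then have P: "restrict_vars U (pdiff i F) \<in> polys {}"
        using restrict_vars_polys_Int[of "pdiff i F" "X - U" U] by (simp add: Int_Diff_disjoint inf_commute)
      have "coeff (restrict_vars U (pdiff i F)) a = 0" for a
      proof (cases "a = 0")
        case True
        then show ?thesis by (simp add: coeff_restrict_vars F_crit[OF i])
      next
        case False
        then have "\<not> supp a \<subseteq> {}" by simp
        then show ?thesis using polysD[OF P] by blast
      qed
      then have "restrict_vars U (pdiff i F) = 0" by (intro poly_eqI) simp
      then show ?thesis by (simp add: jac_zero[OF U.F_polys])
    qed
  qed
  finally show ?thesis .
qed

text \<open>Contracting the \<open>V\<close>-part of a tensor with a functional that kills the ideal of \<open>V\<close>.\<close>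

lemma contract_jac:
  fixes l :: "mpoly \<Rightarrow> complex"
  assumes U: "U \<subseteq> X" "splits F U" and V: "V = X - U"
    and l_add: "\<And>p r. p \<in> polys V \<Longrightarrow> r \<in> polys V \<Longrightarrow> l (p + r) = l p + l r"
    and l_smult: "\<And>c p. p \<in> polys V \<Longrightarrow> l (Const c * p) = c * l p"
    and l_jac: "\<And>p. p \<in> jac V (restrict_vars V F) \<Longrightarrow> l p = 0"
  defines "L \<equiv> lin_ext (\<lambda>a. mon (exp_restrict U a) (l (mon (exp_restrict V a) 1)))"
  shows contract_mult: "p \<in> polys U \<Longrightarrow> r \<in> polys V \<Longrightarrow> L (p * r) = Const (l r) * p"
    and contract_in_jac: "p \<in> jac X F \<Longrightarrow> L p \<in> jac U (restrict_vars U F)"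
proof -
  interpret U: quasihomogeneous U "restrict_vars U F" q
    by (rule restrict_quasihomogeneous[OF U])
  have sV: "splits F V" unfolding V by (intro splits_Diff splits_self F_polys U)
  interpret V: quasihomogeneous V "restrict_vars V F" q
    by (rule restrict_quasihomogeneous[OF _ sV]) (auto simp: V)
  have UV: "U \<inter> V = {}" "X = U \<union> V" using U V by auto
  have l_zero: "l 0 = 0" using l_smult[of 0 0] by simp
  show mult: "L (p * r) = Const (l r) * p" if "p \<in> polys U" "r \<in> polys V" for p r
    using that(1)
  proof (induction p rule: polys_induct)
    case zero
    then show ?case by (simp add: L_def)
  next
    case (mon a c)
    show ?case using that(2)
    proof (induction r rule: polys_induct)
      case zero
      then show ?case by (simp add: L_def l_zero)
    next
      case (mon b d)
      have e: "exp_restrict U (a + b) = a" "exp_restrict V (a + b) = b"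
      proof -
        have "supp a \<inter> V = {}" "supp b \<inter> U = {}" using \<open>supp a \<subseteq> U\<close> mon UV by blast+
        then show "exp_restrict U (a + b) = a" "exp_restrict V (a + b) = b"
          using \<open>supp a \<subseteq> U\<close> mon
          by (simp_all add: exp_restrict_add exp_restrict_id exp_restrict_disjoint)
      qed
      have "l (mon b d) = d * l (mon b 1)"
        using l_smult[of "mon b 1" d] mon by (auto simp: Const_mon)
      then show ?case by (simp add: L_def mon_mult lin_ext_mon e Const_mon) (simp add: mult_ac)
    next
      case (add r s)
      then show ?case by (simp add: L_def lin_ext_add distrib_left l_add Const_add distrib_right)
    qed
  next
    case (add p s)
    then show ?case by (simp add: L_def lin_ext_add distrib_left distrib_right)
  qed
  show "L p \<in> jac U (restrict_vars U F)" if p: "p \<in> jac X F"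
  proof -
    from p obtain r where r: "\<And>i. i \<in> X \<Longrightarrow> r i \<in> polys X" "p = (\<Sum>i\<in>X. r i * pdiff i F)"
      using jac_explicit[OF F_polys finite_X] by metis
    have "L (s * pdiff i F) \<in> jac U (restrict_vars U F)" if "i \<in> X" "s \<in> polys X" for i s
      using that(2)
    proof (induction s rule: polys_induct)
      case zero
      then show ?case by (simp add: L_def jac_zero U.F_polys)
    next
      case (mon a c)
      \<comment> \<open>One tensor factor absorbs the derivative: for \<open>i\<close> in
        \<open>U\<close> the first factor enters the ideal of \<open>U\<close>; otherwise the second
        enters the ideal of \<open>V\<close> and is killed by \<open>l\<close>.\<close>
      define u v where "u = mon (exp_restrict U a) c" and "v = mon (exp_restrict V a) (1::complex)"
      have uv: "mon a c = u * v" "u \<in> polys U" "v \<in> polys V"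
        using mon UV by (auto simp: u_def v_def mon_mult exp_restrict_Un supp_exp_restrict)
      show ?case
      proof (cases "i \<in> U")
        case True
        have "L (mon a c * pdiff i F) = L ((u * pdiff i F) * v)"
          by (simp add: uv(1) mult_ac)
        also have "\<dots> = Const (l v) * (u * pdiff i F)"
          using uv True pdiff_split_polys[OF U(2)] by (intro mult) auto
        also have "\<dots> \<in> jac U (restrict_vars U F)"
          using True uv jac_pdiff[OF U.F_polys, of i] U
          by (intro jac_mult U.F_polys) (auto simp: pdiff_restrict)
        finally show ?thesis .
      next
        case False
        then have i: "i \<in> V" using that(1) UV by auto
        have "l (v * pdiff i F) = 0"
          using i uv jac_pdiff[OF V.F_polys, of i] sV
          by (intro l_jac jac_mult V.F_polys) (auto simp: pdiff_restrict)
        moreover have "L (mon a c * pdiff i F) = Const (l (v * pdiff i F)) * u"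
          using mult[of u "v * pdiff i F"] uv i pdiff_split_polys[OF sV i] by (simp add: mult_ac polys_mult)
        ultimately show ?thesis by (simp add: jac_zero U.F_polys)
      qed
    next
      case (add s s')
      then show ?case by (simp add: distrib_right L_def lin_ext_add jac_add U.F_polys)
    qed
    then show ?thesis
      unfolding r(2) L_def lin_ext_sum using r(1)
      by (intro jac_sum U.F_polys) (auto simp: L_def)
  qed
qed

end

section \<open>Graded socles\<close>

text \<open>\<open>t\<close> is a multiple of the functional \<open>\<langle>\<cdot>, 1\<rangle>\<close> on the Milnor ring.\<close>

locale socle = quasihomogeneous +
  fixes t :: "mpoly \<Rightarrow> complex"
  assumes t_add: "p \<in> polys X \<Longrightarrow> r \<in> polys X \<Longrightarrow> t (p + r) = t p + t r"
    and t_smult: "p \<in> polys X \<Longrightarrow> t (Const c * p) = c * t p"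
    and t_jac: "p \<in> jac X F \<Longrightarrow> t p = 0"
    and t_homog: "p \<in> polys X \<Longrightarrow> homog_of q d p \<Longrightarrow> d \<noteq> hdeg q X \<Longrightarrow> t p = 0"
    and t_nondeg: "p \<in> polys X \<Longrightarrow> (\<And>a. supp a \<subseteq> X \<Longrightarrow> t (p * mon a 1) = 0) \<Longrightarrow> p \<in> jac X F"
    and t_Hess: "t (Hess X F) \<noteq> 0"
begin

abbreviation "J \<equiv> jac X F"
abbreviation "H \<equiv> Hess X F"

lemma H_polys: "H \<in> polys X" by (intro Hess_polys splits_self F_polys)
lemma H_homog: "homog_of q (hdeg q X) H" by (rule Hess_homog[OF F_homog])
lemma H_notin: "H \<notin> J" using t_jac t_Hess by blast
lemma one_notin: "1 \<notin> J" using jac_mult[OF F_polys _ H_polys, of 1] H_notin by auto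

lemma t_zero: "t 0 = 0" using t_jac[OF jac_zero[OF F_polys]] .
lemma t_uminus: "p \<in> polys X \<Longrightarrow> t (- p) = - t p"
  using t_smult[of p "-1"] by (simp add: Const_uminus)
lemma t_diff: "p \<in> polys X \<Longrightarrow> r \<in> polys X \<Longrightarrow> t (p - r) = t p - t r"
  using t_add[of p "-r"] t_uminus[of r] by (auto simp: polys_uminus)
lemma t_sum: "(\<And>x. x \<in> A \<Longrightarrow> f x \<in> polys X) \<Longrightarrow> t (sum f A) = (\<Sum>x\<in>A. t (f x))"
  by (induction A rule: infinite_finite_induct) (auto simp: t_zero t_add polys_sum)
lemma t_cong: "p \<in> polys X \<Longrightarrow> r \<in> polys X \<Longrightarrow> p - r \<in> J \<Longrightarrow> t p = t r"
  using t_diff[of p r] t_jac[of "p - r"] by simp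
text \<open>Weights are positive, so multiplying by a monomial never lowers the degree back to the
  one degree that \<open>t\<close> sees; nondegeneracy then puts \<open>p\<close> into the
  ideal.\<close>

lemma high_degree_jac:
  assumes "p \<in> polys X" "homog_of q d p" "d > hdeg q X"
  shows "p \<in> J"
proof (rule t_nondeg[OF assms(1)])
  fix a :: "nat \<Rightarrow>\<^sub>0 nat" assume a: "supp a \<subseteq> X"
  have "mono_deg q a \<ge> 0" using a q_pos by (rule mono_deg_nonneg)
  then have "d + mono_deg q a \<noteq> hdeg q X" using assms(3) by simp
  moreover have "homog_of q (d + mono_deg q a) (p * mon a 1)"
    using assms(2) by (intro homog_of_mult homog_of_mon) auto
  ultimately show "t (p * mon a 1) = 0"
    using assms(1) a by (intro t_homog[of _ "d + mono_deg q a"]) auto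
qed

text \<open>The top degree is a line. The difference is killed by \<open>t\<close> through the
  choice of the scalar, and its product with any nonconstant monomial is killed by degree.\<close>

lemma top_degree_jac:
  assumes p: "p \<in> polys X" "homog_of q (hdeg q X) p"
  shows "p - Const (t p / t H) * H \<in> J"
proof (rule t_nondeg)
  let ?r = "p - Const (t p / t H) * H"
  show r: "?r \<in> polys X" using p H_polys by auto
  fix a :: "nat \<Rightarrow>\<^sub>0 nat" assume a: "supp a \<subseteq> X"
  have homog: "homog_of q (hdeg q X) ?r"
    by (intro homog_of_diff homog_of_Const_mult H_homog p)
  show "t (?r * mon a 1) = 0"
  proof (cases "a = 0")
    case True
    have "t ?r = t p - t p / t H * t H" using p H_polys by (simp add: t_diff t_smult polys_mult)
    then show ?thesis using True t_Hess by simp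
  next
    case False
    then have "mono_deg q a > 0" using a q_pos by (intro mono_deg_pos)
    then show ?thesis
      using r a homog by (intro t_homog[of _ "hdeg q X + mono_deg q a"] homog_of_mult homog_of_mon) auto
  qed
qed

lemma Hess_mult:
  assumes "p \<in> polys X" shows "H * p - Const (coeff p 0) * H \<in> J"
  using assms
proof (induction p rule: polys_induct)
  case zero
  then show ?case by (simp add: jac_zero F_polys)
next
  case (mon a c)
  show ?case
  proof (cases "a = 0")
    case True
    then show ?thesis by (simp add: Const_def mult.commute jac_zero F_polys)
  next
    case False
    then have "mono_deg q a > 0" using mon q_pos by (intro mono_deg_pos)
    then have "H * mon a c \<in> J"
      using mon H_polys H_homog
      by (intro high_degree_jac[of _ "hdeg q X + mono_deg q a"] homog_of_mult homog_of_mon) auto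
    then show ?thesis using False by (simp add: lookup_single when_def)
  qed
next
  case (add p r)
  have "H * (p + r) - Const (coeff (p + r) 0) * H =
      (H * p - Const (coeff p 0) * H) + (H * r - Const (coeff r 0) * H)"
    by (simp add: lookup_add Const_add algebra_simps)
  then show ?case using add jac_add[OF F_polys] by simp
qed

text \<open>A degree bound \<open>d\<close> bounds the exponent of each variable by
  \<open>d / (2 * q i)\<close>, as all weights are positive.\<close>

lemma finite_bounded_degree: "finite {a. supp a \<subseteq> X \<and> mono_deg q a \<le> d}"
proof -
  define N where "N = (\<lambda>i. nat \<lceil>d / (2 * q i)\<rceil>)"
  have "{a. supp a \<subseteq> X \<and> mono_deg q a \<le> d} \<subseteq>
      (\<lambda>f. \<Sum>i\<in>X. mon i (f i)) ` (PiE X (\<lambda>i. {..N i}))"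
  proof
    fix a assume "a \<in> {a. supp a \<subseteq> X \<and> mono_deg q a \<le> d}"
    then have a: "supp a \<subseteq> X" "mono_deg q a \<le> d" by auto
    have "coeff a i \<le> N i" if i: "i \<in> X" for i
    proof -
      have "of_nat (coeff a i) * q i \<le> (\<Sum>i\<in>X. of_nat (coeff a i) * q i)"
        by (rule member_le_sum) (use i finite_X in \<open>auto intro!: mult_nonneg_nonneg less_imp_le[OF q_pos]\<close>)
      also have "2 * (\<Sum>i\<in>X. of_nat (coeff a i) * q i) \<le> d"
        using a(2) mono_deg_superset[OF finite_X a(1), of q] by simp
      finally have "of_nat (coeff a i) \<le> d / (2 * q i)"
        using q_pos[OF i] by (simp add: field_simps)
      then have "int (coeff a i) \<le> \<lceil>d / (2 * q i)\<rceil>"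
        using le_of_int_ceiling[of "d / (2 * q i)"] by linarith
      then show ?thesis by (simp add: N_def)
    qed
    then have "restrict (coeff a) X \<in> PiE X (\<lambda>i. {..N i})" by auto
    moreover have "a = (\<Sum>i\<in>X. mon i (restrict (coeff a) X i))"
      using sum_mon_superset[OF finite_X a(1)] by (simp cong: sum.cong)
    ultimately show "a \<in> (\<lambda>f. \<Sum>i\<in>X. mon i (f i)) ` (PiE X (\<lambda>i. {..N i}))" by blast
  qed
  then show ?thesis
    by (rule finite_subset) (intro finite_imageI finite_PiE finite_X finite_atMost)
qed

section \<open>Monomial bases and the explicit form of the pairing\<close>

definition monomial_basis :: "(nat \<Rightarrow>\<^sub>0 nat) set \<Rightarrow> bool" where
  "monomial_basis B \<longleftrightarrow> finite B \<and> (\<forall>a\<in>B. supp a \<subseteq> X) \<and>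
     (\<forall>p. supp p \<subseteq> B \<longrightarrow> p \<in> J \<longrightarrow> p = 0) \<and>
     (\<forall>p\<in>polys X. \<exists>r. supp r \<subseteq> B \<and> p - r \<in> J)"

lemma monomial_basisD:
  assumes "monomial_basis B"
  shows "finite B" "a \<in> B \<Longrightarrow> supp a \<subseteq> X" "supp p \<subseteq> B \<Longrightarrow> p \<in> J \<Longrightarrow> p = 0"
    "p \<in> polys X \<Longrightarrow> \<exists>r. supp r \<subseteq> B \<and> p - r \<in> J"
  using assms unfolding monomial_basis_def by simp_all

text \<open>Above the degree of the Hessian everything lies in the ideal, so the candidates are the
  finitely many monomials up to that degree. An independent set of them of maximal size
  spans.\<close>

lemma exists_monomial_basis: "\<exists>B. monomial_basis B"
proof -
  define M where "M = {a. supp a \<subseteq> X \<and> mono_deg q a \<le> hdeg q X}"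
  have finM: "finite M" unfolding M_def by (rule finite_bounded_degree)
  define I where "I B \<longleftrightarrow> B \<subseteq> M \<and> (\<forall>p. supp p \<subseteq> B \<longrightarrow> p \<in> J \<longrightarrow> p = 0)" for B
  have "I {}" by (simp add: I_def)
  moreover have "I B \<longrightarrow> card B < Suc (card M)" for B
    using finM by (auto simp: I_def less_Suc_eq_le intro: card_mono)
  ultimately obtain B where B: "I B" "\<And>B'. I B' \<Longrightarrow> card B' \<le> card B"
    using ex_has_greatest_nat[of I "{}" card "Suc (card M)"] by blast
  have BM: "B \<subseteq> M" and indep: "supp p \<subseteq> B \<Longrightarrow> p \<in> J \<Longrightarrow> p = 0" for p
    using B(1) by (auto simp: I_def)
  have finB: "finite B" using BM finM by (rule finite_subset)
  have BX: "supp a \<subseteq> X" if "a \<in> B" for a using that BM by (auto simp: M_def)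
  have span_mon: "\<exists>r. supp r \<subseteq> B \<and> mon a c - r \<in> J" if a: "supp a \<subseteq> X" for a c
  proof (cases "a \<in> B")
    case True
    then have "supp (mon a c) \<subseteq> B" using supp_single by fastforce
    then show ?thesis by (intro exI[of _ "mon a c"]) (simp add: jac_zero F_polys)
  next
    case aB: False
    show ?thesis
    proof (cases "mono_deg q a \<le> hdeg q X")
      case False
      then have "mon a c \<in> J"
        using a by (intro high_degree_jac[of _ "mono_deg q a"] homog_of_mon) auto
      then show ?thesis by (intro exI[of _ 0]) simp
    next
      case True
      \<comment> \<open>Maximality of \<open>B\<close> supplies a relation that involves
        \<open>a\<close>; solving it for this monomial rewrites it in terms of
        \<open>B\<close>.\<close>
      have "\<not> I (insert a B)" using B(2)[of "insert a B"] aB finB by auto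
      then obtain p where p: "supp p \<subseteq> insert a B" "p \<in> J" "p \<noteq> 0"
        using True a BM by (auto simp: I_def M_def)
      have ca: "coeff p a \<noteq> 0"
      proof
        assume "coeff p a = 0"
        then have "supp p \<subseteq> B" using p(1) by (metis in_keys_iff insert_iff subset_iff)
        then show False using indep p by blast
      qed
      define r where "r = mon a c - Const (c / coeff p a) * p"
      have cr: "coeff r b = (if b = a then 0 else - (c / coeff p a) * coeff p b)" for b
        unfolding r_def lookup_minus coeff_Const_mult using ca by (auto simp: lookup_single when_def)
      have "supp r \<subseteq> B"
      proof
        fix b assume "b \<in> supp r"
        then have "b \<noteq> a" "coeff p b \<noteq> 0" using cr[of b] by (auto simp: in_keys_iff split: if_splits)
        then show "b \<in> B" using p(1) by (auto simp: in_keys_iff[symmetric])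
      qed
      moreover have "mon a c - r \<in> J"
        using jac_mult[OF F_polys p(2), of "Const (c / coeff p a)"] by (simp add: r_def)
      ultimately show ?thesis by blast
    qed
  qed
  have span: "\<exists>r. supp r \<subseteq> B \<and> p - r \<in> J" if "p \<in> polys X" for p
    using that
  proof (induction p rule: polys_induct)
    case zero
    then show ?case by (intro exI[of _ 0]) (simp add: jac_zero F_polys)
  next
    case (mon a c)
    then show ?case by (rule span_mon)
  next
    case (add p p')
    then obtain r r' where r: "supp r \<subseteq> B" "p - r \<in> J" "supp r' \<subseteq> B" "p' - r' \<in> J" by blast
    have "supp (r + r') \<subseteq> B" using r supp_add[of r r'] by blast
    moreover have "p + p' - (r + r') \<in> J" using jac_add[OF F_polys r(2,4)] by (simp add: algebra_simps)
    ultimately show ?case by blast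
  qed
  show ?thesis
    unfolding monomial_basis_def
    by (intro exI[of _ B] conjI ballI allI impI finB BX indep span)
qed

lemma milnor_number_eq_card: "monomial_basis B \<Longrightarrow> milnor_number X F = card B"
  unfolding monomial_basis_def by (rule milnor_number_basis[OF F_polys]) (use one_notin in blast)+

lemma milnor_number_pos: "milnor_number X F > 0"
proof -
  obtain B where B: "monomial_basis B" using exists_monomial_basis by blast
  have "B \<noteq> {}"
  proof
    assume "B = {}"
    then have "\<exists>r. supp r \<subseteq> {} \<and> 1 - r \<in> J" using B by (auto simp: monomial_basis_def)
    then show False using one_notin by auto
  qed
  then show ?thesis using B milnor_number_eq_card[OF B] by (auto simp: monomial_basis_def card_gt_0_iff)
qed

text \<open>Applying \<open>t\<close> to the defining decomposition kills the terms of lower degree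
  and so forces the scalar. A decomposition exists because the top degree is spanned by the Hessian
  and all higher degrees lie in the ideal.\<close>

lemma milnor_pairing_eq:
  assumes w: "\<And>i. i \<in> X \<Longrightarrow> weights X F i = q i" and p: "p \<in> polys X" and r: "r \<in> polys X"
  shows "milnor_pairing X F (cls X F p) (cls X F r) = of_nat (milnor_number X F) * t (p * r) / t H"
proof -
  let ?w = "weights X F" and ?\<mu> = "of_nat (milnor_number X F) :: complex"
  have \<mu>: "?\<mu> \<noteq> 0" using milnor_number_pos by simp
  have H0: "H \<noteq> 0" using H_notin jac_zero[OF F_polys] by auto
  have Hw: "mono_deg ?w ` supp H = {hdeg q X}"
  proof -
    have "mono_deg ?w a = hdeg q X" if "a \<in> supp H" for a
      using that H_homog H_polys mono_deg_cong[of a X ?w q] w by (auto simp: homog_of_def polys_def)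
    moreover have "supp H \<noteq> {}" using H0 by simp
    ultimately show ?thesis by (metis (no_types, lifting) image_cong image_constant_conv)
  qed
  then have deg: "poly_deg ?w H = hdeg q X" by (simp add: poly_deg_def)
  have wq: "mono_deg ?w a = mono_deg q a" if "supp a \<subseteq> X" for a
    using that w by (intro mono_deg_cong[of a X])
  define P where "P c \<longleftrightarrow> (\<exists>s\<in>polys X.
        (\<forall>a\<in>supp s. mono_deg ?w a < hdeg q X) \<and>
        cls X F (p * r) = cls X F (Const (c / ?\<mu>) * H + s))" for c
  have low: "t s = 0" if s: "s \<in> polys X" "\<forall>a\<in>supp s. mono_deg ?w a < hdeg q X" for s
  proof -
    have *: "t (mon a (coeff s a)) = 0" if "a \<in> supp s" for a
      using that s wq[of a] by (intro t_homog[of _ "mono_deg q a"] homog_of_mon) (auto simp: polys_def)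
    have "t (\<Sum>a\<in>supp s. mon a (coeff s a)) = (\<Sum>a\<in>supp s. t (mon a (coeff s a)))"
      using s by (intro t_sum) (auto simp: polys_def)
    then show ?thesis using * by (simp add: sum_mon)
  qed
  have uniq: "c = ?\<mu> * t (p * r) / t H" if "P c" for c
  proof -
    from that obtain s where s: "s \<in> polys X" "\<forall>a\<in>supp s. mono_deg ?w a < hdeg q X"
      "cls X F (p * r) = cls X F (Const (c / ?\<mu>) * H + s)" by (auto simp: P_def)
    have "p * r - (Const (c / ?\<mu>) * H + s) \<in> J"
      using s(3) p r s(1) H_polys by (subst (asm) cls_eq_iff[OF F_polys]) auto
    then have "t (p * r) = t (Const (c / ?\<mu>) * H + s)"
      using p r s(1) H_polys by (intro t_cong) auto
    also have "\<dots> = c / ?\<mu> * t H"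
      using s H_polys low by (simp add: t_add t_smult polys_mult)
    finally show ?thesis using \<mu> t_Hess by (simp add: field_simps)
  qed
  have ex: "P (?\<mu> * t (p * r) / t H)"
  proof -
    define u where "u = p * r"
    have u: "u \<in> polys X" using p r by (auto simp: u_def)
    define A where "A = mono_deg q ` supp u"
    define s where "s = (\<Sum>d\<in>{d\<in>A. d < hdeg q X}. hcomp q d u)"
    have finA: "finite A" by (simp add: A_def)
    have s_polys: "s \<in> polys X" unfolding s_def using u by auto
    have s_low: "mono_deg ?w a < hdeg q X" if "a \<in> supp s" for a
    proof -
      have "mono_deg q a < hdeg q X"
      proof (rule ccontr)
        assume "\<not> mono_deg q a < hdeg q X"
        then have "coeff s a = 0"
          unfolding s_def lookup_sum by (intro sum.neutral) (auto simp: coeff_hcomp)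
        then show False using that by (simp add: in_keys_iff)
      qed
      moreover have "supp a \<subseteq> X" using s_polys that by (auto simp: polys_def)
      ultimately show ?thesis using wq by simp
    qed
    define h where "h = hcomp q (hdeg q X) u"
    define e where "e = (\<Sum>d\<in>{d\<in>A. d > hdeg q X}. hcomp q d u)"
    have h: "h \<in> polys X" "homog_of q (hdeg q X) h"
      using u homog_of_hcomp by (auto simp: h_def)
    have e: "e \<in> J"
      unfolding e_def using u homog_of_hcomp
      by (intro jac_sum F_polys high_degree_jac[of "hcomp q d u" d for d]) auto
    have "u = (\<Sum>d\<in>insert (hdeg q X) A. hcomp q d u)"
      using finA by (intro sum_hcomp[symmetric]) (auto simp: A_def)
    also have "insert (hdeg q X) A = insert (hdeg q X) ({d\<in>A. d < hdeg q X} \<union> {d\<in>A. d > hdeg q X})"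
      by auto
    also have "(\<Sum>d\<in>\<dots>. hcomp q d u) = h + (s + e)"
      unfolding h_def s_def e_def using finA
      by (subst sum.insert) (auto intro!: sum.union_disjoint)
    finally have ueq: "u = h + (s + e)" .
    have th: "t u = t h"
    proof -
      have "e \<in> polys X" using e by (rule jac_polys[OF F_polys])
      then have "t u = t h + (t s + t e)"
        unfolding ueq using h(1) s_polys by (simp add: t_add polys_add)
      then show ?thesis using low[OF s_polys] s_low t_jac[OF e] by simp
    qed
    have "u - (Const (t u / t H) * H + s) = (h - Const (t h / t H) * H) + e"
      using ueq th by (simp add: algebra_simps)
    also have "\<dots> \<in> J" by (intro jac_add F_polys top_degree_jac h e)
    finally have "cls X F u = cls X F (Const (t u / t H) * H + s)"
      using u s_polys H_polys by (subst cls_eq_iff[OF F_polys]) auto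
    then show ?thesis
      unfolding P_def using s_polys s_low \<mu> by (auto simp: u_def)
  qed
  have "milnor_pairing X F (cls X F p) (cls X F r) = (THE c. P c)"
    unfolding milnor_pairing_def P_def milnor_ring_mult[OF F_polys p r] deg ..
  also have "\<dots> = ?\<mu> * t (p * r) / t H"
    by (rule the_equality[of P]) (use uniq ex in blast)+
  finally show ?thesis .
qed

end

lemma restrict_vars_empty: "restrict_vars {} p = Const (coeff p 0)"
  by (rule poly_eqI) (auto simp: coeff_restrict_vars Const_def lookup_single when_def)

lemma coeff_mult_zero: "coeff (p * r) 0 = coeff p 0 * coeff r 0" for p r :: mpoly
proof -
  have "Const (coeff (p * r) 0) = Const (coeff p 0 * coeff r 0)"
    unfolding Const_mult restrict_vars_empty[symmetric] by (rule restrict_vars_mult)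
  then show ?thesis unfolding Const_def by (metis lookup_single_eq)
qed

context quasihomogeneous
begin

lemma coeff_jac_zero: "p \<in> jac X F \<Longrightarrow> coeff p 0 = 0"
proof -
  assume "p \<in> jac X F"
  then obtain r where r: "p = (\<Sum>i\<in>X. r i * pdiff i F)"
    using jac_explicit[OF F_polys finite_X] by metis
  have "coeff p 0 = (\<Sum>i\<in>X. coeff (r i) 0 * coeff (pdiff i F) 0)"
    unfolding r lookup_sum coeff_mult_zero ..
  then show "coeff p 0 = 0" using F_crit by simp
qed

text \<open>If the Hessian were redundant modulo lower degrees, the defining description of the pairing
would hold for all scalars or for none, so the pairing would vanish identically.\<close>

lemma socle_of_frobenius:
  assumes w: "\<And>i. i \<in> X \<Longrightarrow> weights X F i = q i"
    and A: "graded_frobenius_algebra (milnor X F)"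
  shows "socle X F q (\<lambda>p. milnor_pairing X F (cls X F p) (cls X F 1))"
proof -
  interpret A: graded_frobenius_algebra "milnor X F" by (rule A)
  define t where "t p = milnor_pairing X F (cls X F p) (cls X F 1)" for p
  let ?J = "jac X F" and ?H = "Hess X F"
  let ?w = "weights X F" and ?\<mu> = "of_nat (milnor_number X F) :: complex"
  define low where "low s \<longleftrightarrow> s \<in> polys X \<and> (\<forall>a\<in>supp s. mono_deg ?w a < poly_deg ?w ?H)" for s
  \<comment> \<open>The condition under the definite description in the pairing of \<open>p\<close>
    with 1. Until existence and uniqueness are known, the value of \<open>t\<close> may be an
    unspecified default.\<close>
  define P where "P p c \<longleftrightarrow> (\<exists>s. low s \<and> p - (Const (c / ?\<mu>) * ?H + s) \<in> ?J)" for p c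
  have H: "?H \<in> polys X" by (intro Hess_polys splits_self F_polys)
  have pairing: "pairing (milnor X F) = milnor_pairing X F" by (simp add: milnor_def)
  have cl: "cls X F p \<in> carrier (milnor X F)" if "p \<in> polys X" for p
    using that by (auto simp: carrier_milnor[OF F_polys])
  have t_add: "t (p + r) = t p + t r" if "p \<in> polys X" "r \<in> polys X" for p r
    using A.pairing_add[OF cl cl cl, of p r 1] that by (simp add: t_def pairing milnor_add F_polys)
  have t_smult: "t (Const c * p) = c * t p" if "p \<in> polys X" for c p
    using A.pairing_smult[OF cl cl, of p 1 c] that by (simp add: t_def pairing milnor_smult F_polys)
  have t0: "t 0 = 0" using t_smult[of 0 0] by simp
  have t_THE: "t p = (THE c. P p c)" if p: "p \<in> polys X" for p
  proof -
    have "(\<exists>s\<in>polys X. (\<forall>a\<in>supp s. mono_deg ?w a < poly_deg ?w ?H) \<and>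
        cls X F p = cls X F (Const (c / ?\<mu>) * ?H + s)) \<longleftrightarrow> P p c" for c
    proof -
      have "cls X F p = cls X F (Const (c / ?\<mu>) * ?H + s) \<longleftrightarrow> p - (Const (c / ?\<mu>) * ?H + s) \<in> ?J"
        if "s \<in> polys X" for s
        using p that H by (intro cls_eq_iff[OF F_polys]) auto
      then show ?thesis unfolding P_def low_def by blast
    qed
    then show ?thesis
      unfolding t_def milnor_pairing_def milnor_ring_mult[OF F_polys p polys_one] by simp
  qed
  have low_zero: "low 0" by (simp add: low_def)
  have low_add: "low (s + s')" if "low s" "low s'" for s s'
    using that supp_add[of s s'] unfolding low_def by blast
  have low_smult: "low (Const c * s)" if "low s" for c s
  proof -
    have "a \<in> supp s" if "a \<in> supp (Const c * s)" for a
      using that by (auto simp: in_keys_iff)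
    then show ?thesis using that unfolding low_def by blast
  qed
  have P_smult: "P (Const d * p) (d * c)" if pc: "P p c" for p c d
  proof -
    obtain s where s: "low s" "p - (Const (c / ?\<mu>) * ?H + s) \<in> ?J" using pc P_def by auto
    have "Const (d * c / ?\<mu>) = Const d * Const (c / ?\<mu>)" by (simp flip: Const_mult)
    then have "Const d * (p - (Const (c / ?\<mu>) * ?H + s)) = Const d * p - (Const (d * c / ?\<mu>) * ?H + Const d * s)"
      by (simp add: algebra_simps)
    then have "Const d * p - (Const (d * c / ?\<mu>) * ?H + Const d * s) \<in> ?J"
      using jac_mult[OF F_polys s(2), of "Const d"] by simp
    then show ?thesis using low_smult[OF s(1)] P_def by blast
  qed
  have nondeg: "p \<in> ?J" if p: "p \<in> polys X" and z: "\<And>r. r \<in> polys X \<Longrightarrow> t (p * r) = 0" for p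
  proof -
    have "pairing (milnor X F) (cls X F p) y = 0" if y: "y \<in> carrier (milnor X F)" for y
    proof -
      obtain r where r: "r \<in> polys X" "y = cls X F r" using y by (auto simp: carrier_milnor[OF F_polys])
      have "pairing (milnor X F) (cls X F p \<otimes>\<^bsub>milnor X F\<^esub> cls X F r) (cls X F 1) =
          pairing (milnor X F) (cls X F p) (cls X F r \<otimes>\<^bsub>milnor X F\<^esub> cls X F 1)"
        using p r by (intro A.pairing_mult cl) auto
      then show ?thesis
        using z[OF r(1)] p r by (simp add: milnor_mult[OF F_polys] pairing t_def)
    qed
    then have "cls X F p = \<zero>\<^bsub>milnor X F\<^esub>" by (intro A.pairing_nondegenerate cl p)
    then show ?thesis using p by (simp add: milnor_zero[OF F_polys] cls_eq_iff[OF F_polys])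
  qed
  have one: "1 \<notin> ?J" using coeff_jac_zero[of 1] by auto
  have nd: "?\<mu> \<noteq> 0 \<and> (\<forall>s. low s \<longrightarrow> ?H - s \<notin> ?J)"
  proof (rule ccontr)
    assume deg: "\<not> (?\<mu> \<noteq> 0 \<and> (\<forall>s. low s \<longrightarrow> ?H - s \<notin> ?J))"
    have all: "P p c'" if pc: "P p c" for p c c'
    proof (cases "?\<mu> = 0")
      case True
      then show ?thesis using pc by (simp add: P_def)
    next
      case False
      then obtain s0 where s0: "low s0" "?H - s0 \<in> ?J" using deg by blast
      obtain s where s: "low s" "p - (Const (c / ?\<mu>) * ?H + s) \<in> ?J" using pc P_def by auto
      let ?e = "Const ((c - c') / ?\<mu>)"
      have "Const (c / ?\<mu>) = ?e + Const (c' / ?\<mu>)" by (simp add: diff_divide_distrib flip: Const_add)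
      then have "p - (Const (c' / ?\<mu>) * ?H + (s + ?e * s0)) =
          (p - (Const (c / ?\<mu>) * ?H + s)) + ?e * (?H - s0)"
        by (simp add: algebra_simps)
      also have "\<dots> \<in> ?J" by (intro jac_add jac_mult F_polys s s0 polys_Const)
      finally show ?thesis using low_add[OF s(1) low_smult[OF s0(1)]] P_def by blast
    qed
    have "P 0 0" unfolding P_def by (intro exI[of _ 0]) (simp add: low_zero jac_zero F_polys)
    then have "P 0 = (\<lambda>c. True)" using all by blast
    then have T: "(THE c::complex. True) = 0" using t_THE[of 0] t0 by simp
    have "t p = 0 \<or> t p = (THE c. False)" if "p \<in> polys X" for p
    proof (cases "\<exists>c. P p c")
      case True
      then have "P p = (\<lambda>c. True)" using all by blast
      then show ?thesis using t_THE[OF that] T by simp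
    next
      case False
      then have "P p = (\<lambda>c. False)" by blast
      then show ?thesis using t_THE[OF that] by simp
    qed
    note alt = this
    \<comment> \<open>Every value of \<open>t\<close> is 0 or the default
      \<open>THE c. False\<close>. Doubling \<open>p\<close> doubles the value, which leaves only
      0.\<close>
    have "t p = 0" if p: "p \<in> polys X" for p
      using alt[OF p] alt[of "Const 2 * p"] t_smult[OF p, of 2] p by (auto simp: polys_mult)
    then have "1 \<in> ?J" by (intro nondeg) auto
    then show False using one by blast
  qed
  then have \<mu>: "?\<mu> \<noteq> 0" and Hlow: "\<And>s. low s \<Longrightarrow> ?H - s \<notin> ?J" by auto
  have uniq: "c = c'" if "P p c" "P p c'" for p c c'
  proof (rule ccontr)
    assume ne: "c \<noteq> c'"
    obtain s where s: "low s" "p - (Const (c / ?\<mu>) * ?H + s) \<in> ?J" using \<open>P p c\<close> unfolding P_def by blast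
    obtain s' where s': "low s'" "p - (Const (c' / ?\<mu>) * ?H + s') \<in> ?J" using \<open>P p c'\<close> unfolding P_def by blast
    \<comment> \<open>Subtracting the two decompositions leaves a multiple of the Hessian modulo
      lower terms; \<open>?e\<close> is the inverse of its coefficient.\<close>
    let ?e = "?\<mu> / (c' - c)"
    have 1: "Const ?e * (Const (c' / ?\<mu>) - Const (c / ?\<mu>)) = 1"
      using \<mu> ne by (simp add: divide_simps flip: Const_diff Const_mult)
    have "Const ?e * ((p - (Const (c / ?\<mu>) * ?H + s)) - (p - (Const (c' / ?\<mu>) * ?H + s'))) =
        (Const ?e * (Const (c' / ?\<mu>) - Const (c / ?\<mu>))) * ?H - Const ?e * (s + Const (-1) * s')"
      by (simp add: algebra_simps Const_uminus)
    also have "\<dots> = ?H - Const ?e * (s + Const (-1) * s')" unfolding 1 by simp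
    finally have "?H - Const ?e * (s + Const (-1) * s') \<in> ?J"
      using jac_mult[OF F_polys jac_diff[OF F_polys s(2) s'(2)], of "Const ?e"] by simp
    moreover have "low (Const ?e * (s + Const (-1) * s'))" by (intro low_smult low_add s s')
    ultimately show False using Hlow by blast
  qed
  have tP: "t p = c" if "p \<in> polys X" "P p c" for p c
    unfolding t_THE[OF that(1)] by (rule the_equality) (use that uniq in blast)+
  have "P ?H ?\<mu>" unfolding P_def
    by (intro exI[of _ 0]) (use \<mu> in \<open>simp add: low_zero jac_zero F_polys\<close>)
  then have tH: "t ?H = ?\<mu>" using H tP by blast
  have ex: "\<exists>c. P p c" if p: "p \<in> polys X" for p
  proof (rule ccontr)
    \<comment> \<open>If \<open>p\<close> had no decomposition, neither would its double nor its sum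
      with the Hessian, so \<open>t\<close> would take the same default value at all three. By
      additivity the last value differs from the first by \<open>t\<close> of the Hessian, which is
      nonzero.\<close>
    assume no: "\<nexists>c. P p c"
    have no2: "\<nexists>c. P (Const 2 * p) c"
    proof
      assume "\<exists>c. P (Const 2 * p) c"
      then obtain c where "P (Const 2 * p) c" by blast
      then have "P (Const (1/2) * (Const 2 * p)) (1/2 * c)" by (rule P_smult)
      moreover have "Const (1/2) * (Const 2 * p) = p" by (simp flip: mult.assoc Const_mult)
      ultimately show False using no by metis
    qed
    have no3: "\<nexists>c. P (p + ?H) c"
    proof
      assume "\<exists>c. P (p + ?H) c"
      then obtain c s where s: "low s" "p + ?H - (Const (c / ?\<mu>) * ?H + s) \<in> ?J" unfolding P_def by blast
      have "Const (c / ?\<mu>) = Const ((c - ?\<mu>) / ?\<mu>) + 1"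
        using \<mu> by (simp add: divide_simps flip: Const_add Const_one)
      then have eq: "p + ?H - (Const (c / ?\<mu>) * ?H + s) = p - (Const ((c - ?\<mu>) / ?\<mu>) * ?H + s)"
        by (simp add: algebra_simps)
      have "p - (Const ((c - ?\<mu>) / ?\<mu>) * ?H + s) \<in> ?J" using s(2) unfolding eq .
      then have "P p (c - ?\<mu>)" using s(1) unfolding P_def by blast
      then show False using no by blast
    qed
    have F: "t r = (THE c. False)" if "r \<in> polys X" "\<nexists>c. P r c" for r
    proof -
      have "P r = (\<lambda>c. False)" using that by blast
      then show ?thesis using t_THE[OF that(1)] by simp
    qed
    have "t (Const 2 * p) = t p" using F[of p] F[of "Const 2 * p"] p no no2 by (simp add: polys_mult)
    moreover have "t (p + ?H) = t p" using F[of p] F[of "p + ?H"] p no no3 H by (simp add: polys_add)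
    ultimately show False using t_smult[OF p, of 2] t_add[OF p H] tH \<mu> by simp
  qed
  have H0: "?H \<noteq> 0" using Hlow[OF low_zero] jac_zero[OF F_polys] by auto
  have wq: "mono_deg ?w a = mono_deg q a" if "supp a \<subseteq> X" for a
    using that w by (intro mono_deg_cong[of a X])
  have H_homog: "homog_of q (hdeg q X) ?H" by (rule Hess_homog[OF F_homog])
  have "mono_deg ?w ` supp ?H = {hdeg q X}"
  proof -
    have "mono_deg ?w a = hdeg q X" if "a \<in> supp ?H" for a
      using that H_homog H wq[of a] by (auto simp: homog_of_def polys_def)
    moreover have "supp ?H \<noteq> {}" using H0 by simp
    ultimately show ?thesis by (metis (no_types, lifting) image_cong image_constant_conv)
  qed
  then have deg: "poly_deg ?w ?H = hdeg q X" by (simp add: poly_deg_def)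
  have low_q: "mono_deg q a < hdeg q X" if "low s" "a \<in> supp s" for s a
  proof -
    have "supp a \<subseteq> X" using that by (auto simp: low_def polys_def)
    then show ?thesis using that wq deg by (auto simp: low_def)
  qed
  have t_jac: "t p = 0" if "p \<in> ?J" for p
  proof (rule tP)
    show "p \<in> polys X" using that by (rule jac_polys[OF F_polys])
    show "P p 0" using that low_zero unfolding P_def by (intro exI[of _ 0]) simp
  qed
  have "socle X F q t"
  proof
    fix p d assume p: "p \<in> polys X" "homog_of q d p" "d \<noteq> hdeg q X"
    show "t p = 0"
    \<comment> \<open>Below the top degree \<open>p\<close> serves as its own remainder, with scalar
      0. Above it, the Hessian and the remainder have no component of degree \<open>d\<close>, so
      that component of a decomposition of \<open>p\<close> puts \<open>p\<close> itself into the
      ideal.\<close>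
    proof (cases "d < hdeg q X")
      case True
      have "mono_deg ?w a < hdeg q X" if "a \<in> supp p" for a
      proof -
        have "supp a \<subseteq> X" using that p(1) by (auto simp: polys_def)
        then show ?thesis using that p(2) wq True by (auto simp: homog_of_def)
      qed
      then have "low p" using p(1) by (simp add: low_def deg)
      then have "P p 0" unfolding P_def by (intro exI[of _ p]) (simp add: jac_zero F_polys)
      then show ?thesis using tP p(1) by blast
    next
      case False
      then have d: "d > hdeg q X" using p(3) by simp
      obtain c s where s: "low s" "p - (Const (c / ?\<mu>) * ?H + s) \<in> ?J"
        using ex[OF p(1)] unfolding P_def by blast
      have "hcomp q d s = 0"
      proof (rule poly_eqI)
        fix a show "coeff (hcomp q d s) a = coeff 0 a"
          using low_q[OF s(1), of a] d by (cases "coeff s a = 0") (auto simp: coeff_hcomp in_keys_iff)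
      qed
      moreover have "hcomp q d p = p" using p(2) by (simp add: hcomp_homog)
      moreover have "hcomp q d ?H = 0" using d by (simp add: hcomp_homog[OF H_homog])
      ultimately have "hcomp q d (p - (Const (c / ?\<mu>) * ?H + s)) = p"
        by (simp add: hcomp_diff hcomp_add hcomp_Const_mult)
      then have "p \<in> ?J" using jac_hcomp[OF F_polys finite_X F_homog s(2), of d] by simp
      then show ?thesis by (rule t_jac)
    qed
  next
    fix p assume p: "p \<in> polys X" and z: "\<And>a. supp a \<subseteq> X \<Longrightarrow> t (p * mon a 1) = 0"
    show "p \<in> ?J"
    proof (rule nondeg[OF p])
      fix r assume "r \<in> polys X"
      then show "t (p * r) = 0"
      proof (induction r rule: polys_induct)
        case zero
        then show ?case by (simp add: t0)
      next
        case (mon a c)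
        have eq: "p * mon a c = Const c * (p * mon a 1)" by (simp add: mon_Const[of a c] mult_ac)
        show ?case unfolding eq using z[OF mon] t_smult[of "p * mon a 1" c] p mon by (simp add: polys_mult polys_mon)
      next
        case (add r r')
        then show ?case using p by (simp add: distrib_left t_add polys_mult)
      qed
    qed
  qed (use t_add t_smult t_jac tH \<mu> in auto)
  then show ?thesis by (simp add: t_def[abs_def])
qed

end

section \<open>The functional on the restriction to a split set of variables\<close>

context socle
begin

lemma
  assumes U: "U \<subseteq> X" "splits F U"
  shows Hess_complement: "H = Hess U F * Hess (X - U) F"
    and hdeg_complement: "hdeg q X = hdeg q U + hdeg q (X - U)"
    and splits_complement: "splits F (X - U)"
proof -
  have fin: "finite U" "finite (X - U)" using U finite_X finite_subset by auto
  have X: "U \<union> (X - U) = X" using U by auto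
  show s: "splits F (X - U)" by (intro splits_Diff splits_self F_polys U)
  show "H = Hess U F * Hess (X - U) F"
    using Hess_split[OF fin _ U(2) s] X by auto
  show "hdeg q X = hdeg q U + hdeg q (X - U)"
    using hdeg_Un[OF fin, of q] X by auto
qed

text \<open>The functional \<open>l\<close> pairs the removed variables with the Hessian of
  \<open>U\<close>; it takes a nonzero value on the Hessian of the removed variables. Contracting
  \<open>p * Hess (X - U) F\<close> with it returns a nonzero multiple of \<open>p\<close> inside
  the ideal of \<open>U\<close>.\<close>

lemma cancel_Hess:
  assumes U: "U \<subseteq> X" "splits F U" and p: "p \<in> polys U" "Hess (X - U) F * p \<in> J"
  shows "p \<in> jac U (restrict_vars U F)"
proof -
  let ?V = "X - U"
  define l where "l s = t (Hess U F * s)" for s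
  have HU: "Hess U F \<in> polys X" using Hess_polys[OF U(2)] U(1) by (rule polys_mono[rotated])
  note V = splits_complement[OF U]
  have l_add: "l (s + s') = l s + l s'" if "s \<in> polys ?V" "s' \<in> polys ?V" for s s'
    using that polys_mono[of ?V X] HU unfolding l_def distrib_left by (intro t_add) auto
  have l_smult: "l (Const c * s) = c * l s" if "s \<in> polys ?V" for c s
    using that polys_mono[of ?V X] HU t_smult[of "Hess U F * s" c] unfolding l_def by (auto simp: mult_ac)
  have l_jac: "l s = 0" if "s \<in> jac ?V (restrict_vars ?V F)" for s
    unfolding l_def using jac_restrict_subset[OF _ V that] HU by (intro t_jac jac_mult F_polys) auto
  have lH: "l (Hess ?V F) \<noteq> 0" unfolding l_def using Hess_complement[OF U] t_Hess by simp
  define L where "L = lin_ext (\<lambda>a. mon (exp_restrict U a) (l (mon (exp_restrict ?V a) 1)))"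
  have "L (p * Hess ?V F) = Const (l (Hess ?V F)) * p"
    unfolding L_def by (rule contract_mult[OF U refl l_add l_smult l_jac p(1) Hess_polys[OF V]])
  moreover have "L (p * Hess ?V F) \<in> jac U (restrict_vars U F)"
    unfolding L_def by (rule contract_in_jac[OF U refl l_add l_smult l_jac]) (use p(2) in \<open>simp_all add: mult.commute\<close>)
  ultimately have "Const (l (Hess ?V F)) * p \<in> jac U (restrict_vars U F)" by simp
  then have "Const (1 / l (Hess ?V F)) * (Const (l (Hess ?V F)) * p) \<in> jac U (restrict_vars U F)"
    by (rule jac_mult[OF restrict_vars_polys]) simp
  moreover have "Const (1 / l (Hess ?V F)) * (Const (l (Hess ?V F)) * p) = p"
    using lH by (simp flip: mult.assoc Const_mult)
  ultimately show ?thesis by simp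
qed

lemma high_degree_jac_restrict:
  assumes U: "U \<subseteq> X" "splits F U" and p: "p \<in> polys U" "homog_of q d p" "d > hdeg q U"
  shows "p \<in> jac U (restrict_vars U F)"
proof (rule cancel_Hess[OF U p(1)])
  show "Hess (X - U) F * p \<in> J"
  proof (rule high_degree_jac)
    show "Hess (X - U) F * p \<in> polys X"
      using Hess_polys[OF splits_complement[OF U]] p(1) U polys_mono by blast
    show "homog_of q (hdeg q (X - U) + d) (Hess (X - U) F * p)"
      by (intro homog_of_mult Hess_homog F_homog p)
    show "hdeg q X < hdeg q (X - U) + d" using p(3) hdeg_complement[OF U] by simp
  qed
qed

text \<open>Multiplication by the Hessian of the removed variables identifies the smaller Milnor
  ring with an ideal of the larger one, injectivity being \<open>cancel_Hess\<close>. The functional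
  of the restriction is \<open>t\<close> on that ideal.\<close>

lemma restrict_socle:
  assumes U: "U \<subseteq> X" "splits F U"
  shows "socle U (restrict_vars U F) q (\<lambda>p. t (Hess (X - U) F * p))"
proof -
  let ?V = "X - U"
  interpret U: quasihomogeneous U "restrict_vars U F" q
    by (rule restrict_quasihomogeneous[OF U])
  note sV = splits_complement[OF U]
  interpret V: quasihomogeneous ?V "restrict_vars ?V F" q
    by (rule restrict_quasihomogeneous[OF _ sV]) auto
  have UX: "p \<in> polys X" if "p \<in> polys U" for p using that U(1) polys_mono by blast
  have VX: "p \<in> polys X" if "p \<in> polys ?V" for p using that polys_mono[of ?V X] by auto
  have HV: "Hess ?V F \<in> polys ?V" by (rule Hess_polys[OF sV])
  note HVX = VX[OF HV]
  \<comment> \<open>A nonconstant monomial in the removed variables pushes their Hessian beyond its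
    top degree, so only the constant monomial survives multiplication.\<close>
  have HVm: "Hess ?V F * mon b 1 - Const (coeff (mon b (1::complex)) 0) * Hess ?V F \<in> J" if b: "supp b \<subseteq> ?V" for b
  proof (cases "b = 0")
    case True
    then show ?thesis by (simp add: jac_zero F_polys)
  next
    case False
    then have "mono_deg q b > 0" using b q_pos by (intro mono_deg_pos[of b ?V]) auto
    then have "Hess ?V F * mon b 1 \<in> jac ?V (restrict_vars ?V F)"
      using HV b by (intro high_degree_jac_restrict[OF _ sV, of _ "hdeg q ?V + mono_deg q b"]
          homog_of_mult homog_of_mon Hess_homog F_homog) auto
    then have "Hess ?V F * mon b 1 \<in> J" using jac_restrict_subset[OF _ sV] by auto
    then show ?thesis using False by (simp add: lookup_single when_def)
  qed
  show ?thesis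
  proof
    fix p r assume "p \<in> polys U" "r \<in> polys U"
    then show "t (Hess ?V F * (p + r)) = t (Hess ?V F * p) + t (Hess ?V F * r)"
      unfolding distrib_left using UX HVX by (intro t_add) auto
  next
    fix p c assume "p \<in> polys U"
    then show "t (Hess ?V F * (Const c * p)) = c * t (Hess ?V F * p)"
      using UX HVX t_smult[of "Hess ?V F * p" c] by (auto simp: mult_ac)
  next
    fix p assume "p \<in> jac U (restrict_vars U F)"
    then show "t (Hess ?V F * p) = 0"
      using jac_restrict_subset[OF U] HVX by (intro t_jac jac_mult F_polys) auto
  next
    fix p d assume p: "p \<in> polys U" "homog_of q d p" "d \<noteq> hdeg q U"
    show "t (Hess ?V F * p) = 0"
      using p HVX UX hdeg_complement[OF U]
      by (intro t_homog[of _ "hdeg q ?V + d"] homog_of_mult Hess_homog F_homog) auto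
  next
    fix p assume p: "p \<in> polys U" and z: "\<And>a. supp a \<subseteq> U \<Longrightarrow> t (Hess ?V F * (p * mon a 1)) = 0"
    show "p \<in> jac U (restrict_vars U F)"
    proof (rule cancel_Hess[OF U p], rule t_nondeg)
      show "Hess ?V F * p \<in> polys X" using HVX UX p by auto
      fix a :: "nat \<Rightarrow>\<^sub>0 nat" assume a: "supp a \<subseteq> X"
      define u v where "u = exp_restrict U a" and "v = exp_restrict ?V a"
      have uv: "a = u + v" "supp u \<subseteq> U" "supp v \<subseteq> ?V"
      proof -
        have "supp a \<subseteq> U \<union> ?V" using a by blast
        then show "a = u + v" unfolding u_def v_def by (intro exp_restrict_Un[symmetric]) auto
        show "supp u \<subseteq> U" "supp v \<subseteq> ?V" using a by (auto simp: u_def v_def supp_exp_restrict)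
      qed
      let ?c = "coeff (mon v (1::complex)) 0"
      have X1: "p * mon u 1 \<in> polys X" by (intro UX polys_mult p polys_mon uv)
      have "(p * mon u 1) * (Hess ?V F * mon v 1 - Const ?c * Hess ?V F) \<in> J"
        by (intro jac_mult F_polys HVm uv X1)
      moreover have "(p * mon u 1) * (Hess ?V F * mon v 1 - Const ?c * Hess ?V F) =
          Hess ?V F * p * mon a 1 - Const ?c * (Hess ?V F * (p * mon u 1))"
      proof -
        have "mon a (1::complex) = mon u 1 * mon v 1" by (simp add: uv(1) mon_mult)
        then show ?thesis by (simp add: algebra_simps)
      qed
      ultimately have "t (Hess ?V F * p * mon a 1) = t (Const ?c * (Hess ?V F * (p * mon u 1)))"
        using UX p HVX X1 a by (intro t_cong) auto
      also have "\<dots> = 0" using z[OF uv(2)] HVX X1 by (simp add: t_smult polys_mult)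
      finally show "t (Hess ?V F * p * mon a 1) = 0" .
    qed
  next
    show "t (Hess ?V F * Hess U (restrict_vars U F)) \<noteq> 0"
      using Hess_complement[OF U] t_Hess by (simp add: Hess_restrict[OF U(2)] mult.commute)
  qed
qed

end

section \<open>Milnor numbers of split polynomials and the factor in the product\<close>

context socle
begin

text \<open>The Milnor ring is the tensor product of those of the two parts, so sums of basis
  exponents form a basis. Independence is reduced to the two parts by contracting a relation with
  functionals on the second one.\<close>

lemma milnor_number_split:
  assumes U: "U \<subseteq> X" "splits F U"
  shows "milnor_number X F =
    milnor_number U (restrict_vars U F) * milnor_number (X - U) (restrict_vars (X - U) F)"
proof -
  let ?V = "X - U"
  let ?FU = "restrict_vars U F" and ?FV = "restrict_vars ?V F"
  note sV = splits_complement[OF U]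
  have VX: "?V \<subseteq> X" by auto
  have XVU: "X - ?V = U" using U by auto
  interpret U: socle U ?FU q "\<lambda>p. t (Hess ?V F * p)" by (rule restrict_socle[OF U])
  interpret V: socle ?V ?FV q "\<lambda>p. t (Hess U F * p)"
    using restrict_socle[OF VX sV] unfolding XVU .
  obtain A where A: "U.monomial_basis A" using U.exists_monomial_basis by blast
  obtain B where B: "V.monomial_basis B" using V.exists_monomial_basis by blast
  note finA = U.monomial_basisD(1)[OF A] and AU = U.monomial_basisD(2)[OF A]
    and indepA = U.monomial_basisD(3)[OF A] and spanA = U.monomial_basisD(4)[OF A]
  note finB = V.monomial_basisD(1)[OF B] and BV = V.monomial_basisD(2)[OF B]
    and indepB = V.monomial_basisD(3)[OF B] and spanB = V.monomial_basisD(4)[OF B]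
  have UX: "p \<in> polys X" if "p \<in> polys U" for p using that U(1) polys_mono by blast
  have VXp: "p \<in> polys X" if "p \<in> polys ?V" for p using that VX polys_mono by blast
  define C where "C = (\<lambda>(a, b). a + b) ` (A \<times> B)"
  have exA: "exp_restrict U (a + b) = a" and exB: "exp_restrict ?V (a + b) = b"
    if "supp a \<subseteq> U" "supp b \<subseteq> ?V" for a b
  proof -
    have "supp b \<inter> U = {}" "supp a \<inter> ?V = {}" using that by blast+
    then show "exp_restrict U (a + b) = a" "exp_restrict ?V (a + b) = b"
      using that by (simp_all add: exp_restrict_add exp_restrict_id exp_restrict_disjoint)
  qed
  have inj: "inj_on (\<lambda>(a, b). a + b) (A \<times> B)"
  proof (rule inj_onI, clarify)
    fix a b a' b' assume *: "a \<in> A" "b \<in> B" "a' \<in> A" "b' \<in> B" "a + b = a' + b'"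
    show "a = a' \<and> b = b'"
      using exA[OF AU BV] exB[OF AU BV] * by metis
  qed
  have "monomial_basis C"
    unfolding monomial_basis_def
  proof (intro conjI ballI allI impI)
    show "finite C" unfolding C_def using finA finB by simp
  next
    fix c assume "c \<in> C"
    then obtain a b where "c = a + b" "a \<in> A" "b \<in> B" by (auto simp: C_def)
    then show "supp c \<subseteq> X" using AU[of a] BV[of b] U by auto
  next
    fix p assume pC: "supp p \<subseteq> C" and pJ: "p \<in> J"
    \<comment> \<open>Read \<open>p\<close> as a polynomial in the variables of \<open>U\<close>;
      \<open>s a\<close> is its coefficient at the exponent \<open>a\<close>, a polynomial in the
      other variables.\<close>
    define s where "s a = (\<Sum>b\<in>B. mon b (coeff p (a + b)))" for a
    have s_coeff: "coeff (s a) b = coeff p (a + b)" if "b \<in> B" for a b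
    proof -
      have "coeff (s a) b = (\<Sum>b'\<in>B. if b = b' then coeff p (a + b) else 0)"
        unfolding s_def lookup_sum by (rule sum.cong) (auto simp: lookup_single when_def)
      then show ?thesis using that finB by simp
    qed
    have s_supp: "supp (s a) \<subseteq> B" for a
    proof
      fix b assume "b \<in> supp (s a)"
      then show "b \<in> B"
        unfolding s_def in_keys_iff lookup_sum
        by (metis (mono_tags, lifting) lookup_single_not_eq sum.neutral)
    qed
    have s_polys: "s a \<in> polys ?V" for a
      unfolding s_def using BV by (intro polys_sum polys_mon) auto
    have p_eq: "p = (\<Sum>a\<in>A. mon a 1 * s a)"
    proof -
      have "p = (\<Sum>c\<in>C. mon c (coeff p c))"
        using pC finA finB by (intro sum_mon_superset[symmetric]) (auto simp: C_def)
      also have "\<dots> = (\<Sum>(a, b)\<in>A \<times> B. mon (a + b) (coeff p (a + b)))"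
        unfolding C_def by (subst sum.reindex[OF inj]) (simp add: case_prod_unfold)
      also have "\<dots> = (\<Sum>a\<in>A. mon a 1 * s a)"
        unfolding s_def sum_distrib_left by (simp add: sum.cartesian_product mon_mult)
      finally show ?thesis .
    qed
    have "s a \<in> jac ?V ?FV" if a: "a \<in> A" for a
    proof (rule V.t_nondeg[OF s_polys])
      fix b :: "nat \<Rightarrow>\<^sub>0 nat" assume b: "supp b \<subseteq> ?V"
      \<comment> \<open>Pairing with the monomial \<open>b\<close> on the second part. The
        contracted relation is supported in \<open>A\<close>, so independence there makes
        \<open>l (s a)\<close> vanish; letting \<open>b\<close> vary, nondegeneracy gives
        \<open>s a\<close> in the ideal.\<close>
      define l where "l r = t (Hess U F * (r * mon b 1))" for r
      have l_add: "l (r + r') = l r + l r'" if "r \<in> polys ?V" "r' \<in> polys ?V" for r r'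
        unfolding l_def distrib_right using that b by (intro V.t_add polys_mult polys_mon)
      have l_smult: "l (Const c * r) = c * l r" if "r \<in> polys ?V" for c r
        unfolding l_def mult.assoc[of "Const c"] using that b by (intro V.t_smult polys_mult polys_mon)
      have l_jac: "l r = 0" if "r \<in> jac ?V ?FV" for r
        unfolding l_def using that b by (intro V.t_jac jac_mult' V.F_polys polys_mon)
      define L where "L = lin_ext (\<lambda>a. mon (exp_restrict U a) (l (mon (exp_restrict ?V a) 1)))"
      have "L p = (\<Sum>a\<in>A. Const (l (s a)) * mon a 1)"
        unfolding p_eq L_def lin_ext_sum
        using AU by (intro sum.cong refl contract_mult[OF U refl l_add l_smult l_jac] s_polys polys_mon) auto
      also have "\<dots> = (\<Sum>a\<in>A. mon a (l (s a)))" by (simp add: Const_mon)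
      finally have Lp: "L p = (\<Sum>a\<in>A. mon a (l (s a)))" .
      have "L p \<in> jac U ?FU"
        unfolding L_def by (rule contract_in_jac[OF U refl l_add l_smult l_jac pJ])
      moreover have coeffL: "coeff (L p) a' = (if a' \<in> A then l (s a') else 0)" for a'
      proof -
        have "coeff (L p) a' = (\<Sum>a\<in>A. if a' = a then l (s a') else 0)"
          unfolding Lp lookup_sum by (rule sum.cong) (auto simp: lookup_single when_def)
        then show ?thesis using finA by simp
      qed
      moreover have "supp (L p) \<subseteq> A" using coeffL by (auto simp: in_keys_iff split: if_splits)
      ultimately have "L p = 0" using indepA by blast
      then have "l (s a) = 0" using coeffL[of a] a by simp
      then show "t (Hess U F * (s a * mon b 1)) = 0" by (simp add: l_def)
    qed
    then have "s a = 0" if "a \<in> A" for a using indepB[OF s_supp] that by blast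
    then show "p = 0" using p_eq by simp
  next
    fix p assume "p \<in> polys X"
    then show "\<exists>r. supp r \<subseteq> C \<and> p - r \<in> J"
    proof (induction p rule: polys_induct)
      case zero
      then show ?case by (intro exI[of _ 0]) (simp add: jac_zero F_polys)
    next
      case (mon a c)
      define u v where "u = mon (exp_restrict U a) c" and "v = mon (exp_restrict ?V a) (1::complex)"
      have uv: "mon a c = u * v" "u \<in> polys U" "v \<in> polys ?V"
      proof -
        have "supp a \<subseteq> U \<union> ?V" using mon by blast
        then show "mon a c = u * v" by (simp add: u_def v_def mon_mult exp_restrict_Un)
        show "u \<in> polys U" "v \<in> polys ?V"
          using mon by (auto simp: u_def v_def supp_exp_restrict intro!: polys_mon)
      qed
      obtain r where r: "supp r \<subseteq> A" "u - r \<in> jac U ?FU" using spanA[OF uv(2)] by blast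
      obtain r' where r': "supp r' \<subseteq> B" "v - r' \<in> jac ?V ?FV" using spanB[OF uv(3)] by blast
      have rU: "r \<in> polys U" using r(1) AU by (auto simp: polys_iff)
      have "supp (r * r') \<subseteq> C"
        using keys_mult[of r r'] r(1) r'(1) by (fastforce simp: C_def)
      moreover have "mon a c - r * r' = (u - r) * v + r * (v - r')"
        by (simp add: uv(1) algebra_simps)
      moreover have "(u - r) * v + r * (v - r') \<in> J"
        using jac_restrict_subset[OF U r(2)] jac_restrict_subset[OF VX sV r'(2)] UX[OF rU] VXp[OF uv(3)]
        by (intro jac_add F_polys jac_mult' jac_mult)
      ultimately show ?case by metis
    next
      case (add p p')
      then obtain r r' where r: "supp r \<subseteq> C" "p - r \<in> J" "supp r' \<subseteq> C" "p' - r' \<in> J" by blast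
      have "supp (r + r') \<subseteq> C" using r supp_add[of r r'] by blast
      moreover have "p + p' - (r + r') \<in> J" using jac_add[OF F_polys r(2,4)] by (simp add: algebra_simps)
      ultimately show ?case by blast
    qed
  qed
  then have "milnor_number X F = card C" by (rule milnor_number_eq_card)
  also have "\<dots> = card A * card B"
    unfolding C_def by (simp add: card_image[OF inj] card_cartesian_product)
  finally show ?thesis using U.milnor_number_eq_card[OF A] V.milnor_number_eq_card[OF B] by simp
qed

text \<open>Some monomial of the Hessian is not killed by \<open>t\<close>, and any such monomial
  spans the top degree. This is why a monomial as required in \<open>gamma_factor\<close>
  exists.\<close>

lemma exists_top_monomial:
  "\<exists>b c. supp b \<subseteq> X \<and> c \<noteq> 0 \<and> mon b c - H \<in> J"
proof -
  have "\<exists>b\<in>supp H. t (mon b (coeff H b)) \<noteq> 0"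
  proof (rule ccontr)
    assume "\<not> ?thesis"
    then have "(\<Sum>b\<in>supp H. t (mon b (coeff H b))) = 0" by (intro sum.neutral) auto
    moreover have "t (\<Sum>b\<in>supp H. mon b (coeff H b)) = (\<Sum>b\<in>supp H. t (mon b (coeff H b)))"
      using H_polys by (intro t_sum polys_mon) (auto simp: polys_def)
    ultimately show False using t_Hess by (simp add: sum_mon)
  qed
  then obtain b where b: "b \<in> supp H" "t (mon b (coeff H b)) \<noteq> 0" by blast
  have bX: "supp b \<subseteq> X" using b(1) H_polys by (auto simp: polys_def)
  let ?m = "mon b (coeff H b)"
  let ?d = "t ?m / t H"
  have d: "?d \<noteq> 0" using b t_Hess by simp
  have "?m - Const ?d * H \<in> J"
    using b(1) bX H_homog by (intro top_degree_jac polys_mon homog_of_mon) (auto simp: homog_of_def)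
  then have "Const (1 / ?d) * (?m - Const ?d * H) \<in> J" by (rule jac_mult[OF F_polys]) simp
  moreover have "Const (1 / ?d) * (?m - Const ?d * H) = Const (1 / ?d) * ?m - Const (1 / ?d * ?d) * H"
    by (simp only: right_diff_distrib Const_mult mult.assoc)
  moreover have "1 / ?d * ?d = 1" using d by simp
  ultimately have "mon b (1 / ?d * coeff H b) - H \<in> J" by (simp add: Const_mon)
  moreover have "1 / ?d * coeff H b \<noteq> 0" using d b(1) by (simp add: in_keys_iff)
  ultimately show ?thesis using bX by blast
qed

text \<open>The Hessian normalised by the Milnor number. Milnor numbers and Hessians both multiply
  over disjoint split sets, hence so does \<open>eps\<close>, and the quotient in the product of
  sectors becomes \<open>eps\<close> of a difference of fixed sets.\<close>

definition eps :: "nat set \<Rightarrow> mpoly" where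
  "eps U = Const (1 / of_nat (milnor_number U (restrict_vars U F))) * Hess U F"

lemma eps_polys: "splits F U \<Longrightarrow> eps U \<in> polys U"
  unfolding eps_def by (intro polys_mult polys_Const Hess_polys)

text \<open>The defining equation of the chosen monomial says only that it agrees with
  \<open>eps (X - A)\<close> after multiplication by the Hessian of \<open>A\<close>. To cancel that
  Hessian, the monomial must first be shown free of the variables of \<open>A\<close>.\<close>

lemma gamma_factor_cong:
  assumes A: "A \<subseteq> X" "splits F A"
  shows "gamma_factor F A X \<in> polys X" "gamma_factor F A X - eps (X - A) \<in> J"
proof -
  let ?D = "X - A"
  note sD = splits_complement[OF A]
  have XDA: "X - ?D = A" using A by auto
  have FX: "restrict_vars X F = F" by (rule restrict_vars_id[OF F_polys])
  let ?\<mu> = "\<lambda>U. of_nat (milnor_number U (restrict_vars U F)) :: complex"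
  interpret A: socle A "restrict_vars A F" q "\<lambda>p. t (Hess ?D F * p)" by (rule restrict_socle[OF A])
  interpret D: socle ?D "restrict_vars ?D F" q "\<lambda>p. t (Hess A F * p)"
    using restrict_socle[OF _ sD] unfolding XDA by auto
  have \<mu>: "?\<mu> X = ?\<mu> A * ?\<mu> ?D" using milnor_number_split[OF A] by (simp add: FX)
  have nz: "?\<mu> A \<noteq> 0" "?\<mu> ?D \<noteq> 0" using A.milnor_number_pos D.milnor_number_pos by simp_all
  have HA: "Hess A F \<in> polys A" by (rule Hess_polys[OF A(2)])
  have HD: "Hess ?D F \<in> polys ?D" by (rule Hess_polys[OF sD])
  have AX: "p \<in> polys X" if "p \<in> polys A" for p using that A(1) polys_mono by blast
  have DX: "p \<in> polys X" if "p \<in> polys ?D" for p using that polys_mono[of ?D X] by auto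
  have \<mu>e: "Const (?\<mu> X) * eps ?D = Const (?\<mu> A) * Hess ?D F"
    unfolding eps_def \<mu> using nz by (simp flip: mult.assoc Const_mult)
  have HX: "Hess X F = Hess A F * Hess ?D F" by (rule Hess_complement[OF A])
  define S where "S \<gamma> \<longleftrightarrow> (\<exists>b c. \<gamma> = mon b c \<and> supp b \<subseteq> X \<and>
        cls X F (\<gamma> * Const (?\<mu> X) * Hess A F) = cls X F (Const (?\<mu> A) * H))" for \<gamma>
  have S_iff: "S \<gamma> \<longleftrightarrow> (\<exists>b c. \<gamma> = mon b c \<and> supp b \<subseteq> X) \<and>
      Const (?\<mu> X) * (Hess A F * (\<gamma> - eps ?D)) \<in> J" for \<gamma>
  proof -
    have "cls X F (\<gamma> * Const (?\<mu> X) * Hess A F) = cls X F (Const (?\<mu> A) * H) \<longleftrightarrow>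
        Const (?\<mu> X) * (Hess A F * (\<gamma> - eps ?D)) \<in> J" if "\<gamma> \<in> polys X"
    proof -
      have "\<gamma> * Const (?\<mu> X) * Hess A F - Const (?\<mu> A) * H =
        Const (?\<mu> X) * (Hess A F * \<gamma>) - Hess A F * (Const (?\<mu> A) * Hess ?D F)"
        by (simp add: HX mult_ac)
      also have "\<dots> = Const (?\<mu> X) * (Hess A F * (\<gamma> - eps ?D))"
        unfolding \<mu>e[symmetric] by (simp add: algebra_simps)
      finally show ?thesis
        using that AX[OF HA] H_polys by (subst cls_eq_iff[OF F_polys]) auto
    qed
    then show ?thesis unfolding S_def by auto
  qed
  have "\<exists>\<gamma>. S \<gamma>"
  proof -
    obtain b c where bc: "supp b \<subseteq> ?D" "mon b c - Hess ?D (restrict_vars ?D F) \<in> jac ?D (restrict_vars ?D F)"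
      using D.exists_top_monomial by blast
    let ?k = "1 / ?\<mu> ?D"
    have "Const ?k * (mon b c - Hess ?D F) \<in> J"
      using jac_restrict_subset[OF _ sD bc(2)] by (intro jac_mult F_polys) (auto simp: Hess_restrict[OF sD])
    moreover have "Const ?k * (mon b c - Hess ?D F) = mon b (?k * c) - eps ?D"
      by (simp only: eps_def right_diff_distrib Const_mon)
    ultimately have "mon b (?k * c) - eps ?D \<in> J" by simp
    then have "S (mon b (?k * c))"
      unfolding S_iff using bc(1) AX[OF HA] by (intro conjI jac_mult F_polys) auto
    then show ?thesis by blast
  qed
  moreover have "gamma_factor F A X = (SOME \<gamma>. S \<gamma>)"
    unfolding gamma_factor_def S_def Const_of_nat FX Hess_restrict[OF A(2)] ..
  ultimately have "S (gamma_factor F A X)" by (simp add: someI_ex)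
  then obtain b c where g: "gamma_factor F A X = mon b c" "supp b \<subseteq> X"
    and gJ: "Const (?\<mu> X) * (Hess A F * (mon b c - eps ?D)) \<in> J"
    unfolding S_iff by auto
  have "Const (1 / ?\<mu> X) * (Const (?\<mu> X) * (Hess A F * (mon b c - eps ?D))) \<in> J"
    using jac_mult[OF F_polys gJ] by simp
  then have e: "Hess A F * (mon b c - eps ?D) \<in> J"
    using nz by (simp add: \<mu> flip: mult.assoc Const_mult)
  show "gamma_factor F A X \<in> polys X" using g by auto
  define a d where "a = exp_restrict A b" and "d = exp_restrict ?D b"
  have bad: "b = a + d" "supp a \<subseteq> A" "supp d \<subseteq> ?D"
  proof -
    have "supp b \<subseteq> A \<union> ?D" using g(2) by blast
    then show "b = a + d" unfolding a_def d_def by (intro exp_restrict_Un[symmetric]) auto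
    show "supp a \<subseteq> A" "supp d \<subseteq> ?D" using g(2) by (auto simp: a_def d_def supp_exp_restrict)
  qed
  \<comment> \<open>Otherwise the Hessian of \<open>A\<close> annihilates the chosen monomial, hence
    also \<open>eps (X - A)\<close>. But its product with the latter is a nonzero multiple of the
    full Hessian, which is not in the ideal.\<close>
  have "a = 0"
  proof (rule ccontr)
    assume "a \<noteq> 0"
    then have "Hess A F * mon a 1 \<in> jac A (restrict_vars A F)"
      using A.Hess_mult[of "mon a 1"] bad by (auto simp: lookup_single when_def Hess_restrict[OF A(2)])
    then have "Hess A F * mon a 1 \<in> J" using jac_restrict_subset[OF A] by blast
    then have "mon d c * (Hess A F * mon a 1) \<in> J"
      by (rule jac_mult[OF F_polys _ DX[OF polys_mon[OF bad(3)]]])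
    moreover have "mon d c * (Hess A F * mon a 1) = Hess A F * mon b c"
      using mon_mult[of d c a 1] by (simp add: bad(1) mult_ac add_ac)
    ultimately have "Hess A F * mon b c - Hess A F * (mon b c - eps ?D) \<in> J"
      using e by (auto intro: jac_diff F_polys)
    then have "Hess A F * eps ?D \<in> J" by (simp add: right_diff_distrib)
    then have "Const (?\<mu> ?D) * (Hess A F * eps ?D) \<in> J"
      by (rule jac_mult[OF F_polys]) simp
    moreover have "Const (?\<mu> ?D) * (Hess A F * eps ?D) = H"
    proof -
      have "Const (?\<mu> ?D) * eps ?D = Hess ?D F"
        unfolding eps_def using nz by (simp flip: mult.assoc Const_mult)
      then have "Hess A F * (Const (?\<mu> ?D) * eps ?D) = H" by (simp add: HX)
      then show ?thesis by (simp add: mult_ac)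
    qed
    ultimately show False using H_notin by simp
  qed
  then have "mon b c - eps ?D \<in> polys ?D" using bad eps_polys[OF sD] by auto
  then have "mon b c - eps ?D \<in> jac ?D (restrict_vars ?D F)"
    using e by (intro cancel_Hess[OF _ sD]) (auto simp: XDA)
  then show "gamma_factor F A X - eps ?D \<in> J"
    unfolding g(1) using jac_restrict_subset[OF _ sD] by auto
qed

end

section \<open>Weights and symmetries of admissible polynomials\<close>

text \<open>As for the independence of characters: substituting \<open>y * x\<close> for
  \<open>x\<close> multiplies each monomial by its value at \<open>y\<close>, and subtracting a
  multiple of the original relation removes the term of \<open>b\<close>.\<close>

lemma mval_independent:
  fixes c :: "(nat \<Rightarrow>\<^sub>0 nat) \<Rightarrow> complex"
  assumes "finite A" "\<And>x. (\<Sum>a\<in>A. c a * mval x a) = 0" "a \<in> A"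
  shows "c a = 0"
  using assms
proof (induction A arbitrary: c a rule: finite_induct)
  case empty
  then show ?case by simp
next
  case (insert b A)
  have A: "c a = 0" if a: "a \<in> A" for a
  proof -
    have "a \<noteq> b" using a insert.hyps by auto
    then obtain i where i: "coeff a i \<noteq> coeff b i" by (metis poly_mapping_eqI)
    \<comment> \<open>The value 2 at a variable in which \<open>a\<close> and \<open>b\<close>
      differ gives the two monomials different powers of 2.\<close>
    define y :: "nat \<Rightarrow> complex" where "y j = (if j = i then 2 else 1)" for j
    have my: "mval y d = 2 ^ coeff d i" for d
    proof -
      have "mval y d = (\<Prod>j\<in>supp d. if j = i then 2 ^ coeff d i else 1)"
        unfolding mval_def by (rule prod.cong) (auto simp: y_def)
      then show ?thesis by (simp add: prod.delta in_keys_iff)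
    qed
    have "(\<Sum>a\<in>A. (c a * (mval y a - mval y b)) * mval x a) = 0" for x
    proof -
      have "(\<Sum>a\<in>insert b A. c a * mval (\<lambda>i. y i * x i) a) - mval y b * (\<Sum>a\<in>insert b A. c a * mval x a) = 0"
        using insert.prems(1) by simp
      then have "(\<Sum>a\<in>insert b A. (c a * (mval y a - mval y b)) * mval x a) = 0"
        unfolding mval_mult sum_distrib_left sum_subtractf[symmetric] by (simp add: algebra_simps)
      then show ?thesis using insert.hyps by simp
    qed
    then have "c a * (mval y a - mval y b) = 0"
      using insert.IH[of "\<lambda>a. c a * (mval y a - mval y b)" a] a by blast
    moreover have "(2::complex) ^ coeff a i \<noteq> 2 ^ coeff b i"
    proof
      assume "(2::complex) ^ coeff a i = 2 ^ coeff b i"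
      then have "complex_of_real (2 ^ coeff a i) = complex_of_real (2 ^ coeff b i)" by simp
      then have "(2::real) ^ coeff a i = 2 ^ coeff b i" unfolding of_real_eq_iff .
      then show False using i by simp
    qed
    ultimately show ?thesis by (simp add: my)
  qed
  then have "c b * mval (\<lambda>_. 1) b = 0"
    using insert.prems(1)[of "\<lambda>_. 1"] insert.hyps by simp
  then have "c b = 0" by simp
  then show ?case using A insert.prems by blast
qed

lemma complex_of_rat_eq: "(of_rat r :: complex) = of_real (of_rat r)"
  by (cases r) (simp add: of_rat_rat)

lemma mval_powr:
  fixes c :: complex and q :: "nat \<Rightarrow> rat"
  assumes "c \<noteq> 0"
  shows "mval (\<lambda>i. c powr of_rat (q i)) a = c powr of_rat (mono_deg q a / 2)"
proof -
  have pow: "(c powr z) ^ n = c powr (of_nat n * z)" for z :: complex and n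
    using assms by (induction n) (auto simp: powr_add distrib_right)
  have "(\<Prod>i\<in>A. c powr z i) = c powr (\<Sum>i\<in>A. z i)" if "finite A" for A and z :: "nat \<Rightarrow> complex"
    using that assms by (induction A rule: finite_induct) (auto simp: powr_add)
  then show ?thesis
    by (simp add: mval_def pow mono_deg_def of_rat_sum of_rat_mult)
qed

text \<open>Scaling by \<open>c = 2\<close> already determines the degree of each monomial:
  monomials are independent functions, and real powers of 2 are injective in the exponent.
  Conversely \<open>c = 0\<close> is a case of its own; there \<open>W\<close> must have no constant
  term, which degree 2 guarantees.\<close>

lemma is_weights_iff:
  assumes "W \<in> polys I"
  shows "is_weights I W q \<longleftrightarrow> (\<forall>i\<in>I. 0 < q i) \<and> (\<forall>i. i \<notin> I \<longrightarrow> q i = 0) \<and> homog_of q 2 W"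
proof -
  let ?y = "\<lambda>c x i. c powr of_rat (q i) * x i :: complex"
  have "(\<forall>c x. eval_poly (?y c x) W = c * eval_poly x W) \<longleftrightarrow> homog_of q 2 W"
  proof
    assume *: "\<forall>c x. eval_poly (?y c x) W = c * eval_poly x W"
    show "homog_of q 2 W"
      unfolding homog_of_def
    proof
      fix a assume a: "a \<in> supp W"
      let ?c = "\<lambda>a. coeff W a * (2 powr of_rat (mono_deg q a / 2) - 2)"
      have "(\<Sum>a\<in>supp W. ?c a * mval x a) = 0" for x
      proof -
        have "eval_poly (?y 2 x) W - 2 * eval_poly x W = 0" using * by simp
        then show ?thesis
          unfolding eval_poly_mval mval_mult sum_distrib_left sum_subtractf[symmetric]
          by (simp add: mval_powr algebra_simps)
      qed
      then have "?c a = 0" using mval_independent[of "supp W" ?c a] a by simp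
      then have "2 powr (of_rat (mono_deg q a / 2) :: complex) = 2" using a by (simp add: in_keys_iff)
      then have "complex_of_real (2 powr of_rat (mono_deg q a / 2)) = complex_of_real 2"
        using powr_of_real[of 2 "of_rat (mono_deg q a / 2)"] by (simp add: complex_of_rat_eq)
      then have "(2::real) powr of_rat (mono_deg q a / 2) = 2 powr 1" unfolding of_real_eq_iff by simp
      then have "(of_rat (mono_deg q a / 2) :: real) = of_rat 1" by (subst (asm) powr_inj) auto
      then have "mono_deg q a / 2 = 1" unfolding of_rat_eq_iff .
      then show "mono_deg q a = 2" by simp
    qed
  next
    assume h: "homog_of q 2 W"
    show "\<forall>c x. eval_poly (?y c x) W = c * eval_poly x W"
    proof (intro allI)
      fix c :: complex and x
      show "eval_poly (?y c x) W = c * eval_poly x W"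
      proof (cases "c = 0")
        case True
        have "mval (\<lambda>i. 0) a = (0::complex)" if "a \<in> supp W" for a
        proof -
          have "a \<noteq> 0" using that h by (auto simp: homog_of_def)
          then obtain l where "l \<in> supp a" by (metis keys_eq_empty all_not_in_conv)
          then show ?thesis by (auto simp: mval_def in_keys_iff intro!: prod_zero)
        qed
        then show ?thesis using True by (simp add: eval_poly_mval)
      next
        case False
        then show ?thesis
          unfolding eval_poly_mval mval_mult sum_distrib_left
          using h by (intro sum.cong refl) (simp add: mval_powr homog_of_def)
      qed
    qed
  qed
  then show ?thesis unfolding is_weights_def by blast
qed

lemma eval_poly_zero: "eval_poly (\<lambda>_. 0) p = coeff p 0"
proof -
  have *: "mval (\<lambda>i. 0) a = (if a = 0 then 1 else (0::complex))" for a
  proof (cases "a = 0")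
    case False
    then obtain l where "l \<in> supp a" by (metis keys_eq_empty all_not_in_conv)
    then show ?thesis using False by (auto simp: mval_def in_keys_iff intro!: prod_zero)
  qed simp
  have "eval_poly (\<lambda>_. 0) p = (\<Sum>a\<in>supp p. if a = 0 then coeff p 0 else 0)"
    unfolding eval_poly_mval * by (rule sum.cong) auto
  then show ?thesis by (simp add: sum.delta in_keys_iff)
qed

locale admissible_poly =
  fixes I :: "nat set" and W :: mpoly
  assumes finite_I: "finite I" and admissible: "admissible I W"
begin

abbreviation "q \<equiv> weights I W"

lemma W_polys: "W \<in> polys I" using admissible by (simp add: admissible_def)

lemma weights_unique: "is_weights I W r \<Longrightarrow> r = q"
  using admissible the1_equality unfolding admissible_def weights_def by metis

lemma is_weights: "is_weights I W q"
  using admissible theI' unfolding admissible_def weights_def by metis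

lemma q_pos: "i \<in> I \<Longrightarrow> q i > 0" and q_outside: "i \<notin> I \<Longrightarrow> q i = 0" and W_homog: "homog_of q 2 W"
  using is_weights is_weights_iff[OF W_polys] by blast+

lemma W_crit: "i \<in> I \<Longrightarrow> coeff (pdiff i W) 0 = 0"
  using admissible
  by (auto simp: admissible_def nondegenerate_def isolated_in_def critical_points_def eval_poly_zero)

sublocale quasihomogeneous I W q
  by standard (auto simp: finite_I W_polys q_pos W_homog W_crit)

lemma no_linear: "j \<in> I \<Longrightarrow> coeff W (mon j 1) = 0"
  using W_crit[of j] by (simp add: coeff_pdiff)

text \<open>Otherwise the whole \<open>x\<^sub>i\<close>-axis would be critical.\<close>

lemma exists_axis_monomial:
  assumes i: "i \<in> I"
  shows "\<exists>k\<ge>2. mon i k \<in> supp W \<or> (\<exists>j\<in>I. j \<noteq> i \<and> mon i k + mon j 1 \<in> supp W)"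
proof (rule ccontr)
  assume no: "\<not> ?thesis"
  define ax where "ax z = (\<lambda>j. if j = i then z else 0)" for z :: complex
  have crit: "ax z \<in> critical_points I W" for z
    unfolding critical_points_def
  proof (intro CollectI conjI ballI allI impI)
    show "ax z j = 0" if "j \<notin> I" for j using i that by (auto simp: ax_def)
    fix j assume j: "j \<in> I"
    show "eval_poly (ax z) (pdiff j W) = 0"
      unfolding eval_poly_mval
    proof (intro sum.neutral ballI)
      fix a assume a: "a \<in> supp (pdiff j W)"
      \<comment> \<open>On the axis only pure powers of the variable \<open>i\<close> survive. Such
        a power with exponent \<open>m\<close> comes from a monomial of \<open>W\<close> that is
        this power times the variable \<open>j\<close>. Large \<open>m\<close> is excluded by
        \<open>no\<close>; what remains is a linear term or a product of two distinct variables, and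
        both are absent from \<open>W\<close>.\<close>
      show "coeff (pdiff j W) a * mval (ax z) a = 0"
      proof (cases "supp a \<subseteq> {i}")
        case False
        then obtain l where "l \<in> supp a" "l \<noteq> i" by auto
        then have "mval (ax z) a = 0" by (auto simp: mval_def ax_def in_keys_iff intro!: prod_zero)
        then show ?thesis by simp
      next
        case True
        define m where "m = coeff a i"
        have am: "a = mon i m"
        proof (rule poly_mapping_eqI)
          fix l show "coeff a l = coeff (mon i m) l"
            using True by (cases "l = i") (auto simp: m_def lookup_single when_def in_keys_iff subset_iff)
        qed
        have "mon i m + mon j 1 \<in> supp W" using a by (simp add: supp_pdiff am)
        then have W0: "coeff W (mon i m + mon j 1) \<noteq> 0" by (simp add: in_keys_iff)
        have False
        proof (cases "j = i")
          case True
          then have e: "mon i m + mon j 1 = mon i (m + 1)" by (simp only: True single_add)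
          have "m = 0" using no W0 by (metis True e in_keys_iff le_add2 not_less_eq_eq numeral_2_eq_2 Suc_eq_plus1 Suc_le_mono le0 One_nat_def not0_implies_Suc)
          then show False using W0 no_linear[OF i] True by simp
        next
          case False
          have "m < 2" using no W0 j False by (metis in_keys_iff not_less)
          then have "m = 0 \<or> m = 1" by auto
          then show False
          proof
            assume "m = 0" then show False using W0 no_linear[OF j] by simp
          next
            assume "m = 1"
            moreover have "coeff W (mon i 1 + mon j 1) = 0"
              using admissible False unfolding admissible_def by metis
            ultimately show False using W0 by simp
          qed
        qed
        then show ?thesis ..
      qed
    qed
  qed
  have ax0: "ax 0 = (\<lambda>_. 0)" by (auto simp: ax_def)
  obtain T where T: "open T" "T \<inter> critical_points I W = {\<lambda>_. 0}"
    using admissible by (auto simp: admissible_def nondegenerate_def isolated_in_def)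
  \<comment> \<open>The axis is a continuous curve of critical points through the origin, so every
    isolating open set contains further points of it.\<close>
  have "continuous_on UNIV (\<lambda>z. ax z j)" for j
    by (cases "j = i") (auto simp: ax_def)
  then have cont: "continuous_on UNIV ax"
    by (intro continuous_on_coordinatewise_then_product)
  have "open (ax -` T)" using cont T(1) by (simp add: continuous_on_open_vimage)
  moreover have "0 \<in> ax -` T" using T(2) ax0 by auto
  ultimately obtain e where e: "e > 0" "ball 0 e \<subseteq> ax -` T" using openE by blast
  have "complex_of_real (e/2) \<in> ball 0 e" using e by simp
  then have "ax (complex_of_real (e/2)) \<in> T \<inter> critical_points I W" using e crit by blast
  then have "ax (complex_of_real (e/2)) i = 0" using T(2) by auto
  then show False using e by (simp add: ax_def)
qed

lemma mono_deg_W: "a \<in> supp W \<Longrightarrow> mono_deg q a = 2"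
  using W_homog by (simp add: homog_of_def)

text \<open>A monomial with the variable \<open>i\<close> to a power \<open>k \<ge> 2\<close>,
  possibly times one other variable, has weighted degree 1. This bounds the weight by 1/2, and
  equality leaves room only for the pure square since weights are positive.\<close>

lemma weight_le_half: "i \<in> I \<Longrightarrow> q i \<le> 1/2"
  and weight_half: "i \<in> I \<Longrightarrow> q i = 1/2 \<Longrightarrow> mon i 2 \<in> supp W"
proof -
  assume i: "i \<in> I"
  obtain k where k: "k \<ge> 2" "mon i k \<in> supp W \<or> (\<exists>j\<in>I. j \<noteq> i \<and> mon i k + mon j 1 \<in> supp W)"
    using exists_axis_monomial[OF i] by blast
  have k2: "of_nat k * q i \<ge> 2 * q i" using k(1) q_pos[OF i] by (intro mult_right_mono) auto
  from k(2) have "q i \<le> 1/2 \<and> (q i = 1/2 \<longrightarrow> mon i 2 \<in> supp W)"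
  proof
    assume m: "mon i k \<in> supp W"
    then have "of_nat k * q i = 1" using mono_deg_W[OF m] by simp
    moreover from this have "k = 2" if "q i = 1/2" using that by simp
    ultimately show ?thesis using k2 m by auto
  next
    assume "\<exists>j\<in>I. j \<noteq> i \<and> mon i k + mon j 1 \<in> supp W"
    then obtain j where j: "j \<in> I" "mon i k + mon j 1 \<in> supp W" by blast
    have "2 * (of_nat k * q i) + 2 * q j = 2" using mono_deg_W[OF j(2)] by (simp add: mono_deg_add)
    then show ?thesis using k2 q_pos[OF j(1)] by auto
  qed
  then show "q i \<le> 1/2" "q i = 1/2 \<Longrightarrow> mon i 2 \<in> supp W" by auto
qed

lemma symmetry_monomial:
  assumes "scale_vars g W = W" "a \<in> supp W" shows "mval g a = 1"
proof -
  have "mval g a * coeff W a = coeff W a" using assms(1) coeff_scale_vars[of g W a] by simp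
  then show ?thesis using assms(2) by (simp add: in_keys_iff)
qed

lemma symmetry_half:
  assumes "scale_vars g W = W" "i \<in> I" "q i = 1/2" shows "g i ^ 2 = 1"
  using symmetry_monomial[OF assms(1) weight_half[OF assms(2,3)]] by simp

lemma symmetry_step:
  assumes i: "i \<in> I"
  shows "\<exists>k\<ge>2. (\<forall>g\<in>carrier (Gmax I W). g i ^ k = 1) \<or>
    (\<exists>j\<in>I. \<forall>g\<in>carrier (Gmax I W). g i ^ k * g j = 1)"
proof -
  obtain k where k: "k \<ge> 2" "mon i k \<in> supp W \<or> (\<exists>j\<in>I. j \<noteq> i \<and> mon i k + mon j 1 \<in> supp W)"
    using exists_axis_monomial[OF i] by blast
  have "mval g a = 1" if "g \<in> carrier (Gmax I W)" "a \<in> supp W" for g a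
    using that by (intro symmetry_monomial) (auto simp: Gmax_def)
  from this k have "(\<forall>g\<in>carrier (Gmax I W). g i ^ k = 1) \<or>
    (\<exists>j\<in>I. \<forall>g\<in>carrier (Gmax I W). g i ^ k * g j = 1)"
    by (metis mval_add mval_single power_one_right)
  then show ?thesis using k(1) by blast
qed

text \<open>Following the monomials \<open>x\<^sub>i\<^sup>k x\<^sub>j\<close> from variable to variable expresses later coordinates of a
symmetry as powers of the first, with strictly growing exponents; a repetition bounds the order.\<close>

lemma symmetry_torsion:
  assumes i: "i \<in> I"
  shows "\<exists>N>0. \<forall>g\<in>carrier (Gmax I W). g i ^ N = 1"
proof (rule ccontr)
  assume no: "\<not> ?thesis"
  let ?G = "carrier (Gmax I W)"
  have nz: "g j \<noteq> 0" if "g \<in> ?G" "j \<in> I" for g j using that by (auto simp: Gmax_def)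
  have tors: "e = 0" if "\<forall>g\<in>?G. g i powi e = 1" for e
  proof (rule ccontr)
    assume "e \<noteq> 0"
    have "g i ^ nat \<bar>e\<bar> = 1" if g: "g \<in> ?G" for g
    proof -
      have "g i powi e = 1" using \<open>\<forall>g\<in>?G. g i powi e = 1\<close> g by blast
      then show ?thesis by (cases "e \<ge> 0") (auto simp: power_int_def power_inverse)
    qed
    then show False using no \<open>e \<noteq> 0\<close> by (metis zero_less_nat_eq zero_less_abs_iff)
  qed
  \<comment> \<open>A pair \<open>(j, e)\<close> records that coordinate \<open>j\<close> of every
    symmetry is the power \<open>e\<close> of coordinate \<open>i\<close>. Exponents are integers
    because solving for the next coordinate inverts.\<close>
  define Q where "Q je \<longleftrightarrow> fst je \<in> I \<and> (\<forall>g\<in>?G. g (fst je) = g i powi snd je) \<and> snd je \<noteq> 0"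
    for je :: "nat \<times> int"
  have step: "\<exists>y. Q y \<and> \<bar>snd x\<bar> < \<bar>snd y\<bar>" if "Q x" for x
  proof -
    obtain j e where x: "x = (j, e)" "j \<in> I" "\<And>g. g \<in> ?G \<Longrightarrow> g j = g i powi e" "e \<noteq> 0"
      using \<open>Q x\<close> by (cases x) (auto simp: Q_def)
    obtain k where k: "k \<ge> 2" "(\<forall>g\<in>?G. g j ^ k = 1) \<or> (\<exists>l\<in>I. \<forall>g\<in>?G. g j ^ k * g l = 1)"
      using symmetry_step[OF x(2)] by blast
    have pk: "g j ^ k = g i powi (e * int k)" if "g \<in> ?G" for g
      using x(3)[OF that] by (simp add: power_int_mult)
    from k(2) show ?thesis
    proof
      assume "\<forall>g\<in>?G. g j ^ k = 1"
      then have "e * int k = 0" using pk tors by metis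
      then show ?thesis using x k by auto
    next
      assume "\<exists>l\<in>I. \<forall>g\<in>?G. g j ^ k * g l = 1"
      then obtain l where l: "l \<in> I" "\<And>g. g \<in> ?G \<Longrightarrow> g j ^ k * g l = 1" by blast
      have "g l = g i powi (- (e * int k))" if g: "g \<in> ?G" for g
      proof -
        have "g i powi (e * int k) * g l = 1" using l(2)[OF g] pk[OF g] by simp
        then show ?thesis using nz[OF g i] by (simp add: power_int_minus field_simps)
      qed
      moreover have "\<bar>e\<bar> < \<bar>- (e * int k)\<bar>"
        using k(1) x(4) by (simp add: abs_mult)
      ultimately show ?thesis using x l k(1) by (intro exI[of _ "(l, - (e * int k))"]) (auto simp: Q_def)
    qed
  qed
  have Q0: "Q (i, 1)" using i by (simp add: Q_def)
  obtain s where s: "\<And>n. Q (s n)" "\<And>n. \<bar>snd (s n)\<bar> < \<bar>snd (s (Suc n))\<bar>"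
  proof -
    have "\<exists>f. \<forall>n. Q (f n) \<and> \<bar>snd (f n)\<bar> < \<bar>snd (f (Suc n))\<bar>"
      using dependent_nat_choice[of "\<lambda>_. Q" "\<lambda>_ x y. \<bar>snd x\<bar> < \<bar>snd y\<bar>"] Q0 step by blast
    then show ?thesis using that by blast
  qed
  have mono: "strict_mono (\<lambda>n. \<bar>snd (s n)\<bar>)" using s(2) by (simp add: strict_mono_Suc_iff)
  have "\<not> inj (\<lambda>n. fst (s n))"
  proof
    assume "inj (\<lambda>n. fst (s n))"
    moreover have "range (\<lambda>n. fst (s n)) \<subseteq> I" using s(1) by (auto simp: Q_def)
    ultimately show False using finite_I by (meson finite_imageD finite_subset infinite_UNIV_nat)
  qed
  then obtain m n where mn: "m \<noteq> n" "fst (s m) = fst (s n)" by (auto simp: inj_def)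
  have "g i powi (snd (s m) - snd (s n)) = 1" if g: "g \<in> ?G" for g
  proof -
    have "g i powi snd (s m) = g i powi snd (s n)" using s(1)[of m] s(1)[of n] mn(2) g by (auto simp: Q_def)
    then show ?thesis using nz[OF g i] by (simp add: power_int_diff)
  qed
  then have "snd (s m) - snd (s n) = 0" by (intro tors) auto
  then have "\<bar>snd (s m)\<bar> = \<bar>snd (s n)\<bar>" by simp
  then show False using mono mn(1) by (metis strict_mono_eq)
qed

lemma finite_Gmax: "finite (carrier (Gmax I W))"
proof -
  obtain N where N: "\<And>i. i \<in> I \<Longrightarrow> N i > 0 \<and> (\<forall>g\<in>carrier (Gmax I W). g i ^ N i = 1)"
    using symmetry_torsion by metis
  define R where "R i = {z::complex. z ^ N i = 1}" for i
  have finR: "finite (R i)" if "i \<in> I" for i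
    using N[OF that] finite_roots_unity[of "N i"] by (simp add: R_def Suc_leI)
  have "carrier (Gmax I W) \<subseteq> (\<lambda>f i. if i \<in> I then f i else 1) ` (PiE I R)"
  proof
    fix g assume g: "g \<in> carrier (Gmax I W)"
    have "restrict g I \<in> PiE I R" using N g by (auto simp: R_def)
    moreover have "g = (\<lambda>i. if i \<in> I then restrict g I i else 1)" using g by (auto simp: Gmax_def)
    ultimately show "g \<in> (\<lambda>f i. if i \<in> I then f i else 1) ` (PiE I R)" by blast
  qed
  then show ?thesis
    by (rule finite_subset) (intro finite_imageI finite_PiE finite_I finR)
qed

text \<open>A second weight system on \<open>U\<close> could be glued to the weights of
  \<open>W\<close> outside \<open>U\<close>, since no monomial mixes the two sides; this would
  contradict uniqueness for \<open>W\<close>.\<close>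

lemma weights_restrict:
  assumes U: "U \<subseteq> I" "splits W U" and i: "i \<in> U"
  shows "weights U (restrict_vars U W) i = q i"
proof -
  let ?w = "\<lambda>i. if i \<in> U then q i else 0"
  have P: "restrict_vars U W \<in> polys U" by (rule restrict_vars_polys)
  have "homog_of ?w 2 (restrict_vars U W)"
    using homog_of_restrict[OF W_homog, of U] homog_of_cong[OF P, of ?w q] by simp
  then have 1: "is_weights U (restrict_vars U W) ?w"
    unfolding is_weights_iff[OF P] using U q_pos by auto
  have "r = ?w" if r: "is_weights U (restrict_vars U W) r" for r
  proof -
    have r': "\<forall>i\<in>U. 0 < r i" "\<forall>i. i \<notin> U \<longrightarrow> r i = 0" "homog_of r 2 (restrict_vars U W)"
      using r unfolding is_weights_iff[OF P] by auto
    let ?s = "\<lambda>i. if i \<in> U then r i else q i"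
    have "homog_of ?s 2 W"
      unfolding homog_of_def
    proof
      fix a assume a: "a \<in> supp W"
      then consider "supp a \<subseteq> U" | "supp a \<inter> U = {}" using U(2) unfolding splits_def by blast
      then show "mono_deg ?s a = 2"
      proof cases
        case 1
        then have "a \<in> supp (restrict_vars U W)" using a by (simp add: in_keys_iff coeff_restrict_vars)
        then have "mono_deg r a = 2" using r'(3) by (simp add: homog_of_def)
        then show ?thesis using mono_deg_cong[OF 1, of ?s r] by simp
      next
        case 2
        then have "supp a \<subseteq> - U" by blast
        then show ?thesis using mono_deg_cong[of a "- U" ?s q] mono_deg_W[OF a] by simp
      qed
    qed
    then have "is_weights I W ?s"
      unfolding is_weights_iff[OF W_polys] using r' U q_pos q_outside by auto
    then have s: "?s = q" by (rule weights_unique)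
    show ?thesis
    proof
      fix i show "r i = ?w i" using fun_cong[OF s, of i] r'(2) by auto
    qed
  qed
  then have "(THE r. is_weights U (restrict_vars U W) r) = ?w"
    using 1 by (intro the_equality)
  then have "weights U (restrict_vars U W) = ?w" by (simp add: weights_def[of U])
  then show ?thesis using i by simp
qed

end

text \<open>The form in which well-behavedness is used. The last property expresses that the group
  is a direct sum: all components of an element but one may be replaced by the identity.\<close>

lemma well_behaved_blocks:
  assumes "finite I" "well_behaved I W G"
  obtains P where "partition_on I P" "\<And>S. S \<in> P \<Longrightarrow> splits W S"
    "\<And>g S. g \<in> G \<Longrightarrow> S \<in> P \<Longrightarrow> S \<subseteq> fix_vars I g \<or> S \<inter> fix_vars I g = {}"
    "\<And>g S. g \<in> G \<Longrightarrow> S \<in> P \<Longrightarrow> (\<lambda>i. if i \<in> S then g i else 1) \<in> G"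
proof -
  from assms(2) obtain P w \<Gamma> where P: "partition_on I P"
    and adm: "\<And>S. S \<in> P \<Longrightarrow> admissible S (w S)"
    and sub: "\<And>S. S \<in> P \<Longrightarrow> subgroup (\<Gamma> S) (Gmax S (w S))"
    and fixall: "\<And>S g. S \<in> P \<Longrightarrow> g \<in> \<Gamma> S \<Longrightarrow> fix_vars S g = S \<or> fix_vars S g = {}"
    and W: "W = (\<Sum>S\<in>P. w S)"
    and G: "G = {\<lambda>i. \<Prod>S\<in>P. f S i | f. \<forall>S\<in>P. f S \<in> \<Gamma> S}"
    unfolding well_behaved_def by blast
  have finP: "finite P" using assms(1) P by (rule finite_elements)
  have disj: "S = T" if "S \<in> P" "T \<in> P" "i \<in> S" "i \<in> T" for S T i
    using that P by (auto simp: partition_on_def disjoint_def)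
  have SI: "S \<subseteq> I" if "S \<in> P" for S using that P by (auto simp: partition_on_def)
  have wS: "w S \<in> polys S" if "S \<in> P" for S using adm[OF that] by (simp add: admissible_def)
  have out: "g i = 1" if "S \<in> P" "g \<in> \<Gamma> S" "i \<notin> S" for S g i
    using subgroup.subset[OF sub[OF that(1)]] that by (auto simp: Gmax_def)
  \<comment> \<open>Components belonging to other blocks have entry 1 at \<open>i\<close>.\<close>
  have val: "(\<Prod>T\<in>P. f T i) = f S i" if f: "\<forall>S\<in>P. f S \<in> \<Gamma> S" and S: "S \<in> P" "i \<in> S" for f S i
  proof -
    have "f T i = (if T = S then f S i else 1)" if "T \<in> P" for T
      using that f S disj out by metis
    then have "(\<Prod>T\<in>P. f T i) = (\<Prod>T\<in>P. if T = S then f S i else 1)" by simp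
    then show ?thesis using finP S by simp
  qed
  show ?thesis
  proof (rule that[OF P])
    fix S assume S: "S \<in> P"
    show "splits W S"
      unfolding splits_def
    proof
      fix a assume "a \<in> supp W"
      then have "coeff W a \<noteq> 0" by (simp add: in_keys_iff)
      then obtain T where T: "T \<in> P" "coeff (w T) a \<noteq> 0"
        unfolding W lookup_sum by (meson sum.not_neutral_contains_not_neutral)
      then have "supp a \<subseteq> T" using wS polysD by blast
      then show "supp a \<subseteq> S \<or> supp a \<inter> S = {}" using disj[OF S T(1)] by blast
    qed
    fix g assume "g \<in> G"
    then obtain f where f: "g = (\<lambda>i. \<Prod>S\<in>P. f S i)" "\<forall>S\<in>P. f S \<in> \<Gamma> S" by (auto simp: G)
    have gS: "g i = f S i" if "i \<in> S" for i using val[OF f(2) S that] by (simp add: f(1))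
    then have "fix_vars S g = fix_vars S (f S)" by (auto simp: fix_vars_def)
    moreover have "fix_vars I g \<inter> S = fix_vars S g" using SI[OF S] by (auto simp: fix_vars_def)
    ultimately show "S \<subseteq> fix_vars I g \<or> S \<inter> fix_vars I g = {}"
      using fixall[OF S, of "f S"] f(2) S by auto
    define f' where "f' T = (if T = S then f S else diag_one)" for T
    have f': "\<forall>T\<in>P. f' T \<in> \<Gamma> T"
      using f(2) S subgroup.one_closed[OF sub] by (auto simp: f'_def Gmax_def)
    have "(\<Prod>T\<in>P. f' T i) = (if i \<in> S then g i else 1)" for i
    proof -
      have "(\<Prod>T\<in>P. f' T i) = (\<Prod>T\<in>P. if T = S then f S i else 1)"
        by (rule prod.cong) (auto simp: f'_def diag_one_def)
      also have "\<dots> = f S i" using finP S by simp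
      finally show ?thesis using gS out[OF S, of "f S" i] f(2) S by auto
    qed
    then show "(\<lambda>i. if i \<in> S then g i else 1) \<in> G"
      unfolding G using f' by (intro CollectI exI[of _ f']) auto
  qed
qed

section \<open>Sectors of the orbifolded model\<close>

text \<open>\<open>t_norm\<close> fixes the scale so that \<open>t\<close> is exactly the pairing
  with 1. Well-behavedness enters here only through \<open>G_splits\<close>; the finer block
  structure returns with the square roots.\<close>

locale orbifold = admissible_poly I W + socle I W "weights I W" t
  for I :: "nat set" and W :: mpoly and t :: "mpoly \<Rightarrow> complex" +
  fixes G :: "(nat \<Rightarrow> complex) set"
  assumes t_norm: "t (Hess I W) = of_nat (milnor_number I W)"
    and G_subgroup: "subgroup G (Gmax I W)"
    and G_SL: "g \<in> G \<Longrightarrow> diag_det I g = 1"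
    and G_splits: "g \<in> G \<Longrightarrow> splits W (fix_vars I g)"
begin

section \<open>Split sets of variables and congruence in sectors\<close>

definition good :: "nat set \<Rightarrow> bool" where "good X \<longleftrightarrow> X \<subseteq> I \<and> splits W X"

lemma good_Int [intro]: "good X \<Longrightarrow> good Y \<Longrightarrow> good (X \<inter> Y)"
  and good_Un [intro]: "good X \<Longrightarrow> good Y \<Longrightarrow> good (X \<union> Y)"
  and good_Diff [intro]: "good X \<Longrightarrow> good Y \<Longrightarrow> good (X - Y)"
  and good_empty [intro]: "good {}"
  and good_I [intro]: "good I"
  by (auto simp: good_def splits_Int splits_Un splits_Diff splits_empty splits_self W_polys)

lemma good_fix: "g \<in> G \<Longrightarrow> good (fix_vars I g)"
  using G_splits[of g] by (auto simp: good_def fix_vars_def)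

abbreviation WX :: "nat set \<Rightarrow> mpoly" where "WX X \<equiv> restrict_vars X W"
abbreviation JX :: "nat set \<Rightarrow> mpoly set" where "JX X \<equiv> jac X (WX X)"
abbreviation \<mu> :: "nat set \<Rightarrow> nat" where "\<mu> X \<equiv> milnor_number X (WX X)"

lemma WX_polys: "WX X \<in> polys X" by (rule restrict_vars_polys)

lemma WX_restrict: "Y \<subseteq> X \<Longrightarrow> restrict_vars Y (WX X) = WX Y"
  by (simp add: restrict_restrict inf_absorb1)

lemma WX_I: "WX I = W" by (rule restrict_vars_id[OF W_polys])

lemma socle_good: "good X \<Longrightarrow> socle X (WX X) q (\<lambda>p. t (Hess (I - X) W * p))"
  unfolding good_def by (intro restrict_socle) auto

lemma quasihomogeneous_good: "good X \<Longrightarrow> quasihomogeneous X (WX X) q"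
  by (rule socle.axioms(1)[OF socle_good])

lemma splits_good: "good Y \<Longrightarrow> splits (WX X) Y"
  by (auto simp: good_def splits_restrict)

text \<open>Equality of classes in the sector \<open>X\<close>. Membership in the ring is built in,
  so the relation is reflexive only on polynomials in \<open>X\<close>, and most side conditions
  need not be stated again.\<close>

definition eqv :: "nat set \<Rightarrow> mpoly \<Rightarrow> mpoly \<Rightarrow> bool" where
  "eqv X p r \<longleftrightarrow> p \<in> polys X \<and> r \<in> polys X \<and> p - r \<in> JX X"

lemma eqv_refl: "p \<in> polys X \<Longrightarrow> eqv X p p"
  by (simp add: eqv_def jac_zero WX_polys)
lemma eqv_sym: "eqv X p r \<Longrightarrow> eqv X r p"
  using jac_uminus[OF WX_polys, of "p - r"] by (auto simp: eqv_def)
lemma eqv_trans [trans]: "eqv X p r \<Longrightarrow> eqv X r s \<Longrightarrow> eqv X p s"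
  using jac_add[OF WX_polys, of "p - r" X "r - s"] by (auto simp: eqv_def)
lemma eqv_eq_trans1 [trans]: "p = r \<Longrightarrow> eqv X r s \<Longrightarrow> eqv X p s" by simp
lemma eqv_eq_trans2 [trans]: "eqv X p r \<Longrightarrow> r = s \<Longrightarrow> eqv X p s" by simp
lemma eqv_add: "eqv X p r \<Longrightarrow> eqv X p' r' \<Longrightarrow> eqv X (p + p') (r + r')"
  using jac_add[OF WX_polys, of "p - r" X "p' - r'"] by (auto simp: eqv_def algebra_simps)
lemma eqv_mult: "eqv X p r \<Longrightarrow> eqv X p' r' \<Longrightarrow> eqv X (p * p') (r * r')"
proof -
  assume *: "eqv X p r" "eqv X p' r'"
  then have "(p - r) * p' + r * (p' - r') \<in> JX X"
    by (intro jac_add WX_polys jac_mult jac_mult') (auto simp: eqv_def)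
  then show ?thesis using * by (auto simp: eqv_def algebra_simps)
qed
lemma eqv_mult_left: "q' \<in> polys X \<Longrightarrow> eqv X p r \<Longrightarrow> eqv X (q' * p) (q' * r)"
  by (intro eqv_mult eqv_refl)
lemma eqv_mult_right: "q' \<in> polys X \<Longrightarrow> eqv X p r \<Longrightarrow> eqv X (p * q') (r * q')"
  by (intro eqv_mult eqv_refl)
lemma eqv_smult: "eqv X p r \<Longrightarrow> eqv X (Const c * p) (Const c * r)"
  by (intro eqv_mult_left) auto
lemma eqv_sum: "(\<And>x. x \<in> A \<Longrightarrow> eqv X (f x) (h x)) \<Longrightarrow> eqv X (sum f A) (sum h A)"
  by (induction A rule: infinite_finite_induct) (auto intro: eqv_add eqv_refl)
lemma eqv_polys: "eqv X p r \<Longrightarrow> p \<in> polys X" "eqv X p r \<Longrightarrow> r \<in> polys X"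
  by (auto simp: eqv_def)
lemma eqv_zero_iff: "eqv X p 0 \<longleftrightarrow> p \<in> JX X"
  using jac_polys[OF WX_polys] by (auto simp: eqv_def)

lemma cls_eq_eqv: "p \<in> polys X \<Longrightarrow> r \<in> polys X \<Longrightarrow> cls X (WX X) p = cls X (WX X) r \<longleftrightarrow> eqv X p r"
  by (simp add: cls_eq_iff[OF WX_polys] eqv_def)

lemma mem_cls_eqv: "p \<in> polys X \<Longrightarrow> r \<in> cls X (WX X) p \<longleftrightarrow> eqv X r p"
  using cls_subset[OF WX_polys, of p X r] by (auto simp: mem_cls[OF WX_polys] eqv_def)

lemma eqv_mono:
  assumes "good X" "good Y" "X \<subseteq> Y" "eqv X p r" shows "eqv Y p r"
  using quasihomogeneous.jac_restrict_subset[OF quasihomogeneous_good[OF assms(2)] assms(3) splits_good[OF assms(1)]]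
    assms(4) polys_mono[OF assms(3)] unfolding eqv_def WX_restrict[OF assms(3)] by blast

lemma eqv_restrict:
  assumes "good X" "good Y" "X \<subseteq> Y" "eqv Y p r" shows "eqv X (restrict_vars X p) (restrict_vars X r)"
  using quasihomogeneous.restrict_jac[OF quasihomogeneous_good[OF assms(2)] assms(3) splits_good[OF assms(1)]]
    assms(4) unfolding eqv_def WX_restrict[OF assms(3)]
  by (auto simp: restrict_vars_polys simp flip: restrict_vars_diff)

lemma eqv_scale:
  assumes "good X" "scale_vars g W = W" "\<And>i. i \<in> I \<Longrightarrow> g i \<noteq> 0" "eqv X p r"
  shows "eqv X (scale_vars g p) (scale_vars g r)"
proof -
  have fX: "finite X" using assms(1) finite_I finite_subset by (auto simp: good_def)
  have s: "scale_vars g (WX X) = WX X" using assms(2) restrict_scale[of X g W] by simp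
  have "scale_vars g (p - r) \<in> JX X"
    using assms by (intro jac_scale[OF WX_polys fX s]) (auto simp: eqv_def good_def)
  then show ?thesis using assms(4) by (auto simp: eqv_def scale_vars_diff)
qed

lemma eqv_hcomp:
  assumes "good X" "eqv X p r" shows "eqv X (hcomp q d p) (hcomp q d r)"
proof -
  interpret X: quasihomogeneous X "WX X" q by (rule quasihomogeneous_good[OF assms(1)])
  have "hcomp q d (p - r) \<in> JX X"
    using assms(2) by (intro jac_hcomp[OF WX_polys X.finite_X X.F_homog]) (auto simp: eqv_def)
  then show ?thesis using assms(2) by (auto simp: eqv_def hcomp_diff)
qed

lemma \<mu>_pos: "good X \<Longrightarrow> \<mu> X > 0"
  by (rule socle.milnor_number_pos[OF socle_good])

lemma \<mu>_Un:
  assumes "good U" "good V" "U \<inter> V = {}" shows "\<mu> (U \<union> V) = \<mu> U * \<mu> V"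
proof -
  have "U \<union> V - U = V" using assms(3) by auto
  then show ?thesis
    using socle.milnor_number_split[OF socle_good[OF good_Un[OF assms(1,2)]] _ splits_good[OF assms(1)]]
    by (simp add: WX_restrict)
qed

lemma eps_Un:
  assumes "good U" "good V" "U \<inter> V = {}" shows "eps (U \<union> V) = eps U * eps V"
proof -
  have fin: "finite U" "finite V" using assms finite_I finite_subset by (auto simp: good_def)
  have H: "Hess (U \<union> V) W = Hess U W * Hess V W"
    using assms by (intro Hess_split fin) (auto simp: good_def)
  have "Const (1 / of_nat (\<mu> (U \<union> V))) = Const (1 / of_nat (\<mu> U)) * Const (1 / of_nat (\<mu> V))"
    using assms by (simp add: \<mu>_Un flip: Const_mult)
  then show ?thesis unfolding eps_def H by (simp add: mult_ac)
qed

lemma \<mu>_empty: "\<mu> {} = 1"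
  using \<mu>_Un[of "{}" I] \<mu>_pos[of I] by (auto simp: good_empty good_I)

lemma eps_empty [simp]: "eps {} = 1"
  by (simp add: eps_def \<mu>_empty)

lemma eps_polys_good: "good U \<Longrightarrow> U \<subseteq> X \<Longrightarrow> eps U \<in> polys X"
  using eps_polys[of U] polys_mono[of U X] by (auto simp: good_def)

lemma eps_homog: "homog_of q (hdeg q U) (eps U)"
  unfolding eps_def by (intro homog_of_Const_mult Hess_homog W_homog)

lemma eps_scale:
  assumes "U \<subseteq> I" "scale_vars g W = W" "\<And>i. i \<in> I \<Longrightarrow> g i \<noteq> 0"
  shows "scale_vars g (eps U) = Const (1 / diag_det U g ^ 2) * eps U"
  unfolding eps_def scale_vars_Const_mult
  using Hess_scale[of g W U] assms by (auto simp: mult_ac)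

text \<open>A variable of \<open>D\<close> pushes the Hessian of \<open>D\<close> beyond its top
  degree. So next to \<open>eps D\<close> polynomials may be restricted to the complement of
  \<open>D\<close>; the comparisons of sector products rest on this.\<close>

lemma eps_kill:
  assumes "good D" "good X" "D \<subseteq> X" "p \<in> polys X"
  shows "eqv X (eps D * p) (eps D * restrict_vars (X - D) p)"
  using assms(4)
proof (induction p rule: polys_induct)
  case zero
  then show ?case by (simp add: eqv_refl)
next
  case (mon a c)
  have eD: "eps D \<in> polys X" using assms by (intro eps_polys_good)
  show ?case
  proof (cases "supp a \<subseteq> X - D")
    case True
    then show ?thesis using mon eD by (auto simp: restrict_vars_mon intro!: eqv_refl)
  next
    case False
    interpret D: socle D "WX D" q "\<lambda>p. t (Hess (I - D) W * p)" by (rule socle_good[OF assms(1)])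
    define d b where "d = exp_restrict D a" and "b = exp_restrict (X - D) a"
    have db: "a = d + b" "supp d \<subseteq> D" "supp b \<subseteq> X"
    proof -
      have "supp a \<subseteq> D \<union> (X - D)" using mon by blast
      then show "a = d + b" unfolding d_def b_def by (intro exp_restrict_Un[symmetric]) auto
      show "supp d \<subseteq> D" "supp b \<subseteq> X" using mon by (auto simp: d_def b_def supp_exp_restrict)
    qed
    have "supp d \<noteq> {}" using False mon by (auto simp: d_def supp_exp_restrict)
    then have "d \<noteq> 0" by auto
    then have "Hess D W * mon d 1 \<in> JX D"
      using D.Hess_mult[of "mon d 1"] db assms(1)
      by (auto simp: lookup_single when_def Hess_restrict good_def)
    then have "eqv D (Hess D W * mon d 1) 0" by (simp add: eqv_zero_iff)
    then have "eqv X (Hess D W * mon d 1) 0" using assms eqv_mono by blast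
    then have "eqv X (Const (1 / of_nat (\<mu> D)) * (mon b c * (Hess D W * mon d 1))) (Const (1 / of_nat (\<mu> D)) * (mon b c * 0))"
      using db by (intro eqv_smult eqv_mult_left) auto
    moreover have "Const (1 / of_nat (\<mu> D)) * (mon b c * (Hess D W * mon d 1)) = eps D * mon a c"
      using mon_mult[of b c d 1] by (simp add: db(1) eps_def mult_ac add_ac)
    ultimately show ?thesis using False by (simp add: restrict_vars_mon)
  qed
next
  case (add p r)
  then show ?case by (simp add: restrict_vars_add distrib_left eqv_add)
qed

text \<open>Pairing with 1 in the sector \<open>X\<close>, computed in the untwisted sector by
  multiplying with the normalised Hessian of the missing variables.\<close>

definition T :: "nat set \<Rightarrow> mpoly \<Rightarrow> complex" where
  "T X p = t (eps (I - X) * p)"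

lemma T_eq: "good X \<Longrightarrow> p \<in> polys X \<Longrightarrow> T X p = t (Hess (I - X) W * p) / of_nat (\<mu> (I - X))"
proof -
  assume X: "good X" "p \<in> polys X"
  have "Hess (I - X) W \<in> polys (I - X)" using X(1) by (intro Hess_polys) (auto simp: good_def splits_complement)
  then have "Hess (I - X) W * p \<in> polys I"
    using X polys_mono[of "I - X" I] polys_mono[of X I] by (auto simp: good_def)
  then show ?thesis
    using t_smult[of "Hess (I - X) W * p" "1 / of_nat (\<mu> (I - X))"] by (simp add: T_def eps_def mult_ac)
qed

lemma T_I: "T I p = t p" by (simp add: T_def)

lemma T_add: "good X \<Longrightarrow> p \<in> polys X \<Longrightarrow> r \<in> polys X \<Longrightarrow> T X (p + r) = T X p + T X r"
  using socle.t_add[OF socle_good, of X p r] by (simp add: T_eq polys_add add_divide_distrib)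

lemma T_smult: "good X \<Longrightarrow> p \<in> polys X \<Longrightarrow> T X (Const c * p) = c * T X p"
  using socle.t_smult[OF socle_good, of X p c] by (simp add: T_eq polys_mult)

lemma T_zero: "good X \<Longrightarrow> T X 0 = 0"
  using T_smult[of X 0 0] by simp

lemma T_sum: "good X \<Longrightarrow> (\<And>x. x \<in> A \<Longrightarrow> f x \<in> polys X) \<Longrightarrow> T X (sum f A) = (\<Sum>x\<in>A. T X (f x))"
  by (induction A rule: infinite_finite_induct) (auto simp: T_zero T_add polys_sum)

lemma T_cong: "good X \<Longrightarrow> eqv X p r \<Longrightarrow> T X p = T X r"
  using socle.t_cong[OF socle_good, of X p r] by (auto simp: T_eq eqv_def)

lemma T_homog: "good X \<Longrightarrow> p \<in> polys X \<Longrightarrow> homog_of q d p \<Longrightarrow> d \<noteq> hdeg q X \<Longrightarrow> T X p = 0"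
  using socle.t_homog[OF socle_good, of X p d] by (simp add: T_eq)

lemma T_nondeg:
  assumes X: "good X" "p \<in> polys X" and z: "\<And>a. supp a \<subseteq> X \<Longrightarrow> T X (p * mon a 1) = 0"
  shows "eqv X p 0"
proof -
  have "\<mu> (I - X) > 0" using X by (intro \<mu>_pos) auto
  then have "t (Hess (I - X) W * (p * mon a 1)) = 0" if "supp a \<subseteq> X" for a
    using z[OF that] X that by (simp add: T_eq polys_mult polys_mon)
  then show ?thesis unfolding eqv_zero_iff by (intro socle.t_nondeg[OF socle_good] X)
qed

lemma T_eps:
  assumes "good A" "good D" "A \<inter> D = {}" "p \<in> polys A"
  shows "T (A \<union> D) (eps D * p) = T A p"
proof -
  have "I - A = (I - (A \<union> D)) \<union> D" using assms by (auto simp: good_def)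
  moreover have "eps ((I - (A \<union> D)) \<union> D) = eps (I - (A \<union> D)) * eps D"
    using assms by (intro eps_Un) auto
  ultimately show ?thesis by (simp add: T_def mult_ac)
qed

text \<open>The normalised Hessians of \<open>X\<close> and of its complement multiply to that of
  \<open>I\<close>, on which \<open>t\<close> is 1 by \<open>t_norm\<close>.\<close>

lemma T_eps_self: "good X \<Longrightarrow> T X (eps X) = 1"
proof -
  assume X: "good X"
  have "eps (I - X) * eps X = eps I"
    using eps_Un[of "I - X" X] X by (auto simp: good_def Un_absorb2 intro!: arg_cong[of _ _ eps] split: )
      (metis Diff_disjoint Int_commute Un_Diff_cancel2 Un_absorb2 good_Diff good_I good_def X eps_Un)
  then have "T X (eps X) = t (eps I)" by (simp add: T_def)
  also have "\<dots> = 1"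
    using t_norm t_smult[of "Hess I W" "1 / of_nat (\<mu> I)"] milnor_number_pos H_polys
    by (simp add: eps_def WX_I)
  finally show ?thesis .
qed

lemma top_degree_eqv:
  assumes X: "good X" "p \<in> polys X" "homog_of q (hdeg q X) p"
  shows "eqv X p (Const (T X p) * eps X)"
proof -
  interpret X: socle X "WX X" q "\<lambda>p. t (Hess (I - X) W * p)" by (rule socle_good[OF X(1)])
  have HX: "Hess X (WX X) = Hess X W" using X by (intro Hess_restrict) (auto simp: good_def)
  let ?k = "t (Hess (I - X) W * p) / t (Hess (I - X) W * Hess X (WX X))"
  have e: "eqv X p (Const ?k * Hess X W)"
    unfolding eqv_def using X.top_degree_jac[OF X(2,3)] X.H_polys X(2) by (auto simp: HX)
  have nz: "of_nat (\<mu> X) \<noteq> (0::complex)" using \<mu>_pos[OF X(1)] by simp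
  have "Const ?k * Hess X W = Const (?k * of_nat (\<mu> X)) * eps X"
    unfolding eps_def using nz by (simp add: Const_mult flip: mult.assoc) (simp add: mult.assoc flip: Const_mult)
  then have e: "eqv X p (Const (?k * of_nat (\<mu> X)) * eps X)" using e by simp
  have "T X p = ?k * of_nat (\<mu> X) * T X (eps X)"
    using T_cong[OF X(1) e] X(1) by (simp add: T_smult eps_polys_good)
  then show ?thesis using e T_eps_self[OF X(1)] by simp
qed

lemma high_degree_eqv:
  "good X \<Longrightarrow> p \<in> polys X \<Longrightarrow> homog_of q d p \<Longrightarrow> d > hdeg q X \<Longrightarrow> eqv X p 0"
  unfolding eqv_zero_iff by (rule socle.high_degree_jac[OF socle_good])

text \<open>The Milnor number of \<open>X\<close> in the definition of the pairing and that of the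
  complement in \<open>T\<close> multiply to the Milnor number of \<open>W\<close>, which is the
  value of \<open>t\<close> on the full Hessian.\<close>

lemma pairing_T:
  assumes X: "good X" "p \<in> polys X" "r \<in> polys X"
  shows "milnor_pairing X (WX X) (cls X (WX X) p) (cls X (WX X) r) = T X (p * r)"
proof -
  interpret X: socle X "WX X" q "\<lambda>p. t (Hess (I - X) W * p)" by (rule socle_good[OF X(1)])
  have w: "weights X (WX X) i = q i" if "i \<in> X" for i
    using weights_restrict that X(1) by (auto simp: good_def)
  have X': "X \<subseteq> I" "splits W X" using X by (auto simp: good_def)
  have HH: "Hess (I - X) W * Hess X (WX X) = Hess I W"
    using Hess_complement[OF X'] by (simp add: Hess_restrict[OF X'(2)] mult.commute)
  have "milnor_number I W = \<mu> X * \<mu> (I - X)" using milnor_number_split[OF X'] .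
  moreover have "\<mu> X > 0" "\<mu> (I - X) > 0" using X by (auto intro!: \<mu>_pos)
  ultimately show ?thesis
    using X.milnor_pairing_eq[OF w X(2,3)] X by (simp add: HH t_norm T_eq polys_mult)
qed

text \<open>From here on the choice inside \<open>gamma_factor\<close> enters only through this
  congruence.\<close>

lemma gamma_eqv:
  assumes "good A" "good X" "A \<subseteq> X"
  shows "eqv X (gamma_factor W A X) (eps (X - A))"
proof -
  interpret X: socle X "WX X" q "\<lambda>p. t (Hess (I - X) W * p)" by (rule socle_good[OF assms(2)])
  have "gamma_factor W A X = gamma_factor (WX X) A X"
    unfolding gamma_factor_def using assms(3) by (simp add: restrict_restrict inf_absorb1)
  moreover have "X.eps (X - A) = eps (X - A)"
  proof -
    have g: "good (X - A)" using assms by auto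
    have r: "restrict_vars (X - A) (WX X) = WX (X - A)" by (intro WX_restrict) auto
    have "Hess (X - A) (WX X) = Hess (X - A) W"
      using Hess_restrict[OF splits_good[OF g], of X] Hess_restrict[of W "X - A"] g r
      by (simp add: good_def)
    then show ?thesis unfolding X.eps_def eps_def r by simp
  qed
  ultimately show ?thesis
    using X.gamma_factor_cong[OF assms(3) splits_good[OF assms(1)]] assms
    by (auto simp: eqv_def intro!: eps_polys_good)
qed

subsection \<open>The product of two sectors\<close>

abbreviation K :: "(nat \<Rightarrow> complex) \<Rightarrow> nat set" where "K g \<equiv> fix_vars I g"
abbreviation dm (infixl \<open>\<cdot>\<close> 70) where "g \<cdot> h \<equiv> diag_mult g h"

section \<open>The symmetry group\<close>

lemma G_carrier: "g \<in> G \<Longrightarrow> g \<in> carrier (Gmax I W)"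
  using subgroup.subset[OF G_subgroup] by blast

lemma G_scale: "g \<in> G \<Longrightarrow> scale_vars g W = W"
  and G_nz: "g \<in> G \<Longrightarrow> i \<in> I \<Longrightarrow> g i \<noteq> 0"
  and G_out: "g \<in> G \<Longrightarrow> i \<notin> I \<Longrightarrow> g i = 1"
  using G_carrier by (auto simp: Gmax_def)

lemma G_nz': "g \<in> G \<Longrightarrow> g i \<noteq> 0"
  using G_nz[of g i] G_out[of g i] by (cases "i \<in> I") auto

lemma finite_G: "finite G"
  using finite_Gmax G_carrier by (meson finite_subset subsetI)

lemma G_mult: "g \<in> G \<Longrightarrow> h \<in> G \<Longrightarrow> g \<cdot> h \<in> G"
  using subgroup.m_closed[OF G_subgroup] by (simp add: Gmax_def)

lemma G_one: "diag_one \<in> G"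
  using subgroup.one_closed[OF G_subgroup] by (simp add: Gmax_def)

lemma dm_commute: "g \<cdot> h = h \<cdot> g" by (auto simp: diag_mult_def mult.commute)
lemma dm_assoc: "g \<cdot> h \<cdot> k = g \<cdot> (h \<cdot> k)" by (auto simp: diag_mult_def mult.assoc)
lemma dm_one [simp]: "diag_one \<cdot> g = g" "g \<cdot> diag_one = g" by (auto simp: diag_mult_def diag_one_def)
lemma dm_inv: "g \<in> G \<Longrightarrow> diag_inv g \<cdot> g = diag_one" "g \<in> G \<Longrightarrow> g \<cdot> diag_inv g = diag_one"
  using G_nz' by (auto simp: diag_mult_def diag_one_def diag_inv_def)
lemma dm_inv_cancel [simp]: "g \<in> G \<Longrightarrow> diag_inv g \<cdot> (g \<cdot> h) = h" "g \<in> G \<Longrightarrow> g \<cdot> (diag_inv g \<cdot> h) = h"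
  by (simp_all add: dm_inv flip: dm_assoc)
lemma diag_inv_mult: "diag_inv (g \<cdot> h) = diag_inv g \<cdot> diag_inv h"
  by (auto simp: diag_mult_def diag_inv_def)
lemma diag_inv_inv [simp]: "diag_inv (diag_inv g) = g"
  by (auto simp: diag_inv_def)

lemma G_finite_order: "g \<in> G \<Longrightarrow> \<exists>n>0. (\<lambda>i. g i ^ n) = diag_one"
proof -
  assume g: "g \<in> G"
  have pow: "(\<lambda>i. g i ^ n) \<in> G" for n
  proof (induction n)
    case 0
    then show ?case using G_one by (simp add: diag_one_def)
  next
    case (Suc n)
    then show ?case using G_mult[OF g Suc] by (simp add: diag_mult_def)
  qed
  have "\<not> inj (\<lambda>n i. g i ^ n)"
    using finite_G pow by (metis (mono_tags, lifting) finite_imageD finite_subset image_subsetI infinite_UNIV_nat)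
  then obtain m n where "m \<noteq> n" "(\<lambda>i. g i ^ m) = (\<lambda>i. g i ^ n)" unfolding inj_def by blast
  then obtain m n where mn: "m < n" "(\<lambda>i. g i ^ m) = (\<lambda>i. g i ^ n)" by (metis linorder_neqE_nat)
  have "g i ^ (n - m) = 1" for i
  proof -
    have "g i ^ (m + (n - m)) = g i ^ m" using mn(1) fun_cong[OF mn(2), of i] by simp
    then have "g i ^ m * g i ^ (n - m) = g i ^ m" by (simp only: power_add)
    then show ?thesis using G_nz'[OF g, of i] by simp
  qed
  then show ?thesis using mn(1) by (intro exI[of _ "n - m"]) (auto simp: diag_one_def)
qed

text \<open>By finite order the inverse is a power, so closure under products is enough.\<close>

lemma G_inv: "g \<in> G \<Longrightarrow> diag_inv g \<in> G"
proof -
  assume g: "g \<in> G"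
  have pow: "(\<lambda>i. g i ^ n) \<in> G" for n
  proof (induction n)
    case 0
    then show ?case using G_one by (simp add: diag_one_def)
  next
    case (Suc n)
    then show ?case using G_mult[OF g Suc] by (simp add: diag_mult_def)
  qed
  obtain n where n: "n > 0" "\<And>i. g i ^ n = 1"
    using G_finite_order[OF g] by (auto simp: diag_one_def fun_eq_iff)
  have "g i ^ (n - 1) * g i = 1" for i using n by (simp flip: power_Suc2)
  then have "diag_inv g = (\<lambda>i. g i ^ (n - 1))"
    using G_nz'[OF g] by (auto simp: diag_inv_def field_simps)
  then show ?thesis using pow by simp
qed

lemma K_inv [simp]: "K (diag_inv g) = K g"
  by (auto simp: fix_vars_def diag_inv_def)

lemma K_one [simp]: "K diag_one = I"
  by (auto simp: fix_vars_def diag_one_def)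

lemma K_subset: "K g \<subseteq> I" by (auto simp: fix_vars_def)

section \<open>The product on representatives\<close>

definition compat :: "(nat \<Rightarrow> complex) \<Rightarrow> (nat \<Rightarrow> complex) \<Rightarrow> bool" where
  "compat g h \<longleftrightarrow> K g \<union> K h \<union> K (g \<cdot> h) = I"

text \<open>At these variables the entries of \<open>g\<close> and \<open>h\<close> are inverse to
  each other and different from 1. As the part of \<open>fix(g + h)\<close> outside
  \<open>fix(g) \<inter> fix(h)\<close>, it is the set whose normalised Hessian is the factor in the
  product.\<close>

definition antifix :: "(nat \<Rightarrow> complex) \<Rightarrow> (nat \<Rightarrow> complex) \<Rightarrow> nat set" where
  "antifix g h = K (g \<cdot> h) - (K g \<inter> K h)"

text \<open>The sector product with \<open>gamma_factor\<close> replaced by the congruent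
  \<open>eps\<close>, which makes it bilinear and symmetric on the level of polynomials.\<close>

definition sm :: "(nat \<Rightarrow> complex) \<Rightarrow> (nat \<Rightarrow> complex) \<Rightarrow> mpoly \<Rightarrow> mpoly \<Rightarrow> mpoly" where
  "sm g h p r = (if compat g h then eps (antifix g h) * restrict_vars (K (g \<cdot> h)) (p * r) else 0)"

lemma compat_commute: "compat g h \<longleftrightarrow> compat h g"
  unfolding compat_def dm_commute[of g h] by auto

lemma antifix_commute: "antifix g h = antifix h g"
  unfolding antifix_def dm_commute[of g h] by auto

lemma sm_commute: "sm g h p r = sm h g r p"
  unfolding sm_def antifix_commute[of g h] compat_commute[of g h] dm_commute[of g h] mult.commute[of p r] ..

lemma good_antifix: "g \<in> G \<Longrightarrow> h \<in> G \<Longrightarrow> good (antifix g h)"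
  unfolding antifix_def by (intro good_Diff good_Int good_fix G_mult)

lemma sm_polys: "g \<in> G \<Longrightarrow> h \<in> G \<Longrightarrow> sm g h p r \<in> polys (K (g \<cdot> h))"
  unfolding sm_def using good_antifix
  by (auto intro!: polys_mult eps_polys_good restrict_vars_polys simp: antifix_def)

lemma sm_add_left: "sm g h (p + p') r = sm g h p r + sm g h p' r"
  by (simp add: sm_def distrib_right restrict_vars_add distrib_left)
lemma sm_add_right: "sm g h p (r + r') = sm g h p r + sm g h p r'"
  by (simp add: sm_def distrib_left restrict_vars_add)
lemma sm_zero [simp]: "sm g h 0 r = 0" "sm g h p 0 = 0"
  by (simp_all add: sm_def)
lemma sm_sum_left: "sm g h (sum f A) r = (\<Sum>x\<in>A. sm g h (f x) r)"
  by (induction A rule: infinite_finite_induct) (auto simp: sm_add_left)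
lemma sm_sum_right: "sm g h p (sum f A) = (\<Sum>x\<in>A. sm g h p (f x))"
  by (induction A rule: infinite_finite_induct) (auto simp: sm_add_right)
lemma sm_Const_left: "sm g h (Const c * p) r = Const c * sm g h p r"
  by (simp add: sm_def restrict_vars_mult mult_ac)

lemma eqv_restrict_general:
  assumes "good X" "good Y" "eqv X p r" shows "eqv Y (restrict_vars Y p) (restrict_vars Y r)"
proof -
  have "eqv (Y \<inter> X) (restrict_vars (Y \<inter> X) p) (restrict_vars (Y \<inter> X) r)"
    using assms by (intro eqv_restrict[of _ X]) auto
  then have "eqv Y (restrict_vars (Y \<inter> X) p) (restrict_vars (Y \<inter> X) r)"
    using assms by (intro eqv_mono[of "Y \<inter> X" Y]) auto
  then show ?thesis using restrict_vars_inter assms(3) by (metis eqv_polys)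
qed

lemma sm_cong:
  assumes g: "g \<in> G" "h \<in> G" and e: "eqv (K g) p p'" "eqv (K h) r r'"
  shows "eqv (K (g \<cdot> h)) (sm g h p r) (sm g h p' r')"
proof (cases "compat g h")
  case True
  have "eqv (K (g \<cdot> h)) (eps (antifix g h) * (restrict_vars (K (g \<cdot> h)) p * restrict_vars (K (g \<cdot> h)) r))
      (eps (antifix g h) * (restrict_vars (K (g \<cdot> h)) p' * restrict_vars (K (g \<cdot> h)) r'))"
    using g e good_antifix[OF g]
    by (intro eqv_mult eqv_refl eps_polys_good eqv_restrict_general[of "K g"] eqv_restrict_general[of "K h"])
      (auto intro!: good_fix G_mult simp: antifix_def)
  then show ?thesis using True by (simp add: sm_def restrict_vars_mult)
qed (simp add: sm_def eqv_refl)

text \<open>A Hessian with nonzero constant term has degree 0, and since weights are at most 1/2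
  they must all equal 1/2. Then the entries of symmetries are signs, and two entries different from
  1 are both -1, with product 1.\<close>

lemma eps_coeff_zero:
  assumes U: "U \<subseteq> I" and i: "i \<in> U" and g: "g \<in> G" and h: "h \<in> G"
    and gh: "g i \<noteq> 1" "h i \<noteq> 1" "g i * h i \<noteq> 1"
  shows "coeff (eps U) 0 = 0"
proof (rule ccontr)
  assume "coeff (eps U) 0 \<noteq> 0"
  then have "0 \<in> supp (eps U)" by (simp add: in_keys_iff)
  then have "hdeg q U = 0" using eps_homog[of U] by (auto simp: homog_of_def)
  moreover have "finite U" using U finite_I finite_subset by blast
  moreover have "2 - 4 * q j \<ge> 0" if "j \<in> U" for j using weight_le_half[of j] that U by auto
  ultimately have "2 - 4 * q i = 0" using i unfolding hdeg_def by (simp add: sum_nonneg_eq_0_iff)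
  then have "q i = 1/2" by simp
  then have "g i ^ 2 = 1" "h i ^ 2 = 1" using symmetry_half G_scale g h i U by blast+
  then have "g i = -1" "h i = -1" using gh by (auto simp: power2_eq_1_iff)
  then show False using gh by simp
qed

lemma K_iff: "i \<in> K g \<longleftrightarrow> i \<in> I \<and> g i = 1" by (simp add: fix_vars_def)

definition K3 where "K3 g h m = K g \<inter> K h \<inter> K m"

text \<open>Only the scalar factor is not visibly symmetric under rebracketing.\<close>

lemma sm_triple:
  assumes g: "g \<in> G" "h \<in> G" "m \<in> G" and p: "p \<in> polys (K g)" "r \<in> polys (K h)" "s \<in> polys (K m)"
    and c: "compat g h" "compat (g \<cdot> h) m"
  defines "E \<equiv> K (g \<cdot> h \<cdot> m)"
  shows "eqv E (sm (g \<cdot> h) m (sm g h p r) s)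
    (Const (coeff (eps (antifix g h - E)) 0) * (eps (E - K3 g h m) * restrict_vars (K3 g h m) (p * r * s)))"
proof -
  let ?L = "K (g \<cdot> h)" and ?Z = "K3 g h m"
  let ?A = "antifix (g \<cdot> h) m" and ?B = "antifix g h"
  note gG = good_fix[OF g(1)] good_fix[OF g(2)] good_fix[OF g(3)]
  have gE: "good E" unfolding E_def using g by (intro good_fix G_mult)
  have gL: "good ?L" using g by (intro good_fix G_mult)
  have gZ: "good ?Z" unfolding K3_def using gG by (intro good_Int)
  have gA: "good ?A" and gB: "good ?B" using g by (auto intro: good_antifix G_mult)
  \<comment> \<open>The variables of \<open>E\<close> outside the triple intersection come either
    from the second multiplication or from the part of the first that the full product still
    fixes.\<close>
  have \<Delta>: "?A \<union> (?B \<inter> E) = E - ?Z" "?A \<inter> (?B \<inter> E) = {}"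
    unfolding E_def antifix_def K3_def by (auto simp: K_iff diag_mult_def)
  \<comment> \<open>Variables of the first factor that the full product moves are set to 0, so their
    Hessian contributes its constant term only. This is the scalar in the statement.\<close>
  have epsB: "restrict_vars E (eps ?B) = Const (coeff (eps (?B - E)) 0) * eps (?B \<inter> E)"
  proof -
    have "eps ?B = eps (?B - E) * eps (?B \<inter> E)"
      using eps_Un[of "?B - E" "?B \<inter> E"] gB gE by (auto simp: Un_Diff_Int good_Diff good_Int)
    moreover have "restrict_vars E (eps (?B \<inter> E)) = eps (?B \<inter> E)"
      using gB gE by (intro restrict_vars_id eps_polys_good) auto
    moreover have "restrict_vars E (eps (?B - E)) = Const (coeff (eps (?B - E)) 0)"
    proof -
      have "eps (?B - E) \<in> polys (?B - E)" using gB gE by (intro eps_polys_good) auto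
      then have "restrict_vars E (eps (?B - E)) = restrict_vars {} (eps (?B - E))"
        using restrict_vars_inter[of _ "?B - E" E] by (simp add: Int_Diff_disjoint inf_commute Int_Diff)
      then show ?thesis by (simp add: restrict_vars_empty)
    qed
    ultimately show ?thesis by (simp add: restrict_vars_mult)
  qed
  let ?c = "Const (coeff (eps (?B - E)) 0)"
  let ?x = "restrict_vars (E \<inter> ?L) p * restrict_vars (E \<inter> ?L) r * restrict_vars E s"
  have "sm (g \<cdot> h) m (sm g h p r) s = eps ?A * (restrict_vars E (eps ?B) * ?x)"
    unfolding sm_def E_def using c by (simp add: restrict_vars_mult restrict_restrict mult_ac)
  also have "\<dots> = ?c * ((eps ?A * eps (?B \<inter> E)) * ?x)"
    unfolding epsB by (simp add: mult_ac)
  also have "eps ?A * eps (?B \<inter> E) = eps (E - ?Z)"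
    using eps_Un[OF gA good_Int[OF gB gE] \<Delta>(2)] unfolding \<Delta>(1) ..
  also have "eqv E (?c * (eps (E - ?Z) * ?x)) (?c * (eps (E - ?Z) * restrict_vars (E - (E - ?Z)) ?x))"
    using gE gZ by (intro eqv_smult eps_kill polys_mult restrict_vars_polys' restrict_vars_polys) auto
  also have "E - (E - ?Z) = ?Z" unfolding E_def K3_def by (auto simp: K_iff diag_mult_def)
  also have "restrict_vars ?Z ?x = restrict_vars ?Z (p * r * s)"
  proof -
    have "?Z \<inter> (E \<inter> ?L) = ?Z" "?Z \<inter> E = ?Z" unfolding E_def K3_def by (auto simp: K_iff diag_mult_def)
    then show ?thesis by (simp add: restrict_vars_mult restrict_restrict)
  qed
  finally show ?thesis .
qed

lemma sm_triple_zero: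
  assumes "\<not> (compat g h \<and> compat (g \<cdot> h) m)" shows "sm (g \<cdot> h) m (sm g h p r) s = 0"
  using assms by (auto simp: sm_def)

lemma compat_iff: "compat g h \<longleftrightarrow> (\<forall>i\<in>I. g i = 1 \<or> h i = 1 \<or> g i * h i = 1)"
  unfolding compat_def by (auto simp: fix_vars_def diag_mult_def)

text \<open>If only one bracketing is compatible, some variable has inverse entries in
  \<open>g\<close> and \<open>h\<close>, while \<open>h\<close>, \<open>m\<close> and their product
  all move it. It lies in the set whose constant term is taken, and \<open>eps_coeff_zero\<close>
  applies to \<open>h\<close> and \<open>m\<close>.\<close>

lemma triple_asymmetric_zero:
  assumes g: "g \<in> G" "h \<in> G" "m \<in> G" and c: "compat g h" "compat (g \<cdot> h) m"
    and nc: "\<not> (compat m h \<and> compat (m \<cdot> h) g)"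
  shows "coeff (eps (antifix g h - K (g \<cdot> h \<cdot> m))) 0 = 0"
proof -
  obtain i where i: "i \<in> I"
    and bad: "\<not> (m i = 1 \<or> h i = 1 \<or> m i * h i = 1) \<or>
      \<not> (m i * h i = 1 \<or> g i = 1 \<or> m i * h i * g i = 1)"
    using nc unfolding compat_iff by (auto simp: diag_mult_def)
  have c1: "g i = 1 \<or> h i = 1 \<or> g i * h i = 1" and c2: "g i * h i = 1 \<or> m i = 1 \<or> g i * h i * m i = 1"
    using c i unfolding compat_iff by (auto simp: diag_mult_def)
  have *: "g i * h i = 1 \<and> h i \<noteq> 1 \<and> m i \<noteq> 1 \<and> h i * m i \<noteq> 1"
    using bad c1 c2 by (auto simp: mult_ac)
  then have "i \<in> antifix g h - K (g \<cdot> h \<cdot> m)"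
    using i by (auto simp: antifix_def K_iff diag_mult_def)
  then show ?thesis
    using * g by (intro eps_coeff_zero[of _ i h m]) (auto simp: antifix_def K_iff)
qed

text \<open>By commutativity the other bracketing is the first one with \<open>g\<close> and
  \<open>m\<close> exchanged, and by \<open>sm_triple\<close> both are multiples of one symmetric
  expression. If both are compatible the scalars agree; if only one is, its scalar is 0.\<close>

lemma sm_assoc:
  assumes g: "g \<in> G" "h \<in> G" "m \<in> G" and p: "p \<in> polys (K g)" "r \<in> polys (K h)" "s \<in> polys (K m)"
  shows "eqv (K (g \<cdot> h \<cdot> m)) (sm (g \<cdot> h) m (sm g h p r) s) (sm g (h \<cdot> m) p (sm h m r s))"
proof -
  have R: "sm g (h \<cdot> m) p (sm h m r s) = sm (m \<cdot> h) g (sm m h s r) p"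
    by (metis sm_commute dm_commute)
  have E: "m \<cdot> h \<cdot> g = g \<cdot> h \<cdot> m" by (auto simp: diag_mult_def)
  have Z: "K3 m h g = K3 g h m" by (auto simp: K3_def)
  let ?E = "K (g \<cdot> h \<cdot> m)"
  let ?l = "compat g h \<and> compat (g \<cdot> h) m" and ?r = "compat m h \<and> compat (m \<cdot> h) g"
  let ?cl = "coeff (eps (antifix g h - ?E)) 0" and ?cr = "coeff (eps (antifix m h - ?E)) 0"
  let ?y = "eps (?E - K3 g h m) * restrict_vars (K3 g h m) (p * r * s)"
  have L: "eqv ?E (sm (g \<cdot> h) m (sm g h p r) s) (Const ?cl * ?y)" if ?l
    using sm_triple[OF g p] that by blast
  have R': "eqv ?E (sm (m \<cdot> h) g (sm m h s r) p) (Const ?cr * ?y)" if ?r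
    using sm_triple[OF g(3,2,1) p(3,2,1)] that unfolding E Z by (simp add: mult_ac)
  show ?thesis
  proof (cases ?l)
    case l: True
    show ?thesis
    proof (cases ?r)
      case r: True
      have "antifix g h - ?E = antifix m h - ?E"
        using l r unfolding compat_iff antifix_def by (auto simp: K_iff diag_mult_def mult_ac)
      then show ?thesis unfolding R using L[OF l] R'[OF r] by (metis eqv_trans eqv_sym)
    next
      case False
      then have "?cl = 0" using triple_asymmetric_zero[OF g] l by blast
      then show ?thesis unfolding R using L[OF l] sm_triple_zero[OF False] by simp
    qed
  next
    case nl: False
    show ?thesis
    proof (cases ?r)
      case r: True
      then have "?cr = 0" using triple_asymmetric_zero[OF g(3,2,1)] nl unfolding E by blast
      then show ?thesis unfolding R using R'[OF r] sm_triple_zero[OF nl] by (simp add: eqv_sym)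
    next
      case False
      then show ?thesis unfolding R using sm_triple_zero[OF nl] sm_triple_zero[OF False] by (simp add: eqv_refl)
    qed
  qed
qed

text \<open>The three-point value depends only on the common fixed variables: \<open>eps\<close> of
  the antifix set removes its variables from the argument and is then absorbed by
  \<open>T\<close>.\<close>

lemma sm_pairing:
  assumes g: "g \<in> G" "h \<in> G" and p: "p \<in> polys (K g)" "r \<in> polys (K h)" "s \<in> polys (K (g \<cdot> h))"
  shows "T (K (g \<cdot> h)) (sm g h p r * s) =
    (if compat g h then T (K g \<inter> K h) (restrict_vars (K g \<inter> K h) (p * r * s)) else 0)"
proof (cases "compat g h")
  case True
  let ?K = "K (g \<cdot> h)" and ?D = "antifix g h" and ?Z = "K g \<inter> K h"
  have gK: "good ?K" and gD: "good ?D" and gZ: "good ?Z"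
    using g by (auto intro!: good_fix G_mult good_antifix good_Int)
  have KD: "?K = ?Z \<union> ?D" "?Z \<inter> ?D = {}" "?K - ?D = ?Z"
    unfolding antifix_def by (auto simp: K_iff diag_mult_def)
  have "sm g h p r * s = eps ?D * restrict_vars ?K (p * r * s)"
    using True p(3) by (simp add: sm_def restrict_vars_mult restrict_vars_id mult_ac)
  also have "eqv ?K (eps ?D * restrict_vars ?K (p * r * s))
      (eps ?D * restrict_vars (?K - ?D) (restrict_vars ?K (p * r * s)))"
    using gK gD KD by (intro eps_kill restrict_vars_polys) auto
  also have "restrict_vars (?K - ?D) (restrict_vars ?K (p * r * s)) = restrict_vars ?Z (p * r * s)"
    using KD by (simp add: restrict_restrict)
  finally have "T ?K (sm g h p r * s) = T ?K (eps ?D * restrict_vars ?Z (p * r * s))"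
    by (rule T_cong[OF gK])
  also have "\<dots> = T ?Z (restrict_vars ?Z (p * r * s))"
    unfolding KD(1) using gZ gD KD by (intro T_eps restrict_vars_polys) auto
  finally show ?thesis using True by simp
next
  case False
  then show ?thesis using g by (simp add: sm_def T_zero good_fix G_mult)
qed

text \<open>For \<open>m\<close> inverse to the product, the pairs \<open>(g, h)\<close> and
  \<open>(h, m)\<close> have the same common fixed set and the same compatibility condition, so both
  sides are the same three-point value.\<close>

lemma sm_Frobenius:
  assumes g: "g \<in> G" "h \<in> G" and m: "m = diag_inv (g \<cdot> h)"
    and p: "p \<in> polys (K g)" "r \<in> polys (K h)" "s \<in> polys (K m)"
  shows "T (K (g \<cdot> h)) (sm g h p r * s) = T (K g) (p * sm h m r s)"
proof -
  have mG: "m \<in> G" unfolding m using g by (intro G_inv G_mult)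
  have hm: "h \<cdot> m = diag_inv g"
    unfolding m using G_nz'[OF g(2)] by (auto simp: diag_mult_def diag_inv_def)
  have Km: "K m = K (g \<cdot> h)" unfolding m by (rule K_inv)
  have Khm: "K (h \<cdot> m) = K g" unfolding hm by (rule K_inv)
  have Z: "K h \<inter> K m = K g \<inter> K h" unfolding Km by (auto simp: K_iff diag_mult_def)
  have c: "compat h m \<longleftrightarrow> compat g h" unfolding compat_def Khm Km by auto
  have rot: "r * s * p = p * r * s" by (simp add: mult_ac)
  have "T (K (h \<cdot> m)) (sm h m r s * p) =
    (if compat h m then T (K h \<inter> K m) (restrict_vars (K h \<inter> K m) (r * s * p)) else 0)"
    using p by (intro sm_pairing g mG) (simp_all add: Khm)
  then have "T (K g) (p * sm h m r s) =
    (if compat g h then T (K g \<inter> K h) (restrict_vars (K g \<inter> K h) (p * r * s)) else 0)"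
    unfolding Khm Z c rot mult.commute[of "sm h m r s" p] .
  then show ?thesis using sm_pairing[OF g p(1,2), of s] p(3) unfolding Km by simp
qed

end

section \<open>The orbifolded model is a graded Frobenius algebra\<close>

lemma cring_complex_ring: "cring complex_ring"
proof (rule cringI)
  show "abelian_group complex_ring"
  proof (rule abelian_groupI)
    fix x assume "x \<in> carrier complex_ring"
    show "\<exists>y\<in>carrier complex_ring. y \<oplus>\<^bsub>complex_ring\<^esub> x = \<zero>\<^bsub>complex_ring\<^esub>"
      by (intro bexI[of _ "-x"]) (auto simp: complex_ring_def)
  qed (auto simp: complex_ring_def)
  show "comm_monoid complex_ring"
    by (rule comm_monoidI) (auto simp: complex_ring_def)
qed (auto simp: complex_ring_def distrib_right)

lemma complex_ring_simps [simp]: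
  "carrier complex_ring = UNIV" "mult complex_ring = (*)" "one complex_ring = 1"
  "zero complex_ring = 0" "add complex_ring = (+)"
  by (simp_all add: complex_ring_def)

lemma diag_det_Un: "finite U \<Longrightarrow> finite V \<Longrightarrow> U \<inter> V = {} \<Longrightarrow> diag_det (U \<union> V) f = diag_det U f * diag_det V f"
  by (simp add: diag_det_def prod.union_disjoint)

lemma hcomp_scale_vars: "hcomp q d (scale_vars g p) = scale_vars g (hcomp q d p)"
  by (rule poly_eqI) (simp add: coeff_hcomp coeff_scale_vars)

context orbifold
begin

section \<open>Symmetries acting on sectors, and invariant elements\<close>

lemma T_hcomp: assumes X: "good X" "p \<in> polys X" shows "T X (hcomp q (hdeg q X) p) = T X p"
proof -
  define A where "A = insert (hdeg q X) (mono_deg q ` supp p)"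
  have fin: "finite A" by (simp add: A_def)
  have "T X p = T X (\<Sum>d\<in>A. hcomp q d p)"
    using sum_hcomp[OF fin, of q p] by (simp add: A_def subset_insertI)
  also have "\<dots> = (\<Sum>d\<in>A. T X (hcomp q d p))" using X by (intro T_sum hcomp_polys)
  also have "\<dots> = (\<Sum>d\<in>A. if d = hdeg q X then T X (hcomp q (hdeg q X) p) else 0)"
    using X T_homog[OF X(1) hcomp_polys[OF X(2)] homog_of_hcomp] by (intro sum.cong) auto
  finally show ?thesis using fin by (simp add: A_def)
qed

text \<open>Only the top-degree component counts; it is a multiple of the Hessian, which scales by
  the inverse square of the determinant.\<close>

lemma T_scale:
  assumes X: "good X" "p \<in> polys X" and f: "f \<in> G"
  shows "T X (scale_vars f p) = T X p / diag_det X f ^ 2"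
proof -
  let ?h = "hcomp q (hdeg q X) p"
  have XI: "X \<subseteq> I" using X by (simp add: good_def)
  have "T X (scale_vars f p) = T X (scale_vars f ?h)"
    using T_hcomp[OF X(1), of "scale_vars f p"] X by (simp add: hcomp_scale_vars scale_vars_polys)
  also have "\<dots> = T X (scale_vars f (Const (T X ?h) * eps X))"
    using X G_scale[OF f] G_nz[OF f]
    by (intro T_cong eqv_scale top_degree_eqv homog_of_hcomp hcomp_polys)
  also have "scale_vars f (Const (T X ?h) * eps X) = Const (T X ?h / diag_det X f ^ 2) * eps X"
    using eps_scale[OF XI G_scale[OF f] G_nz[OF f]]
    by (simp add: scale_vars_Const_mult) (simp flip: mult.assoc Const_mult)
  also have "T X (Const (T X ?h / diag_det X f ^ 2) * eps X) = T X p / diag_det X f ^ 2"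
    using X T_eps_self[OF X(1)] by (simp add: T_smult eps_polys_good T_hcomp)
  finally show ?thesis .
qed

lemma diag_det_nz: "f \<in> G \<Longrightarrow> diag_det X f \<noteq> 0"
  using G_nz' by (cases "finite X") (auto simp: diag_det_def)

definition inva :: "(nat \<Rightarrow> complex) \<Rightarrow> mpoly \<Rightarrow> bool" where
  "inva g p \<longleftrightarrow> p \<in> polys (K g) \<and>
     (\<forall>f\<in>G. eqv (K g) (Const (diag_det (K g) f) * scale_vars f p) p)"

lemma inva_polys: "inva g p \<Longrightarrow> p \<in> polys (K g)" by (simp add: inva_def)

lemma inva_add: "inva g p \<Longrightarrow> inva g r \<Longrightarrow> inva g (p + r)"
  by (auto simp: inva_def scale_vars_add distrib_left intro: eqv_add)

lemma inva_smult: "inva g p \<Longrightarrow> inva g (Const c * p)"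
  unfolding inva_def
proof (intro conjI ballI)
  assume *: "p \<in> polys (K g) \<and> (\<forall>f\<in>G. eqv (K g) (Const (diag_det (K g) f) * scale_vars f p) p)"
  then show "Const c * p \<in> polys (K g)" by auto
  fix f assume "f \<in> G"
  then have "eqv (K g) (Const c * (Const (diag_det (K g) f) * scale_vars f p)) (Const c * p)"
    using * by (intro eqv_smult) auto
  then show "eqv (K g) (Const (diag_det (K g) f) * scale_vars f (Const c * p)) (Const c * p)"
    unfolding scale_vars_Const_mult by (subst mult.left_commute)
qed

lemma inva_uminus: "inva g p \<Longrightarrow> inva g (- p)"
  using inva_smult[of g p "-1"] by (simp add: Const_uminus)

lemma inva_zero: "inva g 0"
  using restrict_vars_empty[of 0] by (auto simp: inva_def eqv_refl scale_vars_def subst_poly_mval)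

lemma inva_sum: "(\<And>x. x \<in> A \<Longrightarrow> inva g (f x)) \<Longrightarrow> inva g (sum f A)"
  by (induction A rule: infinite_finite_induct) (auto simp: inva_zero inva_add)

lemma inva_one: "inva diag_one 1"
  using G_SL by (auto simp: inva_def intro!: eqv_refl)

lemma inva_hcomp: "g \<in> G \<Longrightarrow> inva g p \<Longrightarrow> inva g (hcomp q d p)"
  unfolding inva_def
proof (intro conjI ballI)
  assume *: "g \<in> G" "p \<in> polys (K g) \<and> (\<forall>f\<in>G. eqv (K g) (Const (diag_det (K g) f) * scale_vars f p) p)"
  then show "hcomp q d p \<in> polys (K g)" by auto
  fix f assume "f \<in> G"
  then have "eqv (K g) (hcomp q d (Const (diag_det (K g) f) * scale_vars f p)) (hcomp q d p)"
    using * by (intro eqv_hcomp good_fix) auto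
  then show "eqv (K g) (Const (diag_det (K g) f) * scale_vars f (hcomp q d p)) (hcomp q d p)"
    unfolding hcomp_Const_mult hcomp_scale_vars .
qed

lemma inva_mon:
  assumes "supp a \<subseteq> K g" "\<And>f. f \<in> G \<Longrightarrow> diag_det (K g) f * mval f a = 1"
  shows "inva g (mon a 1)"
  using assms by (auto simp: inva_def scale_vars_mon Const_mon intro!: eqv_refl)

text \<open>A determinant count. The twist on the product sector, together with the inverse square
  coming from \<open>eps\<close>, equals the product of the twists of the factors exactly because
  the full determinant is 1.\<close>

lemma inva_sm:
  assumes g: "g \<in> G" "h \<in> G" and i: "inva g p" "inva h r"
  shows "inva (g \<cdot> h) (sm g h p r)"
  unfolding inva_def
proof (intro conjI ballI sm_polys g)
  fix f assume f: "f \<in> G"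
  let ?K = "K (g \<cdot> h)" and ?D = "antifix g h"
  let ?d = "\<lambda>X. diag_det X f"
  show "eqv ?K (Const (?d ?K) * scale_vars f (sm g h p r)) (sm g h p r)"
  proof (cases "compat g h")
    case True
    \<comment> \<open>For a compatible pair these four sets partition \<open>I\<close>: fixed by
      both, by \<open>g\<close> only, by \<open>h\<close> only, and moved by both.\<close>
    let ?A = "K g \<inter> K h" and ?B = "K g - K h" and ?C = "K h - K g"
    have fin: "finite ?A" "finite ?B" "finite ?C" "finite ?D"
      using finite_subset[OF K_subset finite_I] by (auto simp: antifix_def)
    have sets: "?K = ?A \<union> ?D" "K g = ?A \<union> ?B" "K h = ?A \<union> ?C" "I = (?A \<union> ?B) \<union> (?C \<union> ?D)"
      using True unfolding compat_iff antifix_def by (auto simp: K_iff diag_mult_def)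
    have disj: "?A \<inter> ?D = {}" "?A \<inter> ?B = {}" "?A \<inter> ?C = {}" "?C \<inter> ?D = {}" "(?A \<union> ?B) \<inter> (?C \<union> ?D) = {}"
      unfolding antifix_def by (auto simp: K_iff diag_mult_def)
    have dets: "?d ?K = ?d ?A * ?d ?D" "?d (K g) = ?d ?A * ?d ?B" "?d (K h) = ?d ?A * ?d ?C"
      "?d I = ?d ?A * ?d ?B * (?d ?C * ?d ?D)"
    proof -
      show "?d ?K = ?d ?A * ?d ?D"
        by (rule trans[OF arg_cong[OF sets(1), of ?d] diag_det_Un]) (intro fin disj)+
      show "?d (K g) = ?d ?A * ?d ?B"
        by (rule trans[OF arg_cong[OF sets(2), of ?d] diag_det_Un]) (intro fin disj)+
      show "?d (K h) = ?d ?A * ?d ?C"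
        by (rule trans[OF arg_cong[OF sets(3), of ?d] diag_det_Un]) (intro fin disj)+
      have "?d I = ?d (?A \<union> ?B) * ?d (?C \<union> ?D)"
        by (rule trans[OF arg_cong[OF sets(4), of ?d] diag_det_Un]) (intro fin disj finite_UnI)+
      also have "\<dots> = (?d ?A * ?d ?B) * (?d ?C * ?d ?D)"
        by (intro arg_cong2[where f = "(*)"] diag_det_Un fin disj)
      finally show "?d I = ?d ?A * ?d ?B * (?d ?C * ?d ?D)" .
    qed
    have nz: "?d ?A \<noteq> 0" "?d ?B \<noteq> 0" "?d ?C \<noteq> 0" "?d ?D \<noteq> 0" using diag_det_nz[OF f] by auto
    have one: "?d ?A * ?d ?B * (?d ?C * ?d ?D) = 1" using G_SL[OF f] dets(4) by simp
    have scal: "?d ?K * (1 / ?d ?D ^ 2) = ?d (K g) * ?d (K h)"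
    proof -
      have "?d ?K * (1 / ?d ?D ^ 2) = ?d ?A / ?d ?D"
        using nz by (simp add: dets power2_eq_square)
      also have "\<dots> = (?d ?A / ?d ?D) * (?d ?A * ?d ?B * (?d ?C * ?d ?D))" by (simp only: one mult_1_right)
      also have "\<dots> = ?d (K g) * ?d (K h)" using nz by (simp add: dets mult_ac)
      finally show ?thesis .
    qed
    have DI: "?D \<subseteq> I" using K_subset by (auto simp: antifix_def)
    have "Const (?d ?K) * scale_vars f (sm g h p r) =
        Const (?d ?K) * (Const (1 / ?d ?D ^ 2) * eps ?D) * restrict_vars ?K (scale_vars f (p * r))"
    proof -
      have "scale_vars f (sm g h p r) = (Const (1 / ?d ?D ^ 2) * eps ?D) * restrict_vars ?K (scale_vars f (p * r))"
        using True unfolding sm_def restrict_scale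
        by (simp only: if_True scale_vars_mult[of f "eps ?D"] eps_scale[OF DI G_scale[OF f] G_nz[OF f]])
      then show ?thesis by (simp only: mult.assoc)
    qed
    also have "\<dots> = Const (?d ?K * (1 / ?d ?D ^ 2)) * (eps ?D * restrict_vars ?K (scale_vars f (p * r)))"
      by (simp only: Const_mult mult_ac)
    also have "\<dots> = sm g h (Const (?d (K g)) * scale_vars f p) (Const (?d (K h)) * scale_vars f r)"
      unfolding scal using True
      by (simp add: sm_def restrict_vars_mult scale_vars_mult Const_mult mult_ac)
    also have "eqv ?K \<dots> (sm g h p r)"
      using i f by (intro sm_cong g) (auto simp: inva_def)
    finally show ?thesis .
  next
    case False
    then show ?thesis using inva_zero[of "g \<cdot> h"] f by (simp add: sm_def inva_def)
  qed
qed

section \<open>Families of representatives and the algebra structure\<close>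

definition fam :: "((nat \<Rightarrow> complex) \<Rightarrow> mpoly) \<Rightarrow> bool" where
  "fam p \<longleftrightarrow> (\<forall>g\<in>G. inva g (p g))"

text \<open>Elements of the direct sum are handled through families of representatives, so that
  every algebra law reduces to a congruence in each sector.\<close>

definition mk :: "((nat \<Rightarrow> complex) \<Rightarrow> mpoly) \<Rightarrow> (nat \<Rightarrow> complex) \<Rightarrow> mpoly set" where
  "mk p = (\<lambda>g\<in>G. cls (K g) (WX (K g)) (p g))"

text \<open>Convolution over the group, indexed by the first factor since the second is then
  determined.\<close>

definition star :: "((nat \<Rightarrow> complex) \<Rightarrow> mpoly) \<Rightarrow> ((nat \<Rightarrow> complex) \<Rightarrow> mpoly) \<Rightarrow> (nat \<Rightarrow> complex) \<Rightarrow> mpoly" where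
  "star p r k = (\<Sum>g\<in>G. sm g (diag_inv g \<cdot> k) (p g) (r (diag_inv g \<cdot> k)))"

definition delta :: "(nat \<Rightarrow> complex) \<Rightarrow> mpoly \<Rightarrow> (nat \<Rightarrow> complex) \<Rightarrow> mpoly" where
  "delta h p = (\<lambda>g. if g = h then p else 0)"

definition shift :: "(nat \<Rightarrow> complex) \<Rightarrow> rat" where
  "shift g = (\<Sum>i\<in>I - K g. 1 - 2 * q i)"

abbreviation B where "B \<equiv> bmodel I W G"

lemma fam_polys: "fam p \<Longrightarrow> g \<in> G \<Longrightarrow> p g \<in> polys (K g)"
  by (auto simp: fam_def inva_def)

lemma mk_eq_iff:
  assumes "fam p" "fam r" shows "mk p = mk r \<longleftrightarrow> (\<forall>g\<in>G. eqv (K g) (p g) (r g))"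
proof -
  have "mk p = mk r \<longleftrightarrow> (\<forall>g\<in>G. cls (K g) (WX (K g)) (p g) = cls (K g) (WX (K g)) (r g))"
  proof
    assume e: "mk p = mk r"
    show "\<forall>g\<in>G. cls (K g) (WX (K g)) (p g) = cls (K g) (WX (K g)) (r g)"
    proof
      fix g assume "g \<in> G"
      then show "cls (K g) (WX (K g)) (p g) = cls (K g) (WX (K g)) (r g)"
        using fun_cong[OF e, of g] unfolding mk_def by (simp only: restrict_apply')
    qed
  next
    assume "\<forall>g\<in>G. cls (K g) (WX (K g)) (p g) = cls (K g) (WX (K g)) (r g)"
    then show "mk p = mk r" unfolding mk_def by (intro restrict_ext) (simp only:)
  qed
  then show ?thesis using assms by (simp add: cls_eq_eqv fam_polys)
qed

lemma fam_add: "fam p \<Longrightarrow> fam r \<Longrightarrow> fam (\<lambda>g. p g + r g)"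
  and fam_zero: "fam (\<lambda>g. 0)"
  and fam_smult: "fam p \<Longrightarrow> fam (\<lambda>g. Const c * p g)"
  and fam_uminus: "fam p \<Longrightarrow> fam (\<lambda>g. - p g)"
  by (auto simp: fam_def inva_add inva_zero inva_smult inva_uminus)

lemma fam_sum: "(\<And>x. x \<in> A \<Longrightarrow> fam (f x)) \<Longrightarrow> fam (\<lambda>g. \<Sum>x\<in>A. f x g)"
  by (auto simp: fam_def intro: inva_sum)

lemma fam_star: "fam p \<Longrightarrow> fam r \<Longrightarrow> fam (star p r)"
  unfolding fam_def star_def
proof (intro ballI inva_sum)
  fix k g assume *: "\<forall>g\<in>G. inva g (p g)" "\<forall>g\<in>G. inva g (r g)" "k \<in> G" "g \<in> G"
  have "inva (g \<cdot> (diag_inv g \<cdot> k)) (sm g (diag_inv g \<cdot> k) (p g) (r (diag_inv g \<cdot> k)))"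
    using * by (intro inva_sm) (auto intro: G_mult G_inv)
  then show "inva k (sm g (diag_inv g \<cdot> k) (p g) (r (diag_inv g \<cdot> k)))" using * by simp
qed

lemma fam_delta: "inva h p \<Longrightarrow> fam (delta h p)"
  by (auto simp: fam_def delta_def inva_zero)

lemma invariants_iff:
  assumes "g \<in> G" "p \<in> polys (K g)"
  shows "cls (K g) (WX (K g)) p \<in> invariants (K g) (WX (K g)) G \<longleftrightarrow> inva g p"
proof -
  have fX: "finite (K g)" using K_subset finite_I finite_subset by blast
  have "act (K g) (WX (K g)) f (cls (K g) (WX (K g)) p) =
      cls (K g) (WX (K g)) (Const (diag_det (K g) f) * scale_vars f p)" if f: "f \<in> G" for f
  proof (rule act_cls[OF WX_polys assms(2)])
    have "scale_vars f (WX (K g)) = WX (K g)"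
      using G_scale[OF f] by (simp flip: restrict_scale)
    then show "scale_vars f j \<in> JX (K g)" if "j \<in> JX (K g)" for j
      using G_nz'[OF f] that by (intro jac_scale[OF WX_polys fX]) auto
  qed
  then show ?thesis
    unfolding invariants_def inva_def using assms
    by (auto simp: carrier_milnor[OF WX_polys] cls_eq_eqv scale_vars_polys polys_mult)
qed

lemma carrier_B: "carrier B = mk ` Collect fam"
proof (intro equalityI subsetI)
  fix x assume x: "x \<in> carrier B"
  then have xg: "x g \<in> invariants (K g) (WX (K g)) G" if "g \<in> G" for g
    using that by (auto simp: bmodel_def restr_fix_def)
  then have "\<exists>p. p \<in> polys (K g) \<and> x g = cls (K g) (WX (K g)) p" if "g \<in> G" for g
  proof -
    have "x g \<in> cls (K g) (WX (K g)) ` polys (K g)"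
      using xg[OF that] by (simp add: invariants_def carrier_milnor[OF WX_polys])
    then show ?thesis by blast
  qed
  then obtain p where p: "\<And>g. g \<in> G \<Longrightarrow> p g \<in> polys (K g) \<and> x g = cls (K g) (WX (K g)) (p g)"
    by metis
  have "x = mk p"
  proof
    fix g show "x g = mk p g"
    proof (cases "g \<in> G")
      case True
      then show ?thesis using p[OF True] unfolding mk_def by (simp only: restrict_apply')
    next
      case False
      have "x \<in> extensional G" using x by (simp add: bmodel_def PiE_def)
      then have "x g = undefined" using False by (rule extensional_arb)
      then show ?thesis using False unfolding mk_def restrict_def by (simp only: if_False)
    qed
  qed
  moreover have "fam p"
    unfolding fam_def
  proof
    fix g assume g: "g \<in> G"
    then show "inva g (p g)" using xg[OF g] p[OF g] invariants_iff[OF g, of "p g"] by simp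
  qed
  ultimately show "x \<in> mk ` Collect fam" by auto
next
  fix x assume "x \<in> mk ` Collect fam"
  then obtain p where p: "x = mk p" "fam p" by auto
  have "cls (K g) (WX (K g)) (p g) \<in> invariants (K g) (WX (K g)) G" if "g \<in> G" for g
    using invariants_iff[OF that, of "p g"] p(2) that by (simp add: fam_def inva_polys)
  then show "x \<in> carrier B"
    by (simp add: p(1) mk_def bmodel_def restr_fix_def)
qed

lemma add_B: "fam p \<Longrightarrow> fam r \<Longrightarrow> mk p \<oplus>\<^bsub>B\<^esub> mk r = mk (\<lambda>g. p g + r g)"
  by (auto simp: mk_def bmodel_def sector_def restr_fix_def milnor_add WX_polys fam_polys intro!: restrict_ext)

lemma zero_B: "\<zero>\<^bsub>B\<^esub> = mk (\<lambda>g. 0)"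
  unfolding mk_def by (auto simp: bmodel_def sector_def restr_fix_def milnor_zero WX_polys)

lemma smult_B: "fam p \<Longrightarrow> c \<odot>\<^bsub>B\<^esub> mk p = mk (\<lambda>g. Const c * p g)"
  by (auto simp: mk_def bmodel_def sector_def restr_fix_def milnor_smult WX_polys fam_polys intro!: restrict_ext)

lemma sector_elem_mk: "p \<in> polys (K h) \<Longrightarrow> sector_elem I W G (cls (K h) (WX (K h)) p) h = mk (delta h p)"
  unfolding sector_elem_def mk_def delta_def
  by (intro restrict_ext) (auto simp: sector_def restr_fix_def milnor_zero WX_polys)

lemma one_B: "\<one>\<^bsub>B\<^esub> = mk (delta diag_one 1)"
  using sector_elem_mk[of 1 diag_one] by (simp add: bmodel_def sector_def restr_fix_def milnor_one WX_polys)

lemma pairing_B: "fam p \<Longrightarrow> fam r \<Longrightarrow> pairing B (mk p) (mk r) = (\<Sum>g\<in>G. T (K g) (p g * r (diag_inv g)))"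
proof -
  assume p: "fam p" "fam r"
  have "pairing (sector I W g) (mk p g) (mk r (diag_inv g)) = T (K g) (p g * r (diag_inv g))" if "g \<in> G" for g
    using pairing_T[OF good_fix[OF that], of "p g" "r (diag_inv g)"] fam_polys[OF p(1) that]
      fam_polys[OF p(2) G_inv[OF that]] that G_inv[OF that]
    by (simp add: mk_def sector_def milnor_def restr_fix_def)
  then show ?thesis by (simp add: bmodel_def)
qed

text \<open>The union over representatives collapses to one class, because \<open>sm\<close>
  respects congruence and the chosen factor is congruent to \<open>eps\<close>.\<close>

lemma sector_mult_cls:
  assumes g: "g \<in> G" "h \<in> G" and p: "p \<in> polys (K g)" "r \<in> polys (K h)"
  shows "sector_mult I W g h (cls (K g) (WX (K g)) p) (cls (K h) (WX (K h)) r) =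
    cls (K (g \<cdot> h)) (WX (K (g \<cdot> h))) (sm g h p r)"
proof (cases "compat g h")
  case False
  then show ?thesis
    by (simp add: sector_mult_def compat_def sm_def Let_def sector_def restr_fix_def milnor_zero WX_polys)
next
  case True
  let ?K = "K (g \<cdot> h)" and ?\<gamma> = "gamma_factor W (K g \<inter> K h) (K (g \<cdot> h))"
  have gK: "good ?K" using g by (intro good_fix G_mult)
  have "K g \<inter> K h \<subseteq> ?K" by (auto simp: K_iff diag_mult_def)
  then have \<gamma>: "eqv ?K ?\<gamma> (eps (antifix g h))"
    unfolding antifix_def using gK g by (intro gamma_eqv) (auto intro: good_fix)
  have "cls ?K (WX ?K) (?\<gamma> * restrict_vars ?K (m * m')) = cls ?K (WX ?K) (sm g h p r)"
    if "m \<in> cls (K g) (WX (K g)) p" "m' \<in> cls (K h) (WX (K h)) r" for m m'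
  proof -
    have m: "eqv (K g) m p" "eqv (K h) m' r" using that p by (auto simp: mem_cls_eqv)
    have "eqv ?K (?\<gamma> * restrict_vars ?K (m * m')) (eps (antifix g h) * restrict_vars ?K (m * m'))"
      by (intro eqv_mult_right \<gamma> restrict_vars_polys)
    also have "eps (antifix g h) * restrict_vars ?K (m * m') = sm g h m m'" using True by (simp add: sm_def)
    also have "eqv ?K (sm g h m m') (sm g h p r)" by (intro sm_cong g m)
    finally show ?thesis by (subst cls_eq_eqv) (auto dest: eqv_polys)
  qed
  moreover have "p \<in> cls (K g) (WX (K g)) p" "r \<in> cls (K h) (WX (K h)) r"
    using p by (auto intro: cls_self[OF WX_polys])
  ultimately show ?thesis
    using True by (force simp: sector_mult_def compat_def Let_def restr_fix_def)
qed

lemma mult_B: "fam p \<Longrightarrow> fam r \<Longrightarrow> mk p \<otimes>\<^bsub>B\<^esub> mk r = mk (star p r)"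
proof -
  assume p: "fam p" "fam r"
  have "(\<Oplus>\<^bsub>sector I W k\<^esub>x \<in> {x \<in> G \<times> G. diag_mult (fst x) (snd x) = k}.
          sector_mult I W (fst x) (snd x) (mk p (fst x)) (mk r (snd x))) = cls (K k) (WX (K k)) (star p r k)"
    if k: "k \<in> G" for k
  proof -
    let ?S = "{x \<in> G \<times> G. diag_mult (fst x) (snd x) = k}"
    interpret ab: abelian_group "sector I W k"
      unfolding sector_def restr_fix_def by (rule abelian_group_milnor[OF WX_polys])
    have fin: "finite ?S" using finite_G by simp
    have smP: "sm (fst x) (snd x) (p (fst x)) (r (snd x)) \<in> polys (K k)" if "x \<in> ?S" for x
      using that sm_polys[of "fst x" "snd x"] by auto
    have "(\<Oplus>\<^bsub>sector I W k\<^esub>x \<in> ?S. sector_mult I W (fst x) (snd x) (mk p (fst x)) (mk r (snd x))) =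
        (\<Oplus>\<^bsub>sector I W k\<^esub>x \<in> ?S. cls (K k) (WX (K k)) (sm (fst x) (snd x) (p (fst x)) (r (snd x))))"
    proof (rule ab.finsum_cong'[OF refl])
      show "(\<lambda>x. cls (K k) (WX (K k)) (sm (fst x) (snd x) (p (fst x)) (r (snd x)))) \<in> ?S \<rightarrow> carrier (sector I W k)"
        using smP by (auto simp: sector_def restr_fix_def carrier_milnor[OF WX_polys])
      show "sector_mult I W (fst x) (snd x) (mk p (fst x)) (mk r (snd x)) =
          cls (K k) (WX (K k)) (sm (fst x) (snd x) (p (fst x)) (r (snd x)))" if "x \<in> ?S" for x
        using that sector_mult_cls[of "fst x" "snd x" "p (fst x)" "r (snd x)"] fam_polys[OF p(1)] fam_polys[OF p(2)]
        by (auto simp: mk_def)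
    qed
    also have "\<dots> = cls (K k) (WX (K k)) (\<Sum>x\<in>?S. sm (fst x) (snd x) (p (fst x)) (r (snd x)))"
      unfolding sector_def restr_fix_def by (rule finsum_milnor[OF WX_polys fin smP])
    also have "(\<Sum>x\<in>?S. sm (fst x) (snd x) (p (fst x)) (r (snd x))) = star p r k"
      unfolding star_def
      by (rule sum.reindex_bij_witness[where i = "\<lambda>g. (g, diag_inv g \<cdot> k)" and j = fst])
        (use k G_inv G_mult in auto)
    finally show ?thesis .
  qed
  then show ?thesis
    unfolding mk_def[of "star p r"] by (auto simp: bmodel_def intro!: restrict_ext)
qed

lemma star_commute: "k \<in> G \<Longrightarrow> star p r k = star r p k"
  unfolding star_def
proof (rule sum.reindex_bij_witness[where i = "\<lambda>g. diag_inv g \<cdot> k" and j = "\<lambda>g. diag_inv g \<cdot> k"])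
  fix g assume *: "k \<in> G" "g \<in> G"
  have e: "diag_inv (diag_inv g \<cdot> k) \<cdot> k = g"
    using dm_inv_cancel(1)[OF *(1), of g] by (simp add: diag_inv_mult dm_assoc dm_commute[of g])
  show "diag_inv (diag_inv g \<cdot> k) \<cdot> k = g" "diag_inv (diag_inv g \<cdot> k) \<cdot> k = g" by (fact e)+
  show "diag_inv g \<cdot> k \<in> G" "diag_inv g \<cdot> k \<in> G" using * by (auto intro: G_mult G_inv)
  show "sm (diag_inv g \<cdot> k) (diag_inv (diag_inv g \<cdot> k) \<cdot> k) (r (diag_inv g \<cdot> k)) (p (diag_inv (diag_inv g \<cdot> k) \<cdot> k)) =
      sm g (diag_inv g \<cdot> k) (p g) (r (diag_inv g \<cdot> k))"
    unfolding e by (rule sm_commute)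
qed

lemma star_add: "star (\<lambda>g. p g + p' g) r k = star p r k + star p' r k"
  by (simp add: star_def sm_add_left sum.distrib)

lemma star_smult: "star (\<lambda>g. Const c * p g) r k = Const c * star p r k"
  by (simp add: star_def sm_Const_left sum_distrib_left)

lemma star_one: assumes "fam p" "k \<in> G" shows "star (delta diag_one 1) p k = p k"
proof -
  have K: "K diag_one = I" by simp
  have "antifix diag_one k = {}" using K_subset[of k] by (auto simp: antifix_def)
  moreover have "compat diag_one k" using K_subset by (auto simp: compat_def)
  ultimately have "sm diag_one k 1 (p k) = p k"
    using fam_polys[OF assms] by (simp add: sm_def restrict_vars_id)
  moreover have "diag_inv diag_one = diag_one" by (auto simp: diag_inv_def diag_one_def)
  moreover have "star (delta diag_one 1) p k =
      (\<Sum>g\<in>G. if g = diag_one then sm diag_one (diag_inv diag_one \<cdot> k) 1 (p (diag_inv diag_one \<cdot> k)) else 0)"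
    unfolding star_def delta_def by (intro sum.cong) auto
  ultimately show ?thesis using G_one finite_G by simp
qed

lemma star_assoc:
  assumes p: "fam p" "fam r" "fam s" and k: "k \<in> G"
  shows "eqv (K k) (star (star p r) s k) (star p (star r s) k)"
proof -
  let ?i = diag_inv
  have "star (star p r) s k =
      (\<Sum>l\<in>G. \<Sum>g\<in>G. sm l (?i l \<cdot> k) (sm g (?i g \<cdot> l) (p g) (r (?i g \<cdot> l))) (s (?i l \<cdot> k)))"
    by (simp add: star_def sm_sum_left)
  also have "\<dots> = (\<Sum>g\<in>G. \<Sum>l\<in>G. sm l (?i l \<cdot> k) (sm g (?i g \<cdot> l) (p g) (r (?i g \<cdot> l))) (s (?i l \<cdot> k)))"
    by (rule sum.swap)
  \<comment> \<open>Indexing by the first two factors turns each summand into a triple product to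
    which \<open>sm_assoc\<close> applies.\<close>
  also have "\<dots> = (\<Sum>g\<in>G. \<Sum>h\<in>G. sm (g \<cdot> h) (?i (g \<cdot> h) \<cdot> k) (sm g h (p g) (r h)) (s (?i (g \<cdot> h) \<cdot> k)))"
  proof (rule sum.cong[OF refl])
    fix g assume g: "g \<in> G"
    show "(\<Sum>l\<in>G. sm l (?i l \<cdot> k) (sm g (?i g \<cdot> l) (p g) (r (?i g \<cdot> l))) (s (?i l \<cdot> k))) =
      (\<Sum>h\<in>G. sm (g \<cdot> h) (?i (g \<cdot> h) \<cdot> k) (sm g h (p g) (r h)) (s (?i (g \<cdot> h) \<cdot> k)))"
      by (rule sum.reindex_bij_witness[where i = "\<lambda>h. g \<cdot> h" and j = "\<lambda>l. ?i g \<cdot> l"])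
        (use g G_inv G_mult in auto)
  qed
  also have "eqv (K k) \<dots> (\<Sum>g\<in>G. \<Sum>h\<in>G. sm g (?i g \<cdot> k) (p g) (sm h (?i h \<cdot> (?i g \<cdot> k)) (r h) (s (?i h \<cdot> (?i g \<cdot> k)))))"
  proof (intro eqv_sum)
    fix g h assume g: "g \<in> G" "h \<in> G"
    let ?m = "?i (g \<cdot> h) \<cdot> k"
    have m: "?m \<in> G" using g k by (intro G_mult G_inv)
    have e: "?m = ?i h \<cdot> (?i g \<cdot> k)" unfolding diag_inv_mult by (metis dm_assoc dm_commute)
    have hm: "h \<cdot> ?m = ?i g \<cdot> k" unfolding e using g by simp
    have ghm: "g \<cdot> h \<cdot> ?m = k" unfolding dm_assoc hm using g by simp
    show "eqv (K k) (sm (g \<cdot> h) ?m (sm g h (p g) (r h)) (s ?m))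
        (sm g (?i g \<cdot> k) (p g) (sm h (?i h \<cdot> (?i g \<cdot> k)) (r h) (s (?i h \<cdot> (?i g \<cdot> k)))))"
      using sm_assoc[OF g m fam_polys[OF p(1) g(1)] fam_polys[OF p(2) g(2)] fam_polys[OF p(3) m]]
      unfolding ghm hm unfolding e .
  qed
  also have "(\<Sum>g\<in>G. \<Sum>h\<in>G. sm g (?i g \<cdot> k) (p g) (sm h (?i h \<cdot> (?i g \<cdot> k)) (r h) (s (?i h \<cdot> (?i g \<cdot> k))))) = star p (star r s) k"
    by (simp add: star_def sm_sum_right)
  finally show ?thesis .
qed

lemma cring_B: "cring B"
proof (rule cringI)
  show "abelian_group B"
  proof (rule abelian_groupI)
    fix x assume "x \<in> carrier B"
    then obtain p where p: "fam p" "x = mk p" by (auto simp: carrier_B)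
    show "\<exists>y\<in>carrier B. y \<oplus>\<^bsub>B\<^esub> x = \<zero>\<^bsub>B\<^esub>"
      using p fam_uminus[OF p(1)] by (intro bexI[of _ "mk (\<lambda>g. - p g)"]) (auto simp: carrier_B add_B zero_B)
    show "\<zero>\<^bsub>B\<^esub> \<oplus>\<^bsub>B\<^esub> x = x" using p fam_zero by (simp add: zero_B add_B)
  qed (auto simp: carrier_B add_B zero_B fam_zero fam_add add_ac)
  show "comm_monoid B"
  proof (rule comm_monoidI)
    fix x y assume "x \<in> carrier B" "y \<in> carrier B"
    then obtain p r where p: "fam p" "x = mk p" "fam r" "y = mk r" by (auto simp: carrier_B)
    show "x \<otimes>\<^bsub>B\<^esub> y \<in> carrier B" using p by (simp add: mult_B carrier_B fam_star)
    show "x \<otimes>\<^bsub>B\<^esub> y = y \<otimes>\<^bsub>B\<^esub> x"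
      using p by (simp add: mult_B mk_eq_iff fam_star star_commute[of _ p r] eqv_refl fam_polys)
    fix z assume "z \<in> carrier B"
    then obtain s where s: "fam s" "z = mk s" by (auto simp: carrier_B)
    show "x \<otimes>\<^bsub>B\<^esub> y \<otimes>\<^bsub>B\<^esub> z = x \<otimes>\<^bsub>B\<^esub> (y \<otimes>\<^bsub>B\<^esub> z)"
      using p s by (simp add: mult_B mk_eq_iff fam_star star_assoc)
  next
    show "\<one>\<^bsub>B\<^esub> \<in> carrier B" by (simp add: one_B carrier_B fam_delta inva_one)
    fix x assume "x \<in> carrier B"
    then obtain p where p: "fam p" "x = mk p" by (auto simp: carrier_B)
    show "\<one>\<^bsub>B\<^esub> \<otimes>\<^bsub>B\<^esub> x = x"
      using p by (simp add: one_B mult_B fam_delta inva_one mk_eq_iff fam_star star_one eqv_refl fam_polys)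
  qed
  fix x y z assume "x \<in> carrier B" "y \<in> carrier B" "z \<in> carrier B"
  then obtain p r s where p: "fam p" "x = mk p" "fam r" "y = mk r" "fam s" "z = mk s"
    by (auto simp: carrier_B)
  show "(x \<oplus>\<^bsub>B\<^esub> y) \<otimes>\<^bsub>B\<^esub> z = x \<otimes>\<^bsub>B\<^esub> z \<oplus>\<^bsub>B\<^esub> y \<otimes>\<^bsub>B\<^esub> z"
    using p by (simp add: add_B mult_B fam_add fam_star mk_eq_iff star_add eqv_refl fam_polys polys_add)
qed

lemma algebra_B: "algebra complex_ring B"
proof (rule algebraI)
  show "cring complex_ring" "cring B" by (rule cring_complex_ring cring_B)+
  fix a b :: complex and x y assume "x \<in> carrier B" "y \<in> carrier B"
  then obtain p r where p: "fam p" "x = mk p" "fam r" "y = mk r" by (auto simp: carrier_B)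
  show "(a \<odot>\<^bsub>B\<^esub> x) \<otimes>\<^bsub>B\<^esub> y = a \<odot>\<^bsub>B\<^esub> (x \<otimes>\<^bsub>B\<^esub> y)"
    using p by (simp add: smult_B mult_B fam_smult fam_star mk_eq_iff star_smult eqv_refl fam_polys polys_mult)
  show "a \<odot>\<^bsub>B\<^esub> (x \<oplus>\<^bsub>B\<^esub> y) = a \<odot>\<^bsub>B\<^esub> x \<oplus>\<^bsub>B\<^esub> a \<odot>\<^bsub>B\<^esub> y"
    using p by (simp add: smult_B add_B fam_smult fam_add distrib_left)
next
  fix a b :: complex and x assume "x \<in> carrier B"
  then obtain p where p: "fam p" "x = mk p" by (auto simp: carrier_B)
  show "a \<odot>\<^bsub>B\<^esub> x \<in> carrier B" using p by (simp add: smult_B carrier_B fam_smult)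
  show "(a \<oplus>\<^bsub>complex_ring\<^esub> b) \<odot>\<^bsub>B\<^esub> x = a \<odot>\<^bsub>B\<^esub> x \<oplus>\<^bsub>B\<^esub> b \<odot>\<^bsub>B\<^esub> x"
    using p by (simp add: smult_B add_B fam_smult Const_add distrib_right)
  show "(a \<otimes>\<^bsub>complex_ring\<^esub> b) \<odot>\<^bsub>B\<^esub> x = a \<odot>\<^bsub>B\<^esub> (b \<odot>\<^bsub>B\<^esub> x)"
    using p by (simp add: smult_B fam_smult Const_mult mult.assoc)
  show "\<one>\<^bsub>complex_ring\<^esub> \<odot>\<^bsub>B\<^esub> x = x" using p by (simp add: smult_B)
qed

section \<open>The grading\<close>

definition hfam :: "rat \<Rightarrow> ((nat \<Rightarrow> complex) \<Rightarrow> mpoly) \<Rightarrow> bool" where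
  "hfam d p \<longleftrightarrow> fam p \<and> (\<forall>g\<in>G. homog_of q (d - shift g) (p g))"

lemma hfam_fam: "hfam d p \<Longrightarrow> fam p" by (simp add: hfam_def)

lemma homog_B: "homog B d = mk ` Collect (hfam d)"
proof (intro equalityI subsetI)
  fix x assume "x \<in> homog B d"
  then have x: "x \<in> carrier B" "\<And>g. g \<in> G \<Longrightarrow>
      x g \<in> cls (K g) (WX (K g)) ` homog_polys (K g) q (d - shift g)"
    by (auto simp: bmodel_def restr_fix_def shift_def)
  then have "\<exists>p. p \<in> homog_polys (K g) q (d - shift g) \<and> x g = cls (K g) (WX (K g)) p" if "g \<in> G" for g
    using that by blast
  then obtain p where p: "\<And>g. g \<in> G \<Longrightarrow> p g \<in> homog_polys (K g) q (d - shift g) \<and> x g = cls (K g) (WX (K g)) (p g)"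
    by metis
  obtain r where r: "fam r" "x = mk r" using x by (auto simp: carrier_B)
  have "x = mk p"
  proof
    fix g show "x g = mk p g"
    proof (cases "g \<in> G")
      case True
      then show ?thesis using p[OF True] unfolding mk_def by (simp only: restrict_apply')
    qed (simp add: r(2) mk_def)
  qed
  \<comment> \<open>Invariance depends only on the class, so the homogeneous representative inherits
    it.\<close>
  moreover have "inva g (p g)" if "g \<in> G" for g
  proof -
    have "x g \<in> invariants (K g) (WX (K g)) G"
      using x(1) that by (auto simp: bmodel_def restr_fix_def)
    then have "cls (K g) (WX (K g)) (p g) \<in> invariants (K g) (WX (K g)) G"
      using p[OF that] by simp
    then show ?thesis using invariants_iff[OF that] p[OF that] by (auto simp: homog_polys_iff)
  qed
  ultimately show "x \<in> mk ` Collect (hfam d)"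
    using p by (auto simp: hfam_def fam_def homog_polys_iff)
next
  fix x assume "x \<in> mk ` Collect (hfam d)"
  then obtain p where p: "x = mk p" "hfam d p" by auto
  have "x \<in> carrier B" using p by (auto simp: carrier_B hfam_def)
  then show "x \<in> homog B d"
    using p fam_polys[of p] by (auto simp: bmodel_def restr_fix_def shift_def[symmetric] mk_def hfam_def homog_polys_iff)
qed

lemma finsum_B:
  assumes "finite A" "\<And>x. x \<in> A \<Longrightarrow> fam (f x)"
  shows "finsum B (\<lambda>x. mk (f x)) A = mk (\<lambda>g. \<Sum>x\<in>A. f x g)"
  using assms
proof (induction A rule: finite_induct)
  case empty
  interpret cring B by (rule cring_B)
  show ?case by (simp add: zero_B)
next
  case (insert x A)
  interpret cring B by (rule cring_B)
  have "finsum B (\<lambda>x. mk (f x)) (insert x A) = mk (f x) \<oplus>\<^bsub>B\<^esub> finsum B (\<lambda>x. mk (f x)) A"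
    using insert by (intro finsum_insert) (auto simp: carrier_B)
  then show ?case using insert by (simp add: add_B fam_sum)
qed

text \<open>The variables of \<open>antifix g h\<close> are moved by both factors and fixed by the
  product; the degree they lose, counted twice, is the degree of the Hessian that the product
  inserts.\<close>

lemma shift_antifix:
  assumes g: "g \<in> G" "h \<in> G" and c: "compat g h"
  shows "shift g + shift h = shift (g \<cdot> h) + hdeg q (antifix g h)"
proof -
  let ?s = "\<lambda>X. \<Sum>i\<in>X. 1 - 2 * q i"
  let ?B = "K g - K h" and ?C = "K h - K g" and ?D = "antifix g h"
  have fin: "finite ?B" "finite ?C" "finite ?D"
    using finite_subset[OF K_subset finite_I] by (auto simp: antifix_def)
  have "I - K g = ?C \<union> ?D" "I - K h = ?B \<union> ?D" "I - K (g \<cdot> h) = ?B \<union> ?C"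
    using c unfolding compat_iff antifix_def by (auto simp: K_iff diag_mult_def)
  moreover have "?C \<inter> ?D = {}" "?B \<inter> ?D = {}" "?B \<inter> ?C = {}"
    unfolding antifix_def by (auto simp: K_iff diag_mult_def)
  ultimately have "shift g = ?s ?C + ?s ?D" "shift h = ?s ?B + ?s ?D" "shift (g \<cdot> h) = ?s ?B + ?s ?C"
    using fin by (simp_all add: shift_def sum.union_disjoint)
  moreover have "hdeg q ?D = 2 * ?s ?D" by (simp add: hdeg_def sum_distrib_left algebra_simps)
  ultimately show ?thesis by simp
qed

lemma hfam_star:
  assumes p: "hfam d p" "hfam e r" shows "hfam (d + e) (star p r)"
  unfolding hfam_def
proof (intro conjI ballI fam_star)
  show "fam p" "fam r" using p by (auto simp: hfam_def)
  fix k assume k: "k \<in> G"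
  show "homog_of q (d + e - shift k) (star p r k)"
    unfolding star_def
  proof (rule homog_of_sum)
    fix g assume g: "g \<in> G"
    define h where "h = diag_inv g \<cdot> k"
    have h: "h \<in> G" "g \<cdot> h = k" using g k by (auto simp: h_def intro: G_mult G_inv)
    show "homog_of q (d + e - shift k) (sm g (diag_inv g \<cdot> k) (p g) (r (diag_inv g \<cdot> k)))"
      unfolding h_def[symmetric]
    proof (cases "compat g h")
      case True
      have "homog_of q (hdeg q (antifix g h) + ((d - shift g) + (e - shift h))) (sm g h (p g) (r h))"
        unfolding sm_def using True p g h
        by (simp del: homog_of_zero) (intro homog_of_mult eps_homog homog_of_restrict, auto simp: hfam_def)
      moreover have "hdeg q (antifix g h) + ((d - shift g) + (e - shift h)) = d + e - shift k"
        using shift_antifix[OF g h(1) True] h(2) by simp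
      ultimately show "homog_of q (d + e - shift k) (sm g h (p g) (r h))" by simp
    qed (simp add: sm_def)
  qed
qed

section \<open>The pairing and its nondegeneracy\<close>

lemma pairing_star:
  assumes p: "fam p" "fam r" "fam s"
  shows "(\<Sum>k\<in>G. T (K k) (star p r k * s (diag_inv k))) = (\<Sum>g\<in>G. T (K g) (p g * star r s (diag_inv g)))"
proof -
  let ?i = diag_inv
  have "(\<Sum>k\<in>G. T (K k) (star p r k * s (?i k))) =
      (\<Sum>k\<in>G. \<Sum>g\<in>G. T (K k) (sm g (?i g \<cdot> k) (p g) (r (?i g \<cdot> k)) * s (?i k)))"
  proof (rule sum.cong[OF refl])
    fix k assume k: "k \<in> G"
    have "sm g (?i g \<cdot> k) (p g) (r (?i g \<cdot> k)) * s (?i k) \<in> polys (K k)" if g: "g \<in> G" for g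
      using sm_polys[of g "?i g \<cdot> k"] fam_polys[OF p(3) G_inv[OF k]] g k
      by (intro polys_mult) (auto intro: G_mult G_inv)
    then show "T (K k) (star p r k * s (?i k)) = (\<Sum>g\<in>G. T (K k) (sm g (?i g \<cdot> k) (p g) (r (?i g \<cdot> k)) * s (?i k)))"
      unfolding star_def sum_distrib_right using good_fix[OF k] by (intro T_sum)
  qed
  also have "\<dots> = (\<Sum>g\<in>G. \<Sum>k\<in>G. T (K k) (sm g (?i g \<cdot> k) (p g) (r (?i g \<cdot> k)) * s (?i k)))"
    by (rule sum.swap)
  also have "\<dots> = (\<Sum>g\<in>G. \<Sum>h\<in>G. T (K (g \<cdot> h)) (sm g h (p g) (r h) * s (?i (g \<cdot> h))))"
  proof (rule sum.cong[OF refl])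
    fix g assume g: "g \<in> G"
    show "(\<Sum>k\<in>G. T (K k) (sm g (?i g \<cdot> k) (p g) (r (?i g \<cdot> k)) * s (?i k))) =
        (\<Sum>h\<in>G. T (K (g \<cdot> h)) (sm g h (p g) (r h) * s (?i (g \<cdot> h))))"
      by (rule sum.reindex_bij_witness[where i = "\<lambda>h. g \<cdot> h" and j = "\<lambda>l. ?i g \<cdot> l"])
        (use g G_inv G_mult in auto)
  qed
  also have "\<dots> = (\<Sum>g\<in>G. \<Sum>h\<in>G. T (K g) (p g * sm h (?i h \<cdot> ?i g) (r h) (s (?i h \<cdot> ?i g))))"
  proof (intro sum.cong refl)
    fix g h assume g: "g \<in> G" "h \<in> G"
    have e: "?i (g \<cdot> h) = ?i h \<cdot> ?i g" by (simp add: diag_inv_mult dm_commute)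
    show "T (K (g \<cdot> h)) (sm g h (p g) (r h) * s (?i (g \<cdot> h))) = T (K g) (p g * sm h (?i h \<cdot> ?i g) (r h) (s (?i h \<cdot> ?i g)))"
      using sm_Frobenius[OF g e[symmetric], of "p g" "r h" "s (?i h \<cdot> ?i g)"] fam_polys p g
      unfolding e by (auto intro: G_mult G_inv)
  qed
  also have "\<dots> = (\<Sum>g\<in>G. T (K g) (p g * star r s (?i g)))"
  proof (rule sum.cong[OF refl])
    fix g assume g: "g \<in> G"
    have "p g * sm h (?i h \<cdot> ?i g) (r h) (s (?i h \<cdot> ?i g)) \<in> polys (K g)" if h: "h \<in> G" for h
      using sm_polys[of h "?i h \<cdot> ?i g"] fam_polys[OF p(1) g] g h
      by (intro polys_mult) (auto intro: G_mult G_inv)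
    then show "(\<Sum>h\<in>G. T (K g) (p g * sm h (?i h \<cdot> ?i g) (r h) (s (?i h \<cdot> ?i g)))) = T (K g) (p g * star r s (?i g))"
      unfolding star_def sum_distrib_left using good_fix[OF g] by (intro T_sum[symmetric])
  qed
  finally show ?thesis .
qed

text \<open>A monomial that is not invariant pairs to zero with invariant classes, because the pairing
is preserved by the action.\<close>

lemma inva_nondeg:
  assumes g: "g \<in> G" and p: "inva g p"
    and z: "\<And>r. inva g r \<Longrightarrow> T (K g) (p * r) = 0"
  shows "eqv (K g) p 0"
proof (rule T_nondeg[OF good_fix[OF g] inva_polys[OF p]])
  fix a :: "nat \<Rightarrow>\<^sub>0 nat" assume a: "supp a \<subseteq> K g"
  note gK = good_fix[OF g] and pK = inva_polys[OF p]
  show "T (K g) (p * mon a 1) = 0"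
  proof (cases "\<forall>f\<in>G. diag_det (K g) f * mval f a = 1")
    case True
    then show ?thesis using a by (intro z inva_mon) auto
  next
    case False
    then obtain f where f: "f \<in> G" "diag_det (K g) f * mval f a \<noteq> 1" by blast
    let ?d = "diag_det (K g) f" and ?c = "mval f a"
    have nz: "?d \<noteq> 0" "?c \<noteq> 0" by (rule diag_det_nz[OF f(1)], rule mval_nonzero, rule G_nz'[OF f(1)])
    have pa: "p * mon a 1 \<in> polys (K g)" using pK a by auto
    \<comment> \<open>Replacing \<open>p\<close> by its twisted image and moving the symmetry over
      to the whole product divides the value by \<open>?d * ?c\<close>; as this number is not 1, the
      value is 0.\<close>
    have "T (K g) (p * mon a 1) = T (K g) ((Const ?d * scale_vars f p) * mon a 1)"
      using p f a by (intro T_cong gK eqv_mult_right) (auto simp: inva_def intro: eqv_sym)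
    also have "(Const ?d * scale_vars f p) * mon a 1 = Const (?d / ?c) * scale_vars f (p * mon a 1)"
      using nz mon_Const[of a ?c]
      by (simp add: scale_vars_mult scale_vars_mon divide_inverse Const_mult mult_ac)
        (simp flip: mult.assoc Const_mult)
    also have "T (K g) \<dots> = ?d / ?c * (T (K g) (p * mon a 1) / ?d ^ 2)"
      using gK pa f by (simp add: T_smult T_scale scale_vars_polys)
    finally have "T (K g) (p * mon a 1) * (?d * ?c - 1) = 0"
      using nz by (simp add: field_simps power2_eq_square)
    then show ?thesis using f(2) by simp
  qed
qed

lemma graded_frobenius_algebra_B: "graded_frobenius_algebra B"
proof (rule graded_frobenius_algebra.intro[OF algebra_B])
  interpret A: algebra complex_ring B by (rule algebra_B)
  have neg: "\<ominus>\<^bsub>B\<^esub> mk p = mk (\<lambda>g. - p g)" if "fam p" for p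
    using that fam_uminus[OF that] by (intro A.minus_equality) (auto simp: add_B carrier_B zero_B)
  show "graded_frobenius_algebra_axioms B"
  proof (rule graded_frobenius_algebra_axioms.intro)
    fix d
    show "submodule (homog B d) complex_ring B"
    proof (rule A.submoduleI)
      show "homog B d \<subseteq> carrier B" by (auto simp: homog_B carrier_B hfam_def)
      show "\<zero>\<^bsub>B\<^esub> \<in> homog B d" by (auto simp: homog_B zero_B hfam_def fam_zero)
      fix x assume "x \<in> homog B d"
      then obtain p where p: "x = mk p" "hfam d p" by (auto simp: homog_B)
      have "hfam d (\<lambda>g. - p g)"
        using p fam_uminus homog_of_diff[OF homog_of_zero] by (fastforce simp: hfam_def)
      then show "\<ominus>\<^bsub>B\<^esub> x \<in> homog B d" using p by (auto simp: homog_B neg hfam_fam)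
      show "a \<odot>\<^bsub>B\<^esub> x \<in> homog B d" for a
      proof -
        have "hfam d (\<lambda>g. Const a * p g)"
          using p fam_smult homog_of_Const_mult by (auto simp: hfam_def)
        then show ?thesis using p by (auto simp: homog_B smult_B hfam_fam)
      qed
      fix y assume "y \<in> homog B d"
      then obtain r where r: "y = mk r" "hfam d r" by (auto simp: homog_B)
      have "hfam d (\<lambda>g. p g + r g)"
        using p r fam_add homog_of_add by (auto simp: hfam_def)
      then show "x \<oplus>\<^bsub>B\<^esub> y \<in> homog B d" using p r by (auto simp: homog_B add_B hfam_fam)
    qed
  next
    fix x assume "x \<in> carrier B"
    then obtain p where p: "fam p" "x = mk p" by (auto simp: carrier_B)
    \<comment> \<open>The shift is constant on a sector, so total degree \<open>d\<close> means
      polynomial degree \<open>d - shift g\<close> there.\<close>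
    define c where "c d g = hcomp q (d - shift g) (p g)" for d g
    have c: "hfam d (c d)" for d
      using p inva_hcomp homog_of_hcomp by (auto simp: hfam_def fam_def c_def)
    note cf = hfam_fam[OF c]
    define S where "S = (\<Union>g\<in>G. (\<lambda>a. mono_deg q a + shift g) ` supp (p g))"
    have finS: "finite S" using finite_G by (simp add: S_def)
    have outS: "c d g = 0" if "d \<notin> S" "g \<in> G" for d g
    proof (rule poly_eqI)
      fix a show "coeff (c d g) a = coeff 0 a"
        using that by (force simp: c_def coeff_hcomp S_def in_keys_iff)
    qed
    have sumS: "(\<Sum>d\<in>S. c d g) = p g" if g: "g \<in> G" for g
    proof -
      have "(\<Sum>d\<in>S. c d g) = (\<Sum>e\<in>(\<lambda>d. d - shift g) ` S. hcomp q e (p g))"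
        unfolding c_def by (subst sum.reindex) (auto simp: inj_on_def)
      also have "\<dots> = p g"
        using finS g by (intro sum_hcomp) (force simp: S_def image_iff)+
      finally show ?thesis .
    qed
    show "\<exists>!f. (\<forall>d. f d \<in> homog B d) \<and> finite {d. f d \<noteq> \<zero>\<^bsub>B\<^esub>} \<and> x = (\<Oplus>\<^bsub>B\<^esub>d\<in>{d. f d \<noteq> \<zero>\<^bsub>B\<^esub>}. f d)"
    proof (rule ex1I[of _ "\<lambda>d. mk (c d)"])
      let ?S = "{d. mk (c d) \<noteq> \<zero>\<^bsub>B\<^esub>}"
      have sub: "?S \<subseteq> S"
      proof
        fix d assume "d \<in> ?S"
        then show "d \<in> S" using outS[of d] mk_eq_iff[OF cf fam_zero, of d] by (auto simp: zero_B eqv_refl)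
      qed
      have fin: "finite ?S" using sub finS by (rule finite_subset)
      have "eqv (K g) (p g) (\<Sum>d\<in>?S. c d g)" if g: "g \<in> G" for g
      proof -
        have "eqv (K g) (\<Sum>d\<in>S - ?S. c d g) (\<Sum>d\<in>S - ?S. 0)"
        proof (rule eqv_sum)
          fix d assume "d \<in> S - ?S"
          then have "mk (c d) = mk (\<lambda>g. 0)" by (simp add: zero_B)
          then show "eqv (K g) (c d g) 0" using mk_eq_iff[OF cf fam_zero] g by auto
        qed
        then have "eqv (K g) ((\<Sum>d\<in>S - ?S. c d g) + (\<Sum>d\<in>?S. c d g)) ((\<Sum>d\<in>S - ?S. 0) + (\<Sum>d\<in>?S. c d g))"
          using fam_polys[OF cf g] by (intro eqv_add eqv_refl polys_sum)
        then show ?thesis using sum.subset_diff[OF sub finS, of "\<lambda>d. c d g"] sumS[OF g] by simp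
      qed
      then have "x = (\<Oplus>\<^bsub>B\<^esub>d\<in>?S. mk (c d))"
        using p cf by (simp add: finsum_B[OF fin] mk_eq_iff fam_sum)
      then show "(\<forall>d. mk (c d) \<in> homog B d) \<and> finite ?S \<and> x = (\<Oplus>\<^bsub>B\<^esub>d\<in>?S. mk (c d))"
        using fin c by (auto simp: homog_B)
    next
      fix f assume f: "(\<forall>d. f d \<in> homog B d) \<and> finite {d. f d \<noteq> \<zero>\<^bsub>B\<^esub>} \<and> x = (\<Oplus>\<^bsub>B\<^esub>d\<in>{d. f d \<noteq> \<zero>\<^bsub>B\<^esub>}. f d)"
      let ?S = "{d. f d \<noteq> \<zero>\<^bsub>B\<^esub>}"
      have fin: "finite ?S" using f by blast
      have "\<exists>r. hfam d r \<and> f d = mk r" for d using f by (auto simp: homog_B)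
      then obtain r where r: "\<And>d. hfam d (r d)" "\<And>d. f d = mk (r d)" by metis
      note rf = hfam_fam[OF r(1)]
      have "x = mk (\<lambda>g. \<Sum>d\<in>?S. r d g)"
        using f finsum_B[OF fin, of r] rf by (simp add: r(2))
      then have e: "eqv (K g) (p g) (\<Sum>d\<in>?S. r d g)" if "g \<in> G" for g
        using p rf that by (simp add: mk_eq_iff fam_sum)
      show "f = (\<lambda>d. mk (c d))"
      proof
        fix d
        \<comment> \<open>Taking homogeneous components respects congruence, so the component of a
          competing decomposition recovers its own term.\<close>
        have "eqv (K g) (c d g) (r d g)" if g: "g \<in> G" for g
        proof -
          have "eqv (K g) (c d g) (\<Sum>e\<in>?S. hcomp q (d - shift g) (r e g))"
            unfolding c_def hcomp_sum[symmetric] by (intro eqv_hcomp good_fix g e)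
          also have "(\<Sum>e\<in>?S. hcomp q (d - shift g) (r e g)) = (\<Sum>e\<in>?S. if e = d then r d g else 0)"
          proof (rule sum.cong[OF refl])
            fix e
            have h: "homog_of q (e - shift g) (r e g)" using r(1)[of e] g by (simp add: hfam_def)
            show "hcomp q (d - shift g) (r e g) = (if e = d then r d g else 0)"
              unfolding hcomp_homog[OF h] by auto
          qed
          also have "\<dots> = (if d \<in> ?S then r d g else 0)" using fin by simp
          also have "eqv (K g) \<dots> (r d g)"
          proof (cases "d \<in> ?S")
            case True
            then show ?thesis using fam_polys[OF rf g] by (simp add: eqv_refl)
          next
            case False
            then have "mk (r d) = mk (\<lambda>g. 0)" using r(2) zero_B by auto
            then show ?thesis using False mk_eq_iff[OF rf fam_zero] g by (auto intro: eqv_sym)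
          qed
          finally show ?thesis .
        qed
        then show "f d = mk (c d)" using mk_eq_iff[OF rf cf] r(2) eqv_sym by metis
      qed
    qed
  next
    have "hfam 0 (delta diag_one 1)"
      unfolding hfam_def using fam_delta[OF inva_one] by (auto simp: delta_def shift_def)
    then show "\<one>\<^bsub>B\<^esub> \<in> homog B 0" by (auto simp: homog_B one_B)
  next
    fix x y d e assume "x \<in> homog B d" "y \<in> homog B e"
    then obtain p r where "x = mk p" "hfam d p" "y = mk r" "hfam e r" by (auto simp: homog_B)
    then show "x \<otimes>\<^bsub>B\<^esub> y \<in> homog B (d + e)"
      using hfam_star[of d p e r] by (auto simp: homog_B mult_B hfam_fam)
  next
    fix x y assume "x \<in> carrier B" "y \<in> carrier B"
    then obtain p r where p: "x = mk p" "fam p" "y = mk r" "fam r" by (auto simp: carrier_B)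
    have "(\<Sum>g\<in>G. T (K g) (p g * r (diag_inv g))) = (\<Sum>g\<in>G. T (K g) (r g * p (diag_inv g)))"
      by (rule sum.reindex_bij_witness[where i = diag_inv and j = diag_inv])
        (auto simp: G_inv mult.commute)
    then show "pairing B x y = pairing B y x" using p by (simp add: pairing_B)
  next
    fix x y z assume "x \<in> carrier B" "y \<in> carrier B" "z \<in> carrier B"
    then obtain p r s where p: "x = mk p" "fam p" "y = mk r" "fam r" "z = mk s" "fam s"
      by (auto simp: carrier_B)
    have "T (K g) ((p g + r g) * s (diag_inv g)) = T (K g) (p g * s (diag_inv g)) + T (K g) (r g * s (diag_inv g))"
      if "g \<in> G" for g
      unfolding distrib_right
      using fam_polys[OF p(2) that] fam_polys[OF p(4) that] fam_polys[OF p(6) G_inv[OF that]]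
      by (intro T_add good_fix[OF that] polys_mult) auto
    then show "pairing B (x \<oplus>\<^bsub>B\<^esub> y) z = pairing B x z + pairing B y z"
      using p by (simp add: add_B pairing_B fam_add sum.distrib)
  next
    fix x y c assume "x \<in> carrier B" "y \<in> carrier B"
    then obtain p r where p: "x = mk p" "fam p" "y = mk r" "fam r" by (auto simp: carrier_B)
    have "T (K g) (Const c * p g * r (diag_inv g)) = c * T (K g) (p g * r (diag_inv g))" if "g \<in> G" for g
      unfolding mult.assoc using fam_polys[OF p(2) that] fam_polys[OF p(4) G_inv[OF that]]
      by (intro T_smult good_fix[OF that] polys_mult) auto
    then show "pairing B (c \<odot>\<^bsub>B\<^esub> x) y = c * pairing B x y"
      using p by (simp add: smult_B pairing_B fam_smult sum_distrib_left)
  next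
    fix x assume "x \<in> carrier B" and z: "\<And>y. y \<in> carrier B \<Longrightarrow> pairing B x y = 0"
    then obtain p where p: "x = mk p" "fam p" by (auto simp: carrier_B)
    have "eqv (K g) (p g) 0" if g: "g \<in> G" for g
    proof (rule inva_nondeg[OF g])
      show "inva g (p g)" using p g by (simp add: fam_def)
      fix r assume "inva g r"
      \<comment> \<open>Since an element pairs only with its inverse, \<open>p g\<close> is tested
        by an element concentrated in the inverse sector.\<close>
      then have r: "inva (diag_inv g) r" by (simp add: inva_def)
      have "0 = pairing B x (mk (delta (diag_inv g) r))"
        using z fam_delta[OF r] by (simp add: carrier_B)
      also have "\<dots> = (\<Sum>h\<in>G. T (K h) (p h * delta (diag_inv g) r (diag_inv h)))"
        using p fam_delta[OF r] by (simp add: pairing_B)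
      also have "\<dots> = (\<Sum>h\<in>G. if h = g then T (K g) (p g * r) else 0)"
      proof (rule sum.cong[OF refl])
        fix h assume h: "h \<in> G"
        have "diag_inv h = diag_inv g \<longleftrightarrow> h = g" by (metis diag_inv_inv)
        then show "T (K h) (p h * delta (diag_inv g) r (diag_inv h)) = (if h = g then T (K g) (p g * r) else 0)"
          using T_zero[OF good_fix[OF h]] by (auto simp: delta_def)
      qed
      also have "\<dots> = T (K g) (p g * r)" using g finite_G by simp
      finally show "T (K g) (p g * r) = 0" by simp
    qed
    then show "x = \<zero>\<^bsub>B\<^esub>" using p by (simp add: zero_B mk_eq_iff fam_zero)
  next
    fix x y z assume "x \<in> carrier B" "y \<in> carrier B" "z \<in> carrier B"
    then obtain p r s where p: "x = mk p" "fam p" "y = mk r" "fam r" "z = mk s" "fam s"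
      by (auto simp: carrier_B)
    then show "pairing B (x \<otimes>\<^bsub>B\<^esub> y) z = pairing B x (y \<otimes>\<^bsub>B\<^esub> z)"
      using pairing_star[of p r s] by (simp add: mult_B pairing_B fam_star)
  qed
qed

end

section \<open>Transporting sectors along an equivariant isomorphism\<close>

text \<open>\<open>R p r\<close> says that the isomorphism maps the class of \<open>p\<close> to the class of \<open>r\<close>. The conditions
are symmetric, so that every consequence also holds for the inverse.\<close>

locale transport = W: orbifold I W t G + V: orbifold I V t' G
  for I :: "nat set" and W V :: mpoly and t t' :: "mpoly \<Rightarrow> complex" and G :: "(nat \<Rightarrow> complex) set" +
  fixes R :: "mpoly \<Rightarrow> mpoly \<Rightarrow> bool"
  assumes R_polys: "R p r \<Longrightarrow> p \<in> polys I" "R p r \<Longrightarrow> r \<in> polys I"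
    and R_left_total: "p \<in> polys I \<Longrightarrow> \<exists>r. R p r"
    and R_right_total: "r \<in> polys I \<Longrightarrow> \<exists>p. R p r"
    and R_add: "R p r \<Longrightarrow> R p' r' \<Longrightarrow> R (p + p') (r + r')"
    and R_mult: "R p r \<Longrightarrow> R p' r' \<Longrightarrow> R (p * p') (r * r')"
    and R_Const: "R (Const c) (Const c)"
    and R_left_zero: "R p 0 \<Longrightarrow> W.eqv I p 0"
    and R_right_zero: "R 0 r \<Longrightarrow> V.eqv I r 0"
    and R_left_cong: "R p r \<Longrightarrow> W.eqv I p p' \<Longrightarrow> R p' r"
    and R_right_cong: "R p r \<Longrightarrow> V.eqv I r r' \<Longrightarrow> R p r'"
    and R_scale: "g \<in> G \<Longrightarrow> R p r \<Longrightarrow> R (scale_vars g p) (scale_vars g r)"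
    and R_t: "R p r \<Longrightarrow> t p = t' r"
    and R_left_homog: "homog_of (weights I W) d p \<Longrightarrow> p \<in> polys I \<Longrightarrow> \<exists>r. R p r \<and> homog_of (weights I V) d r"
    and R_right_homog: "homog_of (weights I V) d r \<Longrightarrow> r \<in> polys I \<Longrightarrow> \<exists>p. R p r \<and> homog_of (weights I W) d p"
begin

lemma flip: "transport I V W t' t G (\<lambda>r p. R p r)"
  by unfold_locales
    (blast intro: R_polys R_left_total R_right_total R_add R_mult R_Const R_left_zero R_right_zero
      R_left_cong R_right_cong R_scale R_t[symmetric] R_left_homog R_right_homog)+

abbreviation K where "K g \<equiv> fix_vars I g"
abbreviation N where "N g \<equiv> I - fix_vars I g"

lemma R_smult: "R p r \<Longrightarrow> R (Const c * p) (Const c * r)"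
  by (rule R_mult[OF R_Const])

lemma R_diff: "R p r \<Longrightarrow> R p' r' \<Longrightarrow> R (p - p') (r - r')"
  using R_add[of p r "Const (-1) * p'" "Const (-1) * r'"] R_smult[of p' r' "-1"]
  by (simp add: Const_uminus)

lemma R_right_unique: "R p r \<Longrightarrow> R p r' \<Longrightarrow> V.eqv I r r'"
  using R_right_zero[of "r - r'"] R_diff[of p r p r'] R_polys by (simp add: V.eqv_def)

lemma polys_K: "p \<in> polys (K g) \<Longrightarrow> p \<in> polys I"
  using polys_mono[OF W.K_subset] .

lemma NK: "I - N g = K g" using W.K_subset by blast

lemma good_N: "g \<in> G \<Longrightarrow> W.good (N g)" "g \<in> G \<Longrightarrow> V.good (N g)"
  by (auto intro: W.good_fix V.good_fix W.good_I V.good_I W.good_Diff V.good_Diff)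

lemma V_restrict: "g \<in> G \<Longrightarrow> V.eqv I r r' \<Longrightarrow> V.eqv (K g) (restrict_vars (K g) r) (restrict_vars (K g) r')"
  by (rule V.eqv_restrict[OF V.good_fix V.good_I V.K_subset])

text \<open>By equivariance \<open>r\<close> is an eigenvector of \<open>g\<close> with eigenvalue other than \<open>1\<close>.\<close>

lemma moving_variable:
  assumes g: "g \<in> G" and i: "i \<in> N g" and r: "R (Var i) r"
  shows "V.eqv (K g) (restrict_vars (K g) r) 0"
proof -
  have gi: "g i \<noteq> 1" using i by (auto simp: fix_vars_def)
  have "scale_vars g (Var i) = Const (g i) * Var i"
    by (simp add: Var_def scale_vars_mon Const_mon)
  then have "R (Const (g i) * Var i) (scale_vars g r)" using R_scale[OF g r] by simp
  then have "V.eqv I (scale_vars g r) (Const (g i) * r)"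
    using R_smult[OF r] by (rule R_right_unique)
  \<comment> \<open>On the fixed variables \<open>g\<close> acts as the identity, so the restriction
    of \<open>r\<close> is congruent to \<open>g i\<close> times itself; the factor
    \<open>1 - g i\<close> can then be divided out.\<close>
  then have "V.eqv (K g) (restrict_vars (K g) (scale_vars g r)) (restrict_vars (K g) (Const (g i) * r))"
    by (rule V_restrict[OF g])
  then have e: "V.eqv (K g) (restrict_vars (K g) r) (Const (g i) * restrict_vars (K g) r)"
    by (subst (asm) restrict_scale_fix) (auto simp: fix_vars_def restrict_vars_mult)
  let ?r = "restrict_vars (K g) r"
  have "V.eqv (K g) (?r + Const (- g i) * ?r) (Const (g i) * ?r + Const (- g i) * ?r)"
    by (intro V.eqv_add e V.eqv_refl polys_mult restrict_vars_polys polys_Const)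
  then have "V.eqv (K g) (Const (1 - g i) * ?r) 0"
    by (simp add: Const_diff Const_uminus left_diff_distrib)
  then have "V.eqv (K g) (Const (1 / (1 - g i)) * (Const (1 - g i) * ?r)) (Const (1 / (1 - g i)) * 0)"
    by (rule V.eqv_smult)
  then show ?thesis using gi by (simp flip: mult.assoc Const_mult)
qed

text \<open>This is the descent to sectors. Up to an element that already vanishes in the Milnor
  ring, \<open>p\<close> consists of monomials containing a moved variable, and the image of each
  moved variable restricts to zero.\<close>

lemma restrict_zero:
  assumes g: "g \<in> G" and p: "R p r" and z: "W.eqv (K g) (restrict_vars (K g) p) 0"
  shows "V.eqv (K g) (restrict_vars (K g) r) 0"
proof -
  let ?A = "{a. supp a \<subseteq> I \<and> \<not> supp a \<subseteq> K g}"
  have *: "V.eqv (K g) (restrict_vars (K g) r) 0" if "supp p \<subseteq> ?A" "R p r" for p r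
    using that
  proof (induction p arbitrary: r rule: poly_supp_induct)
    case zero
    then have "V.eqv I r 0" by (intro R_right_zero)
    then show ?case using V_restrict[OF g, of r 0] by simp
  next
    case (mon a c)
    then obtain i where i: "i \<in> supp a" "i \<in> N g" by auto
    define b where "b = a - mon i 1"
    have ab: "a = mon i 1 + b"
      using i(1) by (intro poly_mapping_eqI) (auto simp: b_def lookup_add lookup_minus lookup_single when_def in_keys_iff)
    have bI: "supp b \<subseteq> I" using mon(1) ab by auto
    have m: "mon a c = Var i * mon b c" by (simp add: ab Var_def mon_mult)
    obtain r1 where r1: "R (Var i) r1" using R_left_total[of "Var i"] i(2) by auto
    obtain r2 where r2: "R (mon b c) r2" using R_left_total[of "mon b c"] bI by auto
    have "V.eqv I r (r1 * r2)" using mon(2) R_mult[OF r1 r2] unfolding m by (rule R_right_unique)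
    then have "V.eqv (K g) (restrict_vars (K g) r) (restrict_vars (K g) r1 * restrict_vars (K g) r2)"
      using V_restrict[OF g] by (metis restrict_vars_mult)
    also have "V.eqv (K g) \<dots> (0 * restrict_vars (K g) r2)"
      by (intro V.eqv_mult_right moving_variable[OF g i(2) r1] restrict_vars_polys)
    finally show ?case by simp
  next
    case (add p p')
    have "p \<in> polys I" "p' \<in> polys I" using add.hyps by (auto simp: polys_iff)
    then obtain r1 r2 where r: "R p r1" "R p' r2" using R_left_total by blast
    have "V.eqv I r (r1 + r2)" using add.prems R_add[OF r] by (rule R_right_unique)
    then have "V.eqv (K g) (restrict_vars (K g) r) (restrict_vars (K g) r1 + restrict_vars (K g) r2)"
      using V_restrict[OF g] by (metis restrict_vars_add)
    also have "V.eqv (K g) \<dots> (0 + 0)" by (intro V.eqv_add add.IH r)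
    finally show ?case by simp
  qed
  let ?p = "restrict_vars (K g) p"
  have pI: "p \<in> polys I" by (rule R_polys[OF p])
  \<comment> \<open>The Jacobian ideal of the sector is contained in that of \<open>W\<close>, so
    the restriction of \<open>p\<close> is already zero in the untwisted sector.\<close>
  have "W.eqv I ?p 0" by (rule W.eqv_mono[OF W.good_fix[OF g] W.good_I W.K_subset z])
  then have R0: "R ?p 0" using R_left_cong[OF _ W.eqv_sym] R_Const[of 0] by simp
  have "supp (p - ?p) \<subseteq> ?A"
  proof
    fix a assume "a \<in> supp (p - ?p)"
    then have "coeff p a - (if supp a \<subseteq> K g then coeff p a else 0) \<noteq> 0"
      by (simp add: in_keys_iff lookup_minus coeff_restrict_vars)
    then have "\<not> supp a \<subseteq> K g" "coeff p a \<noteq> 0" by (auto split: if_splits)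
    then show "a \<in> ?A" using polysD[OF pI] by auto
  qed
  moreover have "R (p - ?p) (r - 0)" by (intro R_diff p R0)
  ultimately show ?thesis using * by force
qed

lemma restrict_cong:
  assumes g: "g \<in> G" and p: "R p r" "R p' r'"
    and e: "W.eqv (K g) (restrict_vars (K g) p) (restrict_vars (K g) p')"
  shows "V.eqv (K g) (restrict_vars (K g) r) (restrict_vars (K g) r')"
proof -
  have "W.eqv (K g) (restrict_vars (K g) (p - p')) 0"
    using e unfolding restrict_vars_diff by (auto simp: W.eqv_def)
  then have "V.eqv (K g) (restrict_vars (K g) (r - r')) 0"
    by (rule restrict_zero[OF g R_diff[OF p]])
  then show ?thesis unfolding restrict_vars_diff by (auto simp: V.eqv_def restrict_vars_polys)
qed

section \<open>Degrees of the sectors on both sides\<close>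

lemma eps_K_nonzero: "g \<in> G \<Longrightarrow> \<not> W.eqv (K g) (W.eps (K g)) 0"
  using W.T_cong[OF W.good_fix] W.T_eps_self[OF W.good_fix] W.T_zero[OF W.good_fix] by force

text \<open>The Hessian of the sector is nonzero and its image keeps the degree. Were that degree
  above the top degree of the sector of \<open>V\<close>, the image would restrict to zero, and the
  inverse would return zero as well.\<close>

lemma hdeg_le:
  assumes g: "g \<in> G" shows "hdeg (weights I W) (K g) \<le> hdeg (weights I V) (K g)"
proof (rule ccontr)
  assume l: "\<not> ?thesis"
  have eK: "W.eps (K g) \<in> polys (K g)" by (intro W.eps_polys_good W.good_fix g) simp
  obtain r where r: "R (W.eps (K g)) r" "homog_of (weights I V) (hdeg (weights I W) (K g)) r"
    using R_left_homog[OF W.eps_homog polys_K[OF eK]] by blast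
  have "V.eqv (K g) (restrict_vars (K g) r) 0"
    using l by (intro V.high_degree_eqv[OF V.good_fix[OF g] restrict_vars_polys homog_of_restrict[OF r(2)]]) simp
  then have "W.eqv (K g) (restrict_vars (K g) (W.eps (K g))) 0"
    using transport.restrict_zero[OF flip g] r(1) by blast
  then show False using eps_K_nonzero[OF g] by (simp add: restrict_vars_id[OF eK])
qed

lemma hdeg_eq: "g \<in> G \<Longrightarrow> hdeg (weights I W) (K g) = hdeg (weights I V) (K g)"
  using hdeg_le transport.hdeg_le[OF flip] by (intro antisym)

lemma hdeg_I: "hdeg (weights I W) I = hdeg (weights I V) I"
  using hdeg_eq[OF W.G_one] by simp

lemma hdeg_split: "hdeg r I = hdeg r (K g) + hdeg r (N g)"
  using hdeg_Un[of "K g" "N g" r] W.K_subset[of g] W.finite_I finite_subset[OF W.K_subset W.finite_I]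
  by (simp add: Un_absorb1)

text \<open>The weights themselves are not compared. The shift is half the degree of the Hessian in
  the moved variables, and that degree is the difference of the total and the sector degrees, which
  agree.\<close>

lemma shift_eq: assumes g: "g \<in> G" shows "W.shift g = V.shift g"
proof -
  have s: "2 * (\<Sum>i\<in>X. 1 - 2 * r i) = hdeg r X" for r :: "nat \<Rightarrow> rat" and X
    by (simp add: hdeg_def sum_distrib_left algebra_simps)
  have "hdeg (weights I W) (N g) = hdeg (weights I V) (N g)"
    using hdeg_split[of "weights I W" g] hdeg_split[of "weights I V" g] hdeg_eq[OF g] hdeg_I by simp
  then show ?thesis
    using s[of "weights I W" "N g"] s[of "weights I V" "N g"] unfolding W.shift_def V.shift_def by simp
qed

lemma kill_moving:
  assumes z: "z \<in> polys I" "\<And>i. i \<in> N g \<Longrightarrow> V.eqv I (Var i * z) 0" and a: "supp a \<subseteq> I" "\<not> supp a \<subseteq> K g"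
  shows "V.eqv I (z * mon a c) 0"
proof -
  obtain i where i: "i \<in> supp a" "i \<in> N g" using a by auto
  define b where "b = a - mon i 1"
  have ab: "a = mon i 1 + b"
    using i(1) by (intro poly_mapping_eqI) (auto simp: b_def lookup_add lookup_minus lookup_single when_def in_keys_iff)
  have "mon b c \<in> polys I" using a ab by auto
  then have "V.eqv I (mon b c * (Var i * z)) (mon b c * 0)" by (intro V.eqv_mult_left z i)
  moreover have "mon b c * (Var i * z) = z * mon a c"
    using mon_mult[of b c "mon i 1" 1] by (simp add: Var_def ab mult_ac add_ac)
  ultimately show ?thesis by simp
qed

text \<open>The image of the Hessian of the moved variables is annihilated by every moved variable
  and homogeneous of the right degree. These two properties determine it up to a scalar.\<close>

lemma eps_image:
  assumes g: "g \<in> G"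
  shows "\<exists>s. s \<noteq> 0 \<and> R (W.eps (N g)) (Const s * V.eps (N g))"
proof -
  let ?e = "W.eps (N g)" and ?f = "V.eps (N g)" and ?h = "V.eps (K g)"
  have eI: "?e \<in> polys I" by (intro W.eps_polys_good good_N g) auto
  have fI: "?f \<in> polys I" by (intro V.eps_polys_good good_N g) auto
  have hK: "?h \<in> polys (K g)" by (intro V.eps_polys_good V.good_fix g) auto
  obtain z where z: "R ?e z" "homog_of (weights I V) (hdeg (weights I W) (N g)) z"
    using R_left_homog[OF W.eps_homog eI] by blast
  have zI: "z \<in> polys I" by (rule R_polys[OF z(1)])
  \<comment> \<open>Pull the moved variable back: its preimage vanishes on the fixed variables, and
    is therefore annihilated by \<open>?e\<close>.\<close>
  have zkill: "V.eqv I (Var i * z) 0" if i: "i \<in> N g" for i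
  proof -
    have "Var i \<in> polys I" using i by auto
    then obtain p where p: "R p (Var i)" using R_right_total by blast
    have pI: "p \<in> polys I" by (rule R_polys[OF p])
    have pz: "W.eqv (K g) (restrict_vars (K g) p) 0"
      using transport.moving_variable[OF flip g i] p by blast
    have "W.eqv I (?e * p) (?e * restrict_vars (I - N g) p)"
      by (intro W.eps_kill good_N g W.good_I pI) auto
    also have "W.eqv I (?e * restrict_vars (I - N g) p) (?e * 0)"
      unfolding NK by (intro W.eqv_mult_left eI W.eqv_mono[OF W.good_fix[OF g] W.good_I W.K_subset pz])
    finally have "W.eqv I (p * ?e) 0" by (simp add: mult.commute)
    then have "R 0 (Var i * z)" using R_left_cong R_mult[OF p z(1)] by blast
    then show ?thesis by (rule R_right_zero)
  qed
  have fkill: "V.eqv I (Var i * ?f) 0" if i: "i \<in> N g" for i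
  proof -
    have "V.eqv I (?f * Var i) (?f * restrict_vars (I - N g) (Var i))"
      using i by (intro V.eps_kill good_N g V.good_I) auto
    moreover have "restrict_vars (I - N g) (Var i) = 0"
      using i unfolding NK by (simp add: Var_def restrict_vars_mon)
    ultimately show ?thesis by (simp add: mult.commute)
  qed
  \<comment> \<open>The only possible scalar: \<open>?f\<close> and \<open>?h\<close> pair to
    1.\<close>
  define s where "s = t' (z * ?h)"
  let ?u = "z - Const s * ?f"
  have uI: "?u \<in> polys I" using zI fI by auto
  have "V.eqv I ?u 0"
  proof (rule V.T_nondeg[OF V.good_I uI])
    fix a :: "nat \<Rightarrow>\<^sub>0 nat" assume a: "supp a \<subseteq> I"
    have aI: "mon a (1::complex) \<in> polys I" using a by auto
    have split: "V.T I (?u * mon a 1) = t' (z * mon a 1) - s * t' (?f * mon a 1)"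
    proof -
      have "?u * mon a 1 = z * mon a 1 + Const (- s) * (?f * mon a 1)"
        by (simp add: algebra_simps Const_uminus)
      then show ?thesis
        using zI fI aI by (simp add: V.T_I V.t_add V.t_smult polys_mult)
    qed
    \<comment> \<open>A monomial with a moved variable annihilates both sides. A monomial in the
      fixed variables matters only in the top degree of the sector, where it is a multiple of
      \<open>?h\<close>.\<close>
    have "t' (z * mon a 1) = s * t' (?f * mon a 1)"
    proof (cases "supp a \<subseteq> K g")
      case False
      have "t' (z * mon a 1) = 0"
        using V.T_cong[OF V.good_I kill_moving[OF zI zkill a False]] by (simp add: V.T_I V.t_zero)
      moreover have "t' (?f * mon a 1) = 0"
        using V.T_cong[OF V.good_I kill_moving[OF fI fkill a False]] by (simp add: V.T_I V.t_zero)
      ultimately show ?thesis by simp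
    next
      case True
      have aK: "mon a (1::complex) \<in> polys (K g)" using True by auto
      have fT: "t' (?f * mon a 1) = V.T (K g) (mon a 1)" by (simp add: V.T_def)
      show ?thesis
      proof (cases "mono_deg (weights I V) a = hdeg (weights I V) (K g)")
        case False
        have "V.T (K g) (mon a 1) = 0"
          by (rule V.T_homog[OF V.good_fix[OF g] aK homog_of_mon[OF refl] False])
        moreover have "t' (z * mon a 1) = 0"
        proof (rule V.t_homog)
          show "homog_of (weights I V) (hdeg (weights I W) (N g) + mono_deg (weights I V) a) (z * mon a 1)"
            by (intro homog_of_mult z homog_of_mon refl)
          show "hdeg (weights I W) (N g) + mono_deg (weights I V) a \<noteq> hdeg (weights I V) I"
            using False hdeg_split[of "weights I W" g] hdeg_eq[OF g] hdeg_I by simp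
        qed (use zI aI in auto)
        ultimately show ?thesis using fT by simp
      next
        case True
        have "V.eqv (K g) (mon a 1) (Const (V.T (K g) (mon a 1)) * ?h)"
          by (rule V.top_degree_eqv[OF V.good_fix[OF g] aK homog_of_mon[OF True]])
        then have "V.eqv I (z * mon a 1) (z * (Const (V.T (K g) (mon a 1)) * ?h))"
          by (intro V.eqv_mult_left zI V.eqv_mono[OF V.good_fix[OF g] V.good_I V.K_subset])
        then have "t' (z * mon a 1) = t' (Const (V.T (K g) (mon a 1)) * (z * ?h))"
          using V.T_cong[OF V.good_I] by (metis V.T_I mult.left_commute)
        then show ?thesis
          using fT zI polys_K[OF hK] by (simp add: V.t_smult polys_mult s_def)
      qed
    qed
    then show "V.T I (?u * mon a 1) = 0" using split by simp
  qed
  then have zs: "V.eqv I z (Const s * ?f)" using zI fI by (auto simp: V.eqv_def)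
  then have Rs: "R ?e (Const s * ?f)" by (rule R_right_cong[OF z(1)])
  \<comment> \<open>Otherwise \<open>?e\<close> would be zero in the Milnor ring of
    \<open>W\<close>, although it pairs to 1 with the normalised Hessian of the fixed
    variables.\<close>
  have "s \<noteq> 0"
  proof
    assume "s = 0"
    then have "W.eqv I ?e 0" using Rs R_left_zero by simp
    then have "W.eqv I (W.eps (K g) * ?e) (W.eps (K g) * 0)"
      by (intro W.eqv_mult_left W.eps_polys_good W.good_fix g W.K_subset)
    then have "t (W.eps (K g) * ?e) = 0"
      using W.T_cong[OF W.good_I] by (metis W.T_I W.t_zero mult_zero_right)
    moreover have "t (W.eps (K g) * ?e) = W.T (K g) (W.eps (K g))" by (simp add: W.T_def mult.commute)
    ultimately show False using W.T_eps_self[OF W.good_fix[OF g]] by simp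
  qed
  then show ?thesis using Rs by blast
qed

text \<open>The argument is the set of moved variables instead of the group element, so that blocks
  and antifix sets can be inserted. The choice is known to be possible only when some group element
  moves exactly the set \<open>A\<close>.\<close>

definition dd :: "nat set \<Rightarrow> complex" where
  "dd A = (SOME s. s \<noteq> 0 \<and> R (W.eps A) (Const s * V.eps A))"

lemma dd: assumes "g \<in> G" shows "dd (N g) \<noteq> 0" "R (W.eps (N g)) (Const (dd (N g)) * V.eps (N g))"
  using someI_ex[OF eps_image[OF assms]] by (auto simp: dd_def)

lemma dd_unique:
  assumes g: "g \<in> G" and s: "R (W.eps (N g)) (Const s * V.eps (N g))"
  shows "s = dd (N g)"
proof -
  let ?f = "V.eps (N g)"
  have fI: "?f \<in> polys I" by (intro V.eps_polys_good good_N g) auto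
  have hI: "V.eps (K g) \<in> polys I" by (intro V.eps_polys_good V.good_fix g V.K_subset)
  have "V.eqv I (Const s * ?f) (Const (dd (N g)) * ?f)" by (rule R_right_unique[OF s dd(2)[OF g]])
  then have "V.eqv I (V.eps (K g) * (Const s * ?f)) (V.eps (K g) * (Const (dd (N g)) * ?f))"
    by (rule V.eqv_mult_left[OF hI])
  then have "t' (V.eps (K g) * (Const s * ?f)) = t' (V.eps (K g) * (Const (dd (N g)) * ?f))"
    using V.T_cong[OF V.good_I] by (metis V.T_I)
  moreover have "t' (V.eps (K g) * (Const c * ?f)) = c" for c
  proof -
    have e: "V.eps (K g) * (Const c * ?f) = Const c * (?f * V.eps (K g))" by (simp add: mult_ac)
    have "t' (?f * V.eps (K g)) = 1"
      using V.T_eps_self[OF V.good_fix[OF g]] by (simp add: V.T_def)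
    then show ?thesis unfolding e using fI hI by (simp add: V.t_smult polys_mult)
  qed
  ultimately show ?thesis by simp
qed

lemma dd_Un:
  assumes g: "g1 \<in> G" "g2 \<in> G" "g \<in> G" and n: "N g = N g1 \<union> N g2" "N g1 \<inter> N g2 = {}"
  shows "dd (N g) = dd (N g1) * dd (N g2)"
proof (rule dd_unique[OF g(3), symmetric])
  have "R (W.eps (N g1) * W.eps (N g2)) ((Const (dd (N g1)) * V.eps (N g1)) * (Const (dd (N g2)) * V.eps (N g2)))"
    by (intro R_mult dd g)
  moreover have "W.eps (N g) = W.eps (N g1) * W.eps (N g2)"
    unfolding n(1) by (intro W.eps_Un good_N g n)
  moreover have "V.eps (N g) = V.eps (N g1) * V.eps (N g2)"
    unfolding n(1) by (intro V.eps_Un good_N g n)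
  ultimately show "R (W.eps (N g)) (Const (dd (N g1) * dd (N g2)) * V.eps (N g))"
    by (simp only: Const_mult mult_ac)
qed

lemma dd_empty: "dd {} = 1"
  using dd_unique[OF W.G_one, of 1] R_Const[of 1] by simp

end

section \<open>Multiplicative square roots over the blocks\<close>

locale block_transport = transport +
  fixes P :: "nat set set"
  assumes P: "partition_on I P"
    and P_fix: "g \<in> G \<Longrightarrow> S \<in> P \<Longrightarrow> S \<subseteq> fix_vars I g \<or> S \<inter> fix_vars I g = {}"
    and P_part: "g \<in> G \<Longrightarrow> S \<in> P \<Longrightarrow> (\<lambda>i. if i \<in> S then g i else 1) \<in> G"
begin

lemma finite_P: "finite P" using W.finite_I P by (rule finite_elements)
lemma P_subset: "S \<in> P \<Longrightarrow> S \<subseteq> I" using P by (auto simp: partition_on_def)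
lemma P_nonempty: "S \<in> P \<Longrightarrow> S \<noteq> {}" using P by (auto simp: partition_on_def)
lemma P_disjoint: "S \<in> P \<Longrightarrow> S' \<in> P \<Longrightarrow> S \<noteq> S' \<Longrightarrow> S \<inter> S' = {}"
  using P by (auto simp: partition_on_def disjoint_def)
lemma P_cover: "i \<in> I \<Longrightarrow> \<exists>S\<in>P. i \<in> S" using P by (auto simp: partition_on_def)

definition part :: "(nat \<Rightarrow> complex) \<Rightarrow> nat set \<Rightarrow> nat \<Rightarrow> complex" where
  "part g A = (\<lambda>i. if i \<in> A then g i else 1)"

lemma part_in_G: "g \<in> G \<Longrightarrow> Q \<subseteq> P \<Longrightarrow> part g (\<Union>Q) \<in> G"
proof -
  assume g: "g \<in> G" and Q: "Q \<subseteq> P"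
  have "finite Q" using Q finite_P by (rule finite_subset)
  then show ?thesis using Q
  proof (induction Q rule: finite_induct)
    case empty
    then show ?case using W.G_one by (simp add: part_def diag_one_def)
  next
    case (insert S Q)
    have "S \<inter> S' = {}" if "S' \<in> Q" for S'
      using that insert.prems insert.hyps by (intro P_disjoint) auto
    then have "S \<inter> \<Union>Q = {}" by blast
    then have "part g (\<Union>(insert S Q)) = diag_mult (part g S) (part g (\<Union>Q))"
      by (auto simp: part_def diag_mult_def fun_eq_iff)
    then show ?case using insert P_part[OF g, of S] W.G_mult by (simp add: part_def)
  qed
qed

lemma N_part: "A \<subseteq> I \<Longrightarrow> N (part g A) = A \<inter> N g"
  by (auto simp: part_def fix_vars_def)

text \<open>One principal root per block; the principal root of \<open>dd A\<close> itself would be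
  multiplicative only up to sign. For a block moved by no element the factor is an arbitrary number,
  and \<open>root_square\<close> claims nothing about it.\<close>

definition root :: "nat set \<Rightarrow> complex" where
  "root A = (\<Prod>S | S \<in> P \<and> S \<subseteq> A. csqrt (dd S))"

definition block_union :: "nat set \<Rightarrow> bool" where
  "block_union A \<longleftrightarrow> A \<subseteq> I \<and> (\<forall>S\<in>P. S \<subseteq> A \<or> S \<inter> A = {})"

lemma block_union_K: "g \<in> G \<Longrightarrow> block_union (K g)"
  using P_fix by (auto simp: block_union_def fix_vars_def)

lemma block_union_Int: "block_union A \<Longrightarrow> block_union B \<Longrightarrow> block_union (A \<inter> B)"
  unfolding block_union_def by blast

lemma block_union_Diff: "block_union A \<Longrightarrow> block_union B \<Longrightarrow> block_union (A - B)"
  unfolding block_union_def by blast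

lemma block_union_eq: "block_union A \<Longrightarrow> A = \<Union>{S \<in> P. S \<subseteq> A}"
proof (intro equalityI subsetI)
  fix i assume A: "block_union A" and i: "i \<in> A"
  then have "i \<in> I" by (auto simp: block_union_def)
  then obtain S where S: "S \<in> P" "i \<in> S" using P_cover by auto
  then have "S \<subseteq> A \<or> S \<inter> A = {}" using A unfolding block_union_def by simp
  then have "S \<subseteq> A" using S(2) i by blast
  then show "i \<in> \<Union>{S \<in> P. S \<subseteq> A}" using S by blast
qed blast

lemma root_Un:
  assumes "block_union A" "block_union B" "A \<inter> B = {}" shows "root (A \<union> B) = root A * root B"
proof -
  have "{S. S \<in> P \<and> S \<subseteq> A \<union> B} = {S. S \<in> P \<and> S \<subseteq> A} \<union> {S. S \<in> P \<and> S \<subseteq> B}"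
  proof (intro equalityI subsetI)
    fix S assume S: "S \<in> {S. S \<in> P \<and> S \<subseteq> A \<union> B}"
    then have "S \<subseteq> A \<or> S \<inter> A = {}" using assms(1) unfolding block_union_def by simp
    then show "S \<in> {S. S \<in> P \<and> S \<subseteq> A} \<union> {S. S \<in> P \<and> S \<subseteq> B}" using S by blast
  qed auto
  moreover have "{S. S \<in> P \<and> S \<subseteq> A} \<inter> {S. S \<in> P \<and> S \<subseteq> B} = {}"
    using assms(3) P_nonempty by blast
  ultimately show ?thesis
    unfolding root_def using finite_P by (simp add: prod.union_disjoint)
qed

text \<open>Keeping the entries of \<open>g\<close> on the blocks inside \<open>A\<close> and
  setting the others to 1 stays in the group. This gives \<open>dd A\<close> its meaning for such
  sets.\<close>

lemma moved_set:
  assumes g: "g \<in> G" and A: "block_union A" "A \<subseteq> N g"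
  obtains f where "f \<in> G" "N f = A"
proof
  show "part g A \<in> G"
    using part_in_G[OF g, of "{S \<in> P. S \<subseteq> A}"] block_union_eq[OF A(1)] by auto
  show "N (part g A) = A" using A by (subst N_part) auto
qed

lemma root_square:
  assumes g: "g \<in> G" and A: "block_union A" "A \<subseteq> N g"
  shows "root A ^ 2 = dd A"
proof -
  have "(\<Prod>S\<in>Q. csqrt (dd S)) ^ 2 = dd (\<Union>Q)" if "finite Q" "Q \<subseteq> {S \<in> P. S \<subseteq> A}" for Q
    using that
  proof (induction Q rule: finite_induct)
    case empty
    then show ?case by (simp add: dd_empty)
  next
    case (insert S Q)
    have bu: "block_union (\<Union>Q')" if "Q' \<subseteq> P" for Q'
      unfolding block_union_def
    proof (intro conjI ballI)
      show "\<Union>Q' \<subseteq> I" using that P_subset by blast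
      fix S assume "S \<in> P"
      then show "S \<subseteq> \<Union>Q' \<or> S \<inter> \<Union>Q' = {}" using that P_disjoint by blast
    qed
    obtain f1 where f1: "f1 \<in> G" "N f1 = S"
      using moved_set[OF g bu[of "{S}"]] insert.prems A by auto
    have QN: "Q \<subseteq> P" "\<Union>Q \<subseteq> N g" using insert.prems A by auto
    obtain f2 where f2: "f2 \<in> G" "N f2 = \<Union>Q"
      by (rule moved_set[OF g bu[OF QN(1)] QN(2)])
    have QP: "insert S Q \<subseteq> P" "\<Union>(insert S Q) \<subseteq> N g" using insert.prems A by auto
    obtain f3 where f3: "f3 \<in> G" "N f3 = \<Union>(insert S Q)"
      by (rule moved_set[OF g bu[OF QP(1)] QP(2)])
    have "S \<inter> S' = {}" if "S' \<in> Q" for S'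
      using that insert.prems insert.hyps by (intro P_disjoint) auto
    then have "S \<inter> \<Union>Q = {}" by blast
    then have "dd (N f3) = dd (N f1) * dd (N f2)"
      using f1 f2 f3 by (intro dd_Un) auto
    then show ?case
      using insert f1 f2 f3 by (simp add: power_mult_distrib)
  qed
  from this[of "{S \<in> P. S \<subseteq> A}"] show ?thesis
    using finite_P block_union_eq[OF A(1)] by (simp add: root_def)
qed

lemma block_union_N: "g \<in> G \<Longrightarrow> block_union (N g)"
proof -
  assume "g \<in> G"
  moreover have "block_union I" using P_subset by (auto simp: block_union_def)
  ultimately show ?thesis by (intro block_union_Diff block_union_K)
qed

lemma root_N: "g \<in> G \<Longrightarrow> root (N g) ^ 2 = dd (N g)" "g \<in> G \<Longrightarrow> root (N g) \<noteq> 0"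
  using root_square[OF _ block_union_N] dd(1) by force+

lemma antifix_moved:
  assumes g: "g \<in> G" "h \<in> G"
  obtains f where "f \<in> G" "N f = W.antifix g h"
proof (rule moved_set[OF g(1)])
  show "block_union (W.antifix g h)"
    unfolding W.antifix_def by (intro block_union_Diff block_union_Int block_union_K W.G_mult g)
  show "W.antifix g h \<subseteq> N g"
    unfolding W.antifix_def by (auto simp: fix_vars_def diag_mult_def)
qed

text \<open>The identity that the rescaling must satisfy for the product. The antifix set is moved
  by both factors, so its root occurs twice on the left and gives \<open>dd\<close>; every other
  variable moved by the product is moved by exactly one factor.\<close>

lemma root_antifix:
  assumes g: "g \<in> G" "h \<in> G" and c: "W.compat g h"
  shows "root (N g) * root (N h) = root (N (diag_mult g h)) * dd (W.antifix g h)"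
proof -
  let ?B = "K g - K h" and ?C = "K h - K g" and ?D = "W.antifix g h"
  have bu: "block_union ?B" "block_union ?C" "block_union ?D"
    unfolding W.antifix_def by (intro block_union_Diff block_union_Int block_union_K W.G_mult g)+
  have sets: "N g = ?C \<union> ?D" "N h = ?B \<union> ?D" "N (diag_mult g h) = ?B \<union> ?C"
    using c unfolding W.compat_iff W.antifix_def by (auto simp: fix_vars_def diag_mult_def)
  have disj: "?C \<inter> ?D = {}" "?B \<inter> ?D = {}" "?B \<inter> ?C = {}"
    unfolding W.antifix_def by (auto simp: fix_vars_def diag_mult_def)
  have "root ?D ^ 2 = dd ?D"
    by (rule root_square[OF g(1) bu(3)]) (auto simp: W.antifix_def fix_vars_def diag_mult_def)
  then show ?thesis
    unfolding sets using bu disj by (simp add: root_Un power2_eq_square mult_ac)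
qed

section \<open>The maps between sectors\<close>

definition rep :: "mpoly \<Rightarrow> mpoly" where "rep p = (SOME r. R p r)"

lemma rep: "p \<in> polys I \<Longrightarrow> R p (rep p)"
  unfolding rep_def using someI_ex[OF R_left_total] .

text \<open>A polynomial of the sector is read in the untwisted sector, mapped by the isomorphism,
  restricted again and rescaled.\<close>

definition tr :: "(nat \<Rightarrow> complex) \<Rightarrow> mpoly \<Rightarrow> mpoly" where
  "tr g p = Const (root (N g)) * restrict_vars (K g) (rep p)"

lemma tr_polys: "tr g p \<in> polys (K g)"
  unfolding tr_def by (intro polys_mult polys_Const restrict_vars_polys)

text \<open>Well-definedness of the descent: the map may be computed from any related pair that
  agrees with \<open>p\<close> on the sector. The compatibilities below only choose a convenient
  pair.\<close>

lemma tr_eqv: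
  assumes g: "g \<in> G" and p: "p \<in> polys I" and r: "R p' r"
    and e: "W.eqv (K g) (restrict_vars (K g) p) (restrict_vars (K g) p')"
  shows "V.eqv (K g) (tr g p) (Const (root (N g)) * restrict_vars (K g) r)"
  unfolding tr_def by (intro V.eqv_smult restrict_cong[OF g rep[OF p] r e])

lemma tr_cong:
  assumes g: "g \<in> G" and e: "W.eqv (K g) p p'" shows "V.eqv (K g) (tr g p) (tr g p')"
proof -
  have p: "p \<in> polys (K g)" "p' \<in> polys (K g)" using e by (auto simp: W.eqv_def)
  show ?thesis
    unfolding tr_def[of g p']
    by (rule tr_eqv[OF g polys_K[OF p(1)] rep[OF polys_K[OF p(2)]]]) (use e p in \<open>simp add: restrict_vars_id\<close>)
qed

lemma tr_add:
  assumes g: "g \<in> G" and p: "p \<in> polys (K g)" "p' \<in> polys (K g)"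
  shows "V.eqv (K g) (tr g (p + p')) (tr g p + tr g p')"
proof -
  have "V.eqv (K g) (tr g (p + p')) (Const (root (N g)) * restrict_vars (K g) (rep p + rep p'))"
    by (rule tr_eqv[OF g polys_K[OF polys_add[OF p]] R_add[OF rep[OF polys_K[OF p(1)]] rep[OF polys_K[OF p(2)]]]
          W.eqv_refl[OF restrict_vars_polys]])
  then show ?thesis by (simp add: tr_def restrict_vars_add distrib_left)
qed

lemma tr_smult:
  assumes g: "g \<in> G" and p: "p \<in> polys (K g)"
  shows "V.eqv (K g) (tr g (Const c * p)) (Const c * tr g p)"
proof -
  have "V.eqv (K g) (tr g (Const c * p)) (Const (root (N g)) * restrict_vars (K g) (Const c * rep p))"
    by (rule tr_eqv[OF g polys_K[OF polys_mult[OF polys_Const p]] R_smult[OF rep[OF polys_K[OF p]]]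
          W.eqv_refl[OF restrict_vars_polys]])
  then show ?thesis by (simp add: tr_def restrict_vars_mult mult_ac)
qed

lemma tr_zero: assumes g: "g \<in> G" shows "V.eqv (K g) (tr g 0) 0"
  using tr_smult[OF g, of 0 0] by simp

lemma tr_sum:
  assumes g: "g \<in> G" and p: "\<And>x. x \<in> A \<Longrightarrow> f x \<in> polys (K g)"
  shows "V.eqv (K g) (tr g (sum f A)) (\<Sum>x\<in>A. tr g (f x))"
  using p
proof (induction A rule: infinite_finite_induct)
  case (insert x A)
  have "V.eqv (K g) (tr g (f x + sum f A)) (tr g (f x) + tr g (sum f A))"
    using insert by (intro tr_add g polys_sum) auto
  also have "V.eqv (K g) \<dots> (tr g (f x) + (\<Sum>x\<in>A. tr g (f x)))"
    using insert by (intro V.eqv_add V.eqv_refl tr_polys) auto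
  finally show ?case using insert by simp
qed (use tr_zero[OF g] in auto)

lemma tr_inj:
  assumes g: "g \<in> G" and p: "p \<in> polys (K g)" "p' \<in> polys (K g)" and e: "V.eqv (K g) (tr g p) (tr g p')"
  shows "W.eqv (K g) p p'"
proof -
  have "V.eqv (K g) (Const (1 / root (N g)) * tr g p) (Const (1 / root (N g)) * tr g p')"
    by (rule V.eqv_smult[OF e])
  then have "V.eqv (K g) (restrict_vars (K g) (rep p)) (restrict_vars (K g) (rep p'))"
    using root_N(2)[OF g] unfolding tr_def by (simp flip: mult.assoc Const_mult)
  then have "W.eqv (K g) (restrict_vars (K g) p) (restrict_vars (K g) p')"
    using transport.restrict_cong[OF flip g] rep[OF polys_K] p by blast
  then show ?thesis using p by (simp add: restrict_vars_id)
qed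

lemma tr_scale:
  assumes g: "g \<in> G" "f \<in> G" and p: "p \<in> polys (K g)"
  shows "V.eqv (K g) (tr g (Const c * scale_vars f p)) (Const c * scale_vars f (tr g p))"
proof -
  have "V.eqv (K g) (tr g (Const c * scale_vars f p))
      (Const (root (N g)) * restrict_vars (K g) (Const c * scale_vars f (rep p)))"
    by (rule tr_eqv[OF g(1) polys_K[OF polys_mult[OF polys_Const scale_vars_polys[OF p]]]
          R_smult[OF R_scale[OF g(2) rep[OF polys_K[OF p]]]] W.eqv_refl[OF restrict_vars_polys]])
  moreover have "Const (root (N g)) * restrict_vars (K g) (Const c * scale_vars f (rep p)) = Const c * scale_vars f (tr g p)"
    unfolding tr_def scale_vars_Const_mult restrict_vars_mult restrict_vars_Const restrict_scale
    by (rule mult.left_commute)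
  ultimately show ?thesis by simp
qed

lemma tr_inva: assumes g: "g \<in> G" and p: "W.inva g p" shows "V.inva g (tr g p)"
  unfolding V.inva_def
proof (intro conjI ballI tr_polys)
  fix f assume f: "f \<in> G"
  have "V.eqv (K g) (Const (diag_det (K g) f) * scale_vars f (tr g p))
      (tr g (Const (diag_det (K g) f) * scale_vars f p))"
    by (rule V.eqv_sym[OF tr_scale[OF g f W.inva_polys[OF p]]])
  also have "V.eqv (K g) \<dots> (tr g p)"
    using p f by (intro tr_cong g) (auto simp: W.inva_def)
  finally show "V.eqv (K g) (Const (diag_det (K g) f) * scale_vars f (tr g p)) (tr g p)" .
qed

text \<open>Dividing by the root before pulling back cancels the rescaling. The preimage is
  invariant because the map commutes with the action and is injective.\<close>

lemma tr_surj:
  assumes g: "g \<in> G" and r: "V.inva g r"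
  obtains p where "W.inva g p" "V.eqv (K g) (tr g p) r"
proof -
  note rK = V.inva_polys[OF r]
  have "Const (1 / root (N g)) * r \<in> polys I" using polys_K[OF rK] by auto
  then obtain p0 where p0: "R p0 (Const (1 / root (N g)) * r)" using R_right_total by blast
  define p where "p = restrict_vars (K g) p0"
  have pK: "p \<in> polys (K g)" unfolding p_def by (rule restrict_vars_polys)
  have "V.eqv (K g) (tr g p) (Const (root (N g)) * restrict_vars (K g) (Const (1 / root (N g)) * r))"
    using pK by (intro tr_eqv[OF g polys_K p0]) (auto simp: p_def restrict_restrict intro: W.eqv_refl restrict_vars_polys)
  also have "Const (root (N g)) * restrict_vars (K g) (Const (1 / root (N g)) * r) = r"
    using root_N(2)[OF g] by (simp add: restrict_vars_mult restrict_vars_id[OF rK]) (simp flip: mult.assoc Const_mult)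
  finally have e: "V.eqv (K g) (tr g p) r" .
  have "W.inva g p"
    unfolding W.inva_def
  proof (intro conjI ballI pK)
    fix f assume f: "f \<in> G"
    have "V.eqv (K g) (tr g (Const (diag_det (K g) f) * scale_vars f p)) (Const (diag_det (K g) f) * scale_vars f (tr g p))"
      by (rule tr_scale[OF g f pK])
    also have "V.eqv (K g) \<dots> (Const (diag_det (K g) f) * scale_vars f r)"
      by (intro V.eqv_smult V.eqv_scale[OF V.good_fix[OF g] V.G_scale[OF f] _ e] V.G_nz[OF f])
    also have "V.eqv (K g) \<dots> r" using r f by (auto simp: V.inva_def)
    also have "V.eqv (K g) r (tr g p)" by (rule V.eqv_sym[OF e])
    finally show "W.eqv (K g) (Const (diag_det (K g) f) * scale_vars f p) p"
      using pK by (intro tr_inj[OF g]) auto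
  qed
  then show ?thesis using e that by blast
qed

text \<open>The image of \<open>W.eps\<close> of the antifix set contributes \<open>dd\<close>, and
  \<open>root_antifix\<close> converts this factor and the root of the product sector into the roots
  of the two factors.\<close>

lemma tr_sm:
  assumes g: "g \<in> G" "h \<in> G" and p: "p \<in> polys (K g)" "r \<in> polys (K h)"
  shows "V.eqv (K (diag_mult g h)) (tr (diag_mult g h) (W.sm g h p r)) (V.sm g h (tr g p) (tr h r))"
proof (cases "W.compat g h")
  case False
  then show ?thesis using tr_zero[OF W.G_mult[OF g]] by (simp add: W.sm_def V.sm_def)
next
  case c: True
  let ?k = "diag_mult g h" and ?D = "W.antifix g h" and ?Z = "K g \<inter> K h"
  let ?K = "K ?k"
  have k: "?k \<in> G" by (rule W.G_mult[OF g])
  have gD: "V.good ?D" using V.good_antifix[OF g] .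
  have gDW: "W.good ?D" by (rule W.good_antifix[OF g])
  have DK: "?D \<subseteq> ?K" "?K - ?D = ?Z" unfolding W.antifix_def by (auto simp: fix_vars_def diag_mult_def)
  have eD: "V.eps ?D \<in> polys ?K" by (rule V.eps_polys_good[OF gD DK(1)])
  have eDW: "W.eps ?D \<in> polys ?K" by (rule W.eps_polys_good[OF gDW DK(1)])
  obtain f where f: "f \<in> G" "N f = ?D" using antifix_moved[OF g] .
  have RD: "R (W.eps ?D) (Const (dd ?D) * V.eps ?D)" using dd(2)[OF f(1)] unfolding f(2) .
  have pI: "p \<in> polys I" "r \<in> polys I" using p polys_K by auto
  have RR: "R (W.eps ?D * (p * r)) ((Const (dd ?D) * V.eps ?D) * (rep p * rep r))"
    by (intro R_mult RD rep pI)
  have "restrict_vars ?K (W.sm g h p r) = restrict_vars ?K (W.eps ?D * (p * r))"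
    using c by (simp add: W.sm_def restrict_vars_mult restrict_restrict)
  then have "V.eqv ?K (tr ?k (W.sm g h p r))
      (Const (root (N ?k)) * restrict_vars ?K ((Const (dd ?D) * V.eps ?D) * (rep p * rep r)))"
    by (intro tr_eqv[OF k polys_K[OF W.sm_polys[OF g]] RR]) (simp add: W.eqv_refl restrict_vars_polys)
  also have "Const (root (N ?k)) * restrict_vars ?K ((Const (dd ?D) * V.eps ?D) * (rep p * rep r)) =
      Const (root (N g) * root (N h)) * (V.eps ?D * restrict_vars ?K (rep p * rep r))"
    unfolding root_antifix[OF g c] Const_mult restrict_vars_mult
    by (simp add: restrict_vars_id[OF eD] mult_ac)
  \<comment> \<open>The two sides restrict the images before or after multiplying, which can differ
    only in the variables of the antifix set; next to \<open>V.eps ?D\<close> those are 0.\<close>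
  also have "V.eqv ?K \<dots> (Const (root (N g) * root (N h)) * (V.eps ?D * restrict_vars ?Z (rep p * rep r)))"
  proof (rule V.eqv_smult)
    have "V.eqv ?K (V.eps ?D * restrict_vars ?K (rep p * rep r))
        (V.eps ?D * restrict_vars (?K - ?D) (restrict_vars ?K (rep p * rep r)))"
      by (intro V.eps_kill gD V.good_fix k DK restrict_vars_polys)
    moreover have "?Z \<inter> ?K = ?Z" using DK by blast
    ultimately show "V.eqv ?K (V.eps ?D * restrict_vars ?K (rep p * rep r)) (V.eps ?D * restrict_vars ?Z (rep p * rep r))"
      unfolding DK(2) restrict_restrict by simp
  qed
  also have "V.eqv ?K \<dots> (Const (root (N g) * root (N h)) *
      (V.eps ?D * restrict_vars ?K (restrict_vars (K g) (rep p) * restrict_vars (K h) (rep r))))"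
  proof (rule V.eqv_smult[OF V.eqv_sym])
    let ?x = "restrict_vars (K g) (rep p) * restrict_vars (K h) (rep r)"
    have "V.eqv ?K (V.eps ?D * restrict_vars ?K ?x) (V.eps ?D * restrict_vars (?K - ?D) (restrict_vars ?K ?x))"
      by (intro V.eps_kill gD V.good_fix k DK restrict_vars_polys)
    moreover have "restrict_vars ?Z (restrict_vars ?K ?x) = restrict_vars ?Z (rep p * rep r)"
    proof -
      have "?Z \<inter> (?K \<inter> K g) = ?Z" "?Z \<inter> (?K \<inter> K h) = ?Z" using DK by blast+
      then show ?thesis by (simp add: restrict_restrict restrict_vars_mult)
    qed
    ultimately show "V.eqv ?K (V.eps ?D * restrict_vars ?K ?x) (V.eps ?D * restrict_vars ?Z (rep p * rep r))"
      unfolding DK(2) by simp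
  qed
  also have "Const (root (N g) * root (N h)) *
      (V.eps ?D * restrict_vars ?K (restrict_vars (K g) (rep p) * restrict_vars (K h) (rep r))) =
      V.sm g h (tr g p) (tr h r)"
    using c by (simp add: V.sm_def tr_def restrict_vars_mult Const_mult mult_ac)
  finally show ?thesis .
qed

text \<open>A sector and its inverse have the same moved variables, so the roots square to
  \<open>dd (N g)\<close>. This is the factor by which the image of the Hessian in those variables
  differs from the Hessian of \<open>V\<close>, and the functionals correspond in the untwisted
  sector.\<close>

lemma tr_T:
  assumes g: "g \<in> G" and p: "p \<in> polys (K g)" "r \<in> polys (K g)"
  shows "V.T (K g) (tr g p * tr (diag_inv g) r) = W.T (K g) (p * r)"
proof -
  let ?e = "W.eps (N g)" and ?f = "V.eps (N g)"
  have Ki: "K (diag_inv g) = K g" by simp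
  have pI: "p \<in> polys I" "r \<in> polys I" using p polys_K by auto
  have rI: "rep p * rep r \<in> polys I" using R_polys(2)[OF rep[OF pI(1)]] R_polys(2)[OF rep[OF pI(2)]] by auto
  have fI: "?f \<in> polys I" by (intro V.eps_polys_good good_N g) auto
  have "tr g p * tr (diag_inv g) r = Const (root (N g) ^ 2) * restrict_vars (K g) (rep p * rep r)"
    unfolding tr_def Ki by (simp add: power2_eq_square Const_mult restrict_vars_mult mult_ac)
  also have "\<dots> = Const (dd (N g)) * restrict_vars (K g) (rep p * rep r)" using root_N(1)[OF g] by simp
  finally have "V.T (K g) (tr g p * tr (diag_inv g) r) = dd (N g) * V.T (K g) (restrict_vars (K g) (rep p * rep r))"
    using V.T_smult[OF V.good_fix[OF g] restrict_vars_polys] by simp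
  also have "V.T (K g) (restrict_vars (K g) (rep p * rep r)) = t' (?f * (rep p * rep r))"
  proof -
    have "V.eqv I (?f * (rep p * rep r)) (?f * restrict_vars (I - N g) (rep p * rep r))"
      by (intro V.eps_kill good_N g V.good_I rI) auto
    then show ?thesis
      using V.T_cong[OF V.good_I] unfolding NK V.T_def[of "K g"] by (metis V.T_I)
  qed
  also have "dd (N g) * t' (?f * (rep p * rep r)) = t' ((Const (dd (N g)) * ?f) * (rep p * rep r))"
    using V.t_smult[of "?f * (rep p * rep r)" "dd (N g)"] fI rI by (simp add: mult.assoc polys_mult)
  also have "\<dots> = t (?e * (p * r))"
    by (intro R_t[symmetric] R_mult dd g rep pI)
  also have "\<dots> = W.T (K g) (p * r)" by (simp add: W.T_def)
  finally show ?thesis .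
qed

lemma tr_homog:
  assumes g: "g \<in> G" and p: "p \<in> polys (K g)" "homog_of (weights I W) d p"
  obtains r where "r \<in> polys (K g)" "homog_of (weights I V) d r" "V.eqv (K g) (tr g p) r"
proof -
  obtain r where r: "R p r" "homog_of (weights I V) d r" using R_left_homog[OF p(2) polys_K[OF p(1)]] by blast
  show ?thesis
  proof (rule that)
    show "V.eqv (K g) (tr g p) (Const (root (N g)) * restrict_vars (K g) r)"
      by (rule tr_eqv[OF g polys_K[OF p(1)] r(1) W.eqv_refl[OF restrict_vars_polys]])
  qed (auto intro: homog_of_Const_mult homog_of_restrict r restrict_vars_polys)
qed

lemma tr_one: "V.eqv I (tr diag_one 1) 1"
proof -
  have "V.eqv (K diag_one) (tr diag_one 1) (Const (root (N diag_one)) * restrict_vars (K diag_one) 1)"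
    using tr_eqv[OF W.G_one polys_one R_Const[of 1, unfolded Const_one] W.eqv_refl[OF restrict_vars_polys]] .
  moreover have "root {} = 1" using P_nonempty by (auto simp: root_def intro!: prod.neutral)
  ultimately show ?thesis by simp
qed

lemma tr_identity_sector: "p \<in> polys I \<Longrightarrow> V.eqv I (tr diag_one p) (rep p)"
proof -
  assume p: "p \<in> polys I"
  have "root {} = 1" using P_nonempty by (auto simp: root_def intro!: prod.neutral)
  then have "tr diag_one p = rep p"
    using restrict_vars_id[OF R_polys(2)[OF rep[OF p]]] by (simp add: tr_def)
  then show ?thesis using R_polys(2)[OF rep[OF p]] by (simp add: V.eqv_refl)
qed

section \<open>The isomorphism of the orbifolded models\<close>

definition psi :: "((nat \<Rightarrow> complex) \<Rightarrow> mpoly set) \<Rightarrow> (nat \<Rightarrow> complex) \<Rightarrow> mpoly set" where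
  "psi x = V.mk (\<lambda>g. tr g ((SOME p. W.fam p \<and> x = W.mk p) g))"

lemma fam_tr: "W.fam p \<Longrightarrow> V.fam (\<lambda>g. tr g (p g))"
  by (auto simp: W.fam_def V.fam_def intro: tr_inva)

lemma psi_mk:
  assumes p: "W.fam p" shows "psi (W.mk p) = V.mk (\<lambda>g. tr g (p g))"
proof -
  let ?p = "SOME p'. W.fam p' \<and> W.mk p = W.mk p'"
  have s: "W.fam ?p \<and> W.mk p = W.mk ?p" by (rule someI[of _ p]) (use p in simp)
  then have "\<forall>g\<in>G. W.eqv (K g) (?p g) (p g)" using W.mk_eq_iff[OF p] W.eqv_sym by blast
  then have "\<forall>g\<in>G. V.eqv (K g) (tr g (?p g)) (tr g (p g))" using tr_cong by blast
  then show ?thesis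
    unfolding psi_def using V.mk_eq_iff[OF fam_tr fam_tr] s p by blast
qed

lemma psi_eqI:
  assumes "W.fam p" "V.fam r" "\<And>g. g \<in> G \<Longrightarrow> V.eqv (K g) (tr g (p g)) (r g)"
  shows "psi (W.mk p) = V.mk r"
  using assms by (simp add: psi_mk V.mk_eq_iff[OF fam_tr])

lemma psi_sector_elem:
  assumes p: "W.inva diag_one p"
  shows "psi (W.mk (W.delta diag_one p)) = V.mk (V.delta diag_one (rep p))"
proof (rule psi_eqI)
  have pI: "p \<in> polys I" using W.inva_polys[OF p] by simp
  show "W.fam (W.delta diag_one p)" by (rule W.fam_delta[OF p])
  have "V.inva diag_one (tr diag_one p)" by (rule tr_inva[OF W.G_one p])
  moreover have "tr diag_one p = rep p"
  proof -
    have "root {} = 1" using P_nonempty by (auto simp: root_def intro!: prod.neutral)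
    then show ?thesis
      using restrict_vars_id[OF R_polys(2)[OF rep[OF pI]]] by (simp add: tr_def)
  qed
  ultimately show "V.fam (V.delta diag_one (rep p))" using V.fam_delta by simp
  fix g assume "g \<in> G"
  then show "V.eqv (K g) (tr g (W.delta diag_one p g)) (V.delta diag_one (rep p) g)"
    using tr_identity_sector[OF pI] tr_zero by (auto simp: W.delta_def V.delta_def)
qed

lemma frobenius_iso_psi: "frobenius_iso W.B V.B psi"
  unfolding frobenius_iso_def
proof (intro conjI allI ballI)
  show "graded_frobenius_algebra W.B" by (rule W.graded_frobenius_algebra_B)
  show "graded_frobenius_algebra V.B" by (rule V.graded_frobenius_algebra_B)
  have mult: "psi (W.mk p \<otimes>\<^bsub>W.B\<^esub> W.mk r) = psi (W.mk p) \<otimes>\<^bsub>V.B\<^esub> psi (W.mk r)" if p: "W.fam p" "W.fam r" for p r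
  proof -
    have "psi (W.mk (W.star p r)) = V.mk (V.star (\<lambda>g. tr g (p g)) (\<lambda>g. tr g (r g)))"
    proof (rule psi_eqI)
      show "W.fam (W.star p r)" by (rule W.fam_star[OF p])
      show "V.fam (V.star (\<lambda>g. tr g (p g)) (\<lambda>g. tr g (r g)))" by (intro V.fam_star fam_tr p)
      fix k assume k: "k \<in> G"
      have i: "diag_mult (diag_inv g) k \<in> G" if "g \<in> G" for g
        using that k by (intro W.G_mult W.G_inv)
      have sK: "W.sm g (diag_mult (diag_inv g) k) (p g) (r (diag_mult (diag_inv g) k)) \<in> polys (K k)" if "g \<in> G" for g
        using W.sm_polys[OF that i[OF that]] W.dm_inv_cancel(2)[OF that, of k] by simp
      have "V.eqv (K k) (tr k (W.star p r k))
          (\<Sum>g\<in>G. tr k (W.sm g (diag_mult (diag_inv g) k) (p g) (r (diag_mult (diag_inv g) k))))"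
        unfolding W.star_def by (rule tr_sum[OF k sK])
      also have "V.eqv (K k) \<dots> (V.star (\<lambda>g. tr g (p g)) (\<lambda>g. tr g (r g)) k)"
        unfolding V.star_def
      proof (rule V.eqv_sum)
        fix g assume g: "g \<in> G"
        show "V.eqv (K k) (tr k (W.sm g (diag_mult (diag_inv g) k) (p g) (r (diag_mult (diag_inv g) k))))
            (V.sm g (diag_mult (diag_inv g) k) (tr g (p g)) (tr (diag_mult (diag_inv g) k) (r (diag_mult (diag_inv g) k))))"
          using tr_sm[OF g i[OF g] W.fam_polys[OF p(1) g] W.fam_polys[OF p(2) i[OF g]]]
          unfolding W.dm_inv_cancel(2)[OF g] .
      qed
      finally show "V.eqv (K k) (tr k (W.star p r k)) (V.star (\<lambda>g. tr g (p g)) (\<lambda>g. tr g (r g)) k)" .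
    qed
    then show ?thesis using p by (simp add: W.mult_B psi_mk V.mult_B fam_tr)
  qed
  have add: "psi (W.mk p \<oplus>\<^bsub>W.B\<^esub> W.mk r) = psi (W.mk p) \<oplus>\<^bsub>V.B\<^esub> psi (W.mk r)" if p: "W.fam p" "W.fam r" for p r
  proof -
    have "psi (W.mk (\<lambda>g. p g + r g)) = V.mk (\<lambda>g. tr g (p g) + tr g (r g))"
      by (rule psi_eqI) (auto intro!: W.fam_add V.fam_add fam_tr tr_add W.fam_polys p)
    then show ?thesis using p by (simp add: W.add_B psi_mk V.add_B fam_tr)
  qed
  have one: "psi \<one>\<^bsub>W.B\<^esub> = \<one>\<^bsub>V.B\<^esub>"
    unfolding W.one_B V.one_B
  proof (rule psi_eqI)
    show "W.fam (W.delta diag_one 1)" by (rule W.fam_delta[OF W.inva_one])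
    show "V.fam (V.delta diag_one 1)" by (rule V.fam_delta[OF V.inva_one])
    fix g assume "g \<in> G"
    then show "V.eqv (K g) (tr g (W.delta diag_one 1 g)) (V.delta diag_one 1 g)"
      using tr_one tr_zero by (auto simp: W.delta_def V.delta_def)
  qed
  have "bij_betw psi (carrier W.B) (carrier V.B)"
    unfolding bij_betw_def
  proof
    show "inj_on psi (carrier W.B)"
    proof (rule inj_onI)
      fix x y assume "x \<in> carrier W.B" "y \<in> carrier W.B" and e: "psi x = psi y"
      then obtain p r where p: "W.fam p" "x = W.mk p" "W.fam r" "y = W.mk r" by (auto simp: W.carrier_B)
      then have "\<forall>g\<in>G. V.eqv (K g) (tr g (p g)) (tr g (r g))"
        using e by (simp add: psi_mk V.mk_eq_iff[OF fam_tr fam_tr])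
      then have "\<forall>g\<in>G. W.eqv (K g) (p g) (r g)" using tr_inj W.fam_polys p by blast
      then show "x = y" using p by (simp add: W.mk_eq_iff)
    qed
    show "psi ` carrier W.B = carrier V.B"
    proof (intro equalityI subsetI)
      fix y assume "y \<in> psi ` carrier W.B"
      then show "y \<in> carrier V.B" by (auto simp: W.carrier_B V.carrier_B psi_mk fam_tr)
    next
      fix y assume "y \<in> carrier V.B"
      then obtain r where r: "V.fam r" "y = V.mk r" by (auto simp: V.carrier_B)
      have "\<exists>p. W.inva g p \<and> V.eqv (K g) (tr g p) (r g)" if g: "g \<in> G" for g
      proof -
        have "V.inva g (r g)" using r g by (simp add: V.fam_def)
        then show ?thesis using tr_surj[OF g] by metis
      qed
      then obtain p where p: "\<And>g. g \<in> G \<Longrightarrow> W.inva g (p g) \<and> V.eqv (K g) (tr g (p g)) (r g)" by metis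
      then have "W.fam p" by (simp add: W.fam_def)
      then have "psi (W.mk p) = y" unfolding r(2) using p r(1) by (intro psi_eqI) auto
      then show "y \<in> psi ` carrier W.B" using \<open>W.fam p\<close> by (auto simp: W.carrier_B)
    qed
  qed
  then show "psi \<in> ring_iso W.B V.B"
    using mult add one
    by (auto simp: ring_iso_def ring_hom_def W.carrier_B V.carrier_B psi_mk fam_tr)
  fix c x assume "x \<in> carrier W.B"
  then obtain p where p: "W.fam p" "x = W.mk p" by (auto simp: W.carrier_B)
  have "psi (W.mk (\<lambda>g. Const c * p g)) = V.mk (\<lambda>g. Const c * tr g (p g))"
    by (rule psi_eqI) (auto intro!: W.fam_smult V.fam_smult fam_tr tr_smult W.fam_polys p)
  then show "psi (c \<odot>\<^bsub>W.B\<^esub> x) = c \<odot>\<^bsub>V.B\<^esub> psi x"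
    using p by (simp add: W.smult_B psi_mk V.smult_B fam_tr)
next
  fix d x assume "x \<in> homog W.B d"
  then obtain p where p: "W.hfam d p" "x = W.mk p" by (auto simp: W.homog_B)
  have pf: "W.fam p" by (rule W.hfam_fam[OF p(1)])
  have "\<exists>r. r \<in> polys (K g) \<and> homog_of (weights I V) (d - V.shift g) r \<and> V.eqv (K g) (tr g (p g)) r" if g: "g \<in> G" for g
  proof -
    have "homog_of (weights I W) (d - V.shift g) (p g)"
      using p(1) g unfolding W.hfam_def shift_eq[OF g, symmetric] by simp
    then show ?thesis using tr_homog[OF g W.fam_polys[OF pf g]] by metis
  qed
  then obtain r where r: "\<And>g. g \<in> G \<Longrightarrow> r g \<in> polys (K g) \<and> homog_of (weights I V) (d - V.shift g) (r g) \<and> V.eqv (K g) (tr g (p g)) (r g)"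
    by metis
  \<comment> \<open>The homogeneous representative is only congruent to the image of
    \<open>p g\<close>, so its invariance is carried over along the congruence.\<close>
  have "V.inva g (r g)" if g: "g \<in> G" for g
    unfolding V.inva_def
  proof (intro conjI ballI)
    show "r g \<in> polys (K g)" using r[OF g] by simp
    fix f assume f: "f \<in> G"
    have e: "V.eqv (K g) (r g) (tr g (p g))" using r[OF g] V.eqv_sym by blast
    have "V.eqv (K g) (Const (diag_det (K g) f) * scale_vars f (r g)) (Const (diag_det (K g) f) * scale_vars f (tr g (p g)))"
      by (intro V.eqv_smult V.eqv_scale[OF V.good_fix[OF g] V.G_scale[OF f] _ e] V.G_nz[OF f])
    also have "V.eqv (K g) \<dots> (tr g (p g))"
      using fam_tr[OF pf] f g by (auto simp: V.fam_def V.inva_def)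
    also have "V.eqv (K g) \<dots> (r g)" using r[OF g] by simp
    finally show "V.eqv (K g) (Const (diag_det (K g) f) * scale_vars f (r g)) (r g)" .
  qed
  then have "V.hfam d r" using r by (simp add: V.hfam_def V.fam_def)
  moreover have "psi x = V.mk r"
    unfolding p(2) using r by (intro psi_eqI pf V.hfam_fam[OF \<open>V.hfam d r\<close>]) auto
  ultimately show "psi x \<in> homog V.B d" by (auto simp: V.homog_B)
next
  fix x y assume "x \<in> carrier W.B" "y \<in> carrier W.B"
  then obtain p r where p: "W.fam p" "x = W.mk p" "W.fam r" "y = W.mk r" by (auto simp: W.carrier_B)
  have "(\<Sum>g\<in>G. V.T (K g) (tr g (p g) * tr (diag_inv g) (r (diag_inv g)))) = (\<Sum>g\<in>G. W.T (K g) (p g * r (diag_inv g)))"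
  proof (rule sum.cong[OF refl])
    fix g assume g: "g \<in> G"
    have "r (diag_inv g) \<in> polys (K g)" using W.fam_polys[OF p(3) W.G_inv[OF g]] by simp
    then show "V.T (K g) (tr g (p g) * tr (diag_inv g) (r (diag_inv g))) = W.T (K g) (p g * r (diag_inv g))"
      by (intro tr_T g W.fam_polys[OF p(1)])
  qed
  then show "pairing V.B (psi x) (psi y) = pairing W.B x y"
    using p by (simp add: psi_mk V.pairing_B W.pairing_B fam_tr)
qed

end

section \<open>From the hypotheses to sectors and transport\<close>

lemma orbifold_of_frobenius:
  assumes I: "finite I" and W: "admissible I W" and A: "graded_frobenius_algebra (milnor I W)"
    and G: "subgroup G (Gmax I W)" "\<And>g. g \<in> G \<Longrightarrow> diag_det I g = 1" and wb: "well_behaved I W G"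
  shows "orbifold I W (\<lambda>p. milnor_pairing I W (cls I W p) (cls I W 1)) G"
proof -
  let ?t = "\<lambda>p. milnor_pairing I W (cls I W p) (cls I W 1)"
  interpret admissible_poly I W using I W by unfold_locales
  interpret S: socle I W "weights I W" ?t by (rule socle_of_frobenius[OF refl A])
  obtain P where P: "partition_on I P" "\<And>S. S \<in> P \<Longrightarrow> splits W S"
    "\<And>g S. g \<in> G \<Longrightarrow> S \<in> P \<Longrightarrow> S \<subseteq> fix_vars I g \<or> S \<inter> fix_vars I g = {}"
    using well_behaved_blocks[OF I wb] by metis
  show ?thesis
  proof (rule orbifold.intro[OF admissible_poly_axioms S.socle_axioms], rule orbifold_axioms.intro)
    show "?t (Hess I W) = of_nat (milnor_number I W)"
      using S.milnor_pairing_eq[OF refl S.H_polys polys_one] S.t_Hess by simp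
    fix g assume g: "g \<in> G"
    \<comment> \<open>A fixed set is a union of blocks, and each nonconstant monomial of
      \<open>W\<close> lies in a single block.\<close>
    show "splits W (fix_vars I g)"
      unfolding splits_def
    proof (intro ballI disjCI)
      fix a assume a: "a \<in> supp W" and "supp a \<inter> fix_vars I g \<noteq> {}"
      then obtain i where i: "i \<in> supp a" "i \<in> fix_vars I g" by blast
      then have "i \<in> I" by (simp add: fix_vars_def)
      then obtain S where S: "S \<in> P" "i \<in> S" using P(1) by (auto simp: partition_on_def)
      have "S \<subseteq> fix_vars I g" using P(3)[OF g S(1)] S(2) i(2) by blast
      moreover have "supp a \<subseteq> S" using P(2)[OF S(1)] a i(1) S(2) unfolding splits_def by blast
      ultimately show "supp a \<subseteq> fix_vars I g" by blast
    qed
  qed (use G in blast)+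
qed

lemma transport_of_iso:
  assumes W: "orbifold I W (\<lambda>p. milnor_pairing I W (cls I W p) (cls I W 1)) G"
    and V: "orbifold I V (\<lambda>p. milnor_pairing I V (cls I V p) (cls I V 1)) G"
    and iso: "frobenius_iso (milnor I W) (milnor I V) \<phi>"
    and eq: "equivariant I W V G \<phi>"
  shows "transport I W V (\<lambda>p. milnor_pairing I W (cls I W p) (cls I W 1))
    (\<lambda>p. milnor_pairing I V (cls I V p) (cls I V 1)) G
    (\<lambda>p r. p \<in> polys I \<and> r \<in> polys I \<and> \<phi> (cls I W p) = cls I V r)"
proof -
  interpret W: orbifold I W "\<lambda>p. milnor_pairing I W (cls I W p) (cls I W 1)" G by (rule W)
  interpret V: orbifold I V "\<lambda>p. milnor_pairing I V (cls I V p) (cls I V 1)" G by (rule V)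
  let ?R = "\<lambda>p r. p \<in> polys I \<and> r \<in> polys I \<and> \<phi> (cls I W p) = cls I V r"
  have hom: "\<phi> \<in> ring_hom (milnor I W) (milnor I V)" and bij: "bij_betw \<phi> (carrier (milnor I W)) (carrier (milnor I V))"
    using iso by (auto simp: frobenius_iso_def ring_iso_def)
  have cW: "cls I W p \<in> carrier (milnor I W)" if "p \<in> polys I" for p
    using that by (simp add: carrier_milnor[OF W.W_polys])
  have cV: "carrier (milnor I V) = cls I V ` polys I" by (rule carrier_milnor[OF V.W_polys])
  have Weq: "W.eqv I p p' \<longleftrightarrow> cls I W p = cls I W p'" if "p \<in> polys I" "p' \<in> polys I" for p p'
    using W.cls_eq_eqv[OF that] unfolding W.WX_I by blast
  have Veq: "V.eqv I p p' \<longleftrightarrow> cls I V p = cls I V p'" if "p \<in> polys I" "p' \<in> polys I" for p p'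
    using V.cls_eq_eqv[OF that] unfolding V.WX_I by blast
  have one: "\<phi> (cls I W 1) = cls I V 1"
    using ring_hom_one[OF hom] by (simp add: milnor_one W.W_polys V.W_polys)
  have add: "?R (p + p') (r + r')" if "?R p r" "?R p' r'" for p r p' r'
    using ring_hom_add[OF hom cW cW, of p p'] that
    by (auto simp: milnor_add[OF W.W_polys] milnor_add[OF V.W_polys])
  have mult: "?R (p * p') (r * r')" if "?R p r" "?R p' r'" for p r p' r'
    using ring_hom_mult[OF hom cW cW, of p p'] that
    by (auto simp: milnor_mult[OF W.W_polys] milnor_mult[OF V.W_polys])
  have const: "?R (Const c) (Const c)" for c
  proof -
    have "\<phi> (c \<odot>\<^bsub>milnor I W\<^esub> cls I W 1) = c \<odot>\<^bsub>milnor I V\<^esub> \<phi> (cls I W 1)"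
      using iso cW[OF polys_one] unfolding frobenius_iso_def by blast
    then show ?thesis by (simp add: one milnor_smult[OF W.W_polys] milnor_smult[OF V.W_polys])
  qed
  have zero: "?R 0 0" using const[of 0] by simp
  have left: "\<exists>r. ?R p r" if p: "p \<in> polys I" for p
  proof -
    have "\<phi> (cls I W p) \<in> cls I V ` polys I" using bij cW[OF p] unfolding cV bij_betw_def by blast
    then show ?thesis using p by blast
  qed
  have right: "\<exists>p. ?R p r" if r: "r \<in> polys I" for r
  proof -
    have "cls I V r \<in> \<phi> ` carrier (milnor I W)" using bij r unfolding cV bij_betw_def by blast
    then show ?thesis using r unfolding carrier_milnor[OF W.W_polys] by fastforce
  qed
  have inj: "cls I W p = cls I W p'" if "p \<in> polys I" "p' \<in> polys I" "\<phi> (cls I W p) = \<phi> (cls I W p')" for p p'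
    using bij cW that by (meson bij_betw_imp_inj_on inj_onD)
  have sum: "?R (sum f A) (sum h A)" if "\<And>x. x \<in> A \<Longrightarrow> ?R (f x) (h x)" for f h and A :: "rat set"
    using that
  proof (induction A rule: infinite_finite_induct)
    case (insert x A)
    show ?case unfolding sum.insert[OF insert.hyps] by (rule add) (use insert in auto)
  qed (use zero in auto)
  have homog: "\<exists>r. ?R p r \<and> homog_of V.q d r" if "homog_of W.q d p" "p \<in> polys I" for d p
  proof -
    have "cls I W p \<in> homog (milnor I W) d" using that by (auto simp: milnor_def homog_polys_iff)
    then have "\<phi> (cls I W p) \<in> homog (milnor I V) d" using iso by (auto simp: frobenius_iso_def)
    then show ?thesis using that by (auto simp: milnor_def homog_polys_iff)
  qed
  show ?thesis
  proof unfold_locales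
    fix p r p' assume "?R p r" "W.eqv I p p'"
    then show "?R p' r" using Weq by (metis W.eqv_polys(2))
  next
    fix p r r' assume "?R p r" "V.eqv I r r'"
    then show "?R p r'" using Veq by (metis V.eqv_polys(2))
  next
    fix p assume "?R p 0"
    then show "W.eqv I p 0" using inj[of p 0] zero Weq by auto
  next
    fix r assume "?R 0 r"
    then show "V.eqv I r 0" using zero Veq by auto
  next
    fix g p r assume g: "g \<in> G" and R: "?R p r"
    \<comment> \<open>The determinant twist of the action is 1 on the untwisted sector, so
      equivariance becomes compatibility with plain rescaling of the variables.\<close>
    have "act I W g (cls I W p) = cls I W (scale_vars g p)" if "p \<in> polys I" for p
      using act_cls[OF W.W_polys that, of g] jac_scale[OF W.W_polys W.finite_I W.G_scale[OF g] W.G_nz[OF g]]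
      by (simp add: W.G_SL[OF g])
    moreover have "act I V g (cls I V r) = cls I V (scale_vars g r)" if "r \<in> polys I" for r
      using act_cls[OF V.W_polys that, of g] jac_scale[OF V.W_polys V.finite_I V.G_scale[OF g] V.G_nz[OF g]]
      by (simp add: V.G_SL[OF g])
    moreover have "\<phi> (act I W g (cls I W p)) = act I V g (\<phi> (cls I W p))"
      using eq g cW R unfolding equivariant_def by blast
    ultimately show "?R (scale_vars g p) (scale_vars g r)" using R by auto
  next
    fix p r assume R: "?R p r"
    have "pairing (milnor I V) (\<phi> (cls I W p)) (\<phi> (cls I W 1)) = pairing (milnor I W) (cls I W p) (cls I W 1)"
      using iso cW R polys_one unfolding frobenius_iso_def by blast
    then show "milnor_pairing I W (cls I W p) (cls I W 1) = milnor_pairing I V (cls I V r) (cls I V 1)"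
      using R by (simp add: milnor_def one)
  next
    \<comment> \<open>Only the forward map is assumed to preserve degrees. The image of the
      component of degree \<open>d\<close> of a preimage \<open>p\<close> is congruent to the
      component of degree \<open>d\<close> of \<open>r\<close>, that is, to
      \<open>r\<close>.\<close>
    fix d r assume h: "homog_of V.q d r" and r: "r \<in> polys I"
    obtain p where p: "?R p r" using right[OF r] by blast
    define A where "A = insert d (mono_deg W.q ` supp p)"
    have fin: "finite A" by (simp add: A_def)
    have "\<exists>s. ?R (hcomp W.q e p) s \<and> homog_of V.q e s" for e
      using p by (intro homog homog_of_hcomp hcomp_polys) auto
    then obtain s where s: "\<And>e. ?R (hcomp W.q e p) (s e)" "\<And>e. homog_of V.q e (s e)" by metis
    have "?R (\<Sum>e\<in>A. hcomp W.q e p) (\<Sum>e\<in>A. s e)" by (intro sum s)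
    moreover have "(\<Sum>e\<in>A. hcomp W.q e p) = p" by (rule sum_hcomp[OF fin]) (auto simp: A_def)
    ultimately have "V.eqv I r (\<Sum>e\<in>A. s e)" using p Veq by auto
    then have "V.eqv I (hcomp V.q d r) (hcomp V.q d (\<Sum>e\<in>A. s e))" by (rule V.eqv_hcomp[OF V.good_I])
    moreover have "hcomp V.q d r = r" using h by (simp add: homog_of_iff)
    moreover have "hcomp V.q d (\<Sum>e\<in>A. s e) = s d"
    proof -
      have "hcomp V.q d (\<Sum>e\<in>A. s e) = (\<Sum>e\<in>A. if e = d then s d else 0)"
        unfolding hcomp_sum by (intro sum.cong refl) (auto simp: hcomp_homog[OF s(2)])
      then show ?thesis using fin by (simp add: A_def)
    qed
    ultimately have "V.eqv I r (s d)" by simp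
    then have "cls I V r = cls I V (s d)" using Veq s(1) r by blast
    then have "?R (hcomp W.q d p) r" using s(1)[of d] r by simp
    then show "\<exists>p. ?R p r \<and> homog_of W.q d p" using homog_of_hcomp by blast
  qed (use left right add mult const homog in auto)
qed

theorem theorem3p6:
  fixes n :: nat and W V :: mpoly and G :: "(nat \<Rightarrow> complex) set"
    and \<phi> :: "mpoly set \<Rightarrow> mpoly set"
  assumes "admissible {..<n} W" and "admissible {..<n} V"
    and "subgroup G (Gmax {..<n} W)" and "subgroup G (Gmax {..<n} V)"
    and "\<And>g. g \<in> G \<Longrightarrow> diag_det {..<n} g = 1"
    and "well_behaved {..<n} W G" and "well_behaved {..<n} V G"
    and "frobenius_iso (milnor {..<n} W) (milnor {..<n} V) \<phi>"
    and "equivariant {..<n} W V G \<phi>"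
  shows "\<exists>\<psi>. frobenius_iso (bmodel {..<n} W G) (bmodel {..<n} V G) \<psi> \<and>
    (\<forall>m \<in> invariants {..<n} W G.
       \<psi> (sector_elem {..<n} W G m diag_one) = sector_elem {..<n} V G (\<phi> m) diag_one)"
proof -
  let ?I = "{..<n}"
  define t where "t W = (\<lambda>p. milnor_pairing ?I W (cls ?I W p) (cls ?I W 1))" for W
  define R where "R = (\<lambda>p r. p \<in> polys ?I \<and> r \<in> polys ?I \<and> \<phi> (cls ?I W p) = cls ?I V r)"
  have A: "graded_frobenius_algebra (milnor ?I W)" "graded_frobenius_algebra (milnor ?I V)"
    using assms(8) by (auto simp: frobenius_iso_def)
  have W: "orbifold ?I W (t W) G"
    unfolding t_def by (rule orbifold_of_frobenius[OF _ assms(1) A(1) assms(3,5,6)]) auto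
  have V: "orbifold ?I V (t V) G"
    unfolding t_def by (rule orbifold_of_frobenius[OF _ assms(2) A(2) assms(4,5,7)]) auto
  have T: "transport ?I W V (t W) (t V) G R"
    using transport_of_iso[OF W[unfolded t_def] V[unfolded t_def] assms(8,9)] unfolding t_def R_def .
  obtain P where P: "partition_on ?I P" "\<And>S. S \<in> P \<Longrightarrow> splits W S"
    "\<And>g S. g \<in> G \<Longrightarrow> S \<in> P \<Longrightarrow> S \<subseteq> fix_vars ?I g \<or> S \<inter> fix_vars ?I g = {}"
    "\<And>g S. g \<in> G \<Longrightarrow> S \<in> P \<Longrightarrow> (\<lambda>i. if i \<in> S then g i else 1) \<in> G"
  proof (rule well_behaved_blocks[OF finite_lessThan assms(6)])
    fix P assume "partition_on ?I P" "\<And>S. S \<in> P \<Longrightarrow> splits W S"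
      "\<And>g S. g \<in> G \<Longrightarrow> S \<in> P \<Longrightarrow> S \<subseteq> fix_vars ?I g \<or> S \<inter> fix_vars ?I g = {}"
      "\<And>g S. g \<in> G \<Longrightarrow> S \<in> P \<Longrightarrow> (\<lambda>i. if i \<in> S then g i else 1) \<in> G"
    then show thesis by (rule that)
  qed
  interpret block_transport ?I W V "t W" "t V" G R P
    by (rule block_transport.intro[OF T block_transport_axioms.intro[OF P(1,3,4)]])
  have "psi (sector_elem ?I W G m diag_one) = sector_elem ?I V G (\<phi> m) diag_one"
    if m: "m \<in> invariants ?I W G" for m
  proof -
    obtain p where p: "p \<in> polys ?I" "m = cls ?I W p"
      using m by (auto simp: invariants_def carrier_milnor[OF W.W_polys])
    have inv: "W.inva diag_one p"
      using W.invariants_iff[OF W.G_one, of p] p m by (simp add: W.WX_I)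
    have r: "rep p \<in> polys ?I" "\<phi> m = cls ?I V (rep p)" using rep[OF p(1)] p(2) unfolding R_def by auto
    have "sector_elem ?I W G m diag_one = W.mk (W.delta diag_one p)"
      using W.sector_elem_mk[of p diag_one] p by (simp add: W.WX_I)
    moreover have "sector_elem ?I V G (\<phi> m) diag_one = V.mk (V.delta diag_one (rep p))"
      using V.sector_elem_mk[of "rep p" diag_one] r by (simp add: V.WX_I)
    ultimately show ?thesis using psi_sector_elem[OF inv] by simp
  qed
  then show ?thesis using frobenius_iso_psi by blast
qed

end
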